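(* Let the operators $\tilde{\mathcal K}_{\star,\bullet}$ ($\star,\bullet\in\{*_1,*_2,\circ_1,\circ_2\}$), depending on a parameter $a\in\mathbb{C}$, and the reduced operator $\mathcal M_{\circ,r}$ on $L^2(\Gamma_\circ)$ be as in the context (including the invertibility assumptions there). Let $\mathcal M_{\circ,r}^{+}$ and $\mathcal M_{\circ,r}^{-}$ denote $\mathcal M_{\circ,r}$ with $a=ik$ and $a=-ik$, respectively. If $\mathcal M_{\circ,r}^{+}$ and $\mathcal M_{\circ,r}^{-}$ are invertible on $L^2(\Gamma_\circ)$, then the impedance-to-impedance maps $$\mathcal I_{-,+}=\mathcal M_{\circ,r}^-(\mathcal M_{\circ,r}^+)^{-1},\qquad \mathcal I_{+,-}=\mathcal M_{\circ,r}^+(\mathcal M_{\circ,r}^-)^{-1}$$ are Fredholm second-kind on $L^2(\Gamma_\circ)$, i.e. each is a nonzero scalar multiple of the identity plus a compact operator.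
   Context: **Geometry.** $\Omega\subset\mathbb{R}^2$ is a region whose positively oriented boundary $\Gamma=\partial\Omega$ has finite length and is the union of $\Gamma_*=\Gamma_*^1\cup\Gamma_*^2$ and $\Gamma_\circ=\Gamma_\circ^1\cup\Gamma_\circ^2$. Here $\Gamma_*^1,\Gamma_*^2$ are disjoint smooth planar open curves (arcs), and so are $\Gamma_\circ^1,\Gamma_\circ^2$. The curves $\Gamma_*$ and $\Gamma_\circ$ meet only at their endpoints (the four corners of $\Gamma$, as for a finite waveguide with walls $\Gamma_*^1,\Gamma_*^2$ and end caps $\Gamma_\circ^1,\Gamma_\circ^2$), and they meet there at right angles. The curvature of $\Gamma_\circ$ vanishes at its endpoints. $n$ is the outward unit normal and $\kappa=\nabla_\Gamma\cdot n$ is the curvature. $L^2(\Gamma_\circ)=L^2(\Gamma_\circ^1)\times L^2(\Gamma_\circ^2)$. For $i\in\{1,2\}$, $\neg i$ denotes the other element of $\{1,2\}$. **Constants.** $k>0$ is the wave number; $a,c_1,c_2\in\mathbb{C}$ with $c_1\ne 0$; $k_\Gamma=\sqrt{(1+c_1c_2)/c_1^2}$ with the branch chosen so that $\Im k_\Gamma>0$ (it is assumed that $c_1,c_2$ are such that this strict inequality holds). **Layer potentials.** $G(x,y)=\frac{i}{4}H_0^{(1)}(k|x-y|)$. For a curve $C$ with unit normal $n$, $S[\sigma](x)=\int_C G(x,y)\sigma(y)\,ds(y)$ and $D[\sigma](x)=\int_C \partial_{n_y}G(x,y)\,\sigma(y)\,ds(y)$. A prime denotes that the kernel is differentiated in the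 direction $n_x$ (the normal to $\Gamma$ at the target $x$); two primes denote two such derivatives. On-surface integrals with hypersingular kernels are taken in the Hadamard finite part sense. **Fins.** Fix a small $R>0$. At each endpoint $x_0$ of a curve $C\in\{\Gamma_*^1,\Gamma_*^2,\Gamma_\circ^1,\Gamma_\circ^2\}$, let $\ell$ be the line through $x_0$ in the direction of the normal to $C$ at $x_0$. The fin of $C$ at $x_0$ is the reflection across $\ell$ of $C\cap B_R(x_0)$. It carries the reflected normals, so that $C$ together with its fins is an extended curve with continuous normal. $R$ is small enough that the fins lie outside $\Omega$ and meet $\Gamma$ only at the corners. The potentials $\tilde S_{*_i}\sigma$, $\tilde D_{*_i}\sigma$ are the single and double layer potentials over $\Gamma_*^i$ together with its fins, where the density on each fin is the even reflection of $\sigma$ (the value at a reflected point equals the value at the original point). The potential $\tilde S_{\circ_j}\rho$ is the single layer potential over $\Gamma_\circ^j$ together with its fins, where the density on each fin is the odd reflection of $\rho$ (the value at a reflected point is minus the value at the original point). For a target curve $\star$ and a source curve $\bullet$ (among $*_1,*_2,\circ_1,\circ_2$), $\tilde{\mathcal S}_{\star,\bullet}$ denotes the restriction of $\tilde S_\bullet$ to the curve $\star$ (on-surface evaluation), and similarly for $\tilde{\mathcal D}_{\star,\bullet}$ and for the primed and doubly primed versions. Also $\tilde{\mathcal S}_{\bullet}:=\tilde{\mathcal S}_{\bullet,\bullet}$, etc. **Surface operators.** Parameterize $\Gamma_*^i$ by arc length $s\in[0,L_i]$. $G_\Gamma^i(s,s')$ is the Green's function of $\frac{d^2}{ds^2}+k_\Gamma^2$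 on $[0,L_i]$ with zero Neumann boundary conditions, i.e. $G_\Gamma^i(s,s')=\frac{1}{2ik_\Gamma}e^{ik_\Gamma|s-s'|}+\psi_i(s,s')$, where $\psi_i$ is smooth and annihilated by $\frac{d^2}{ds^2}+k_\Gamma^2$ in each variable, and $\partial_{s'}G_\Gamma^i(s,0)=\partial_{s'}G_\Gamma^i(s,L_i)=0$. Set $$\mathcal G_i[\varphi](s)=\int_0^{L_i}G_\Gamma^i(s,s')\varphi(s')\,ds',\qquad F_i[\varphi](s)=G_\Gamma^i(s,L_i)\varphi'(L_i)-G_\Gamma^i(s,0)\varphi'(0).$$ **Entries.** For $i,j\in\{1,2\}$ (first index = target, second index = source; densities on $\Gamma_*^i$ are in $H^2(\Gamma_*^i)$, densities on $\Gamma_\circ^j$ in $L^2(\Gamma_\circ^j)$, and likewise for the outputs): $$\tilde{\mathcal K}_{*_i,*_i}=-\tfrac{c_1}{2}I+c_1\tilde{\mathcal D}_{*_i}-\tfrac1{c_1}\mathcal G_i\tilde{\mathcal D}_{*_i}+\mathcal G_i(\tilde{\mathcal D}'_{*_i}+\tilde{\mathcal S}''_{*_i})+\Big(k^2-\tfrac{c_2}{c_1}\Big)\mathcal G_i\tilde{\mathcal S}_{*_i}+\mathcal G_i\Big(\kappa-\tfrac1{c_1}\Big)\tilde{\mathcal S}'_{*_i}+F_i\tilde{\mathcal S}_{*_i},$$ $$\tilde{\mathcal K}_{\circ_j,*_i}=a\Big(\tilde{\mathcal D}_{\circ_j,*_i}-\tfrac1{c_1}\tilde{\mathcal S}_{\circ_j,*_i}\Big)+\tilde{\mathcal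 D}'_{\circ_j,*_i}-\tfrac1{c_1}\tilde{\mathcal S}'_{\circ_j,*_i},$$ $$\tilde{\mathcal K}_{*_{\neg i},*_i}=c_1\Big(\tilde{\mathcal D}_{*_{\neg i},*_i}-\tfrac1{c_1}\tilde{\mathcal S}_{*_{\neg i},*_i}\Big)-\tfrac1{c_1}\mathcal G_{\neg i}\Big(\tilde{\mathcal D}_{*_{\neg i},*_i}-\tfrac1{c_1}\tilde{\mathcal S}_{*_{\neg i},*_i}\Big)+\mathcal G_{\neg i}\Big(\tilde{\mathcal D}'_{*_{\neg i},*_i}-\tfrac1{c_1}\tilde{\mathcal S}'_{*_{\neg i},*_i}\Big),$$ $$\tilde{\mathcal K}_{\circ_j,\circ_j}=\tfrac12 I+a\tilde{\mathcal S}_{\circ_j}+\tilde{\mathcal S}'_{\circ_j},\qquad \tilde{\mathcal K}_{\circ_{\neg j},\circ_j}=a\tilde{\mathcal S}_{\circ_{\neg j},\circ_j}+\tilde{\mathcal S}'_{\circ_{\neg j},\circ_j},$$ $$\tilde{\mathcal K}_{*_i,\circ_j}=c_1\tilde{\mathcal S}_{*_i,\circ_j}-\tfrac1{c_1}\mathcal G_i\tilde{\mathcal S}_{*_i,\circ_j}+\mathcal G_i\tilde{\mathcal S}'_{*_i,\circ_j}.$$ **Reduced operator.** It is assumed that, for $i=1,2$, $\tilde{\mathcal K}_{*_i,*_i}$ is invertible on $H^2(\Gamma_*^i)$; set $\mathcal A_i=\tilde{\mathcal K}_{*_{\neg i},*_i}\tilde{\mathcal K}_{*_i,*_i}^{-1}$.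 It is also assumed that $\tilde{\mathcal K}_{*_i,*_i}-\mathcal A_{\neg i}\tilde{\mathcal K}_{*_{\neg i},*_i}$ is invertible on $H^2(\Gamma_*^i)$ for $i=1,2$. With $$\tilde{\mathcal K}_{*_i,\circ}=\begin{bmatrix}\tilde{\mathcal K}_{*_i,\circ_1}&\tilde{\mathcal K}_{*_i,\circ_2}\end{bmatrix},\quad \tilde{\mathcal K}_{\circ,*_i}=\begin{bmatrix}\tilde{\mathcal K}_{\circ_1,*_i}\\ \tilde{\mathcal K}_{\circ_2,*_i}\end{bmatrix},\quad \tilde{\mathcal K}_\circ=\begin{bmatrix}\tilde{\mathcal K}_{\circ_1,\circ_1}&\tilde{\mathcal K}_{\circ_1,\circ_2}\\ \tilde{\mathcal K}_{\circ_2,\circ_1}&\tilde{\mathcal K}_{\circ_2,\circ_2}\end{bmatrix},$$ $$\mathcal B_i=\big(\tilde{\mathcal K}_{*_i,*_i}-\mathcal A_{\neg i}\tilde{\mathcal K}_{*_{\neg i},*_i}\big)^{-1}\big(\mathcal A_{\neg i}\tilde{\mathcal K}_{*_{\neg i},\circ}-\tilde{\mathcal K}_{*_i,\circ}\big),$$ define $\mathcal M_{\circ,r}=\tilde{\mathcal K}_\circ+\tilde{\mathcal K}_{\circ,*_1}\mathcal B_1+\tilde{\mathcal K}_{\circ,*_2}\mathcal B_2$ on $L^2(\Gamma_\circ)$. *)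

theory Defs
  imports "HOL-Analysis.Analysis"
begin

section \<open>Function spaces and operators\<close>

text \<open>
  A space of (representatives of) complex-valued functions with a seminorm; two functions are
  identified when their difference lies in the carrier and has seminorm 0. For \<open>L\<^sup>2\<close> this is
  equality almost everywhere, for \<open>H\<^sup>2\<close> equality on the parameter interval. Operators act on
  representatives.
\<close>

record 'x fspace =
  carr :: "('x \<Rightarrow> complex) set"
  nrm :: "('x \<Rightarrow> complex) \<Rightarrow> real"

definition eq_in :: "'x fspace \<Rightarrow> ('x \<Rightarrow> complex) \<Rightarrow> ('x \<Rightarrow> complex) \<Rightarrow> bool" where
  "eq_in X f g \<longleftrightarrow> (\<lambda>x. f x - g x) \<in> carr X \<and> nrm X (\<lambda>x. f x - g x) = 0"

definition linear_op ::
    "'x fspace \<Rightarrow> 'y fspace \<Rightarrow> (('x \<Rightarrow> complex) \<Rightarrow> ('y \<Rightarrow> complex)) \<Rightarrow> bool" where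
  "linear_op X Y T \<longleftrightarrow>
     (\<forall>f\<in>carr X. T f \<in> carr Y) \<and>
     (\<forall>f\<in>carr X. \<forall>g\<in>carr X. \<forall>\<alpha> \<beta>.
        eq_in Y (T (\<lambda>x. \<alpha> * f x + \<beta> * g x)) (\<lambda>y. \<alpha> * T f y + \<beta> * T g y))"

definition bounded_op ::
    "'x fspace \<Rightarrow> 'y fspace \<Rightarrow> (('x \<Rightarrow> complex) \<Rightarrow> ('y \<Rightarrow> complex)) \<Rightarrow> bool" where
  "bounded_op X Y T \<longleftrightarrow>
     linear_op X Y T \<and> (\<exists>C. \<forall>f\<in>carr X. nrm Y (T f) \<le> C * nrm X f)"

definition compact_op ::
    "'x fspace \<Rightarrow> 'y fspace \<Rightarrow> (('x \<Rightarrow> complex) \<Rightarrow> ('y \<Rightarrow> complex)) \<Rightarrow> bool" where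
  "compact_op X Y T \<longleftrightarrow>
     linear_op X Y T \<and>
     (\<forall>f :: nat \<Rightarrow> 'x \<Rightarrow> complex. (\<forall>m. f m \<in> carr X) \<and> (\<exists>B. \<forall>m. nrm X (f m) \<le> B) \<longrightarrow>
        (\<exists>r :: nat \<Rightarrow> nat. strict_mono r \<and>
           (\<exists>g\<in>carr Y. (\<lambda>m. nrm Y (\<lambda>y. T (f (r m)) y - g y)) \<longlonglongrightarrow> 0)))"

definition invertible_on :: "'x fspace \<Rightarrow> (('x \<Rightarrow> complex) \<Rightarrow> ('x \<Rightarrow> complex)) \<Rightarrow> bool" where
  "invertible_on X T \<longleftrightarrow>
     (\<forall>f\<in>carr X. T f \<in> carr X) \<and>
     (\<exists>S. bounded_op X X S \<and> (\<forall>f\<in>carr X. eq_in X (S (T f)) f \<and> eq_in X (T (S f)) f))"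

text \<open>For \<open>T\<close> invertible on \<open>X\<close> the preimage chosen here is unique up to \<open>eq_in X\<close>.\<close>

definition inv_on ::
    "'x fspace \<Rightarrow> (('x \<Rightarrow> complex) \<Rightarrow> ('x \<Rightarrow> complex)) \<Rightarrow> ('x \<Rightarrow> complex) \<Rightarrow> ('x \<Rightarrow> complex)" where
  "inv_on X T f = (SOME g. g \<in> carr X \<and> eq_in X (T g) f)"

definition fredholm_second_kind ::
    "'x fspace \<Rightarrow> (('x \<Rightarrow> complex) \<Rightarrow> ('x \<Rightarrow> complex)) \<Rightarrow> bool" where
  "fredholm_second_kind X T \<longleftrightarrow>
     (\<exists>\<mu>. \<mu> \<noteq> 0 \<and>
        (\<exists>C. compact_op X X C \<and> (\<forall>f\<in>carr X. eq_in X (T f) (\<lambda>x. \<mu> * f x + C f x))))"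

definition L2_carr :: "real \<Rightarrow> (real \<Rightarrow> complex) set" where
  "L2_carr L = {f. f \<in> borel_measurable (lebesgue_on {0..L}) \<and>
                  integrable (lebesgue_on {0..L}) (\<lambda>s. (cmod (f s))\<^sup>2)}"

definition L2_sq :: "real \<Rightarrow> (real \<Rightarrow> complex) \<Rightarrow> real" where
  "L2_sq L f = (\<integral>s. (cmod (f s))\<^sup>2 \<partial>lebesgue_on {0..L})"

text \<open>One-sided at the endpoints of \<open>[0,L]\<close>.\<close>

definition dint :: "real \<Rightarrow> (real \<Rightarrow> complex) \<Rightarrow> real \<Rightarrow> complex" where
  "dint L u = (\<lambda>s. vector_derivative u (at s within {0..L}))"

text \<open>
  \<open>H\<^sup>2\<close> of the interval \<open>[0,L]\<close>: \<open>u\<close> is differentiable, \<open>u'\<close> is absolutely continuous, and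
  its almost-everywhere derivative \<open>u''\<close> is square integrable.
\<close>

definition H2_space :: "real \<Rightarrow> real fspace" where
  "H2_space L = \<lparr>
     carr = {u. (\<forall>s\<in>{0..L}. u differentiable (at s within {0..L})) \<and>
                dint L (dint L u) \<in> L2_carr L \<and>
                (\<forall>s\<in>{0..L}. dint L u s
                   = dint L u 0 + (\<integral>t. dint L (dint L u) t \<partial>lebesgue_on {0..s}))},
     nrm = (\<lambda>u. sqrt (L2_sq L u + L2_sq L (dint L u) + L2_sq L (dint L (dint L u)))) \<rparr>"

section \<open>Helmholtz kernels\<close>

definition bessel_J0 :: "real \<Rightarrow> real" where
  "bessel_J0 r = (\<Sum>m. (-1) ^ m / (fact m)\<^sup>2 * (r / 2) ^ (2 * m))"

definition bessel_Y0 :: "real \<Rightarrow> real" where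
  "bessel_Y0 r = 2 / pi * (ln (r / 2) + euler_mascheroni) * bessel_J0 r
     + 2 / pi * (\<Sum>m. (-1) ^ (m + 1) * harm m / (fact m)\<^sup>2 * (r / 2) ^ (2 * m))"

definition hankel_H0 :: "real \<Rightarrow> complex" where
  "hankel_H0 r = Complex (bessel_J0 r) (bessel_Y0 r)"

text \<open>The plane is identified with \<open>complex\<close>; \<open>\<bullet>\<close> is the Euclidean inner product.\<close>

definition Gfun :: "real \<Rightarrow> complex \<Rightarrow> complex \<Rightarrow> complex" where
  "Gfun k x y = \<i> / 4 * hankel_H0 (k * dist x y)"

definition dird :: "complex \<Rightarrow> (complex \<Rightarrow> complex) \<Rightarrow> complex \<Rightarrow> complex" where
  "dird v f x = vector_derivative (\<lambda>t::real. f (x + t *\<^sub>R v)) (at 0)"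

text \<open>A kernel takes the target point and normal, then the source point and normal.\<close>

type_synonym kernel = "complex \<Rightarrow> complex \<Rightarrow> complex \<Rightarrow> complex \<Rightarrow> complex"

definition kerS :: "real \<Rightarrow> kernel" where
  "kerS k x nx y ny = Gfun k x y"

definition kerS' :: "real \<Rightarrow> kernel" where
  "kerS' k x nx y ny = dird nx (\<lambda>z. Gfun k z y) x"

definition kerS'' :: "real \<Rightarrow> kernel" where
  "kerS'' k x nx y ny = dird nx (dird nx (\<lambda>z. Gfun k z y)) x"

definition kerD :: "real \<Rightarrow> kernel" where
  "kerD k x nx y ny = dird ny (\<lambda>w. Gfun k x w) y"

definition kerD' :: "real \<Rightarrow> kernel" where
  "kerD' k x nx y ny = dird nx (\<lambda>z. dird ny (\<lambda>w. Gfun k z w) y) x"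

section \<open>Geometry\<close>

text \<open>
  The index set \<open>{1,2}\<close> is \<open>bool\<close>, so that the other element of \<open>i\<close> is \<open>\<not> i\<close>. The curve
  \<open>Star i\<close> is the wall \<open>\<Gamma>\<^sub>*\<^sup>i\<close>, the curve \<open>Circ j\<close> is the end cap \<open>\<Gamma>\<^sub>\<circ>\<^sup>j\<close>.
\<close>

datatype curve = Star bool | Circ bool

record waveguide =
  region :: "complex set"
  gam :: "curve \<Rightarrow> real \<Rightarrow> complex"            \<comment> \<open>arc length parametrizations\<close>
  len :: "curve \<Rightarrow> real"
  finR :: real
  wnum :: real
  c1 :: complex
  c2 :: complex
  kGam :: complex
  greenF :: "bool \<Rightarrow> real \<Rightarrow> real \<Rightarrow> complex"    \<comment> \<open>\<open>G\<^sub>\<Gamma>\<^sup>i (s, s')\<close>\<close>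

definition tang :: "waveguide \<Rightarrow> curve \<Rightarrow> real \<Rightarrow> complex" where
  "tang W C s = vector_derivative (gam W C) (at s within {0..len W C})"

text \<open>The tangent turned clockwise; it points out of the region for positive orientation.\<close>

definition nml :: "waveguide \<Rightarrow> curve \<Rightarrow> real \<Rightarrow> complex" where
  "nml W C s = - \<i> * tang W C s"

text \<open>The surface divergence of the normal.\<close>

definition curvature :: "waveguide \<Rightarrow> curve \<Rightarrow> real \<Rightarrow> real" where
  "curvature W C s = vector_derivative (nml W C) (at s within {0..len W C}) \<bullet> tang W C s"

definition arc_of :: "waveguide \<Rightarrow> curve \<Rightarrow> complex set" where
  "arc_of W C = gam W C ` {0..len W C}"

definition endpts :: "waveguide \<Rightarrow> curve \<Rightarrow> complex set" where
  "endpts W C = gam W C ` {0, len W C}"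

text \<open>Reflection across the line through \<open>x0\<close> with unit direction \<open>d\<close>, and its linear part.\<close>

definition lrefl :: "complex \<Rightarrow> complex \<Rightarrow> complex" where
  "lrefl d v = (2 * (v \<bullet> d)) *\<^sub>R d - v"

definition refl_pt :: "complex \<Rightarrow> complex \<Rightarrow> complex \<Rightarrow> complex" where
  "refl_pt x0 d z = x0 + lrefl d (z - x0)"

text \<open>The endpoint at parameter \<open>e \<in> {0, len}\<close>, the parameters reflected there, and the fin.\<close>

definition fin_dom :: "waveguide \<Rightarrow> curve \<Rightarrow> real \<Rightarrow> real set" where
  "fin_dom W C e = {s \<in> {0..len W C}. dist (gam W C s) (gam W C e) < finR W}"

definition fin_pt :: "waveguide \<Rightarrow> curve \<Rightarrow> real \<Rightarrow> real \<Rightarrow> complex" where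
  "fin_pt W C e s = refl_pt (gam W C e) (nml W C e) (gam W C s)"

definition fin_nml :: "waveguide \<Rightarrow> curve \<Rightarrow> real \<Rightarrow> real \<Rightarrow> complex" where
  "fin_nml W C e s = lrefl (nml W C e) (nml W C s)"

definition smooth_curve :: "real \<Rightarrow> (real \<Rightarrow> complex) \<Rightarrow> bool" where
  "smooth_curve L g \<longleftrightarrow>
     (\<exists>D :: nat \<Rightarrow> real \<Rightarrow> complex. D 0 = g \<and>
        (\<forall>m. \<forall>s\<in>{0..L}. (D m has_vector_derivative D (Suc m) s) (at s within {0..L})))"

definition waveguide_geometry :: "waveguide \<Rightarrow> bool" where
  "waveguide_geometry W \<longleftrightarrow>
     open (region W) \<and> connected (region W) \<and>
     frontier (region W) = (\<Union>C. arc_of W C) \<and>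
     (\<forall>C. 0 < len W C \<and> smooth_curve (len W C) (gam W C) \<and> inj_on (gam W C) {0..len W C} \<and>
        (\<forall>s\<in>{0..len W C}. norm (tang W C s) = 1)) \<and>
     \<comment> \<open>positive orientation: \<open>nml\<close> is the outward normal\<close>
     (\<forall>C. \<forall>s\<in>{0<..<len W C}. \<forall>\<^sub>F t in at_right 0.
        gam W C s - t *\<^sub>R nml W C s \<in> region W \<and> gam W C s + t *\<^sub>R nml W C s \<notin> region W) \<and>
     (\<forall>i. arc_of W (Star i) \<inter> arc_of W (Star (\<not> i)) = {}) \<and>
     (\<forall>j. arc_of W (Circ j) \<inter> arc_of W (Circ (\<not> j)) = {}) \<and>
     (\<Union>i. arc_of W (Star i)) \<inter> (\<Union>j. arc_of W (Circ j)) = (\<Union>i. endpts W (Star i)) \<and>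
     (\<Union>i. endpts W (Star i)) = (\<Union>j. endpts W (Circ j)) \<and>
     (\<forall>i j. \<forall>e\<in>{0, len W (Star i)}. \<forall>e'\<in>{0, len W (Circ j)}.
        gam W (Star i) e = gam W (Circ j) e' \<longrightarrow> tang W (Star i) e \<bullet> tang W (Circ j) e' = 0) \<and>
     (\<forall>j. \<forall>e\<in>{0, len W (Circ j)}. curvature W (Circ j) e = 0)"

text \<open>
  Smallness of the fin radius. Connectedness of the reflected parameter set says that the curve
  together with its fins is again a curve.
\<close>

definition small_fins :: "waveguide \<Rightarrow> bool" where
  "small_fins W \<longleftrightarrow>
     0 < finR W \<and>
     (\<forall>C. \<forall>e\<in>{0, len W C}.
        connected (fin_dom W C e) \<and>
        closure (fin_pt W C e ` fin_dom W C e) \<inter> region W = {} \<and>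
        closure (fin_pt W C e ` fin_dom W C e) \<inter> frontier (region W) = {gam W C e})"

section \<open>Layer potentials over curves with fins\<close>

text \<open>Density on the fins: even reflection on the walls, odd reflection on the end caps.\<close>

fun parity :: "curve \<Rightarrow> complex" where
  "parity (Star i) = 1"
| "parity (Circ j) = - 1"

text \<open>
  The integral over the part of the extended curve at distance more than \<open>\<epsilon>\<close> from the target.
  For \<open>\<epsilon> = 0\<close> at most a null set is left out.
\<close>

definition layer_cut :: "waveguide \<Rightarrow> kernel \<Rightarrow> curve \<Rightarrow> (real \<Rightarrow> complex) \<Rightarrow>
    complex \<Rightarrow> complex \<Rightarrow> real \<Rightarrow> complex" where
  "layer_cut W K C \<sigma> x nx \<epsilon> =
     (\<integral>s. K x nx (gam W C s) (nml W C s) * \<sigma> s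
        \<partial>lebesgue_on {s \<in> {0..len W C}. \<epsilon> < dist x (gam W C s)})
     + (\<Sum>e\<in>{0, len W C}.
          (\<integral>s. K x nx (fin_pt W C e s) (fin_nml W C e s) * (parity C * \<sigma> s)
             \<partial>lebesgue_on {s \<in> fin_dom W C e. \<epsilon> < dist x (fin_pt W C e s)}))"

text \<open>
  Hadamard finite part: the constant term of the expansion as \<open>\<epsilon> \<rightarrow> 0\<close>. At targets off the
  extended curve it is the ordinary integral.
\<close>

definition layer_fp :: "waveguide \<Rightarrow> kernel \<Rightarrow> curve \<Rightarrow> (real \<Rightarrow> complex) \<Rightarrow>
    complex \<Rightarrow> complex \<Rightarrow> complex" where
  "layer_fp W K C \<sigma> x nx =
     (THE c. \<exists>b. ((\<lambda>\<epsilon>. layer_cut W K C \<sigma> x nx \<epsilon> - b / of_real \<epsilon>) \<longlongrightarrow> c) (at_right 0))"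

text \<open>First curve: target; second curve: source.\<close>

definition Sop :: "waveguide \<Rightarrow> curve \<Rightarrow> curve \<Rightarrow> (real \<Rightarrow> complex) \<Rightarrow> real \<Rightarrow> complex" where
  "Sop W T C \<sigma> s = layer_cut W (kerS (wnum W)) C \<sigma> (gam W T s) (nml W T s) 0"

definition Sop' :: "waveguide \<Rightarrow> curve \<Rightarrow> curve \<Rightarrow> (real \<Rightarrow> complex) \<Rightarrow> real \<Rightarrow> complex" where
  "Sop' W T C \<sigma> s = layer_cut W (kerS' (wnum W)) C \<sigma> (gam W T s) (nml W T s) 0"

definition Sop'' :: "waveguide \<Rightarrow> curve \<Rightarrow> curve \<Rightarrow> (real \<Rightarrow> complex) \<Rightarrow> real \<Rightarrow> complex" where
  "Sop'' W T C \<sigma> s = layer_fp W (kerS'' (wnum W)) C \<sigma> (gam W T s) (nml W T s)"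

definition Dop :: "waveguide \<Rightarrow> curve \<Rightarrow> curve \<Rightarrow> (real \<Rightarrow> complex) \<Rightarrow> real \<Rightarrow> complex" where
  "Dop W T C \<sigma> s = layer_cut W (kerD (wnum W)) C \<sigma> (gam W T s) (nml W T s) 0"

definition Dop' :: "waveguide \<Rightarrow> curve \<Rightarrow> curve \<Rightarrow> (real \<Rightarrow> complex) \<Rightarrow> real \<Rightarrow> complex" where
  "Dop' W T C \<sigma> s = layer_fp W (kerD' (wnum W)) C \<sigma> (gam W T s) (nml W T s)"

section \<open>Surface operators\<close>

text \<open>\<open>P m n\<close> is the mixed partial derivative of order \<open>m\<close> in \<open>s\<close> and \<open>n\<close> in \<open>s'\<close>.\<close>

definition partials_on_square :: "real \<Rightarrow> (real \<Rightarrow> real \<Rightarrow> complex) \<Rightarrow>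
    (nat \<Rightarrow> nat \<Rightarrow> real \<Rightarrow> real \<Rightarrow> complex) \<Rightarrow> bool" where
  "partials_on_square L \<psi> P \<longleftrightarrow>
     P 0 0 = \<psi> \<and>
     (\<forall>m n. continuous_on ({0..L} \<times> {0..L}) (\<lambda>(s, s'). P m n s s') \<and>
        (\<forall>s\<in>{0..L}. \<forall>s'\<in>{0..L}.
           ((\<lambda>t. P m n t s') has_vector_derivative P (Suc m) n s s') (at s within {0..L}) \<and>
           ((\<lambda>t. P m n s t) has_vector_derivative P m (Suc n) s s') (at s' within {0..L})))"

text \<open>
  The Neumann conditions are required for \<open>0 < s < L\<close>: at \<open>s = s'\<close> the kernel has a kink.
\<close>

definition neumann_green :: "complex \<Rightarrow> real \<Rightarrow> (real \<Rightarrow> real \<Rightarrow> complex) \<Rightarrow> bool" where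
  "neumann_green kG L g \<longleftrightarrow>
     (\<exists>\<psi> P. partials_on_square L \<psi> P \<and>
        (\<forall>s\<in>{0..L}. \<forall>s'\<in>{0..L}.
           g s s' = 1 / (2 * \<i> * kG) * exp (\<i> * kG * of_real \<bar>s - s'\<bar>) + \<psi> s s' \<and>
           P 2 0 s s' + kG\<^sup>2 * \<psi> s s' = 0 \<and>
           P 0 2 s s' + kG\<^sup>2 * \<psi> s s' = 0)) \<and>
     (\<forall>s\<in>{0<..<L}.
        (g s has_vector_derivative 0) (at 0 within {0..L}) \<and>
        (g s has_vector_derivative 0) (at L within {0..L}))"

definition Gop :: "waveguide \<Rightarrow> bool \<Rightarrow> (real \<Rightarrow> complex) \<Rightarrow> real \<Rightarrow> complex" where
  "Gop W i \<phi> s = (\<integral>s'. greenF W i s s' * \<phi> s' \<partial>lebesgue_on {0..len W (Star i)})"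

definition Fop :: "waveguide \<Rightarrow> bool \<Rightarrow> (real \<Rightarrow> complex) \<Rightarrow> real \<Rightarrow> complex" where
  "Fop W i \<phi> s =
     (let L = len W (Star i)
      in greenF W i s L * dint L \<phi> L - greenF W i s 0 * dint L \<phi> 0)"

definition waveguide_constants :: "waveguide \<Rightarrow> bool" where
  "waveguide_constants W \<longleftrightarrow>
     0 < wnum W \<and> c1 W \<noteq> 0 \<and>
     (kGam W)\<^sup>2 = (1 + c1 W * c2 W) / (c1 W)\<^sup>2 \<and> 0 < Im (kGam W) \<and>
     (\<forall>i. neumann_green (kGam W) (len W (Star i)) (greenF W i))"

section \<open>The entries and the reduced operator\<close>

definition H2_star :: "waveguide \<Rightarrow> bool \<Rightarrow> real fspace" where
  "H2_star W i = H2_space (len W (Star i))"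

text \<open>
  \<open>L\<^sup>2(\<Gamma>\<^sub>\<circ>)\<close> as the product over both end caps: the pair \<open>(j, s)\<close> is the point with arc length
  parameter \<open>s\<close> on the \<open>j\<close>-th one.
\<close>

definition L2_circ :: "waveguide \<Rightarrow> (bool \<times> real) fspace" where
  "L2_circ W = \<lparr>
     carr = {\<rho>. \<forall>j. (\<lambda>s. \<rho> (j, s)) \<in> L2_carr (len W (Circ j))},
     nrm = (\<lambda>\<rho>. sqrt (\<Sum>j\<in>UNIV. L2_sq (len W (Circ j)) (\<lambda>s. \<rho> (j, s)))) \<rparr>"

text \<open>Target \<open>Star i\<close>, source \<open>Star i\<close>.\<close>

definition K_star_self :: "waveguide \<Rightarrow> bool \<Rightarrow> (real \<Rightarrow> complex) \<Rightarrow> real \<Rightarrow> complex" where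
  "K_star_self W i \<sigma> s =
     (let C = Star i in
      - (c1 W / 2) * \<sigma> s + c1 W * Dop W C C \<sigma> s
      - 1 / c1 W * Gop W i (Dop W C C \<sigma>) s
      + Gop W i (\<lambda>t. Dop' W C C \<sigma> t + Sop'' W C C \<sigma> t) s
      + ((of_real (wnum W))\<^sup>2 - c2 W / c1 W) * Gop W i (Sop W C C \<sigma>) s
      + Gop W i (\<lambda>t. (of_real (curvature W C t) - 1 / c1 W) * Sop' W C C \<sigma> t) s
      + Fop W i (Sop W C C \<sigma>) s)"

text \<open>Target \<open>Star (\<not> i)\<close>, source \<open>Star i\<close>.\<close>

definition K_star_cross :: "waveguide \<Rightarrow> bool \<Rightarrow> (real \<Rightarrow> complex) \<Rightarrow> real \<Rightarrow> complex" where
  "K_star_cross W i \<sigma> s =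
     (let T = Star (\<not> i); C = Star i in
      c1 W * (Dop W T C \<sigma> s - 1 / c1 W * Sop W T C \<sigma> s)
      - 1 / c1 W * Gop W (\<not> i) (\<lambda>t. Dop W T C \<sigma> t - 1 / c1 W * Sop W T C \<sigma> t) s
      + Gop W (\<not> i) (\<lambda>t. Dop' W T C \<sigma> t - 1 / c1 W * Sop' W T C \<sigma> t) s)"

text \<open>Target \<open>Circ j\<close>, source \<open>Star i\<close>.\<close>

definition K_circ_star ::
    "waveguide \<Rightarrow> complex \<Rightarrow> bool \<Rightarrow> bool \<Rightarrow> (real \<Rightarrow> complex) \<Rightarrow> real \<Rightarrow> complex" where
  "K_circ_star W a j i \<sigma> s =
     (let T = Circ j; C = Star i in
      a * (Dop W T C \<sigma> s - 1 / c1 W * Sop W T C \<sigma> s)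
      + Dop' W T C \<sigma> s - 1 / c1 W * Sop' W T C \<sigma> s)"

text \<open>Target \<open>Star i\<close>, source \<open>Circ j\<close>.\<close>

definition K_star_circ ::
    "waveguide \<Rightarrow> bool \<Rightarrow> bool \<Rightarrow> (real \<Rightarrow> complex) \<Rightarrow> real \<Rightarrow> complex" where
  "K_star_circ W i j \<rho> s =
     (let T = Star i; C = Circ j in
      c1 W * Sop W T C \<rho> s - 1 / c1 W * Gop W i (Sop W T C \<rho>) s + Gop W i (Sop' W T C \<rho>) s)"

text \<open>Target \<open>Circ j'\<close>, source \<open>Circ j\<close>.\<close>

definition K_circ_circ ::
    "waveguide \<Rightarrow> complex \<Rightarrow> bool \<Rightarrow> bool \<Rightarrow> (real \<Rightarrow> complex) \<Rightarrow> real \<Rightarrow> complex" where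
  "K_circ_circ W a j' j \<rho> s =
     (let T = Circ j'; C = Circ j in
      (if j' = j then \<rho> s / 2 else 0) + a * Sop W T C \<rho> s + Sop' W T C \<rho> s)"

definition K_star_row :: "waveguide \<Rightarrow> bool \<Rightarrow> (bool \<times> real \<Rightarrow> complex) \<Rightarrow> real \<Rightarrow> complex" where
  "K_star_row W i \<rho> s = (\<Sum>j\<in>UNIV. K_star_circ W i j (\<lambda>t. \<rho> (j, t)) s)"

definition K_star_col ::
    "waveguide \<Rightarrow> complex \<Rightarrow> bool \<Rightarrow> (real \<Rightarrow> complex) \<Rightarrow> bool \<times> real \<Rightarrow> complex" where
  "K_star_col W a i \<sigma> = (\<lambda>(j, s). K_circ_star W a j i \<sigma> s)"

definition K_circ_block ::
    "waveguide \<Rightarrow> complex \<Rightarrow> (bool \<times> real \<Rightarrow> complex) \<Rightarrow> bool \<times> real \<Rightarrow> complex" where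
  "K_circ_block W a \<rho> = (\<lambda>(j', s). \<Sum>j\<in>UNIV. K_circ_circ W a j' j (\<lambda>t. \<rho> (j, t)) s)"

definition A_op :: "waveguide \<Rightarrow> bool \<Rightarrow> (real \<Rightarrow> complex) \<Rightarrow> real \<Rightarrow> complex" where
  "A_op W i \<sigma> = K_star_cross W i (inv_on (H2_star W i) (K_star_self W i) \<sigma>)"

definition schur_op :: "waveguide \<Rightarrow> bool \<Rightarrow> (real \<Rightarrow> complex) \<Rightarrow> real \<Rightarrow> complex" where
  "schur_op W i \<sigma> = (\<lambda>s. K_star_self W i \<sigma> s - A_op W (\<not> i) (K_star_cross W i \<sigma>) s)"

definition B_op :: "waveguide \<Rightarrow> bool \<Rightarrow> (bool \<times> real \<Rightarrow> complex) \<Rightarrow> real \<Rightarrow> complex" where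
  "B_op W i \<rho> = inv_on (H2_star W i) (schur_op W i)
     (\<lambda>s. A_op W (\<not> i) (K_star_row W (\<not> i) \<rho>) s - K_star_row W i \<rho> s)"

definition M_red ::
    "waveguide \<Rightarrow> complex \<Rightarrow> (bool \<times> real \<Rightarrow> complex) \<Rightarrow> bool \<times> real \<Rightarrow> complex" where
  "M_red W a \<rho> = (\<lambda>x. K_circ_block W a \<rho> x + (\<Sum>i\<in>UNIV. K_star_col W a i (B_op W i \<rho>) x))"

definition M_plus :: "waveguide \<Rightarrow> (bool \<times> real \<Rightarrow> complex) \<Rightarrow> bool \<times> real \<Rightarrow> complex" where
  "M_plus W = M_red W (\<i> * of_real (wnum W))"

definition M_minus :: "waveguide \<Rightarrow> (bool \<times> real \<Rightarrow> complex) \<Rightarrow> bool \<times> real \<Rightarrow> complex" where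
  "M_minus W = M_red W (- \<i> * of_real (wnum W))"

definition I_minus_plus ::
    "waveguide \<Rightarrow> (bool \<times> real \<Rightarrow> complex) \<Rightarrow> bool \<times> real \<Rightarrow> complex" where
  "I_minus_plus W = M_minus W \<circ> inv_on (L2_circ W) (M_plus W)"

definition I_plus_minus ::
    "waveguide \<Rightarrow> (bool \<times> real \<Rightarrow> complex) \<Rightarrow> bool \<times> real \<Rightarrow> complex" where
  "I_plus_minus W = M_plus W \<circ> inv_on (L2_circ W) (M_minus W)"

end

theory Submission
  imports Defs "HOL-Library.Diagonal_Subsequence"
begin

text \<open>
  Only the terms with the factor \<open>a\<close> distinguish the two reduced operators, so \<open>M\<^sup>- - M\<^sup>+\<close> is a multiple
  of the sum of the single layer operator of the end caps and of the operators \<open>(D - S / c\<^sub>1) B\<^sub>i\<close>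
  from the end caps to the walls and back, and \<open>M\<^sup>- (M\<^sup>+)\<^sup>-\<^sup>1 = I + (M\<^sup>- - M\<^sup>+) (M\<^sup>+)\<^sup>-\<^sup>1\<close>. It is enough
  that this difference is compact.

  The operators \<open>B\<^sub>i\<close> are bounded from \<open>L\<^sup>2\<close> to \<open>H\<^sup>2\<close>. The only critical term is the second tangential
  derivative on a wall of the single layer potential of an end cap. Near a corner the kernel and
  its two derivatives are singular; but curve and fin are mirror images in a line tangent to the
  wall and carry opposite densities, so the leading singularities cancel and a kernel of size
  \<open>1 / (s + t)\<close> remains, where \<open>s\<close> and \<open>t\<close> are the distances from the corner. Hilbert's inequality
  bounds it on \<open>L\<^sup>2\<close>.

  Given a bounded sequence in \<open>L\<^sup>2\<close> of the end caps, pass to a subsequence such that it and its images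
  under \<open>B\<^sub>i\<close> converge weakly in \<open>L\<^sup>2\<close>. At each fixed interior target the kernels of \<open>S\<close> and \<open>D\<close> are
  square integrable, so the layer potentials converge pointwise. The images under \<open>B\<^sub>i\<close> are bounded
  uniformly, which dominates the potentials by a multiple of \<open>1 + s\<^bsup>-1/4\<^esup>\<close>, and dominated convergence
  gives convergence in \<open>L\<^sup>2\<close>.
\<close>

section \<open>Square integrable functions and weak compactness\<close>

text \<open>Hypersingular integrals are never estimated near a singularity. \<open>Sop''\<close> and
  the on-surface \<open>Dop'\<close> occur only inside \<open>K_star_self\<close>, which enters
  through inverses assumed to be bounded; the \<open>Dop'\<close> from the walls to the end caps
  carries no factor \<open>a\<close> and cancels in the difference; the \<open>Dop'\<close> from
  wall to wall has its targets at a positive distance from the source. What remains is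
  \<open>Sop\<close>, \<open>Sop'\<close> and \<open>Dop\<close> off the source curve, and
  \<open>Sop\<close> on it. The logarithm is replaced throughout by the power -1/4 of the distance,
  whose square is still integrable.

  Two features of the setting shape the algebra. Operators act on representatives, so the reduced
  operators must be shown to respect equality almost everywhere. Moreover
  \<open>invertible_on\<close> does not ask for linearity, so the linearity demanded of the compact
  part is recovered from the bounded linear inverses.\<close>

definition sqi :: "'a measure \<Rightarrow> ('a \<Rightarrow> real) \<Rightarrow> bool" where
  "sqi M f \<longleftrightarrow> f \<in> borel_measurable M \<and> integrable M (\<lambda>x. (f x)\<^sup>2)"

lemma sqi_measurable[measurable_dest]: "sqi M f \<Longrightarrow> f \<in> borel_measurable M"
  by (simp add: sqi_def)

lemma sqi_square: "sqi M f \<Longrightarrow> integrable M (\<lambda>x. (f x)\<^sup>2)"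
  by (simp add: sqi_def)

lemma sqi_mult:
  assumes "sqi M f" "sqi M g"
  shows "integrable M (\<lambda>x. f x * g x)"
proof (rule Bochner_Integration.integrable_bound)
  show "integrable M (\<lambda>x. (f x)\<^sup>2 + (g x)\<^sup>2)"
    using assms by (simp add: sqi_def)
  show "(\<lambda>x. f x * g x) \<in> borel_measurable M"
    using assms by (auto simp: sqi_def)
  have "norm (f x * g x) \<le> norm ((f x)\<^sup>2 + (g x)\<^sup>2)" for x
  proof -
    have "0 \<le> (\<bar>f x\<bar> - \<bar>g x\<bar>)\<^sup>2" by simp
    then have "2 * (\<bar>f x\<bar> * \<bar>g x\<bar>) \<le> (f x)\<^sup>2 + (g x)\<^sup>2"
      by (simp add: power2_diff)
    moreover have "0 \<le> \<bar>f x\<bar> * \<bar>g x\<bar>" by simp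
    ultimately have "\<bar>f x\<bar> * \<bar>g x\<bar> \<le> (f x)\<^sup>2 + (g x)\<^sup>2" by linarith
    then show ?thesis by (simp add: abs_mult)
  qed
  then show "AE x in M. norm (f x * g x) \<le> norm ((f x)\<^sup>2 + (g x)\<^sup>2)" by simp
qed

lemma sqi_zero: "sqi M (\<lambda>x. 0)"
  by (simp add: sqi_def)

lemma sqi_scale: "sqi M f \<Longrightarrow> sqi M (\<lambda>x. c * f x)"
  by (auto simp: sqi_def power_mult_distrib)

lemma sqi_add:
  assumes "sqi M f" "sqi M g"
  shows "sqi M (\<lambda>x. f x + g x)"
proof -
  have "(\<lambda>x. (f x + g x)\<^sup>2) = (\<lambda>x. (f x)\<^sup>2 + 2 * (f x * g x) + (g x)\<^sup>2)"
    by (auto simp: power2_sum)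
  then show ?thesis
    using assms sqi_mult[OF assms] by (auto simp: sqi_def)
qed

lemma sqi_bound:
  assumes "sqi M f" "g \<in> borel_measurable M" "\<And>x. x \<in> space M \<Longrightarrow> \<bar>g x\<bar> \<le> \<bar>f x\<bar>"
  shows "sqi M g" "(\<integral>x. (g x)\<^sup>2 \<partial>M) \<le> (\<integral>x. (f x)\<^sup>2 \<partial>M)"
proof -
  have *: "(g x)\<^sup>2 \<le> (f x)\<^sup>2" if "x \<in> space M" for x
    using assms(3)[OF that] by (simp add: abs_le_square_iff)
  have i: "integrable M (\<lambda>x. (g x)\<^sup>2)"
    by (rule Bochner_Integration.integrable_bound[OF sqi_square[OF assms(1)]]) (use assms(2) * in auto)
  then show "sqi M g" using assms(2) by (simp add: sqi_def)
  show "(\<integral>x. (g x)\<^sup>2 \<partial>M) \<le> (\<integral>x. (f x)\<^sup>2 \<partial>M)"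
    by (rule integral_mono[OF i sqi_square[OF assms(1)]]) (rule *)
qed

text \<open>A quadratic polynomial in \<open>l\<close> that is never negative is evaluated at its
  minimiser \<open>b / c\<close>; for \<open>c = 0\<close> it is affine in \<open>l\<close>, which
  forces \<open>b = 0\<close>.\<close>

lemma discriminant_le:
  fixes a b c :: real
  assumes "\<And>l. 0 \<le> a - 2 * l * b + l\<^sup>2 * c" "0 \<le> c"
  shows "b\<^sup>2 \<le> a * c"
proof (cases "c = 0")
  case True
  have "b = 0"
  proof (rule ccontr)
    assume "b \<noteq> 0"
    then show False
      \<comment> \<open>At this \<open>l\<close> the affine expression takes the value -1.\<close>
      using assms(1)[of "(a + 1) / (2 * b)"] True by simp
  qed
  then show ?thesis using True by simp
next
  case False
  then have c: "c > 0" using assms(2) by simp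
  have "0 \<le> a - b\<^sup>2 / c"
    using assms(1)[of "b / c"] c by (simp add: power2_eq_square field_simps)
  then show ?thesis using c by (simp add: field_simps)
qed

lemma complete_square:
  fixes a b y :: real
  assumes "y \<noteq> 0"
  shows "a - 2 * (b / y) * b + (b / y)\<^sup>2 * y = a - b\<^sup>2 / y"
proof -
  have 1: "(b / y)\<^sup>2 * y = b\<^sup>2 / y"
    using assms by (simp add: power2_eq_square)
  have 2: "2 * (b / y) * b = 2 * (b\<^sup>2 / y)"
    by (simp add: power2_eq_square)
  show ?thesis unfolding 1 2 by simp
qed

lemma sqi_diff_expand:
  assumes "sqi M f" "sqi M g"
  shows "(\<integral>x. (f x - l * g x)\<^sup>2 \<partial>M) =
    (\<integral>x. (f x)\<^sup>2 \<partial>M) - 2 * l * (\<integral>x. f x * g x \<partial>M) + l\<^sup>2 * (\<integral>x. (g x)\<^sup>2 \<partial>M)"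
proof -
  have "(\<lambda>x. (f x - l * g x)\<^sup>2) = (\<lambda>x. (f x)\<^sup>2 - 2 * l * (f x * g x) + l\<^sup>2 * (g x)\<^sup>2)"
    by (auto simp: power2_eq_square algebra_simps)
  then show ?thesis
    using assms[THEN sqi_square] sqi_mult[OF assms] by simp
qed

lemma sqi_cauchy_schwarz:
  assumes "sqi M f" "sqi M g"
  shows "(\<integral>x. f x * g x \<partial>M)\<^sup>2 \<le> (\<integral>x. (f x)\<^sup>2 \<partial>M) * (\<integral>x. (g x)\<^sup>2 \<partial>M)"
proof (rule discriminant_le)
  fix l
  have "0 \<le> (\<integral>x. (f x - l * g x)\<^sup>2 \<partial>M)" by simp
  then show "0 \<le> (\<integral>x. (f x)\<^sup>2 \<partial>M) - 2 * l * (\<integral>x. f x * g x \<partial>M) + l\<^sup>2 * (\<integral>x. (g x)\<^sup>2 \<partial>M)"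
    by (simp add: sqi_diff_expand[OF assms])
qed simp

text \<open>The span is built by adding one multiple of a member at a time, because the minimisation
  below perturbs an almost optimal element by exactly one such step.\<close>

inductive_set lspan :: "(nat \<Rightarrow> 'a \<Rightarrow> real) \<Rightarrow> ('a \<Rightarrow> real) set" for f where
  zero: "(\<lambda>x. 0) \<in> lspan f"
| step: "v \<in> lspan f \<Longrightarrow> (\<lambda>x. v x + c * f n x) \<in> lspan f"

text \<open>
  Along a subsequence the integrals against every member of the sequence converge, hence also
  those against its linear span. A function whose distance from the span is almost attained at
  \<open>v\<close> differs from \<open>v\<close> by something nearly orthogonal to the whole sequence; so neither
  completeness nor separability is needed.
\<close>

lemma sqi_weakly_compact:
  assumes f: "\<And>n. sqi M (f n)" and B: "\<And>n. (\<integral>x. (f n x)\<^sup>2 \<partial>M) \<le> B"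
  shows "\<exists>r :: nat \<Rightarrow> nat. strict_mono r \<and>
    (\<forall>g. sqi M g \<longrightarrow> convergent (\<lambda>n. \<integral>x. g x * f (r n) x \<partial>M))"
proof -
  define P where "P m s \<longleftrightarrow> convergent (\<lambda>n. \<integral>x. f m x * f (s n) x \<partial>M)" for m and s :: "nat \<Rightarrow> nat"
  have B0: "0 \<le> B" using B[of 0] by (rule order_trans[OF integral_nonneg_AE, rotated]) simp
  have bnd: "\<bar>\<integral>x. f m x * f n x \<partial>M\<bar> \<le> B" for m n
  proof -
    have "(\<integral>x. f m x * f n x \<partial>M)\<^sup>2 \<le> (\<integral>x. (f m x)\<^sup>2 \<partial>M) * (\<integral>x. (f n x)\<^sup>2 \<partial>M)"
      by (rule sqi_cauchy_schwarz[OF f f])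
    also have "\<dots> \<le> B * B"
      by (rule mult_mono[OF B B B0]) simp
    finally have "(\<integral>x. f m x * f n x \<partial>M)\<^sup>2 \<le> B * B" .
    then show ?thesis
      using abs_le_square_iff[of "\<integral>x. f m x * f n x \<partial>M" B] B0 by (simp add: power2_eq_square)
  qed
  have ex: "\<exists>r. strict_mono r \<and> P m (s \<circ> r)" for m and s :: "nat \<Rightarrow> nat"
  proof -
    have "bounded (range (\<lambda>n. \<integral>x. f m x * f (s n) x \<partial>M))"
      unfolding bounded_iff using bnd by auto
    from bounded_imp_convergent_subsequence[OF this]
    show "\<exists>r. strict_mono r \<and> P m (s \<circ> r)"
      unfolding P_def convergent_def by (auto simp: o_def)
  qed
  interpret subseqs P
    by unfold_locales (rule ex)
  have sub: "P n (s \<circ> r)" if "strict_mono r" "P n s" for r s :: "nat \<Rightarrow> nat" and n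
    using convergent_subseq_convergent[OF that(2)[unfolded P_def] that(1)] by (simp add: P_def o_def)
  \<comment> \<open>The diagonal sequence is a subsequence of the \<open>k\<close>-th extracted one
    only from the index \<open>Suc k\<close> on; the shift is undone right afterwards.\<close>
  have "P k (diagseq \<circ> ((+) (Suc k)))" for k
    by (rule diagseq_holds) (rule sub)
  then have conv: "convergent (\<lambda>n. \<integral>x. f k x * f (diagseq n) x \<partial>M)" for k
  proof -
    have "convergent (\<lambda>n. \<integral>x. f k x * f (diagseq (n + Suc k)) x \<partial>M)"
      using \<open>P k (diagseq \<circ> ((+) (Suc k)))\<close> by (simp add: P_def o_def add.commute)
    then show ?thesis
      using convergent_ignore_initial_segment[of "\<lambda>n. \<integral>x. f k x * f (diagseq n) x \<partial>M" "Suc k"] by simp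
  qed
  have span: "sqi M v \<and> convergent (\<lambda>n. \<integral>x. v x * f (diagseq n) x \<partial>M)" if "v \<in> lspan f" for v
    using that
  proof induction
    case zero
    then show ?case by (simp add: sqi_zero convergent_const)
  next
    case (step v c n)
    have "(\<integral>x. (v x + c * f n x) * f (diagseq k) x \<partial>M) =
        (\<integral>x. v x * f (diagseq k) x \<partial>M) + c * (\<integral>x. f n x * f (diagseq k) x \<partial>M)" for k
    proof -
      have "(\<integral>x. (v x + c * f n x) * f (diagseq k) x \<partial>M) =
          (\<integral>x. v x * f (diagseq k) x + c * (f n x * f (diagseq k) x) \<partial>M)"
        by (simp add: algebra_simps)
      also have "\<dots> = (\<integral>x. v x * f (diagseq k) x \<partial>M) + c * (\<integral>x. f n x * f (diagseq k) x \<partial>M)"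
        using step.IH by (subst Bochner_Integration.integral_add) (auto intro!: sqi_mult f)
      finally show ?thesis .
    qed
    then show ?case
      using step.IH conv[of n] by (auto intro!: sqi_add sqi_scale f convergent_add convergent_mult convergent_const)
  qed
  have "Cauchy (\<lambda>n. \<integral>x. g x * f (diagseq n) x \<partial>M)" if g: "sqi M g" for g
  proof (rule metric_CauchyI)
    fix e :: real assume e: "e > 0"
    define D where "D = (\<lambda>v. \<integral>x. (g x - v x)\<^sup>2 \<partial>M) ` lspan f"
    define d where "d = Inf D"
    have bb: "bdd_below D" unfolding D_def by (intro bdd_belowI[of _ 0]) auto
    have ne: "D \<noteq> {}" unfolding D_def using lspan.zero by auto
    \<comment> \<open>For a pairing b of the remainder with a member, b^2 / (B + 1) <
      \<open>\<eta>\<close> says |b| < e / 3. The summand 1 keeps the divisor positive when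
      \<open>B = 0\<close>.\<close>
    define \<eta> where "\<eta> = (e / 3)\<^sup>2 / (B + 1)"
    have \<eta>: "\<eta> > 0" using e B0 by (simp add: \<eta>_def)
    have "\<exists>z\<in>D. z < d + \<eta>"
      using cInf_lessD[OF ne, of "d + \<eta>"] \<eta> by (auto simp: d_def)
    then obtain v where v: "v \<in> lspan f" "(\<integral>x. (g x - v x)\<^sup>2 \<partial>M) < d + \<eta>"
      by (auto simp: D_def)
    have sv: "sqi M v" using span v by blast
    define w where "w = (\<lambda>x. g x + (-1) * v x)"
    have sw: "sqi M w" unfolding w_def by (intro sqi_add g sqi_scale sv)
    have near: "\<bar>\<integral>x. w x * f n x \<partial>M\<bar> < e / 3" for n
    proof -
      let ?b = "\<integral>x. w x * f n x \<partial>M"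
      \<comment> \<open>This value minimises the bound |w|^2 - 2 l b + l^2 (B + 1) on the squared
        distance after one more step in the span. Since the distance at \<open>v\<close> is optimal
        up to \<open>\<eta>\<close>, the gain b^2 / (B + 1) stays below
        \<open>\<eta>\<close>.\<close>
      let ?l = "?b / (B + 1)"
      have "(\<lambda>x. v x + ?l * f n x) \<in> lspan f" using v by (intro lspan.step)
      then have "(\<integral>x. (g x - (v x + ?l * f n x))\<^sup>2 \<partial>M) \<in> D" unfolding D_def by (rule rev_image_eqI) simp
      then have "d \<le> (\<integral>x. (g x - (v x + ?l * f n x))\<^sup>2 \<partial>M)"
        unfolding d_def by (rule cInf_lower[OF _ bb])
      also have "\<dots> = (\<integral>x. (w x - ?l * f n x)\<^sup>2 \<partial>M)"
        by (simp add: w_def algebra_simps)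
      also have "\<dots> = (\<integral>x. (w x)\<^sup>2 \<partial>M) - 2 * ?l * ?b + ?l\<^sup>2 * (\<integral>x. (f n x)\<^sup>2 \<partial>M)"
        by (rule sqi_diff_expand[OF sw f])
      also have "\<dots> \<le> (\<integral>x. (w x)\<^sup>2 \<partial>M) - 2 * ?l * ?b + ?l\<^sup>2 * (B + 1)"
        using B[of n] by (intro add_left_mono mult_left_mono) auto
      also have "\<dots> = (\<integral>x. (w x)\<^sup>2 \<partial>M) - ?b\<^sup>2 / (B + 1)"
        by (rule complete_square) (use B0 in simp)
      also have "\<dots> < d + \<eta> - ?b\<^sup>2 / (B + 1)"
        using v(2) by (simp add: w_def)
      finally have "?b\<^sup>2 / (B + 1) < (e / 3)\<^sup>2 / (B + 1)" by (simp add: \<eta>_def)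
      then have "?b\<^sup>2 < (e / 3)\<^sup>2" using B0 by (simp add: divide_less_cancel)
      then show ?thesis using power2_less_imp_less[of "\<bar>?b\<bar>" "e / 3"] e by simp
    qed
    have "Cauchy (\<lambda>n. \<integral>x. v x * f (diagseq n) x \<partial>M)"
      using span[OF v(1)] convergent_Cauchy by blast
    from metric_CauchyD[OF this, of "e / 3"] e obtain N where N: "\<forall>m\<ge>N. \<forall>n\<ge>N.
        dist (\<integral>x. v x * f (diagseq m) x \<partial>M) (\<integral>x. v x * f (diagseq n) x \<partial>M) < e / 3"
      by auto
    have split: "(\<integral>x. g x * f n x \<partial>M) = (\<integral>x. w x * f n x \<partial>M) + (\<integral>x. v x * f n x \<partial>M)" for n
    proof -
      have "(\<integral>x. g x * f n x \<partial>M) = (\<integral>x. w x * f n x + v x * f n x \<partial>M)"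
        by (simp add: w_def algebra_simps)
      also have "\<dots> = (\<integral>x. w x * f n x \<partial>M) + (\<integral>x. v x * f n x \<partial>M)"
        by (intro Bochner_Integration.integral_add sqi_mult f sw sv)
      finally show ?thesis .
    qed
    show "\<exists>N. \<forall>m\<ge>N. \<forall>n\<ge>N. dist (\<integral>x. g x * f (diagseq m) x \<partial>M) (\<integral>x. g x * f (diagseq n) x \<partial>M) < e"
    proof (intro exI allI impI)
      fix m n assume "m \<ge> N" "n \<ge> N"
      then have 1: "dist (\<integral>x. v x * f (diagseq m) x \<partial>M) (\<integral>x. v x * f (diagseq n) x \<partial>M) < e / 3" using N by blast
      show "dist (\<integral>x. g x * f (diagseq m) x \<partial>M) (\<integral>x. g x * f (diagseq n) x \<partial>M) < e"
        using 1 near[of "diagseq m"] near[of "diagseq n"]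
        unfolding split[of "diagseq m"] split[of "diagseq n"] dist_real_def by linarith
    qed
  qed
  then show ?thesis
    using subseq_diagseq by (auto intro!: exI[of _ diagseq] simp: Cauchy_convergent_iff)
qed

section \<open>Complex square integrable functions on an interval\<close>

lemma L2_carr_iff_sqi:
  "f \<in> L2_carr L \<longleftrightarrow>
     f \<in> borel_measurable (lebesgue_on {0..L}) \<and> sqi (lebesgue_on {0..L}) (\<lambda>s. cmod (f s))"
  by (auto simp: L2_carr_def sqi_def)

lemma L2_carrD:
  assumes "f \<in> L2_carr L"
  shows "f \<in> borel_measurable (lebesgue_on {0..L})" "sqi (lebesgue_on {0..L}) (\<lambda>s. cmod (f s))"
  using assms by (auto simp: L2_carr_iff_sqi)

lemma L2_sq_nonneg: "0 \<le> L2_sq L f"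
  by (simp add: L2_sq_def)

lemma finite_measure_interval: "finite_measure (lebesgue_on {a..b::real})"
  by (rule finite_measure_lebesgue_on) simp

lemma sqi_const_lebesgue_on: "sqi (lebesgue_on {0..L::real}) (\<lambda>s. c)"
  unfolding sqi_def using finite_measure.integrable_const[OF finite_measure_interval] by simp

lemma L2_bound:
  assumes "sqi (lebesgue_on {0..L}) h" "f \<in> borel_measurable (lebesgue_on {0..L})"
    "\<And>s. s \<in> {0..L} \<Longrightarrow> cmod (f s) \<le> \<bar>h s\<bar>"
  shows "f \<in> L2_carr L" "L2_sq L f \<le> (\<integral>s. (h s)\<^sup>2 \<partial>lebesgue_on {0..L})"
  using sqi_bound[of "lebesgue_on {0..L}" h "\<lambda>s. cmod (f s)"] assms
  by (auto simp: L2_carr_iff_sqi L2_sq_def)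

lemma L2_scale:
  assumes "f \<in> L2_carr L"
  shows "(\<lambda>s. c * f s) \<in> L2_carr L" "L2_sq L (\<lambda>s. c * f s) = (cmod c)\<^sup>2 * L2_sq L f"
  using assms by (auto simp: L2_carr_iff_sqi L2_sq_def norm_mult power_mult_distrib intro!: sqi_scale)

lemma L2_add:
  assumes f: "f \<in> L2_carr L" and g: "g \<in> L2_carr L"
  shows "(\<lambda>s. f s + g s) \<in> L2_carr L"
    "L2_sq L (\<lambda>s. f s + g s) \<le> 2 * L2_sq L f + 2 * L2_sq L g"
proof -
  let ?M = "lebesgue_on {0..L}"
  have m: "(\<lambda>s. f s + g s) \<in> borel_measurable ?M"
    using f g by (auto simp: L2_carr_def)
  have s: "sqi ?M (\<lambda>s. cmod (f s) + cmod (g s))"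
    by (intro sqi_add L2_carrD f g)
  show c: "(\<lambda>s. f s + g s) \<in> L2_carr L"
    by (rule L2_bound(1)[OF s m]) (auto intro: norm_triangle_ineq order_trans)
  have "L2_sq L (\<lambda>s. f s + g s) \<le> (\<integral>s. (cmod (f s) + cmod (g s))\<^sup>2 \<partial>?M)"
    by (rule L2_bound(2)[OF s m]) (auto intro: norm_triangle_ineq order_trans)
  also have "\<dots> \<le> (\<integral>s. 2 * (cmod (f s))\<^sup>2 + 2 * (cmod (g s))\<^sup>2 \<partial>?M)"
  proof (rule integral_mono)
    show "integrable ?M (\<lambda>s. (cmod (f s) + cmod (g s))\<^sup>2)" using s by (rule sqi_square)
    show "integrable ?M (\<lambda>s. 2 * (cmod (f s))\<^sup>2 + 2 * (cmod (g s))\<^sup>2)"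
      using f g by (auto simp: L2_carr_def)
    fix s show "(cmod (f s) + cmod (g s))\<^sup>2 \<le> 2 * (cmod (f s))\<^sup>2 + 2 * (cmod (g s))\<^sup>2"
      using zero_le_power2[of "cmod (f s) - cmod (g s)"] by (simp add: power2_sum power2_diff)
  qed
  also have "\<dots> = 2 * L2_sq L f + 2 * L2_sq L g"
    using f g by (simp add: L2_sq_def L2_carr_def)
  finally show "L2_sq L (\<lambda>s. f s + g s) \<le> 2 * L2_sq L f + 2 * L2_sq L g" .
qed

lemma L2_sub:
  assumes f: "f \<in> L2_carr L" and g: "g \<in> L2_carr L"
  shows "(\<lambda>s. f s - g s) \<in> L2_carr L"
    "L2_sq L (\<lambda>s. f s - g s) \<le> 2 * L2_sq L f + 2 * L2_sq L g"
  using L2_add[OF f L2_scale(1)[OF g, of "-1"]] L2_scale(2)[OF g, of "-1"] by simp_all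

lemma L2_sq_eq_0:
  assumes "f \<in> L2_carr L"
  shows "L2_sq L f = 0 \<longleftrightarrow> (AE s in lebesgue_on {0..L}. f s = 0)"
  using assms unfolding L2_carr_def L2_sq_def by (subst integral_nonneg_eq_0_iff_AE) auto

lemma L2_pairing:
  assumes f: "f \<in> L2_carr L" and g: "g \<in> L2_carr L"
  shows "integrable (lebesgue_on {0..L}) (\<lambda>s. f s * g s)"
    "cmod (\<integral>s. f s * g s \<partial>lebesgue_on {0..L}) \<le> sqrt (L2_sq L f) * sqrt (L2_sq L g)"
proof -
  let ?M = "lebesgue_on {0..L}"
  note sf = L2_carrD(2)[OF f] and sg = L2_carrD(2)[OF g]
  have i: "integrable ?M (\<lambda>s. cmod (f s) * cmod (g s))"
    by (rule sqi_mult[OF sf sg])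
  show "integrable ?M (\<lambda>s. f s * g s)"
    by (rule Bochner_Integration.integrable_bound[OF i]) (use f g in \<open>auto simp: L2_carr_def norm_mult\<close>)
  have "cmod (\<integral>s. f s * g s \<partial>?M) \<le> (\<integral>s. cmod (f s) * cmod (g s) \<partial>?M)"
    using integral_norm_bound[of ?M "\<lambda>s. f s * g s"] by (simp add: norm_mult)
  also have "\<dots> \<le> sqrt ((\<integral>s. (cmod (f s))\<^sup>2 \<partial>?M) * (\<integral>s. (cmod (g s))\<^sup>2 \<partial>?M))"
    by (rule real_le_rsqrt[OF sqi_cauchy_schwarz[OF sf sg]])
  finally show "cmod (\<integral>s. f s * g s \<partial>?M) \<le> sqrt (L2_sq L f) * sqrt (L2_sq L g)"
    by (simp add: L2_sq_def real_sqrt_mult)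
qed

lemma L2_imp_L1:
  assumes f: "f \<in> L2_carr L" and L: "0 \<le> L"
  shows "integrable (lebesgue_on {0..L}) f"
    "(\<integral>s. cmod (f s) \<partial>lebesgue_on {0..L}) \<le> sqrt L * sqrt (L2_sq L f)"
proof -
  let ?M = "lebesgue_on {0..L}"
  note sf = L2_carrD(2)[OF f]
  have i: "integrable ?M (\<lambda>s. cmod (f s) * 1)"
    by (rule sqi_mult[OF sf sqi_const_lebesgue_on])
  show "integrable ?M f"
    by (rule Bochner_Integration.integrable_bound[OF i]) (use f in \<open>auto simp: L2_carr_def\<close>)
  have "(\<integral>s. cmod (f s) * 1 \<partial>?M)\<^sup>2 \<le> (\<integral>s. (cmod (f s))\<^sup>2 \<partial>?M) * (\<integral>s. (1::real)\<^sup>2 \<partial>?M)"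
    by (rule sqi_cauchy_schwarz[OF sf sqi_const_lebesgue_on])
  then have "(\<integral>s. cmod (f s) \<partial>?M)\<^sup>2 \<le> L * L2_sq L f"
    using L by (simp add: L2_sq_def mult.commute measure_restrict_space)
  then show "(\<integral>s. cmod (f s) \<partial>?M) \<le> sqrt L * sqrt (L2_sq L f)"
    by (metis real_le_rsqrt real_sqrt_mult)
qed

lemma L2_Re_Im:
  assumes "f \<in> L2_carr L"
  shows "sqi (lebesgue_on {0..L}) (\<lambda>s. Re (f s))" "sqi (lebesgue_on {0..L}) (\<lambda>s. Im (f s))"
    "(\<integral>s. (Re (f s))\<^sup>2 \<partial>lebesgue_on {0..L}) \<le> L2_sq L f"
    "(\<integral>s. (Im (f s))\<^sup>2 \<partial>lebesgue_on {0..L}) \<le> L2_sq L f"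
  using sqi_bound[OF L2_carrD(2)[OF assms], of "\<lambda>s. Re (f s)"]
    sqi_bound[OF L2_carrD(2)[OF assms], of "\<lambda>s. Im (f s)"] L2_carrD(1)[OF assms]
  by (auto simp: abs_Re_le_cmod abs_Im_le_cmod L2_sq_def)

text \<open>The real case is applied to the real parts and then, along the subsequence found, to the
  imaginary parts. The pairing is bilinear, without conjugation, as kernels act on densities; it is
  a combination of four real pairings.\<close>

lemma L2_weakly_compact:
  assumes \<rho>: "\<And>n. \<rho> n \<in> L2_carr L" and B: "\<And>n. L2_sq L (\<rho> n) \<le> B"
  shows "\<exists>r :: nat \<Rightarrow> nat. strict_mono r \<and>
    (\<forall>g\<in>L2_carr L. convergent (\<lambda>n. \<integral>s. g s * \<rho> (r n) s \<partial>lebesgue_on {0..L}))"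
proof -
  let ?M = "lebesgue_on {0..L}"
  have "\<exists>r :: nat \<Rightarrow> nat. strict_mono r \<and>
    (\<forall>g. sqi ?M g \<longrightarrow> convergent (\<lambda>n. \<integral>x. g x * Re (\<rho> (r n) x) \<partial>?M))"
    by (rule sqi_weakly_compact) (use L2_Re_Im[OF \<rho>] B order_trans in blast)+
  then obtain r where r: "strict_mono r"
    "\<And>g. sqi ?M g \<Longrightarrow> convergent (\<lambda>n. \<integral>x. g x * Re (\<rho> (r n) x) \<partial>?M)" by blast
  have "\<exists>r' :: nat \<Rightarrow> nat. strict_mono r' \<and>
    (\<forall>g. sqi ?M g \<longrightarrow> convergent (\<lambda>n. \<integral>x. g x * Im (\<rho> (r (r' n)) x) \<partial>?M))"
    by (rule sqi_weakly_compact[of ?M "\<lambda>n x. Im (\<rho> (r n) x)"]) (use L2_Re_Im[OF \<rho>] B order_trans in blast)+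
  then obtain r' where r': "strict_mono r'"
    "\<And>g. sqi ?M g \<Longrightarrow> convergent (\<lambda>n. \<integral>x. g x * Im (\<rho> (r (r' n)) x) \<partial>?M)" by blast
  have re: "convergent (\<lambda>n. \<integral>x. g x * Re (\<rho> (r (r' n)) x) \<partial>?M)" if "sqi ?M g" for g
    using convergent_subseq_convergent[OF r(2)[OF that] r'(1)] by (simp add: o_def)
  have "convergent (\<lambda>n. \<integral>s. g s * \<rho> ((r \<circ> r') n) s \<partial>?M)" if g: "g \<in> L2_carr L" for g
  proof -
    note sg = L2_Re_Im(1,2)[OF g]
    have eq: "(\<integral>s. g s * \<rho> (r (r' n)) s \<partial>?M) =
      of_real ((\<integral>x. Re (g x) * Re (\<rho> (r (r' n)) x) \<partial>?M) - (\<integral>x. Im (g x) * Im (\<rho> (r (r' n)) x) \<partial>?M)) +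
      \<i> * of_real ((\<integral>x. Re (g x) * Im (\<rho> (r (r' n)) x) \<partial>?M) + (\<integral>x. Im (g x) * Re (\<rho> (r (r' n)) x) \<partial>?M))" for n
    proof -
      note sr = L2_Re_Im(1,2)[OF \<rho>[of "r (r' n)"]]
      note i = L2_pairing(1)[OF g \<rho>[of "r (r' n)"]]
      show ?thesis
      proof (rule complex_eqI)
        show "Re (\<integral>s. g s * \<rho> (r (r' n)) s \<partial>?M) = Re (of_real ((\<integral>x. Re (g x) * Re (\<rho> (r (r' n)) x) \<partial>?M) - (\<integral>x. Im (g x) * Im (\<rho> (r (r' n)) x) \<partial>?M)) +
      \<i> * of_real ((\<integral>x. Re (g x) * Im (\<rho> (r (r' n)) x) \<partial>?M) + (\<integral>x. Im (g x) * Re (\<rho> (r (r' n)) x) \<partial>?M)))"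
          using integral_Re[OF i] sqi_mult[OF sg(1) sr(1)] sqi_mult[OF sg(2) sr(2)] by simp
        show "Im (\<integral>s. g s * \<rho> (r (r' n)) s \<partial>?M) = Im (of_real ((\<integral>x. Re (g x) * Re (\<rho> (r (r' n)) x) \<partial>?M) - (\<integral>x. Im (g x) * Im (\<rho> (r (r' n)) x) \<partial>?M)) +
      \<i> * of_real ((\<integral>x. Re (g x) * Im (\<rho> (r (r' n)) x) \<partial>?M) + (\<integral>x. Im (g x) * Re (\<rho> (r (r' n)) x) \<partial>?M)))"
          using integral_Im[OF i] sqi_mult[OF sg(1) sr(2)] sqi_mult[OF sg(2) sr(1)] by simp
      qed
    qed
    show ?thesis
      unfolding o_def eq
      by (intro convergent_add convergent_mult convergent_const convergent_of_real convergent_diff re r' sg)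
  qed
  then show ?thesis
    using strict_mono_o[OF r(1) r'(1)] by (intro exI[of _ "r \<circ> r'"]) auto
qed

section \<open>Singular weights and a Hilbert type inequality\<close>

lemma has_integral_nonneg_lebesgue_on:
  fixes f :: "real \<Rightarrow> real"
  assumes "(f has_integral I) S" "\<And>x. x \<in> S \<Longrightarrow> 0 \<le> f x" "S \<in> sets lebesgue"
  shows "integrable (lebesgue_on S) f" "(\<integral>x. f x \<partial>lebesgue_on S) = I"
proof -
  have "f absolutely_integrable_on S"
    by (rule nonnegative_absolutely_integrable_1) (use assms in auto)
  then show *: "integrable (lebesgue_on S) f"
    using assms(3) by (simp add: absolutely_integrable_imp_integrable)
  show "(\<integral>x. f x \<partial>lebesgue_on S) = I"
    using lebesgue_integral_eq_integral[OF * assms(3)] assms(1) by (simp add: integral_unique)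
qed

lemma powr_weight_integral:
  fixes a b M :: real
  assumes a: "0 < a" "a < 1" and M: "0 \<le> M"  and b: "b \<in> {0..M}"
  shows "integrable (lebesgue_on {0..M}) (\<lambda>t. \<bar>t - b\<bar> powr (- a))"
    "(\<integral>t. \<bar>t - b\<bar> powr (- a) \<partial>lebesgue_on {0..M}) \<le> 2 * M powr (1 - a) / (1 - a)"
proof -
  \<comment> \<open>An antiderivative made of the one-sided distances to \<open>b\<close>. On each
    side of \<open>b\<close> one of the two maxima vanishes, so the two branches join continuously
    at the singular point.\<close>
  define F where "F t = (max (t - b) 0 powr (1 - a) - max (b - t) 0 powr (1 - a)) / (1 - a)" for t
  have "((\<lambda>t. \<bar>t - b\<bar> powr (- a)) has_integral F M - F 0) {0..M}"
  proof (rule fundamental_theorem_of_calculus_interior_strong[of "{b}"])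
    show "continuous_on {0..M} F"
      unfolding F_def using a
      by (intro continuous_on_divide continuous_on_diff continuous_on_powr' continuous_on_max continuous_intros) auto
    fix t assume t: "t \<in> {0<..<M} - {b}"
    show "(F has_vector_derivative \<bar>t - b\<bar> powr (- a)) (at t)"
    proof (cases "b < t")
      case True
      have "((\<lambda>t. (t - b) powr (1 - a) / (1 - a)) has_real_derivative
          (1 * (1 - a)) * (t - b) powr (1 - a - 1) / (1 - a)) (at t)"
        using True a by (intro derivative_eq_intros refl) (auto simp: powr_diff)
      then have "((\<lambda>t. (t - b) powr (1 - a) / (1 - a)) has_real_derivative (t - b) powr (- a)) (at t)"
        using a by simp
      then have "((\<lambda>t. (t - b) powr (1 - a) / (1 - a)) has_vector_derivative \<bar>t - b\<bar> powr (- a)) (at t)"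
        using True by (simp add: has_real_derivative_iff_has_vector_derivative)
      then show ?thesis
        by (rule has_vector_derivative_transform_within_open[of _ _ _ "{b<..}"]) (use True in \<open>auto simp: F_def\<close>)
    next
      case False
      then have tb: "t < b" using t by auto
      have "((\<lambda>t. - ((b - t) powr (1 - a)) / (1 - a)) has_real_derivative
          (1 - a) * (b - t) powr (1 - a - 1) / (1 - a)) (at t)"
        using tb a by (intro derivative_eq_intros refl) (auto simp: powr_diff)
      then have "((\<lambda>t. - ((b - t) powr (1 - a)) / (1 - a)) has_real_derivative (b - t) powr (- a)) (at t)"
        using a by simp
      then have "((\<lambda>t. - ((b - t) powr (1 - a)) / (1 - a)) has_vector_derivative \<bar>t - b\<bar> powr (- a)) (at t)"
        using tb by (simp add: has_real_derivative_iff_has_vector_derivative)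
      then show ?thesis
        by (rule has_vector_derivative_transform_within_open[of _ _ _ "{..<b}"]) (use tb in \<open>auto simp: F_def\<close>)
    qed
  qed (use M in auto)
  note * = has_integral_nonneg_lebesgue_on[OF this]
  show "integrable (lebesgue_on {0..M}) (\<lambda>t. \<bar>t - b\<bar> powr (- a))" by (rule *(1)) auto
  have "(\<integral>t. \<bar>t - b\<bar> powr (- a) \<partial>lebesgue_on {0..M}) = F M - F 0" by (rule *(2)) auto
  also have "F M - F 0 = ((M - b) powr (1 - a) + b powr (1 - a)) / (1 - a)"
  proof -
    have "max (M - b) 0 = M - b" "max (b - M) 0 = 0" "max (0 - b) 0 = 0" "max (b - 0) 0 = b"
      using b by auto
    then show ?thesis by (simp add: F_def add_divide_distrib)
  qed
  also have "\<dots> \<le> (M powr (1 - a) + M powr (1 - a)) / (1 - a)"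
    using a b by (intro divide_right_mono add_mono powr_mono2) auto
  finally show "(\<integral>t. \<bar>t - b\<bar> powr (- a) \<partial>lebesgue_on {0..M}) \<le> 2 * M powr (1 - a) / (1 - a)" by simp
qed

text \<open>The arc length distance to the nearer end of a curve of length \<open>L\<close>. Off the
  source curve kernels are singular only at corners, so this one weight describes their size at both
  ends at once.\<close>

definition edge :: "real \<Rightarrow> real \<Rightarrow> real" where
  "edge L s = min s (L - s)"

lemma edge_nonneg: "s \<in> {0..L} \<Longrightarrow> 0 \<le> edge L s"
  and edge_pos: "s \<in> {0<..<L} \<Longrightarrow> 0 < edge L s"
  and edge_le: "edge L s \<le> s" "edge L s \<le> L - s"
  by (auto simp: edge_def)

lemma continuous_on_edge [continuous_intros]:
  "continuous_on A f \<Longrightarrow> continuous_on A (\<lambda>x. edge L (f x))"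
  unfolding edge_def by (intro continuous_intros)

lemma borel_measurable_edge [measurable]: "edge L \<in> borel_measurable borel"
  by (intro borel_measurable_continuous_onI continuous_intros)

lemma powr_edge_le:
  assumes "t \<in> {0..M}"
  shows "edge M t powr (- a) \<le> \<bar>t - 0\<bar> powr (- a) + \<bar>t - M\<bar> powr (- a)"
  using assms by (auto simp: edge_def min_def)

lemma powr_edge_integral:
  assumes a: "0 < a" "a < 1" and M: "0 \<le> M"
  shows "integrable (lebesgue_on {0..M}) (\<lambda>t. edge M t powr (- a))"
    "(\<integral>t. edge M t powr (- a) \<partial>lebesgue_on {0..M}) \<le> 4 * M powr (1 - a) / (1 - a)"
proof -
  let ?L = "lebesgue_on {0..M}"
  note 1 = powr_weight_integral[OF a M, of 0] and 2 = powr_weight_integral[OF a M, of M]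
  have i: "integrable ?L (\<lambda>t. \<bar>t - 0\<bar> powr (- a) + \<bar>t - M\<bar> powr (- a))"
    using M by (intro Bochner_Integration.integrable_add 1 2) auto
  have m: "(\<lambda>t. edge M t powr (- a)) \<in> borel_measurable ?L"
    by (intro measurable_completion measurable_restrict_space1) measurable
  show i2: "integrable ?L (\<lambda>t. edge M t powr (- a))"
    by (rule Bochner_Integration.integrable_bound[OF i m], rule AE_I2)
      (use powr_edge_le[of _ M a] in \<open>auto simp: abs_of_nonneg\<close>)
  have "(\<integral>t. edge M t powr (- a) \<partial>?L) \<le> (\<integral>t. \<bar>t - 0\<bar> powr (- a) + \<bar>t - M\<bar> powr (- a) \<partial>?L)"
    by (rule integral_mono[OF i2 i]) (rule powr_edge_le, simp)
  also have "\<dots> = (\<integral>t. \<bar>t - 0\<bar> powr (- a) \<partial>?L) + (\<integral>t. \<bar>t - M\<bar> powr (- a) \<partial>?L)"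
    using 1 2 M by (intro Bochner_Integration.integral_add) auto
  also have "\<dots> \<le> 2 * M powr (1 - a) / (1 - a) + 2 * M powr (1 - a) / (1 - a)"
    using 1 2 M by (intro add_mono) auto
  finally show "(\<integral>t. edge M t powr (- a) \<partial>?L) \<le> 4 * M powr (1 - a) / (1 - a)" by simp
qed

text \<open>The antiderivative 2 / sqrt c * arctan (sqrt (t / c)) increases by less than pi / sqrt c
  in total, whatever \<open>M\<close> is. This is the weight integral of the Schur test for the
  kernel 1 / (s + t); the second half is its mirror image for the other end of the interval.\<close>

lemma stieltjes_integral:
  fixes c M :: real
  assumes c: "0 < c" and M: "0 \<le> M"
  shows "integrable (lebesgue_on {0..M}) (\<lambda>t. 1 / (sqrt t * (c + t)))"
    "(\<integral>t. 1 / (sqrt t * (c + t)) \<partial>lebesgue_on {0..M}) \<le> pi / sqrt c"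
    "integrable (lebesgue_on {0..M}) (\<lambda>t. 1 / (sqrt (M - t) * (c + (M - t))))"
    "(\<integral>t. 1 / (sqrt (M - t) * (c + (M - t))) \<partial>lebesgue_on {0..M}) \<le> pi / sqrt c"
proof -
  define y where "y = sqrt c"
  have y: "0 < y" "c = y * y" "sqrt c = y" using c by (auto simp: y_def)
  define F where "F t = 2 / y * arctan (sqrt t / y)" for t
  have cont: "continuous_on A F" for A unfolding F_def using y by (intro continuous_intros) auto
  have deriv: "(F has_real_derivative 1 / (sqrt t * (c + t))) (at t)" if "t > 0" for t
  proof -
    define z where "z = sqrt t"
    have z: "0 < z" "t = z * z" "sqrt t = z" using that by (auto simp: z_def)
    have "((\<lambda>t. sqrt t / y) has_real_derivative (inverse z / 2) / y) (at t)"
      using DERIV_cdivide[OF DERIV_real_sqrt[OF that], of y] unfolding z(3) .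
    from DERIV_cmult[OF DERIV_chain2[OF DERIV_arctan this], of "2 / y"]
    have "(F has_real_derivative 2 / y * (inverse (1 + (z / y)\<^sup>2) * ((inverse z / 2) / y))) (at t)"
      using z(1) by (simp add: F_def[abs_def] z(2))
    also have "2 / y * (inverse (1 + (z / y)\<^sup>2) * ((inverse z / 2) / y)) = 1 / (z * (c + t))"
    proof -
      have nz: "y * y + z * z > 0" using y(1) z(1) by (simp add: add_pos_pos)
      have 1: "1 + (z / y)\<^sup>2 = (y * y + z * z) / (y * y)"
        using y(1) by (simp add: field_simps power2_eq_square)
      have *: "2 / y * (inverse (X / (y * y)) * ((inverse z / 2) / y)) = 1 / (z * X)" if "X > 0" for X
        using y(1) z(1) that by (simp add: field_simps)
      show ?thesis unfolding 1 y(2) z(2) by (rule *[OF nz])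
    qed
    finally show ?thesis unfolding z(3) .
  qed
  have Fb: "F M - F 0 \<le> pi / sqrt c"
    using y arctan_ubound[of "sqrt M / y"] by (simp add: F_def field_simps)
  have "((\<lambda>t. 1 / (sqrt t * (c + t))) has_integral F M - F 0) {0..M}"
    by (rule fundamental_theorem_of_calculus_interior[OF M cont])
      (use deriv in \<open>auto simp: has_real_derivative_iff_has_vector_derivative\<close>)
  note * = has_integral_nonneg_lebesgue_on[OF this]
  show "integrable (lebesgue_on {0..M}) (\<lambda>t. 1 / (sqrt t * (c + t)))" by (rule *(1)) (use c in auto)
  have "(\<integral>t. 1 / (sqrt t * (c + t)) \<partial>lebesgue_on {0..M}) = F M - F 0" by (rule *(2)) (use c in auto)
  with Fb show "(\<integral>t. 1 / (sqrt t * (c + t)) \<partial>lebesgue_on {0..M}) \<le> pi / sqrt c" by simp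
  have "((\<lambda>t. 1 / (sqrt (M - t) * (c + (M - t)))) has_integral - F (M - M) - - F (M - 0)) {0..M}"
  proof (rule fundamental_theorem_of_calculus_interior[OF M])
    show "continuous_on {0..M} (\<lambda>t. - F (M - t))"
      by (intro continuous_on_minus continuous_on_compose2[OF cont[of UNIV]] continuous_intros) auto
    fix t assume t: "t \<in> {0<..<M}"
    have "((\<lambda>t. - F (M - t)) has_real_derivative - (1 / (sqrt (M - t) * (c + (M - t))) * (- 1))) (at t)"
      by (intro DERIV_minus DERIV_chain2[OF deriv]) (use t in \<open>auto intro!: derivative_eq_intros\<close>)
    then show "((\<lambda>t. - F (M - t)) has_vector_derivative 1 / (sqrt (M - t) * (c + (M - t)))) (at t)"
      by (simp add: has_real_derivative_iff_has_vector_derivative)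
  qed
  note * = has_integral_nonneg_lebesgue_on[OF this]
  show "integrable (lebesgue_on {0..M}) (\<lambda>t. 1 / (sqrt (M - t) * (c + (M - t))))" by (rule *(1)) (use c in auto)
  have "(\<integral>t. 1 / (sqrt (M - t) * (c + (M - t))) \<partial>lebesgue_on {0..M}) = - F (M - M) - - F (M - 0)"
    by (rule *(2)) (use c in auto)
  with Fb show "(\<integral>t. 1 / (sqrt (M - t) * (c + (M - t))) \<partial>lebesgue_on {0..M}) \<le> pi / sqrt c" by simp
qed

text \<open>At each \<open>t\<close> the integrand coincides with one of the two one-sided
  integrands, and both are nonnegative; hence the doubled constant.\<close>

lemma stieltjes_edge:
  assumes c: "0 < c" and M: "0 \<le> M"
  shows "integrable (lebesgue_on {0..M}) (\<lambda>t. 1 / (sqrt (edge M t) * (c + edge M t)))"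
    "(\<integral>t. 1 / (sqrt (edge M t) * (c + edge M t)) \<partial>lebesgue_on {0..M}) \<le> 2 * pi / sqrt c"
proof -
  let ?L = "lebesgue_on {0..M}"
  let ?g = "\<lambda>t. 1 / (sqrt t * (c + t)) + 1 / (sqrt (M - t) * (c + (M - t)))"
  note s = stieltjes_integral[OF c M]
  have i: "integrable ?L ?g" by (intro Bochner_Integration.integrable_add s)
  have le: "1 / (sqrt (edge M t) * (c + edge M t)) \<le> ?g t" if "t \<in> {0..M}" for t
    using that c by (auto simp: edge_def min_def)
  have m: "(\<lambda>t. 1 / (sqrt (edge M t) * (c + edge M t))) \<in> borel_measurable ?L"
    by (intro measurable_completion measurable_restrict_space1) measurable
  show i2: "integrable ?L (\<lambda>t. 1 / (sqrt (edge M t) * (c + edge M t)))"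
  proof (rule Bochner_Integration.integrable_bound[OF i m], rule AE_I2)
    fix t assume "t \<in> space ?L"
    then have t: "t \<in> {0..M}" by simp
    have "0 \<le> 1 / (sqrt (edge M t) * (c + edge M t))" using edge_nonneg[OF t] c by simp
    with le[OF t] show "norm (1 / (sqrt (edge M t) * (c + edge M t))) \<le> norm (?g t)" by simp
  qed
  have "(\<integral>t. 1 / (sqrt (edge M t) * (c + edge M t)) \<partial>?L) \<le> (\<integral>t. ?g t \<partial>?L)"
    by (rule integral_mono[OF i2 i]) (use le in auto)
  also have "\<dots> = (\<integral>t. 1 / (sqrt t * (c + t)) \<partial>?L) + (\<integral>t. 1 / (sqrt (M - t) * (c + (M - t))) \<partial>?L)"
    by (rule Bochner_Integration.integral_add[OF s(1) s(3)])
  also have "\<dots> \<le> 2 * pi / sqrt c" using s(2,4) by simp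
  finally show "(\<integral>t. 1 / (sqrt (edge M t) * (c + edge M t)) \<partial>?L) \<le> 2 * pi / sqrt c" .
qed

lemma AE_interior: "AE t in lebesgue_on {a..b::real}. t \<in> {a<..<b}"
proof -
  have "AE t in lebesgue. t \<noteq> a" "AE t in lebesgue. t \<noteq> b"
    by (auto intro!: AE_completion AE_lborel_singleton)
  then have "AE t in lebesgue. t \<in> {a..b} \<longrightarrow> t \<in> {a<..<b}"
    by eventually_elim auto
  then show ?thesis by (subst AE_restrict_space_iff) auto
qed

text \<open>Schur test for the Hilbert kernel with the square root of the distance as weight.
  Cauchy-Schwarz in \<open>t\<close> leaves one weight integral of \<open>stieltjes_edge\<close>;
  after the order of integration is exchanged, the same integral in \<open>s\<close> cancels the
  remaining weight. The constant is 2 pi rather than pi because both ends of each curve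
  contribute.\<close>

lemma hilbert_bound:
  fixes U :: "real \<Rightarrow> complex"
  assumes L: "0 < L" and M: "0 < M" and C: "0 \<le> C" and \<rho>: "\<rho> \<in> L2_carr M"
    and U: "U \<in> borel_measurable (lebesgue_on {0..L})"
    and le: "\<And>s. s \<in> {0<..<L} \<Longrightarrow>
      cmod (U s) \<le> C * (\<integral>t. cmod (\<rho> t) / (edge L s + edge M t) \<partial>lebesgue_on {0..M})"
  shows "U \<in> L2_carr L" "L2_sq L U \<le> (2 * pi * C)\<^sup>2 * L2_sq M \<rho>"
proof -
  let ?A = "lebesgue_on {0..L}" and ?B = "lebesgue_on {0..M}"
  note s\<rho> = L2_carrD(2)[OF \<rho>]
  have mB[measurable]: "(\<lambda>t. cmod (\<rho> t)) \<in> borel_measurable ?B" using L2_carrD(1)[OF \<rho>] by measurable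
  have eA[measurable]: "edge L \<in> borel_measurable ?A" by (intro measurable_completion measurable_restrict_space1) measurable
  have eB[measurable]: "edge M \<in> borel_measurable ?B" by (intro measurable_completion measurable_restrict_space1) measurable
  define h where "h s t = (cmod (\<rho> t))\<^sup>2 * (sqrt (edge M t) / (edge L s + edge M t))" for s t
  have h0: "0 \<le> h s t" if "s \<in> {0..L}" "t \<in> {0..M}" for s t
    using edge_nonneg[OF that(1)] edge_nonneg[OF that(2)] by (simp add: h_def)
  have pt: "(cmod (U s))\<^sup>2 \<le> C\<^sup>2 * (2 * pi / sqrt (edge L s)) * (\<integral>t. h s t \<partial>?B) \<and> integrable ?B (h s)"
    if s: "s \<in> {0<..<L}" for s
  proof -
    define c where "c = edge L s"
    have c: "0 < c" unfolding c_def by (rule edge_pos[OF s])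
    \<comment> \<open>The product of \<open>?f\<close> and \<open>?g\<close> is the Hilbert kernel
      times the density. The weight is placed so that the square of \<open>?g\<close> is the
      integrand of \<open>stieltjes_edge\<close>.\<close>
    let ?f = "\<lambda>t. cmod (\<rho> t) * sqrt (sqrt (edge M t) / (c + edge M t))"
    let ?g = "\<lambda>t. sqrt (1 / (sqrt (edge M t) * (c + edge M t)))"
    have f: "sqi ?B ?f"
    proof (rule sqi_bound(1)[OF sqi_scale[OF s\<rho>, of "sqrt (sqrt M / c)"]])
      show "?f \<in> borel_measurable ?B" by measurable
      fix t assume "t \<in> space ?B"
      then have t: "t \<in> {0..M}" by simp
      have "sqrt (edge M t) / (c + edge M t) \<le> sqrt M / c"
        using c edge_nonneg[OF t] edge_le[of M t] t by (intro frac_le) auto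
      then show "\<bar>?f t\<bar> \<le> \<bar>sqrt (sqrt M / c) * cmod (\<rho> t)\<bar>"
        using c edge_nonneg[OF t] M by (simp add: abs_mult mult.commute mult_left_mono)
    qed
    have g2': "(?g t)\<^sup>2 = 1 / (sqrt (edge M t) * (c + edge M t))" if "t \<in> space ?B" for t
      using c edge_nonneg[of t M] that by simp
    note st = stieltjes_edge[OF c, of M]
    have g: "sqi ?B ?g"
    proof -
      have "?g \<in> borel_measurable ?B" by measurable
      moreover have "integrable ?B (\<lambda>t. (?g t)\<^sup>2)"
        using st(1)[OF less_imp_le[OF M]] by (simp only: Bochner_Integration.integrable_cong[OF refl g2'])
      ultimately show ?thesis by (simp add: sqi_def)
    qed
    have f2: "(?f t)\<^sup>2 = h s t" if "t \<in> space ?B" for t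
      using c edge_nonneg[of t M] that by (simp add: h_def c_def[symmetric] power_mult_distrib)
    have ih: "integrable ?B (h s)"
      using sqi_square[OF f] by (simp only: Bochner_Integration.integrable_cong[OF refl f2])
    have "(\<integral>t. cmod (\<rho> t) / (c + edge M t) \<partial>?B) = (\<integral>t. ?f t * ?g t \<partial>?B)"
    proof (rule integral_cong_AE)
      show "AE t in ?B. cmod (\<rho> t) / (c + edge M t) = ?f t * ?g t"
        using AE_interior[of 0 M]
      proof eventually_elim
        case (elim t)
        then have e: "0 < edge M t" by (rule edge_pos)
        have "sqrt (sqrt (edge M t) / (c + edge M t)) * ?g t = sqrt ((1 / (c + edge M t))\<^sup>2)"
          unfolding real_sqrt_mult[symmetric] using e c by (simp add: power2_eq_square)
        then show ?case using e c by (simp add: mult.assoc)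
      qed
    qed measurable
    then have "(\<integral>t. cmod (\<rho> t) / (c + edge M t) \<partial>?B)\<^sup>2 \<le> (\<integral>t. (?f t)\<^sup>2 \<partial>?B) * (\<integral>t. (?g t)\<^sup>2 \<partial>?B)"
      using sqi_cauchy_schwarz[OF f g] by simp
    also have "(\<integral>t. (?f t)\<^sup>2 \<partial>?B) = (\<integral>t. h s t \<partial>?B)"
      by (rule Bochner_Integration.integral_cong[OF refl f2])
    also have "(\<integral>t. (?g t)\<^sup>2 \<partial>?B) = (\<integral>t. 1 / (sqrt (edge M t) * (c + edge M t)) \<partial>?B)"
      by (rule Bochner_Integration.integral_cong[OF refl g2'])
    also have "(\<integral>t. h s t \<partial>?B) * (\<integral>t. 1 / (sqrt (edge M t) * (c + edge M t)) \<partial>?B) \<le> (\<integral>t. h s t \<partial>?B) * (2 * pi / sqrt c)"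
      using st(2) M s h0 by (intro mult_left_mono integral_nonneg_AE) auto
    finally have 1: "(\<integral>t. cmod (\<rho> t) / (c + edge M t) \<partial>?B)\<^sup>2 \<le> (\<integral>t. h s t \<partial>?B) * (2 * pi / sqrt c)" .
    have "(cmod (U s))\<^sup>2 \<le> (C * (\<integral>t. cmod (\<rho> t) / (c + edge M t) \<partial>?B))\<^sup>2"
      using le[OF s] by (intro power_mono) (auto simp: c_def)
    also have "\<dots> \<le> C\<^sup>2 * ((\<integral>t. h s t \<partial>?B) * (2 * pi / sqrt c))"
      unfolding power_mult_distrib by (intro mult_left_mono 1) auto
    finally show ?thesis using ih by (simp add: c_def mult_ac)
  qed
  \<comment> \<open>With values in \<open>ennreal\<close> the two integrations can be exchanged
    before it is known that the square of \<open>U\<close> is integrable; that is the outcome of the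
    estimate.\<close>
  define H where "H s t = ennreal ((C\<^sup>2 * (2 * pi / sqrt (edge L s))) * h s t)" for s t
  have mH: "(\<lambda>(s, t). H s t) \<in> borel_measurable (?A \<Otimes>\<^sub>M ?B)"
    unfolding H_def h_def by measurable
  interpret pair_sigma_finite ?A ?B
    by (intro pair_sigma_finite.intro finite_measure.axioms(1) finite_measure_interval)
  have "(\<integral>\<^sup>+s. ennreal ((cmod (U s))\<^sup>2) \<partial>?A) \<le> (\<integral>\<^sup>+s. (\<integral>\<^sup>+t. H s t \<partial>?B) \<partial>?A)"
  proof (rule nn_integral_mono_AE)
    show "AE s in ?A. ennreal ((cmod (U s))\<^sup>2) \<le> (\<integral>\<^sup>+t. H s t \<partial>?B)"
      using AE_interior[of 0 L]
    proof eventually_elim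
      case (elim s)
      have "(\<integral>\<^sup>+t. H s t \<partial>?B) = ennreal (\<integral>t. (C\<^sup>2 * (2 * pi / sqrt (edge L s))) * h s t \<partial>?B)"
        unfolding H_def
        by (rule nn_integral_eq_integral)
          (use pt[OF elim] h0[of s] edge_nonneg[of s L] elim in \<open>auto intro!: mult_nonneg_nonneg\<close>)
      then show ?case using pt[OF elim] by (auto intro!: ennreal_leI)
    qed
  qed
  also have "\<dots> = (\<integral>\<^sup>+t. (\<integral>\<^sup>+s. H s t \<partial>?A) \<partial>?B)"
    using Fubini'[OF mH] by simp
  also have "\<dots> \<le> (\<integral>\<^sup>+t. ennreal ((2 * pi * C)\<^sup>2 * (cmod (\<rho> t))\<^sup>2) \<partial>?B)"
  proof (rule nn_integral_mono_AE)
    show "AE t in ?B. (\<integral>\<^sup>+s. H s t \<partial>?A) \<le> ennreal ((2 * pi * C)\<^sup>2 * (cmod (\<rho> t))\<^sup>2)"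
      using AE_interior[of 0 M]
    proof eventually_elim
      case (elim t)
      then have e: "0 < edge M t" by (rule edge_pos)
      note st = stieltjes_edge[OF e, of L]
      let ?K = "C\<^sup>2 * (2 * pi) * (cmod (\<rho> t))\<^sup>2 * sqrt (edge M t)"
      have K: "0 \<le> ?K" using e by simp
      have Heq: "H s t = ennreal (?K * (1 / (sqrt (edge L s) * (edge M t + edge L s))))" for s
        unfolding H_def h_def by (simp add: add.commute mult.assoc)
      have int: "(\<integral>\<^sup>+s. H s t \<partial>?A) = ennreal (\<integral>s. ?K * (1 / (sqrt (edge L s) * (edge M t + edge L s))) \<partial>?A)"
        unfolding Heq
      proof (rule nn_integral_eq_integral)
        show "integrable ?A (\<lambda>s. ?K * (1 / (sqrt (edge L s) * (edge M t + edge L s))))"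
          by (intro Bochner_Integration.integrable_mult_right st(1)) (use L in simp)
        show "AE s in ?A. 0 \<le> ?K * (1 / (sqrt (edge L s) * (edge M t + edge L s)))"
          using K e edge_nonneg[of _ L] by (intro AE_I2 mult_nonneg_nonneg) auto
      qed
      have "(\<integral>s. ?K * (1 / (sqrt (edge L s) * (edge M t + edge L s))) \<partial>?A) =
          ?K * (\<integral>s. 1 / (sqrt (edge L s) * (edge M t + edge L s)) \<partial>?A)"
        by (rule integral_mult_right_zero)
      also have "\<dots> \<le> ?K * (2 * pi / sqrt (edge M t))"
        using st(2) L K by (intro mult_left_mono) auto
      also have "\<dots> = (2 * pi * C)\<^sup>2 * (cmod (\<rho> t))\<^sup>2"
        using e by (simp add: power2_eq_square)
      finally show ?case unfolding int by (rule ennreal_leI)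
    qed
  qed
  also have "\<dots> = ennreal ((2 * pi * C)\<^sup>2 * L2_sq M \<rho>)"
  proof -
    have "integrable ?B (\<lambda>t. (2 * pi * C)\<^sup>2 * (cmod (\<rho> t))\<^sup>2)" using sqi_square[OF s\<rho>] by simp
    from nn_integral_eq_integral[OF this] show ?thesis by (simp add: L2_sq_def)
  qed
  finally have fin: "(\<integral>\<^sup>+s. ennreal ((cmod (U s))\<^sup>2) \<partial>?A) \<le> ennreal ((2 * pi * C)\<^sup>2 * L2_sq M \<rho>)" .
  have i: "integrable ?A (\<lambda>s. (cmod (U s))\<^sup>2)"
  proof (rule integrableI_bounded)
    show "(\<lambda>s. (cmod (U s))\<^sup>2) \<in> borel_measurable ?A" using U by measurable
    show "(\<integral>\<^sup>+s. ennreal (norm ((cmod (U s))\<^sup>2)) \<partial>?A) < \<infinity>"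
      using le_less_trans[OF fin ennreal_less_top] by simp
  qed
  then show "U \<in> L2_carr L" using U by (simp add: L2_carr_def)
  have "ennreal (L2_sq L U) \<le> ennreal ((2 * pi * C)\<^sup>2 * L2_sq M \<rho>)"
    using fin nn_integral_eq_integral[OF i] by (simp add: L2_sq_def)
  then show "L2_sq L U \<le> (2 * pi * C)\<^sup>2 * L2_sq M \<rho>"
    using L2_sq_nonneg[of M \<rho>] by (simp add: ennreal_le_iff)
qed

section \<open>Parameter integrals\<close>

lemma param_continuous:
  fixes F :: "real \<Rightarrow> 'a \<Rightarrow> complex"
  assumes meas: "\<And>s. s \<in> X \<Longrightarrow> F s \<in> borel_measurable M" and s0: "s0 \<in> X"
    and cont: "AE t in M. continuous (at s0 within X) (\<lambda>s. F s t)"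
    and bnd: "\<And>s. s \<in> X \<Longrightarrow> AE t in M. norm (F s t) \<le> g t" and g: "integrable M g"
  shows "continuous (at s0 within X) (\<lambda>s. \<integral>t. F s t \<partial>M)"
proof (rule continuous_within_sequentiallyI)
  fix u :: "nat \<Rightarrow> real" assume u: "u \<longlonglongrightarrow> s0" "\<forall>n. u n \<in> X"
  show "(\<lambda>n. \<integral>t. F (u n) t \<partial>M) \<longlonglongrightarrow> (\<integral>t. F s0 t \<partial>M)"
  proof (rule integral_dominated_convergence[where w = g])
    show "AE t in M. (\<lambda>n. F (u n) t) \<longlonglongrightarrow> F s0 t"
      using cont
    proof eventually_elim
      case (elim t)
      then show ?case
        using u unfolding continuous_within_sequentially by (auto simp: o_def)
    qed
  qed (use meas s0 u bnd g in auto)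
qed

lemma real_mvt_bound:
  fixes f :: "real \<Rightarrow> complex"
  assumes "convex X" "\<And>x. x \<in> X \<Longrightarrow> (f has_vector_derivative f' x) (at x within X)"
    "\<And>x. x \<in> X \<Longrightarrow> norm (f' x) \<le> B" "x \<in> X" "y \<in> X"
  shows "norm (f x - f y) \<le> B * \<bar>x - y\<bar>"
proof -
  have "norm (f x - f y) \<le> B * norm (x - y)"
  proof (rule differentiable_bound[OF assms(1) _ _ assms(4,5)])
    fix z assume z: "z \<in> X"
    show "(f has_derivative (\<lambda>h. h *\<^sub>R f' z)) (at z within X)"
      using assms(2)[OF z] by (simp add: has_vector_derivative_def)
    show "onorm (\<lambda>h. h *\<^sub>R f' z) \<le> B"
      by (rule onorm_le) (use assms(3)[OF z] in \<open>simp add: mult.commute[of B] mult_left_mono\<close>)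
  qed
  then show ?thesis by simp
qed

text \<open>By the mean value inequality the normalised remainder of the linearisation in
  \<open>s\<close> is dominated by twice the bound on the derivative, so dominated convergence
  applies along every sequence tending to \<open>s0\<close>.\<close>

lemma param_derivative:
  fixes F :: "real \<Rightarrow> 'a \<Rightarrow> complex"
  assumes X: "convex X" "s0 \<in> X"
    and der: "\<And>s t. s \<in> X \<Longrightarrow> t \<in> space M \<Longrightarrow> ((\<lambda>s. F s t) has_vector_derivative F1 s t) (at s within X)"
    and bnd: "\<And>s t. s \<in> X \<Longrightarrow> t \<in> space M \<Longrightarrow> norm (F1 s t) \<le> g t" and g: "integrable M g"
    and int: "\<And>s. s \<in> X \<Longrightarrow> integrable M (F s)"
    and meas: "F1 s0 \<in> borel_measurable M"
  shows "((\<lambda>s. \<integral>t. F s t \<partial>M) has_vector_derivative (\<integral>t. F1 s0 t \<partial>M)) (at s0 within X)"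
proof -
  have i1: "integrable M (F1 s0)"
    by (rule Bochner_Integration.integrable_bound[OF g meas])
      (use bnd[OF X(2)] in \<open>auto intro!: AE_I2 order_trans[OF _ abs_ge_self]\<close>)
  define q where "q y t = (1 / norm (y - s0)) *\<^sub>R (F y t - (F s0 t + (y - s0) *\<^sub>R F1 s0 t))" for y t
  have lim: "((\<lambda>y. q y t) \<longlongrightarrow> 0) (at s0 within X)" if "t \<in> space M" for t
    using der[OF X(2) that] unfolding q_def has_vector_derivative_def has_derivative_within by auto
  have "((\<lambda>y. \<integral>t. q y t \<partial>M) \<longlongrightarrow> 0) (at s0 within X)"
    unfolding tendsto_at_iff_sequentially
  proof (intro allI impI)
    fix u :: "nat \<Rightarrow> real" assume u: "\<forall>i. u i \<in> X - {s0}" "u \<longlonglongrightarrow> s0"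
    have "(\<lambda>n. \<integral>t. q (u n) t \<partial>M) \<longlonglongrightarrow> (\<integral>t. 0 \<partial>M)"
    proof (rule integral_dominated_convergence[where w = "\<lambda>t. 2 * g t"])
      show "(\<lambda>t. q (u n) t) \<in> borel_measurable M" for n
        unfolding q_def using int[of "u n"] int[OF X(2)] meas u by auto
      show "integrable M (\<lambda>t. 2 * g t)" using g by simp
      show "AE t in M. (\<lambda>n. q (u n) t) \<longlonglongrightarrow> 0"
        using lim u unfolding tendsto_at_iff_sequentially by (auto simp: o_def)
      fix n
      show "AE t in M. norm (q (u n) t) \<le> 2 * g t"
      proof (rule AE_I2)
        fix t assume t: "t \<in> space M"
        have un: "u n \<in> X" "u n \<noteq> s0" using u by auto
        have "norm (F (u n) t - F s0 t) \<le> g t * \<bar>u n - s0\<bar>"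
          by (rule real_mvt_bound[OF X(1), of _ "\<lambda>s. F1 s t"]) (use der bnd t un X in auto)
        moreover have "norm ((u n - s0) *\<^sub>R F1 s0 t) \<le> g t * \<bar>u n - s0\<bar>"
          using bnd[OF X(2) t] by (simp add: mult.commute[of "g t"] mult_left_mono)
        ultimately have "norm (F (u n) t - F s0 t - (u n - s0) *\<^sub>R F1 s0 t) \<le> 2 * g t * \<bar>u n - s0\<bar>"
          using norm_triangle_ineq4[of "F (u n) t - F s0 t" "(u n - s0) *\<^sub>R F1 s0 t"] by linarith
        then show "norm (q (u n) t) \<le> 2 * g t"
          using un by (simp add: q_def diff_diff_eq divide_le_eq)
      qed
    qed simp
    then show "((\<lambda>y. \<integral>t. q y t \<partial>M) \<circ> u) \<longlonglongrightarrow> 0" by (simp add: o_def)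
  qed
  moreover have "(\<integral>t. q y t \<partial>M) = (1 / norm (y - s0)) *\<^sub>R
      ((\<integral>t. F y t \<partial>M) - ((\<integral>t. F s0 t \<partial>M) + (y - s0) *\<^sub>R (\<integral>t. F1 s0 t \<partial>M)))" if "y \<in> X" for y
    unfolding q_def using int[OF that] int[OF X(2)] i1 by simp
  ultimately have "((\<lambda>y. (1 / norm (y - s0)) *\<^sub>R
      ((\<integral>t. F y t \<partial>M) - ((\<integral>t. F s0 t \<partial>M) + (y - s0) *\<^sub>R (\<integral>t. F1 s0 t \<partial>M)))) \<longlongrightarrow> 0) (at s0 within X)"
    by (elim Lim_transform_eventually) (auto simp: eventually_at_filter)
  then show ?thesis
    unfolding has_vector_derivative_def has_derivative_within
    by (auto intro: bounded_linear_scaleR_left)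
qed

lemma kernel_derivative:
  fixes k :: "real \<Rightarrow> real \<Rightarrow> complex"
  assumes X: "convex X" "s0 \<in> X" and \<rho>: "integrable M \<rho>"
    and der: "\<And>s t. s \<in> X \<Longrightarrow> t \<in> space M \<Longrightarrow> ((\<lambda>s. k s t) has_vector_derivative k1 s t) (at s within X)"
    and meas: "\<And>s. s \<in> X \<Longrightarrow> k s \<in> borel_measurable M" "\<And>s. s \<in> X \<Longrightarrow> k1 s \<in> borel_measurable M"
    and bnd: "\<And>s t. s \<in> X \<Longrightarrow> t \<in> space M \<Longrightarrow> norm (k s t) \<le> B"
      "\<And>s t. s \<in> X \<Longrightarrow> t \<in> space M \<Longrightarrow> norm (k1 s t) \<le> B"
  shows "((\<lambda>s. \<integral>t. k s t * \<rho> t \<partial>M) has_vector_derivative (\<integral>t. k1 s0 t * \<rho> t \<partial>M)) (at s0 within X)"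
proof (rule param_derivative[OF X, where g = "\<lambda>t. B * norm (\<rho> t)"])
  show ib: "integrable M (\<lambda>t. B * norm (\<rho> t))" using \<rho> by simp
  have m\<rho>: "\<rho> \<in> borel_measurable M" using \<rho> by simp
  fix s assume s: "s \<in> X"
  have m: "(\<lambda>t. k s t * \<rho> t) \<in> borel_measurable M" using meas(1)[OF s] m\<rho> by simp
  show "integrable M (\<lambda>t. k s t * \<rho> t)"
    by (rule Bochner_Integration.integrable_bound[OF ib m], rule AE_I2)
      (use bnd(1)[OF s] in \<open>auto simp: norm_mult intro!: order_trans[OF _ abs_ge_self] mult_right_mono\<close>)
  fix t assume t: "t \<in> space M"
  show "((\<lambda>s. k s t * \<rho> t) has_vector_derivative k1 s t * \<rho> t) (at s within X)"
    by (rule has_vector_derivative_mult_left[OF der[OF s t]])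
  show "norm (k1 s t * \<rho> t) \<le> B * norm (\<rho> t)"
    using bnd(2)[OF s t] by (simp add: norm_mult mult_right_mono)
next
  show "(\<lambda>t. k1 s0 t * \<rho> t) \<in> borel_measurable M" using meas(2)[OF X(2)] \<rho> by simp
qed

lemma kernel_continuous:
  fixes k :: "real \<Rightarrow> real \<Rightarrow> complex"
  assumes \<rho>: "integrable M \<rho>" and s0: "s0 \<in> X"
    and cont: "\<And>t. t \<in> space M \<Longrightarrow> continuous (at s0 within X) (\<lambda>s. k s t)"
    and meas: "\<And>s. s \<in> X \<Longrightarrow> k s \<in> borel_measurable M"
    and bnd: "\<And>s t. s \<in> X \<Longrightarrow> t \<in> space M \<Longrightarrow> norm (k s t) \<le> B"
  shows "continuous (at s0 within X) (\<lambda>s. \<integral>t. k s t * \<rho> t \<partial>M)"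
proof (rule param_continuous[OF _ s0, where g = "\<lambda>t. B * norm (\<rho> t)"])
  show "integrable M (\<lambda>t. B * norm (\<rho> t))" using \<rho> by simp
  show "(\<lambda>t. k s t * \<rho> t) \<in> borel_measurable M" if "s \<in> X" for s using meas[OF that] \<rho> by simp
  show "AE t in M. continuous (at s0 within X) (\<lambda>s. k s t * \<rho> t)"
    by (rule AE_I2) (intro continuous_mult cont continuous_const)
  show "AE t in M. norm (k s t * \<rho> t) \<le> B * norm (\<rho> t)" if "s \<in> X" for s
    using bnd[OF that] by (auto intro!: AE_I2 mult_right_mono simp: norm_mult)
qed

lemma kernel_norm:
  fixes k :: "real \<Rightarrow> complex"
  assumes \<rho>: "integrable M \<rho>" and meas: "k \<in> borel_measurable M"
    and bnd: "\<And>t. t \<in> space M \<Longrightarrow> norm (k t) \<le> B"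
  shows "integrable M (\<lambda>t. k t * \<rho> t)" "norm (\<integral>t. k t * \<rho> t \<partial>M) \<le> B * (\<integral>t. norm (\<rho> t) \<partial>M)"
proof -
  have ib: "integrable M (\<lambda>t. B * norm (\<rho> t))" using \<rho> by simp
  have m: "(\<lambda>t. k t * \<rho> t) \<in> borel_measurable M" using meas \<rho> by simp
  show i: "integrable M (\<lambda>t. k t * \<rho> t)"
    by (rule Bochner_Integration.integrable_bound[OF ib m], rule AE_I2)
      (use bnd in \<open>auto simp: norm_mult intro!: order_trans[OF _ abs_ge_self] mult_right_mono\<close>)
  have "norm (\<integral>t. k t * \<rho> t \<partial>M) \<le> (\<integral>t. norm (k t * \<rho> t) \<partial>M)" by (rule integral_norm_bound)
  also have "\<dots> \<le> (\<integral>t. B * norm (\<rho> t) \<partial>M)"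
    by (rule integral_mono[OF integrable_norm[OF i] ib]) (use bnd in \<open>auto simp: norm_mult intro!: mult_right_mono\<close>)
  finally show "norm (\<integral>t. k t * \<rho> t \<partial>M) \<le> B * (\<integral>t. norm (\<rho> t) \<partial>M)" by simp
qed

section \<open>A criterion for membership in \<open>H\<^sup>2\<close>\<close>

text \<open>A certificate for membership in \<open>H2_space\<close> that uses classical derivatives
  in the open interval only. Unlike the carrier of \<open>H2_space\<close> it is visibly closed
  under sums and multiples, so all estimates are carried out with it. \<open>N\<close> bounds each
  of the three norms separately.\<close>

definition H2_bounded :: "real \<Rightarrow> (real \<Rightarrow> complex) \<Rightarrow> real \<Rightarrow> bool" where
  "H2_bounded L u N \<longleftrightarrow> 0 \<le> N \<and> continuous_on {0..L} u \<and>
     (\<exists>v w. (\<forall>s\<in>{0<..<L}. (u has_vector_derivative v s) (at s) \<and> (v has_vector_derivative w s) (at s)) \<and>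
        u \<in> L2_carr L \<and> v \<in> L2_carr L \<and> w \<in> L2_carr L \<and>
        L2_sq L u \<le> N\<^sup>2 \<and> L2_sq L v \<le> N\<^sup>2 \<and> L2_sq L w \<le> N\<^sup>2)"

lemma H2_boundedI:
  assumes "0 \<le> N" "continuous_on {0..L} u"
    "\<And>s. s \<in> {0<..<L} \<Longrightarrow> (u has_vector_derivative v s) (at s)"
    "\<And>s. s \<in> {0<..<L} \<Longrightarrow> (v has_vector_derivative w s) (at s)"
    "u \<in> L2_carr L" "v \<in> L2_carr L" "w \<in> L2_carr L"
    "L2_sq L u \<le> N\<^sup>2" "L2_sq L v \<le> N\<^sup>2" "L2_sq L w \<le> N\<^sup>2"
  shows "H2_bounded L u N"
  unfolding H2_bounded_def using assms by (intro conjI exI[of _ v] exI[of _ w] ballI)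

lemma H2_boundedE:
  assumes "H2_bounded L u N"
  obtains v w where "0 \<le> N" "continuous_on {0..L} u"
    "\<And>s. s \<in> {0<..<L} \<Longrightarrow> (u has_vector_derivative v s) (at s)"
    "\<And>s. s \<in> {0<..<L} \<Longrightarrow> (v has_vector_derivative w s) (at s)"
    "u \<in> L2_carr L" "v \<in> L2_carr L" "w \<in> L2_carr L"
    "L2_sq L u \<le> N\<^sup>2" "L2_sq L v \<le> N\<^sup>2" "L2_sq L w \<le> N\<^sup>2"
proof -
  from assms obtain v w where "0 \<le> N \<and> continuous_on {0..L} u \<and>
     (\<forall>s\<in>{0<..<L}. (u has_vector_derivative v s) (at s) \<and> (v has_vector_derivative w s) (at s)) \<and>
        u \<in> L2_carr L \<and> v \<in> L2_carr L \<and> w \<in> L2_carr L \<and>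
        L2_sq L u \<le> N\<^sup>2 \<and> L2_sq L v \<le> N\<^sup>2 \<and> L2_sq L w \<le> N\<^sup>2"
    unfolding H2_bounded_def by (elim conjE exE) (rule that, intro conjI)
  then show ?thesis by - (rule that[of v w], auto)
qed

lemma null_singleton_lebesgue_on:
  fixes x :: real
  assumes "D \<in> sets lebesgue" "x \<in> D"
  shows "emeasure (lebesgue_on D) {x} = 0" "{x} \<in> sets (lebesgue_on D)"
  using assms by (auto simp: emeasure_restrict_space sets_restrict_space_iff)

lemma L2_cong_interior:
  fixes f g :: "real \<Rightarrow> complex"
  assumes "f \<in> L2_carr L" "\<And>s. s \<in> {0<..<L} \<Longrightarrow> f s = g s"
  shows "g \<in> L2_carr L" "L2_sq L g = L2_sq L f"
proof -
  let ?M = "lebesgue_on {0..L}" and ?X = "{0, L} \<inter> {0..L}"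
  have m: "g \<in> borel_measurable ?M"
    by (rule measurable_discrete_difference[of f _ _ ?X])
      (use assms null_singleton_lebesgue_on(2)[of "{0..L}"] in \<open>auto simp: L2_carr_def\<close>)
  have "integrable ?M (\<lambda>s. (cmod (f s))\<^sup>2) \<longleftrightarrow> integrable ?M (\<lambda>s. (cmod (g s))\<^sup>2)"
    by (rule integrable_discrete_difference[of ?X])
      (use assms null_singleton_lebesgue_on[of "{0..L}"] in auto)
  with m show "g \<in> L2_carr L" using assms(1) by (simp add: L2_carr_def)
  show "L2_sq L g = L2_sq L f"
    unfolding L2_sq_def
    by (rule integral_discrete_difference[of ?X])
      (use assms null_singleton_lebesgue_on[of "{0..L}"] in auto)
qed

text \<open>The derivative \<open>v\<close> extends continuously to the closed interval as a
  primitive of the integrable \<open>w\<close>; then \<open>u\<close> is a primitive of this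
  extension and is differentiable at the ends as well. The factor 2 exceeds the square root of the
  number of summands, three.\<close>

lemma H2_bounded_imp_H2:
  assumes L: "0 < L" and u: "H2_bounded L u N"
  shows "u \<in> carr (H2_space L)" "nrm (H2_space L) u \<le> 2 * N"
proof -
  from u obtain v w where N: "0 \<le> N" and cu: "continuous_on {0..L} u"
    and du: "\<And>s. s \<in> {0<..<L} \<Longrightarrow> (u has_vector_derivative v s) (at s)"
    and dv: "\<And>s. s \<in> {0<..<L} \<Longrightarrow> (v has_vector_derivative w s) (at s)"
    and L2: "u \<in> L2_carr L" "v \<in> L2_carr L" "w \<in> L2_carr L"
    and b: "L2_sq L u \<le> N\<^sup>2" "L2_sq L v \<le> N\<^sup>2" "L2_sq L w \<le> N\<^sup>2"
    by (rule H2_boundedE) (rule that)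
  have wi: "integrable (lebesgue_on {0..L}) w" by (rule L2_imp_L1[OF L2(3)]) (use L in simp)
  have wHK: "w integrable_on {0..L}" by (rule integrable_on_lebesgue_on[OF wi]) simp
  \<comment> \<open>An interior base point is needed since nothing is known about \<open>v\<close>
    at the two ends.\<close>
  define c where "c = L / 2"
  have c: "c \<in> {0<..<L}" using L by (simp add: c_def)
  define V where "V s = v c - integral {0..c} w + integral {0..s} w" for s
  have step: "v b - v a = integral {0..b} w - integral {0..a} w" if "a \<in> {0<..<L}" "b \<in> {0<..<L}" "a \<le> b" for a b
  proof -
    have "(w has_integral v b - v a) {a..b}"
      by (rule fundamental_theorem_of_calculus[OF that(3)], rule has_vector_derivative_at_within, rule dv)
        (use that in auto)
    then have "integral {a..b} w = v b - v a" by (rule integral_unique)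
    moreover have "integral {0..a} w + integral {a..b} w = integral {0..b} w"
      by (rule Henstock_Kurzweil_Integration.integral_combine)
        (use that in \<open>auto intro: integrable_subinterval_real[OF wHK]\<close>)
    ultimately show ?thesis by (metis add_diff_cancel_left')
  qed
  have Vv: "V s = v s" if "s \<in> {0<..<L}" for s
    using step[OF c that] step[OF that c] by (cases "c \<le> s") (auto simp: V_def algebra_simps)
  have cV: "continuous_on {0..L} V"
    unfolding V_def by (intro continuous_intros indefinite_integral_continuous_1 wHK)
  have uV: "u s = u 0 + integral {0..s} V" if s: "s \<in> {0..L}" for s
  proof -
    have "(V has_integral u s - u 0) {0..s}"
      by (rule fundamental_theorem_of_calculus_interior)
        (use s du Vv continuous_on_subset[OF cu, of "{0..s}"] in auto)
    then show ?thesis by (simp add: integral_unique)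
  qed
  have dV: "(u has_vector_derivative V s) (at s within {0..L})" if s: "s \<in> {0..L}" for s
  proof (rule has_vector_derivative_transform[OF s uV])
    have "((\<lambda>s. u 0 + integral {0..s} V) has_vector_derivative 0 + V s) (at s within {0..L})"
      by (intro has_vector_derivative_add has_vector_derivative_const integral_has_vector_derivative[OF cV s])
    then show "((\<lambda>s. u 0 + integral {0..s} V) has_vector_derivative V s) (at s within {0..L})" by simp
  qed
  have 1: "dint L u s = V s" if "s \<in> {0..L}" for s
    unfolding dint_def by (rule vector_derivative_within_closed_interval[OF L that dV[OF that]])
  have 2: "dint L (dint L u) s = w s" if s: "s \<in> {0<..<L}" for s
  proof -
    have "(dint L u has_vector_derivative w s) (at s)"
      by (rule has_vector_derivative_transform_within_open[OF dv[OF s], of "{0<..<L}"])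
        (use s 1 Vv in auto)
    then have "(dint L u has_vector_derivative w s) (at s within {0..L})"
      by (rule has_vector_derivative_at_within)
    then show ?thesis
      unfolding dint_def[of L "dint L u"]
      by (rule vector_derivative_within_closed_interval[OF L, rotated]) (use s in auto)
  qed
  have d1: "L2_sq L (dint L u) = L2_sq L v"
    using L2_cong_interior(2)[OF L2(2), of "dint L u"] 1 Vv by force
  have d2: "dint L (dint L u) \<in> L2_carr L" "L2_sq L (dint L (dint L u)) = L2_sq L w"
    using L2_cong_interior[OF L2(3), of "dint L (dint L u)"] 2 by simp_all
  have 3: "dint L u s = dint L u 0 + (\<integral>t. dint L (dint L u) t \<partial>lebesgue_on {0..s})" if s: "s \<in> {0..L}" for s
  proof -
    have "(\<integral>t. dint L (dint L u) t \<partial>lebesgue_on {0..s}) = (\<integral>t. w t \<partial>lebesgue_on {0..s})"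
      by (rule integral_discrete_difference[of "{0, L} \<inter> {0..s}"])
        (use 2 s null_singleton_lebesgue_on[of "{0..s}"] in auto)
    also have "\<dots> = integral {0..s} w"
      by (rule lebesgue_integral_eq_integral) (use s integrable_subinterval[OF wi, of 0 s] in auto)
    finally show ?thesis using 1 s L by (simp add: V_def)
  qed
  show "u \<in> carr (H2_space L)"
    unfolding H2_space_def fspace.select_convs mem_Collect_eq
    by (intro conjI ballI d2(1) 3) (rule differentiableI_vector[OF dV])
  have "nrm (H2_space L) u = sqrt (L2_sq L u + L2_sq L v + L2_sq L w)"
    by (simp add: H2_space_def d1 d2)
  also have "\<dots> \<le> sqrt ((2 * N)\<^sup>2)"
  proof (rule real_sqrt_le_mono)
    show "L2_sq L u + L2_sq L v + L2_sq L w \<le> (2 * N)\<^sup>2"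
    proof -
      have "0 \<le> N\<^sup>2" "(2 * N)\<^sup>2 = 4 * N\<^sup>2" by (simp_all add: power_mult_distrib)
      then show ?thesis using b by linarith
    qed
  qed
  also have "\<dots> = 2 * N" using N by (subst real_sqrt_abs) simp
  finally show "nrm (H2_space L) u \<le> 2 * N" .
qed

lemma H2_bounded_mono: "H2_bounded L u N \<Longrightarrow> N \<le> N' \<Longrightarrow> H2_bounded L u N'"
  unfolding H2_bounded_def by (meson order_trans power_mono)

lemma H2_bounded_scale:
  assumes "H2_bounded L u N"
  shows "H2_bounded L (\<lambda>s. c * u s) (cmod c * N)"
proof -
  from assms obtain v w where *: "0 \<le> N" "continuous_on {0..L} u"
    "\<And>s. s \<in> {0<..<L} \<Longrightarrow> (u has_vector_derivative v s) (at s)"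
    "\<And>s. s \<in> {0<..<L} \<Longrightarrow> (v has_vector_derivative w s) (at s)"
    "u \<in> L2_carr L" "v \<in> L2_carr L" "w \<in> L2_carr L"
    "L2_sq L u \<le> N\<^sup>2" "L2_sq L v \<le> N\<^sup>2" "L2_sq L w \<le> N\<^sup>2"
    by (rule H2_boundedE) (rule that)
  show ?thesis
    by (rule H2_boundedI[where v = "\<lambda>s. c * v s" and w = "\<lambda>s. c * w s"])
      (use * in \<open>simp_all add: L2_scale power_mult_distrib continuous_on_mult mult_left_mono
        has_vector_derivative_mult_right\<close>)
qed

lemma sq_sum_le:
  fixes a b x y :: real
  assumes "a \<le> x\<^sup>2" "b \<le> y\<^sup>2" "0 \<le> x" "0 \<le> y"
  shows "2 * a + 2 * b \<le> (2 * (x + y))\<^sup>2"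
proof -
  have "2 * a + 2 * b \<le> 4 * x\<^sup>2 + 4 * y\<^sup>2 + 8 * (x * y)"
    using assms(1,2) mult_nonneg_nonneg[OF assms(3,4)] zero_le_power2[of x] zero_le_power2[of y] by linarith
  also have "\<dots> = (2 * (x + y))\<^sup>2" by (simp add: power2_eq_square algebra_simps)
  finally show ?thesis .
qed

lemma H2_bounded_add:
  assumes "H2_bounded L u N" "H2_bounded L u' N'"
  shows "H2_bounded L (\<lambda>s. u s + u' s) (2 * (N + N'))"
proof -
  from assms(1) obtain v w where *: "0 \<le> N" "continuous_on {0..L} u"
    "\<And>s. s \<in> {0<..<L} \<Longrightarrow> (u has_vector_derivative v s) (at s)"
    "\<And>s. s \<in> {0<..<L} \<Longrightarrow> (v has_vector_derivative w s) (at s)"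
    "u \<in> L2_carr L" "v \<in> L2_carr L" "w \<in> L2_carr L"
    "L2_sq L u \<le> N\<^sup>2" "L2_sq L v \<le> N\<^sup>2" "L2_sq L w \<le> N\<^sup>2"
    by (rule H2_boundedE) (rule that)
  from assms(2) obtain v' w' where **: "0 \<le> N'" "continuous_on {0..L} u'"
    "\<And>s. s \<in> {0<..<L} \<Longrightarrow> (u' has_vector_derivative v' s) (at s)"
    "\<And>s. s \<in> {0<..<L} \<Longrightarrow> (v' has_vector_derivative w' s) (at s)"
    "u' \<in> L2_carr L" "v' \<in> L2_carr L" "w' \<in> L2_carr L"
    "L2_sq L u' \<le> N'\<^sup>2" "L2_sq L v' \<le> N'\<^sup>2" "L2_sq L w' \<le> N'\<^sup>2"
    by (rule H2_boundedE) (rule that)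
  have sum: "L2_sq L (\<lambda>s. f s + g s) \<le> (2 * (N + N'))\<^sup>2"
    if "f \<in> L2_carr L" "g \<in> L2_carr L" "L2_sq L f \<le> N\<^sup>2" "L2_sq L g \<le> N'\<^sup>2" for f g
    using L2_add(2)[OF that(1,2)] sq_sum_le[OF that(3,4) *(1) **(1)] by linarith
  show ?thesis
  proof (rule H2_boundedI[where v = "\<lambda>s. v s + v' s" and w = "\<lambda>s. w s + w' s"])
    show "0 \<le> 2 * (N + N')" using *(1) **(1) by simp
  qed (rule sum continuous_on_add L2_add has_vector_derivative_add * ** | assumption)+
qed

lemma H2_bounded_zero: "H2_bounded L (\<lambda>s. 0) 0"
  unfolding H2_bounded_def
  by (auto intro!: exI[of _ "\<lambda>s. 0"] simp: L2_carr_def L2_sq_def)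

lemma H2_bounded_cong:
  assumes "H2_bounded L u N" "0 < L" "\<And>s. s \<in> {0..L} \<Longrightarrow> u' s = u s"
  shows "H2_bounded L u' N"
proof -
  from assms(1) obtain v w where *: "0 \<le> N" "continuous_on {0..L} u"
    "\<And>s. s \<in> {0<..<L} \<Longrightarrow> (u has_vector_derivative v s) (at s)"
    "\<And>s. s \<in> {0<..<L} \<Longrightarrow> (v has_vector_derivative w s) (at s)"
    "u \<in> L2_carr L" "v \<in> L2_carr L" "w \<in> L2_carr L"
    "L2_sq L u \<le> N\<^sup>2" "L2_sq L v \<le> N\<^sup>2" "L2_sq L w \<le> N\<^sup>2"
    by (rule H2_boundedE) (rule that)
  have d: "(u' has_vector_derivative v s) (at s)" if "s \<in> {0<..<L}" for s
    by (rule has_vector_derivative_transform_within_open[OF *(3)[OF that], of "{0<..<L}"])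
      (use that assms(3) in auto)
  have c: "continuous_on {0..L} u'"
    by (rule continuous_on_eq[OF *(2)]) (use assms(3) in simp)
  have l: "u' \<in> L2_carr L" "L2_sq L u' = L2_sq L u"
    using L2_cong_interior[OF *(5), of u'] assms(3) by auto
  show ?thesis
    by (rule H2_boundedI[where v = v and w = w]) (use * d c l in simp_all)
qed

lemma L2_sup_bound:
  assumes f: "f \<in> borel_measurable (lebesgue_on {0..L})" and L: "0 \<le> L" and B: "0 \<le> B"
    and b: "\<And>s. s \<in> {0<..<L} \<Longrightarrow> cmod (f s) \<le> B"
  shows "f \<in> L2_carr L" "L2_sq L f \<le> (sqrt L * B)\<^sup>2"
proof -
  define h where "h s = (if s \<in> {0<..<L} then f s else 0)" for s
  have m: "h \<in> borel_measurable (lebesgue_on {0..L})"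
    by (rule measurable_discrete_difference[of f _ _ "{0, L} \<inter> {0..L}"])
      (use f null_singleton_lebesgue_on(2)[of "{0..L}"] in \<open>auto simp: h_def\<close>)
  have *: "h \<in> L2_carr L" "L2_sq L h \<le> (\<integral>s. B\<^sup>2 \<partial>lebesgue_on {0..L})"
    using L2_bound[OF sqi_const_lebesgue_on[of L B] m] b B by (auto simp: h_def)
  show "f \<in> L2_carr L" using L2_cong_interior(1)[OF *(1), of f] by (auto simp: h_def)
  have "L2_sq L f = L2_sq L h" using L2_cong_interior(2)[OF *(1), of f] by (auto simp: h_def)
  then show "L2_sq L f \<le> (sqrt L * B)\<^sup>2"
    using *(2) L by (simp add: power_mult_distrib mult.commute measure_restrict_space)
qed

text \<open>Membership in \<open>L2_carr\<close> asks for measurability on the closed interval,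
  while derivatives are controlled only in its interior; the two ends form a measurable null set
  whose values may be changed freely.\<close>

lemma continuous_on_imp_measurable_interval:
  fixes f :: "real \<Rightarrow> complex"
  assumes "continuous_on {0<..<L} f"
  shows "f \<in> borel_measurable (lebesgue_on {0..L})"
proof -
  define h where "h s = (if s \<in> {0<..<L} then f s else 0)" for s
  have "h \<in> borel_measurable borel"
    unfolding h_def using assms by (intro borel_measurable_continuous_on_if continuous_intros) auto
  then have "h \<in> borel_measurable (lebesgue_on {0..L})"
    by (intro measurable_completion measurable_restrict_space1) simp
  then show ?thesis
    by (rule measurable_discrete_difference[of _ _ _ "{0, L} \<inter> {0..L}"])
      (use null_singleton_lebesgue_on(2)[of "{0..L}"] in \<open>auto simp: h_def\<close>)
qed

lemma H2_bounded_sup: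
  assumes L: "0 < L" and B: "0 \<le> B" and cu: "continuous_on {0..L} u"
    and d: "\<And>s. s \<in> {0<..<L} \<Longrightarrow> (u has_vector_derivative v s) (at s)"
      "\<And>s. s \<in> {0<..<L} \<Longrightarrow> (v has_vector_derivative w s) (at s)"
    and cw: "continuous_on {0<..<L} w"
    and b: "\<And>s. s \<in> {0<..<L} \<Longrightarrow> cmod (u s) \<le> B" "\<And>s. s \<in> {0<..<L} \<Longrightarrow> cmod (v s) \<le> B"
      "\<And>s. s \<in> {0<..<L} \<Longrightarrow> cmod (w s) \<le> B"
  shows "H2_bounded L u (sqrt L * B)"
proof -
  have cv: "continuous_on {0<..<L} v"
    using d(2) by (meson continuous_at_imp_continuous_on has_vector_derivative_continuous)
  have cu': "continuous_on {0<..<L} u" by (rule continuous_on_subset[OF cu]) auto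
  note * = L2_sup_bound[OF continuous_on_imp_measurable_interval _ B]
  have L': "0 \<le> L" using L by simp
  show ?thesis
    by (rule H2_boundedI[where v = v and w = w])
      (use L B cu d *[OF cu' L' b(1)] *[OF cv L' b(2)] *[OF cw L' b(3)] in simp_all)
qed

section \<open>The surface Green operator\<close>

lemma continuous_on_imp_measurable_lebesgue_on:
  fixes f :: "real \<Rightarrow> complex"
  assumes "continuous_on D f" "D \<in> sets lebesgue"
  shows "f \<in> borel_measurable (lebesgue_on D)"
  using assms by (rule continuous_imp_measurable_on_sets_lebesgue)

lemma integral_has_vector_derivative_interior:
  fixes f :: "real \<Rightarrow> complex"
  assumes "f integrable_on {0..L}" "continuous_on {0<..<L} f" "s \<in> {0<..<L}"
  shows "((\<lambda>u. integral {0..u} f) has_vector_derivative f s) (at s)"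
proof -
  have "isCont f s" using assms by (simp add: continuous_on_eq_continuous_at)
  then have "continuous (at s within {0..L} - {}) f" by (rule continuous_at_imp_continuous_at_within)
  from integral_has_vector_derivative_continuous_at[OF assms(1) _ _ this]
  have "((\<lambda>u. integral {0..u} f) has_vector_derivative f s) (at s within {0..L})"
    using assms(3) by auto
  then show ?thesis using assms(3) by (simp add: at_within_Icc_at)
qed

text \<open>Splitting the integral at \<open>s\<close> turns the exponential part into
  \<open>E s\<close> and \<open>E (- s)\<close> times primitives, which can be differentiated
  classically because \<open>\<phi>\<close> is continuous inside. The result solves u'' + kG^2 u =
  \<open>\<phi>\<close>, and this equation is what bounds the second derivative.\<close>

lemma green_operator_bounded:
  fixes kG :: complex
  assumes L: "0 < L" and kG: "kG \<noteq> 0" and green: "neumann_green kG L g"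
  shows "\<exists>C\<ge>0. \<forall>\<phi>\<in>L2_carr L. continuous_on {0<..<L} \<phi> \<longrightarrow>
    H2_bounded L (\<lambda>s. \<integral>s'. g s s' * \<phi> s' \<partial>lebesgue_on {0..L}) (C * sqrt (L2_sq L \<phi>))"
proof -
  let ?M = "lebesgue_on {0..L}"
  from green obtain \<psi> Q where part: "partials_on_square L \<psi> Q"
    and geq: "\<And>s t. s \<in> {0..L} \<Longrightarrow> t \<in> {0..L} \<Longrightarrow>
      g s t = 1 / (2 * \<i> * kG) * exp (\<i> * kG * of_real \<bar>s - t\<bar>) + \<psi> s t \<and> Q 2 0 s t + kG\<^sup>2 * \<psi> s t = 0"
    unfolding neumann_green_def by blast
  have Q00: "Q 0 0 = \<psi>" and Qc: "continuous_on ({0..L} \<times> {0..L}) (\<lambda>(s, s'). Q m n s s')"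
    and Qd: "s \<in> {0..L} \<Longrightarrow> s' \<in> {0..L} \<Longrightarrow>
      ((\<lambda>t. Q m n t s') has_vector_derivative Q (Suc m) n s s') (at s within {0..L})" for m n s s'
    using part unfolding partials_on_square_def by blast+
  have "\<exists>B. \<forall>s\<in>{0..L}. \<forall>t\<in>{0..L}. norm (Q m 0 s t) \<le> B" for m
  proof -
    have "compact ((\<lambda>(s, s'). Q m 0 s s') ` ({0..L} \<times> {0..L}))"
      by (intro compact_continuous_image Qc compact_Times compact_Icc)
    then show ?thesis by (fastforce dest!: compact_imp_bounded simp: bounded_iff)
  qed
  then obtain B where B: "\<And>m s t. s \<in> {0..L} \<Longrightarrow> t \<in> {0..L} \<Longrightarrow> norm (Q m 0 s t) \<le> B m"
    by metis
  define E where "E s = exp (\<i> * kG * of_real s)" for s :: real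
  define e where "e = exp (norm kG * L)"
  have e1: "1 \<le> e" using L by (simp add: e_def)
  have Eb: "norm (E s) \<le> e" if "\<bar>s\<bar> \<le> L" for s
  proof -
    have "Re (\<i> * kG * of_real s) \<le> norm (\<i> * kG * of_real s)" by (rule complex_Re_le_cmod)
    also have "\<dots> \<le> norm kG * L" using that by (simp add: norm_mult mult_left_mono)
    finally show ?thesis by (simp add: E_def e_def)
  qed
  have EE: "E s * E (- s) = 1" for s by (simp add: E_def exp_minus)
  have dE: "(E has_vector_derivative \<i> * kG * E s) (at s)" for s
    unfolding E_def[abs_def]
    by (rule has_vector_derivative_real_field) (auto intro!: derivative_eq_intros)
  have dE': "((\<lambda>s. E (- s)) has_vector_derivative - (\<i> * kG * E (- s))) (at s)" for s
    unfolding E_def of_real_minus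
    by (rule has_vector_derivative_real_field) (auto intro!: derivative_eq_intros)
  have cE: "continuous_on A E" "continuous_on A (\<lambda>s. E (- s))" for A
    unfolding E_def by (intro continuous_intros)+
  define D where "D = 2 * e\<^sup>2 / norm (2 * \<i> * kG) + 2 * e\<^sup>2 + B 0 + B 1"
  have B0: "0 \<le> B m" for m using B[of 0 0 m] L order_trans[OF norm_ge_zero] by fastforce
  have D0: "0 \<le> D" using B0 by (simp add: D_def)
  \<comment> \<open>\<open>D\<close> times the L1 norm of \<open>\<phi>\<close> bounds
    \<open>u\<close> and \<open>v\<close> pointwise; passing to L2 norms on both sides costs a
    factor \<open>L\<close>. The rest covers the second derivative \<open>\<phi>\<close> - kG^2 u,
    bounded by 2 (1 + |kG|^2 L D) times the norm of \<open>\<phi>\<close>.\<close>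
  define C where "C = L * D * (1 + 2 * (norm kG)\<^sup>2) + 2"
  have C0: "0 \<le> C" using L D0 by (simp add: C_def)
  have "H2_bounded L (\<lambda>s. \<integral>s'. g s s' * \<phi> s' \<partial>?M) (C * sqrt (L2_sq L \<phi>))"
    if \<phi>: "\<phi> \<in> L2_carr L" and c\<phi>: "continuous_on {0<..<L} \<phi>" for \<phi>
  proof -
    define n where "n = (\<integral>t. norm (\<phi> t) \<partial>?M)"
    have i\<phi>: "integrable ?M \<phi>" and n: "n \<le> sqrt L * sqrt (L2_sq L \<phi>)"
      using L2_imp_L1[OF \<phi>] L by (auto simp: n_def)
    have n0: "0 \<le> n" by (simp add: n_def)
    define f1 where "f1 t = E (- t) * \<phi> t" for t
    define f2 where "f2 t = E t * \<phi> t" for t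
    have mE: "E \<in> borel_measurable ?M" "(\<lambda>t. E (- t)) \<in> borel_measurable ?M"
      by (intro continuous_on_imp_measurable_lebesgue_on cE; simp)+
    have if1: "integrable ?M f1" and if2: "integrable ?M f2"
      unfolding f1_def f2_def
      by (rule kernel_norm(1)[OF i\<phi>, where B = e]; use mE Eb in auto)+
    have hk1: "f1 integrable_on {0..L}" and hk2: "f2 integrable_on {0..L}"
      using if1 if2 by (auto intro: integrable_on_lebesgue_on)
    have cf1: "continuous_on {0<..<L} f1" and cf2: "continuous_on {0<..<L} f2"
      unfolding f1_def f2_def by (intro continuous_on_mult cE c\<phi>)+
    define P1 where "P1 s = integral {0..s} f1" for s
    define P2 where "P2 s = integral {0..L} f2 - integral {0..s} f2" for s
    have b: "norm (integral {a..b} f) \<le> e * n"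
      if ab: "0 \<le> a" "a \<le> b" "b \<le> L" and f: "integrable ?M f" "\<And>t. t \<in> {0..L} \<Longrightarrow> norm (f t) \<le> e * norm (\<phi> t)" for a b and f :: "real \<Rightarrow> complex"
    proof -
      have sub: "integrable (lebesgue_on {a..b}) f" "integrable (lebesgue_on {a..b}) \<phi>"
        using integrable_subinterval[OF f(1), of a b] integrable_subinterval[OF i\<phi>, of a b] ab by auto
      have "norm (integral {a..b} f) = norm (\<integral>t. f t \<partial>lebesgue_on {a..b})"
        by (simp add: lebesgue_integral_eq_integral[OF sub(1)])
      also have "\<dots> \<le> (\<integral>t. norm (f t) \<partial>lebesgue_on {a..b})" by (rule integral_norm_bound)
      also have "\<dots> \<le> (\<integral>t. e * norm (\<phi> t) \<partial>lebesgue_on {a..b})"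
        by (rule integral_mono) (use sub f(2) ab in auto)
      also have "\<dots> = e * (\<integral>t. indicator {a..b} t * norm (\<phi> t) \<partial>?M)"
      proof -
        have "(\<integral>t. norm (\<phi> t) \<partial>lebesgue_on {a..b}) = (\<integral>t. (if t \<in> {a..b} then norm (\<phi> t) else 0) \<partial>?M)"
          by (rule integral_restrict[symmetric]) (use ab in auto)
        also have "\<dots> = (\<integral>t. indicator {a..b} t * norm (\<phi> t) \<partial>?M)"
          by (rule Bochner_Integration.integral_cong) (auto simp: indicator_def)
        finally show ?thesis by simp
      qed
      also have "\<dots> \<le> e * n"
        unfolding n_def using e1
        by (intro mult_left_mono integral_mono_AE' integrable_norm i\<phi>) (auto simp: indicator_def)
      finally show ?thesis .
    qed
    have bf: "norm (f1 t) \<le> e * norm (\<phi> t)" "norm (f2 t) \<le> e * norm (\<phi> t)" if "t \<in> {0..L}" for t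
      using Eb[of t] Eb[of "-t"] that by (auto simp: f1_def f2_def norm_mult intro!: mult_right_mono)
    have P2': "P2 s = integral {s..L} f2" if "s \<in> {0..L}" for s
      using Henstock_Kurzweil_Integration.integral_combine[OF _ _ hk2, of s] that
      unfolding P2_def by (metis add_diff_cancel_left' atLeastAtMost_iff)
    have bP: "norm (P1 s) \<le> e * n" "norm (P2 s) \<le> e * n" if s: "s \<in> {0..L}" for s
      unfolding P2'[OF s] unfolding P1_def using s by (auto intro!: b if1 if2 bf)
    have cP: "continuous_on {0..L} P1" "continuous_on {0..L} P2"
      unfolding P1_def P2_def by (intro continuous_intros indefinite_integral_continuous_1 hk1 hk2)+
    have dP1: "(P1 has_vector_derivative f1 s) (at s)" if "s \<in> {0<..<L}" for s
      unfolding P1_def by (rule integral_has_vector_derivative_interior[OF hk1 cf1 that])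
    have dP2: "(P2 has_vector_derivative - f2 s) (at s)" if "s \<in> {0<..<L}" for s
    proof -
      have "(P2 has_vector_derivative 0 - f2 s) (at s)"
        unfolding P2_def[abs_def]
        by (intro has_vector_derivative_diff has_vector_derivative_const
            integral_has_vector_derivative_interior[OF hk2 cf2 that])
      then show ?thesis by simp
    qed
    \<comment> \<open>The contributions of the smooth part of the Green function and of its
      derivatives in the first variable.\<close>
    define R where "R m s = (\<integral>t. Q m 0 s t * \<phi> t \<partial>?M)" for m s
    have mQ: "Q m 0 s \<in> borel_measurable ?M" if "s \<in> {0..L}" for m s
    proof (rule continuous_on_imp_measurable_lebesgue_on)
      have "continuous_on {0..L} (\<lambda>t. (\<lambda>(s, s'). Q m 0 s s') (s, t))"
        by (rule continuous_on_compose2[OF Qc]) (use that in \<open>auto intro!: continuous_intros\<close>)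
      then show "continuous_on {0..L} (Q m 0 s)" by simp
    qed simp
    have dR: "(R m has_vector_derivative R (Suc m) s) (at s within {0..L})" if s: "s \<in> {0..L}" for m s
      unfolding R_def
    proof (rule kernel_derivative[OF _ s i\<phi>, where B = "max (B m) (B (Suc m))"])
      show "cmod (Q m 0 s t) \<le> max (B m) (B (Suc m))" "cmod (Q (Suc m) 0 s t) \<le> max (B m) (B (Suc m))"
        if "s \<in> {0..L}" "t \<in> space ?M" for s t
        using B[of s t m] B[of s t "Suc m"] that by auto
    qed (use Qd mQ in auto)
    have cR: "continuous_on {0..L} (R m)" for m
      using dR by (meson continuous_on_eq_continuous_within has_vector_derivative_continuous)
    have bR: "norm (R m s) \<le> B m * n" if s: "s \<in> {0..L}" for m s
      unfolding R_def n_def by (rule kernel_norm(2)[OF i\<phi> mQ[OF s]]) (use B s in auto)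
    define u where "u s = 1 / (2 * \<i> * kG) * (E s * P1 s + E (- s) * P2 s) + R 0 s" for s
    define v where "v s = 1 / 2 * (E s * P1 s - E (- s) * P2 s) + R 1 s" for s
    have ueq: "(\<integral>s'. g s s' * \<phi> s' \<partial>?M) = u s" if s: "s \<in> {0..L}" for s
    proof -
      define h where "h t = exp (\<i> * kG * of_real \<bar>s - t\<bar>) * \<phi> t" for t
      have "integrable ?M h"
        unfolding h_def
      proof (rule kernel_norm(1)[OF i\<phi>, where B = e])
        show "(\<lambda>t. exp (\<i> * kG * of_real \<bar>s - t\<bar>)) \<in> borel_measurable ?M"
          by (intro continuous_on_imp_measurable_lebesgue_on continuous_intros) simp
        show "cmod (exp (\<i> * kG * of_real \<bar>s - t\<bar>)) \<le> e" if "t \<in> space ?M" for t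
        proof -
          have "\<bar>\<bar>s - t\<bar>\<bar> \<le> L" using s that by auto
          from Eb[OF this] show ?thesis by (simp only: E_def)
        qed
      qed
      note ih = this and hh = integrable_on_lebesgue_on[OF this, simplified]
      have "(\<integral>t. h t \<partial>?M) = integral {0..s} h + integral {s..L} h"
        using s hh by (subst lebesgue_integral_eq_integral[OF ih])
          (auto intro: Henstock_Kurzweil_Integration.integral_combine[symmetric])
      also have "integral {0..s} h = integral {0..s} (\<lambda>t. E s * f1 t)"
        by (rule Henstock_Kurzweil_Integration.integral_cong)
          (auto simp: h_def f1_def E_def exp_add[symmetric] algebra_simps)
      also have "\<dots> = E s * P1 s" by (simp add: P1_def)
      also have "integral {s..L} h = integral {s..L} (\<lambda>t. E (- s) * f2 t)"
        by (rule Henstock_Kurzweil_Integration.integral_cong)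
          (auto simp: h_def f2_def E_def exp_add[symmetric] algebra_simps)
      also have "\<dots> = E (- s) * P2 s" by (simp add: P2'[OF s])
      finally have h: "(\<integral>t. h t \<partial>?M) = E s * P1 s + E (- s) * P2 s" .
      have "(\<integral>s'. g s s' * \<phi> s' \<partial>?M) = (\<integral>t. 1 / (2 * \<i> * kG) * h t + Q 0 0 s t * \<phi> t \<partial>?M)"
        by (rule Bochner_Integration.integral_cong)
          (use geq s in \<open>auto simp: h_def Q00 algebra_simps\<close>)
      also have "\<dots> = 1 / (2 * \<i> * kG) * (\<integral>t. h t \<partial>?M) + R 0 s"
        using ih kernel_norm(1)[OF i\<phi> mQ[OF s], of 0 "B 0"] B[OF s] by (simp add: R_def)
      finally show ?thesis by (simp add: h u_def)
    qed
    \<comment> \<open>The two terms that come from differentiating the primitives cancel here; in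
      the derivative of \<open>v\<close> they have equal signs and add up to
      \<open>\<phi> s\<close>.\<close>
    have du: "(u has_vector_derivative v s) (at s)" if s: "s \<in> {0<..<L}" for s
    proof -
      have r: "(R 0 has_vector_derivative R 1 s) (at s)"
        using dR[of s 0] s by (simp add: at_within_Icc_at)
      have "(u has_vector_derivative 1 / (2 * \<i> * kG) * ((E s * f1 s + \<i> * kG * E s * P1 s) +
          (E (- s) * (- f2 s) + (- (\<i> * kG * E (- s))) * P2 s)) + R 1 s) (at s)"
        unfolding u_def[abs_def]
        by (intro has_vector_derivative_add has_vector_derivative_mult_right has_vector_derivative_mult
            dE dE' dP1[OF s] dP2[OF s] r)
      moreover have "E s * f1 s = \<phi> s" "E (- s) * f2 s = \<phi> s"
        using EE[of s] by (simp_all add: f1_def f2_def mult.assoc[symmetric] mult.commute)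
      moreover have "1 / (2 * \<i> * kG) * ((x + \<i> * kG * a * p) + (- x + (- (\<i> * kG * b)) * q)) + r =
          1 / 2 * (a * p - b * q) + r" for x a p b q r
      proof -
        have "(x + \<i> * kG * a * p) + (- x + (- (\<i> * kG * b)) * q) = (\<i> * kG) * (a * p - b * q)"
          by (simp add: algebra_simps)
        then show ?thesis using kG by simp
      qed
      ultimately show ?thesis by (simp only: mult_minus_right v_def)
    qed
    have R2: "R 2 s = - (kG\<^sup>2) * R 0 s" if s: "s \<in> {0..L}" for s
    proof -
      have "R 2 s = (\<integral>t. - (kG\<^sup>2) * (Q 0 0 s t * \<phi> t) \<partial>?M)"
        unfolding R_def
      proof (rule Bochner_Integration.integral_cong[OF refl])
        fix t assume "t \<in> space ?M"
        then have "Q 2 0 s t + kG\<^sup>2 * \<psi> s t = 0" using geq[OF s, of t] by simp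
        then have "Q 2 0 s t = - (kG\<^sup>2) * \<psi> s t" by (simp add: add_eq_0_iff)
        then show "Q 2 0 s t * \<phi> t = - (kG\<^sup>2) * (Q 0 0 s t * \<phi> t)" by (simp add: Q00)
      qed
      then show ?thesis by (simp add: R_def)
    qed
    have dv: "(v has_vector_derivative \<phi> s - kG\<^sup>2 * u s) (at s)" if s: "s \<in> {0<..<L}" for s
    proof -
      have r: "(R 1 has_vector_derivative R 2 s) (at s)"
        using dR[of s 1] s by (simp add: at_within_Icc_at numeral_2_eq_2)
      have "(v has_vector_derivative 1 / 2 * ((E s * f1 s + \<i> * kG * E s * P1 s) -
          (E (- s) * (- f2 s) + (- (\<i> * kG * E (- s))) * P2 s)) + R 2 s) (at s)"
        unfolding v_def[abs_def]
        by (intro has_vector_derivative_add has_vector_derivative_diff has_vector_derivative_mult_right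
            has_vector_derivative_mult dE dE' dP1[OF s] dP2[OF s] r)
      moreover have "E s * f1 s = \<phi> s" "E (- s) * f2 s = \<phi> s"
        using EE[of s] by (simp_all add: f1_def f2_def mult.assoc[symmetric] mult.commute)
      moreover have "1 / 2 * ((\<phi> s + \<i> * kG * E s * P1 s) - (- \<phi> s + (- (\<i> * kG * E (- s))) * P2 s)) +
          - (kG\<^sup>2) * R 0 s = \<phi> s - kG\<^sup>2 * u s"
      proof -
        have "1 / 2 * ((x + \<i> * kG * a * p) - (- x + (- (\<i> * kG * b)) * q)) + - (kG\<^sup>2) * r =
            x - kG\<^sup>2 * (1 / (2 * \<i> * kG) * (a * p + b * q) + r)" for x a p b q r
        proof -
          have *: "kG\<^sup>2 * (1 / (2 * \<i> * kG) * y) = - (\<i> * kG / 2 * y)" for y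
            using kG by (simp add: power2_eq_square divide_simps)
          show ?thesis unfolding distrib_left[of "kG\<^sup>2"] * by (simp add: algebra_simps)
        qed
        then show ?thesis by (simp only: u_def)
      qed
      moreover have "R 2 s = - (kG\<^sup>2) * R 0 s" using R2[of s] s by simp
      ultimately show ?thesis by (simp only: mult_minus_right)
    qed
    have ub: "norm (u s) \<le> D * n" and vb: "norm (v s) \<le> D * n" if s: "s \<in> {0..L}" for s
    proof -
      have p: "norm (E s * P1 s) \<le> e * (e * n)" "norm (E (- s) * P2 s) \<le> e * (e * n)"
        unfolding norm_mult using s e1 n0 by (intro mult_mono Eb bP; auto)+
      have "norm (u s) \<le> norm (1 / (2 * \<i> * kG)) * norm (E s * P1 s + E (- s) * P2 s) + norm (R 0 s)"
        unfolding u_def norm_mult[symmetric] by (rule norm_triangle_ineq)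
      also have "\<dots> \<le> norm (1 / (2 * \<i> * kG)) * (e * (e * n) + e * (e * n)) + B 0 * n"
        by (intro add_mono mult_left_mono norm_triangle_mono p bR s) auto
      also have "\<dots> = (2 * e\<^sup>2 / norm (2 * \<i> * kG) + B 0) * n"
        by (simp add: norm_divide power2_eq_square algebra_simps)
      also have "\<dots> \<le> D * n" using n0 B0[of 1] by (intro mult_right_mono) (auto simp: D_def)
      finally show "norm (u s) \<le> D * n" .
      have "norm (v s) \<le> norm (1 / 2 :: complex) * norm (E s * P1 s - E (- s) * P2 s) + norm (R 1 s)"
        unfolding v_def norm_mult[symmetric] by (rule norm_triangle_ineq)
      also have "norm (E s * P1 s - E (- s) * P2 s) \<le> e * (e * n) + e * (e * n)"
        using norm_triangle_ineq4[of "E s * P1 s" "E (- s) * P2 s"] p by linarith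
      also have "norm (1 / 2 :: complex) * (e * (e * n) + e * (e * n)) + norm (R 1 s) \<le>
         norm (1 / 2 :: complex) * (e * (e * n) + e * (e * n)) + B 1 * n"
        using bR[OF s, of 1] by simp
      also have "\<dots> = (e\<^sup>2 + B 1) * n" by (simp add: power2_eq_square algebra_simps)
      also have "\<dots> \<le> D * n" using n0 B0[of 0] by (intro mult_right_mono) (auto simp: D_def)
      finally show "norm (v s) \<le> D * n" by simp
    qed
    have cu: "continuous_on {0..L} u" and cv: "continuous_on {0..L} v"
      unfolding u_def v_def by (intro continuous_intros cE cP cR)+
    have mu: "u \<in> borel_measurable ?M" "v \<in> borel_measurable ?M"
      using cu cv by (auto intro: continuous_on_imp_measurable_lebesgue_on)
    have Dn: "0 \<le> D * n" using D0 n0 by simp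
    note uL = L2_sup_bound[OF mu(1) less_imp_le[OF L] Dn] and vL = L2_sup_bound[OF mu(2) less_imp_le[OF L] Dn]
    let ?N = "L * D * sqrt (L2_sq L \<phi>)"
    have "sqrt L * (D * n) \<le> sqrt L * (D * (sqrt L * sqrt (L2_sq L \<phi>)))"
      using n D0 L by (intro mult_left_mono) auto
    also have "\<dots> = (sqrt L * sqrt L) * D * sqrt (L2_sq L \<phi>)" by (simp add: mult_ac)
    also have "\<dots> = ?N" using L by simp
    finally have N: "sqrt L * (D * n) \<le> ?N" .
    then have N2: "(sqrt L * (D * n))\<^sup>2 \<le> ?N\<^sup>2" using Dn L by (intro power_mono) auto
    have q0: "0 \<le> sqrt (L2_sq L \<phi>)" by (simp add: L2_sq_nonneg)
    have N0: "0 \<le> ?N" using D0 L q0 by simp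
    have NC: "?N\<^sup>2 \<le> (C * sqrt (L2_sq L \<phi>))\<^sup>2"
    proof (rule power_mono[OF mult_right_mono[OF _ q0] N0])
      have "L * D * 1 \<le> L * D * (1 + 2 * (norm kG)\<^sup>2)" using L D0 by (intro mult_left_mono) auto
      then show "L * D \<le> C" unfolding C_def by simp
    qed
    have u2: "u \<in> L2_carr L" "L2_sq L u \<le> ?N\<^sup>2" using uL ub N2 by fastforce+
    have v2: "v \<in> L2_carr L" "L2_sq L v \<le> ?N\<^sup>2" using vL vb N2 by fastforce+
    have w2: "(\<lambda>s. \<phi> s - kG\<^sup>2 * u s) \<in> L2_carr L"
      "L2_sq L (\<lambda>s. \<phi> s - kG\<^sup>2 * u s) \<le> (C * sqrt (L2_sq L \<phi>))\<^sup>2"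
    proof -
      note ku = L2_scale[OF u2(1), of "kG\<^sup>2"]
      show "(\<lambda>s. \<phi> s - kG\<^sup>2 * u s) \<in> L2_carr L" by (rule L2_sub(1)[OF \<phi> ku(1)])
      have "L2_sq L (\<lambda>s. \<phi> s - kG\<^sup>2 * u s) \<le> 2 * L2_sq L \<phi> + 2 * L2_sq L (\<lambda>s. kG\<^sup>2 * u s)"
        by (rule L2_sub(2)[OF \<phi> ku(1)])
      also have "\<dots> \<le> (2 * (sqrt (L2_sq L \<phi>) + norm (kG\<^sup>2) * ?N))\<^sup>2"
      proof (rule sq_sum_le)
        show "L2_sq L (\<lambda>s. kG\<^sup>2 * u s) \<le> (norm (kG\<^sup>2) * ?N)\<^sup>2"
          unfolding ku(2) power_mult_distrib[of "norm (kG\<^sup>2)"] using u2(2) by (intro mult_left_mono) auto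
      qed (use N0 in \<open>auto simp: L2_sq_nonneg\<close>)
      also have "\<dots> \<le> (C * sqrt (L2_sq L \<phi>))\<^sup>2"
      proof (rule power_mono)
        have "2 * (sqrt (L2_sq L \<phi>) + norm (kG\<^sup>2) * ?N) = (2 + L * D * (2 * (norm kG)\<^sup>2)) * sqrt (L2_sq L \<phi>)"
          by (simp add: norm_power algebra_simps)
        also have "\<dots> \<le> C * sqrt (L2_sq L \<phi>)"
          using L D0 by (intro mult_right_mono q0) (simp add: C_def algebra_simps)
        finally show "2 * (sqrt (L2_sq L \<phi>) + norm (kG\<^sup>2) * ?N) \<le> C * sqrt (L2_sq L \<phi>)" .
        show "0 \<le> 2 * (sqrt (L2_sq L \<phi>) + norm (kG\<^sup>2) * ?N)" using N0 q0 by simp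
      qed
      finally show "L2_sq L (\<lambda>s. \<phi> s - kG\<^sup>2 * u s) \<le> (C * sqrt (L2_sq L \<phi>))\<^sup>2" .
    qed
    have Hu: "H2_bounded L u (C * sqrt (L2_sq L \<phi>))"
      by (rule H2_boundedI[where v = v and w = "\<lambda>s. \<phi> s - kG\<^sup>2 * u s"])
        (use cu du dv u2 v2 w2 NC C0 q0 in auto)
    show ?thesis
      by (rule H2_bounded_cong[OF Hu L]) (use ueq in simp)
  qed
  then show ?thesis using C0 by blast
qed

section \<open>Invertible operators on seminormed function spaces\<close>

lemma inv_on_solves:
  assumes "invertible_on X T" "f \<in> carr X"
  shows "inv_on X T f \<in> carr X" "eq_in X (T (inv_on X T f)) f"
proof -
  from assms(1) obtain S where S: "bounded_op X X S" "\<And>f. f \<in> carr X \<Longrightarrow> eq_in X (T (S f)) f"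
    unfolding invertible_on_def by blast
  have "S f \<in> carr X \<and> eq_in X (T (S f)) f"
    using S assms(2) by (auto simp: bounded_op_def linear_op_def)
  then have "inv_on X T f \<in> carr X \<and> eq_in X (T (inv_on X T f)) f"
    unfolding inv_on_def by (rule someI[of "\<lambda>g. g \<in> carr X \<and> eq_in X (T g) f"])
  then show "inv_on X T f \<in> carr X" "eq_in X (T (inv_on X T f)) f" by auto
qed

text \<open>Null functions form a subspace and equal functions have equal seminorm: this is what
  makes \<open>eq_in\<close> a congruence. For the product space over the end caps both facts are
  read off from equality almost everywhere.\<close>

locale seminormed_fspace =
  fixes X :: "'x fspace"
  assumes lincomb: "\<And>f g \<alpha> \<beta>. f \<in> carr X \<Longrightarrow> g \<in> carr X \<Longrightarrow> (\<lambda>x. \<alpha> * f x + \<beta> * g x) \<in> carr X"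
    and nrm_nonneg: "\<And>f. 0 \<le> nrm X f"
    and null_lincomb: "\<And>f g \<alpha> \<beta>. f \<in> carr X \<Longrightarrow> g \<in> carr X \<Longrightarrow> nrm X f = 0 \<Longrightarrow> nrm X g = 0 \<Longrightarrow>
      nrm X (\<lambda>x. \<alpha> * f x + \<beta> * g x) = 0"
    and nrm_eq_in: "\<And>f g. f \<in> carr X \<Longrightarrow> g \<in> carr X \<Longrightarrow> eq_in X f g \<Longrightarrow> nrm X f = nrm X g"
    and zero_null: "(\<lambda>x. 0) \<in> carr X" "nrm X (\<lambda>x. 0) = 0"
begin

lemma eq_in_lincomb:
  assumes "eq_in X f f'" "eq_in X g g'"
  shows "eq_in X (\<lambda>x. \<alpha> * f x + \<beta> * g x) (\<lambda>x. \<alpha> * f' x + \<beta> * g' x)"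
proof -
  have "(\<lambda>x. (\<alpha> * f x + \<beta> * g x) - (\<alpha> * f' x + \<beta> * g' x)) = (\<lambda>x. \<alpha> * (f x - f' x) + \<beta> * (g x - g' x))"
    by (auto simp: algebra_simps)
  then show ?thesis
    using assms lincomb[of "\<lambda>x. f x - f' x" "\<lambda>x. g x - g' x"]
      null_lincomb[of "\<lambda>x. f x - f' x" "\<lambda>x. g x - g' x"]
    by (simp add: eq_in_def)
qed

lemma eq_in_sym:
  assumes "eq_in X f g"
  shows "eq_in X g f"
proof -
  have "(\<lambda>x. g x - f x) = (\<lambda>x. (- 1) * (f x - g x) + 0 * (f x - g x))" by auto
  then show ?thesis
    using assms lincomb[of "\<lambda>x. f x - g x" "\<lambda>x. f x - g x" "-1" 0]
      null_lincomb[of "\<lambda>x. f x - g x" "\<lambda>x. f x - g x" "-1" 0]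
    by (simp add: eq_in_def)
qed

lemma eq_in_trans [trans]:
  assumes "eq_in X f g" "eq_in X g h"
  shows "eq_in X f h"
proof -
  have "(\<lambda>x. f x - h x) = (\<lambda>x. 1 * (f x - g x) + 1 * (g x - h x))" by auto
  then show ?thesis
    using assms lincomb[of "\<lambda>x. f x - g x" "\<lambda>x. g x - h x" 1 1]
      null_lincomb[of "\<lambda>x. f x - g x" "\<lambda>x. g x - h x" 1 1]
    by (simp add: eq_in_def)
qed

text \<open>The difference of the two arguments is a null function, and the norm bound sends null
  functions to null functions. Linearity itself holds only up to \<open>eq_in\<close>.\<close>

lemma bounded_op_cong:
  assumes S: "bounded_op X X S" and fg: "f \<in> carr X" "g \<in> carr X" "eq_in X f g"
  shows "eq_in X (S f) (S g)"
proof -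
  from S obtain C where lin: "linear_op X X S" and C: "\<And>f. f \<in> carr X \<Longrightarrow> nrm X (S f) \<le> C * nrm X f"
    by (auto simp: bounded_op_def)
  let ?d = "\<lambda>x. 1 * f x + (- 1) * g x"
  have d: "?d \<in> carr X" by (rule lincomb[OF fg(1,2)])
  have "nrm X ?d = 0" using fg(3) by (simp add: eq_in_def)
  then have "nrm X (S ?d) = 0"
    using C[OF d] nrm_nonneg[of "S ?d"] by simp
  moreover have "S ?d \<in> carr X" using lin d unfolding linear_op_def by blast
  ultimately have "eq_in X (S ?d) (\<lambda>x. 0)" by (simp add: eq_in_def)
  moreover have "eq_in X (S ?d) (\<lambda>x. 1 * S f x + (- 1) * S g x)"
    using lin fg unfolding linear_op_def by blast
  ultimately have "eq_in X (\<lambda>x. 1 * S f x + (- 1) * S g x) (\<lambda>x. 0)"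
    using eq_in_sym eq_in_trans by blast
  then show ?thesis by (simp add: eq_in_def)
qed

text \<open>Linearity is part of the inverse only. \<open>S\<close> sends the combination of the
  images to the combination of the arguments up to \<open>eq_in\<close>; applying \<open>P\<close>,
  which respects \<open>eq_in\<close>, carries this back to \<open>P\<close>.\<close>

lemma invertible_linear:
  assumes inv: "invertible_on X P"
    and resp: "\<And>f g. f \<in> carr X \<Longrightarrow> g \<in> carr X \<Longrightarrow> eq_in X f g \<Longrightarrow> eq_in X (P f) (P g)"
    and fg: "f \<in> carr X" "g \<in> carr X"
  shows "eq_in X (P (\<lambda>x. \<alpha> * f x + \<beta> * g x)) (\<lambda>x. \<alpha> * P f x + \<beta> * P g x)"
proof -
  from inv obtain S where S: "bounded_op X X S"
    and SP: "\<And>f. f \<in> carr X \<Longrightarrow> eq_in X (S (P f)) f" and PS: "\<And>f. f \<in> carr X \<Longrightarrow> eq_in X (P (S f)) f"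
    and P: "\<And>f. f \<in> carr X \<Longrightarrow> P f \<in> carr X"
    unfolding invertible_on_def by blast
  have lin: "linear_op X X S" using S by (simp add: bounded_op_def)
  have Sc: "\<And>f. f \<in> carr X \<Longrightarrow> S f \<in> carr X" using lin unfolding linear_op_def by blast
  let ?h = "\<lambda>x. \<alpha> * f x + \<beta> * g x" and ?k = "\<lambda>x. \<alpha> * P f x + \<beta> * P g x"
  have h: "?h \<in> carr X" by (rule lincomb[OF fg])
  have k: "?k \<in> carr X" by (intro lincomb P fg)
  have "eq_in X (S ?k) (\<lambda>x. \<alpha> * S (P f) x + \<beta> * S (P g) x)"
    using lin P[OF fg(1)] P[OF fg(2)] unfolding linear_op_def by blast
  also have "eq_in X (\<lambda>x. \<alpha> * S (P f) x + \<beta> * S (P g) x) ?h"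
    by (intro eq_in_lincomb SP fg)
  finally have "eq_in X (P (S ?k)) (P ?h)" by (rule resp[OF Sc[OF k] h])
  then show ?thesis using PS[OF k] eq_in_sym eq_in_trans by blast
qed

lemma invertible_inj:
  assumes inv: "invertible_on X P" and fg: "f \<in> carr X" "g \<in> carr X" and eq: "eq_in X (P f) (P g)"
  shows "eq_in X f g"
proof -
  from inv obtain S where S: "bounded_op X X S"
    and SP: "\<And>f. f \<in> carr X \<Longrightarrow> eq_in X (S (P f)) f" and P: "\<And>f. f \<in> carr X \<Longrightarrow> P f \<in> carr X"
    unfolding invertible_on_def by blast
  have "eq_in X (S (P f)) (S (P g))" by (rule bounded_op_cong[OF S P P eq]) fact+
  from eq_in_trans[OF eq_in_sym[OF SP[OF fg(1)]] eq_in_trans[OF this SP[OF fg(2)]]]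
  show ?thesis .
qed

text \<open>The preimage picked by \<open>inv_on\<close> is arbitrary, but it agrees up to
  \<open>eq_in\<close> with the value of the bounded inverse, as one sees by applying that inverse
  to its image.\<close>

lemma inv_on_bounded:
  assumes inv: "invertible_on X P"
  shows "\<exists>C\<ge>0. \<forall>f\<in>carr X. nrm X (inv_on X P f) \<le> C * nrm X f"
proof -
  from inv obtain S C where S: "bounded_op X X S" and C: "\<And>f. f \<in> carr X \<Longrightarrow> nrm X (S f) \<le> C * nrm X f"
    and SP: "\<And>f. f \<in> carr X \<Longrightarrow> eq_in X (S (P f)) f" and P: "\<And>f. f \<in> carr X \<Longrightarrow> P f \<in> carr X"
    unfolding invertible_on_def bounded_op_def by blast
  have Sc: "\<And>f. f \<in> carr X \<Longrightarrow> S f \<in> carr X" using S unfolding bounded_op_def linear_op_def by blast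
  have "nrm X (inv_on X P f) \<le> \<bar>C\<bar> * nrm X f" if f: "f \<in> carr X" for f
  proof -
    note g = inv_on_solves[OF inv f]
    have "eq_in X (inv_on X P f) (S f)"
      using bounded_op_cong[OF S P[OF g(1)] f g(2)] SP[OF g(1)] eq_in_sym eq_in_trans by blast
    then have "nrm X (inv_on X P f) = nrm X (S f)" by (rule nrm_eq_in[OF g(1) Sc[OF f]])
    also have "\<dots> \<le> \<bar>C\<bar> * nrm X f"
      using C[OF f] mult_right_mono[OF abs_ge_self[of C] nrm_nonneg[of f]] by linarith
    finally show ?thesis .
  qed
  then show ?thesis by (intro exI[of _ "\<bar>C\<bar>"]) auto
qed

text \<open>The scalar is 1 and the compact part is Q - P composed with the inverse of
  \<open>P\<close>. The last assumption is sequential compactness of Q - P alone: the inverse keeps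
  bounded sequences bounded, and linearity up to \<open>eq_in\<close> comes from
  \<open>invertible_linear\<close>.\<close>

lemma fredholm_quotient:
  assumes P: "invertible_on X P" and Q: "invertible_on X Q"
    and respP: "\<And>f g. f \<in> carr X \<Longrightarrow> g \<in> carr X \<Longrightarrow> eq_in X f g \<Longrightarrow> eq_in X (P f) (P g)"
    and respQ: "\<And>f g. f \<in> carr X \<Longrightarrow> g \<in> carr X \<Longrightarrow> eq_in X f g \<Longrightarrow> eq_in X (Q f) (Q g)"
    and comp: "\<And>f :: nat \<Rightarrow> 'x \<Rightarrow> complex. (\<And>m. f m \<in> carr X) \<Longrightarrow> \<exists>B. \<forall>m. nrm X (f m) \<le> B \<Longrightarrow>
      \<exists>r :: nat \<Rightarrow> nat. strict_mono r \<and>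
        (\<exists>g\<in>carr X. (\<lambda>m. nrm X (\<lambda>y. (Q (f (r m)) y - P (f (r m)) y) - g y)) \<longlonglongrightarrow> 0)"
  shows "fredholm_second_kind X (Q \<circ> inv_on X P)"
proof -
  let ?I = "inv_on X P"
  have I: "?I f \<in> carr X" "eq_in X (P (?I f)) f" if "f \<in> carr X" for f
    by (rule inv_on_solves[OF P that])+
  have Pc: "P f \<in> carr X" if "f \<in> carr X" for f using P that by (simp add: invertible_on_def)
  have Qc: "Q f \<in> carr X" if "f \<in> carr X" for f using Q that by (simp add: invertible_on_def)
  define C where "C f = (\<lambda>x. Q (?I f) x - P (?I f) x)" for f
  have Cc: "C f \<in> carr X" if "f \<in> carr X" for f
    using lincomb[OF Qc[OF I(1)[OF that]] Pc[OF I(1)[OF that]], of 1 "-1"] by (simp add: C_def)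
  have Ilin: "eq_in X (?I (\<lambda>x. \<alpha> * f x + \<beta> * g x)) (\<lambda>x. \<alpha> * ?I f x + \<beta> * ?I g x)"
    if f: "f \<in> carr X" and g: "g \<in> carr X" for f g \<alpha> \<beta>
  proof (rule invertible_inj[OF P])
    let ?h = "\<lambda>x. \<alpha> * f x + \<beta> * g x"
    have h: "?h \<in> carr X" by (rule lincomb[OF f g])
    show "?I ?h \<in> carr X" by (rule I[OF h])
    show "(\<lambda>x. \<alpha> * ?I f x + \<beta> * ?I g x) \<in> carr X" by (intro lincomb I f g)
    have "eq_in X (P (?I ?h)) ?h" by (rule I[OF h])
    also have "eq_in X ?h (\<lambda>x. \<alpha> * P (?I f) x + \<beta> * P (?I g) x)"
      by (intro eq_in_lincomb eq_in_sym[OF I(2)] f g)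
    also have "eq_in X (\<lambda>x. \<alpha> * P (?I f) x + \<beta> * P (?I g) x) (P (\<lambda>x. \<alpha> * ?I f x + \<beta> * ?I g x))"
      by (intro eq_in_sym[OF invertible_linear[OF P respP]] I f g)
    finally show "eq_in X (P (?I ?h)) (P (\<lambda>x. \<alpha> * ?I f x + \<beta> * ?I g x))" .
  qed
  have "linear_op X X C"
    unfolding linear_op_def
  proof (intro conjI ballI allI Cc)
    fix f g \<alpha> \<beta> assume f: "f \<in> carr X" and g: "g \<in> carr X"
    let ?h = "\<lambda>x. \<alpha> * f x + \<beta> * g x" and ?J = "\<lambda>x. \<alpha> * ?I f x + \<beta> * ?I g x"
    have h: "?h \<in> carr X" by (rule lincomb[OF f g])
    have J: "?J \<in> carr X" by (intro lincomb I f g)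
    have q: "eq_in X (Q (?I ?h)) (\<lambda>x. \<alpha> * Q (?I f) x + \<beta> * Q (?I g) x)"
      using respQ[OF I(1)[OF h] J Ilin[OF f g]] invertible_linear[OF Q respQ I(1)[OF f] I(1)[OF g]] eq_in_trans by blast
    have p: "eq_in X (P (?I ?h)) (\<lambda>x. \<alpha> * P (?I f) x + \<beta> * P (?I g) x)"
      using respP[OF I(1)[OF h] J Ilin[OF f g]] invertible_linear[OF P respP I(1)[OF f] I(1)[OF g]] eq_in_trans by blast
    from eq_in_lincomb[OF q p, of 1 "-1"]
    show "eq_in X (C ?h) (\<lambda>x. \<alpha> * C f x + \<beta> * C g x)"
      by (simp add: C_def algebra_simps)
  qed
  moreover have "\<exists>r :: nat \<Rightarrow> nat. strict_mono r \<and>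
      (\<exists>g\<in>carr X. (\<lambda>m. nrm X (\<lambda>y. C (f (r m)) y - g y)) \<longlonglongrightarrow> 0)"
    if f: "\<And>m. f m \<in> carr X" and B: "\<exists>B. \<forall>m. nrm X (f m) \<le> B" for f :: "nat \<Rightarrow> 'x \<Rightarrow> complex"
  proof -
    obtain K where K: "K \<ge> 0" "\<And>f. f \<in> carr X \<Longrightarrow> nrm X (?I f) \<le> K * nrm X f"
      using inv_on_bounded[OF P] by blast
    from B obtain b where b: "\<And>m. nrm X (f m) \<le> b" by blast
    have "nrm X (?I (f m)) \<le> K * b" for m
      using K(2)[OF f, of m] mult_left_mono[OF b[of m] K(1)] by linarith
    then show ?thesis
      unfolding C_def by (intro comp[of "\<lambda>m. ?I (f m)"]) (auto intro: I f)
  qed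
  ultimately have "compact_op X X C" unfolding compact_op_def by blast
  moreover have "eq_in X ((Q \<circ> ?I) f) (\<lambda>x. 1 * f x + C f x)" if f: "f \<in> carr X" for f
    using I(2)[OF f] by (simp add: eq_in_def C_def)
  ultimately show ?thesis
    unfolding fredholm_second_kind_def
    by (intro exI[of _ "1 :: complex"] conjI exI[of _ C] ballI) simp_all
qed

end

section \<open>Properties of \<open>H\<^sup>2\<close> functions\<close>

lemma H2_nrm_nonneg: "0 \<le> nrm (H2_space L) u"
  by (simp add: H2_space_def L2_sq_nonneg)

lemma H2_components:
  "L2_sq L u \<le> (nrm (H2_space L) u)\<^sup>2" "L2_sq L (dint L u) \<le> (nrm (H2_space L) u)\<^sup>2"
  using L2_sq_nonneg[of L u] L2_sq_nonneg[of L "dint L u"] L2_sq_nonneg[of L "dint L (dint L u)"]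
  by (auto simp: H2_space_def)

lemma H2_deriv:
  assumes L: "0 < L" and u: "u \<in> carr (H2_space L)"
  shows "\<And>s. s \<in> {0..L} \<Longrightarrow> (u has_vector_derivative dint L u s) (at s within {0..L})"
    "continuous_on {0..L} u" "continuous_on {0..L} (dint L u)"
proof -
  show d: "(u has_vector_derivative dint L u s) (at s within {0..L})" if "s \<in> {0..L}" for s
  proof -
    have "u differentiable (at s within {0..L})" using u that by (simp add: H2_space_def)
    then show ?thesis unfolding dint_def by (rule vector_derivative_works[THEN iffD1])
  qed
  show "continuous_on {0..L} u"
    using d by (meson continuous_on_eq_continuous_within has_vector_derivative_continuous)
  have w: "integrable (lebesgue_on {0..L}) (dint L (dint L u))"
    by (rule L2_imp_L1) (use u L in \<open>auto simp: H2_space_def\<close>)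
  show "continuous_on {0..L} (dint L u)"
  proof (rule continuous_on_eq)
    show "continuous_on {0..L} (\<lambda>s. dint L u 0 + (\<integral>t. dint L (dint L u) t \<partial>lebesgue_on {0..s}))"
      by (intro continuous_intros indefinite_integral_continuous_real w)
    show "dint L u 0 + (\<integral>t. dint L (dint L u) t \<partial>lebesgue_on {0..s}) = dint L u s" if "s \<in> {0..L}" for s
      using u that unfolding H2_space_def fspace.select_convs mem_Collect_eq by metis
  qed
qed

lemma continuous_on_imp_L2:
  fixes f :: "real \<Rightarrow> complex"
  assumes "continuous_on {0..L} f" "0 < L"
  shows "f \<in> L2_carr L"
proof -
  have "compact (f ` {0..L})" using assms by (intro compact_continuous_image) auto
  then obtain B where B: "\<And>s. s \<in> {0..L} \<Longrightarrow> norm (f s) \<le> B"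
    by (fastforce dest!: compact_imp_bounded simp: bounded_iff)
  have "f \<in> borel_measurable (lebesgue_on {0..L})"
    using assms by (intro continuous_imp_measurable_on_sets_lebesgue) auto
  then show ?thesis
    using B assms(2) order_trans[OF norm_ge_zero B[of 0]] by (intro L2_sup_bound(1)[of f L B]) auto
qed

lemma H2_in_L2:
  assumes "0 < L" "u \<in> carr (H2_space L)"
  shows "u \<in> L2_carr L" "dint L u \<in> L2_carr L"
  using H2_deriv[OF assms] continuous_on_imp_L2[OF _ assms(1)] by auto

text \<open>A member of the space is continuous, so a vanishing L2 norm makes it vanish everywhere
  on the interval, ends included.\<close>

lemma H2_null:
  assumes L: "0 < L" and u: "u \<in> carr (H2_space L)" and 0: "nrm (H2_space L) u = 0" and s: "s \<in> {0..L}"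
  shows "u s = 0"
proof -
  have "L2_sq L u = 0"
    using H2_components(1)[of L u] 0 L2_sq_nonneg[of L u] by simp
  moreover have c: "continuous_on {0..L} (\<lambda>s. (cmod (u s))\<^sup>2)"
    by (intro continuous_intros H2_deriv(2)[OF L u])
  have "L2_sq L u = integral {0..L} (\<lambda>s. (cmod (u s))\<^sup>2)"
    unfolding L2_sq_def
    by (rule lebesgue_integral_eq_integral) (use H2_in_L2(1)[OF L u] in \<open>auto simp: L2_carr_def\<close>)
  ultimately have "integral {0..L} (\<lambda>s. (cmod (u s))\<^sup>2) = 0" by simp
  then have "(cmod (u s))\<^sup>2 = 0"
    using integral_eq_0_iff[OF c L] s by auto
  then show ?thesis by simp
qed

lemma dint_cong:
  assumes "\<And>s. s \<in> {0..L} \<Longrightarrow> f s = g s" "s \<in> {0..L}"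
  shows "dint L f s = dint L g s"
proof -
  have "(f has_vector_derivative d) (at s within {0..L}) \<longleftrightarrow> (g has_vector_derivative d) (at s within {0..L})" for d
    using has_vector_derivative_transform[OF assms(2), of f g d]
      has_vector_derivative_transform[OF assms(2), of g f d] assms(1) by force
  then show ?thesis by (simp add: dint_def vector_derivative_def)
qed

lemma L2_sq_cong: "(\<And>s. s \<in> {0..L} \<Longrightarrow> f s = g s) \<Longrightarrow> L2_sq L f = L2_sq L g"
  unfolding L2_sq_def by (rule Bochner_Integration.integral_cong) auto

lemma H2_nrm_cong:
  assumes "\<And>s. s \<in> {0..L} \<Longrightarrow> f s = g s"
  shows "nrm (H2_space L) f = nrm (H2_space L) g"
proof -
  have "dint L f s = dint L g s" if "s \<in> {0..L}" for s using dint_cong[of L f g] assms that by blast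
  moreover have "dint L (dint L f) s = dint L (dint L g) s" if "s \<in> {0..L}" for s
    using dint_cong[of L "dint L f" "dint L g"] calculation that by blast
  ultimately show ?thesis
    using L2_sq_cong[of L f g] L2_sq_cong[of L "dint L f" "dint L g"]
      L2_sq_cong[of L "dint L (dint L f)" "dint L (dint L g)"] assms
    by (simp add: H2_space_def)
qed

lemma H2_eq_in:
  assumes "0 < L" "eq_in (H2_space L) f g" "s \<in> {0..L}"
  shows "f s = g s"
proof -
  have "f s - g s = 0"
    by (rule H2_null[OF assms(1) _ _ assms(3), of "\<lambda>x. f x - g x"])
      (use assms(2) in \<open>auto simp only: eq_in_def\<close>)
  then show ?thesis by simp
qed

text \<open>
  Sums need not lie in the carrier a priori (that would need almost everywhere
  differentiability of indefinite integrals), so this does not go through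
  \<open>seminormed_fspace\<close>; instead equality in the seminorm is pointwise equality on the interval.
\<close>

lemma H2_inv_on_bounded:
  assumes L: "0 < L" and inv: "invertible_on (H2_space L) T"
  shows "\<exists>C\<ge>0. \<forall>f N. H2_bounded L f N \<longrightarrow>
    inv_on (H2_space L) T f \<in> carr (H2_space L) \<and> nrm (H2_space L) (inv_on (H2_space L) T f) \<le> C * N"
proof -
  let ?X = "H2_space L"
  from inv obtain S C where Tc: "\<And>f. f \<in> carr ?X \<Longrightarrow> T f \<in> carr ?X" and lin: "linear_op ?X ?X S"
    and C: "\<And>f. f \<in> carr ?X \<Longrightarrow> nrm ?X (S f) \<le> C * nrm ?X f"
    and ST: "\<And>f. f \<in> carr ?X \<Longrightarrow> eq_in ?X (S (T f)) f"
    unfolding invertible_on_def bounded_op_def by blast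
  have "nrm ?X (inv_on ?X T f) \<le> \<bar>C\<bar> * 2 * N" if fN: "H2_bounded L f N" for f N
  proof -
    note f = H2_bounded_imp_H2[OF L fN]
    define g where "g = inv_on ?X T f"
    have g: "g \<in> carr ?X" "eq_in ?X (T g) f"
      unfolding g_def by (rule inv_on_solves[OF inv f(1)])+
    let ?d = "\<lambda>x. 1 * T g x + (- 1) * f x"
    have d: "?d \<in> carr ?X" "nrm ?X ?d = 0" using g(2) by (auto simp: eq_in_def)
    have Sd: "S ?d \<in> carr ?X" using lin d unfolding linear_op_def by blast
    have "nrm ?X (S ?d) = 0" using C[OF d(1)] d(2) H2_nrm_nonneg[of L "S ?d"] by simp
    then have 1: "S ?d s = 0" if "s \<in> {0..L}" for s using H2_null[OF L Sd] that by blast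
    have "eq_in ?X (S ?d) (\<lambda>x. 1 * S (T g) x + (- 1) * S f x)"
      using lin Tc[OF g(1)] f(1) unfolding linear_op_def by blast
    then have "S ?d s = 1 * S (T g) s + (- 1) * S f s" if "s \<in> {0..L}" for s
      by (rule H2_eq_in[OF L _ that])
    then have "S (T g) s = S f s" if "s \<in> {0..L}" for s using 1 that by fastforce
    moreover have "S (T g) s = g s" if "s \<in> {0..L}" for s
      by (rule H2_eq_in[OF L ST[OF g(1)] that])
    ultimately have "nrm ?X g = nrm ?X (S f)" by (intro H2_nrm_cong) auto
    also have "\<dots> \<le> \<bar>C\<bar> * nrm ?X f"
      using C[OF f(1)] mult_right_mono[OF abs_ge_self[of C] H2_nrm_nonneg[of L f]] by linarith
    also have "\<dots> \<le> \<bar>C\<bar> * (2 * N)" by (intro mult_left_mono f) auto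
    finally show ?thesis by (simp add: g_def)
  qed
  then show ?thesis
    using inv_on_solves(1)[OF inv] H2_bounded_imp_H2(1)[OF L]
    by (intro exI[of _ "\<bar>C\<bar> * 2"]) auto
qed

text \<open>The fundamental theorem of calculus as a pairing over the fixed interval, so that
  Cauchy-Schwarz in the form of \<open>L2_pairing\<close> applies for each \<open>s\<close>.\<close>

lemma H2_integral_form:
  assumes L: "0 < L" and u: "u \<in> carr (H2_space L)" and s: "s \<in> {0..L}"
  shows "u s = u 0 + (\<integral>t. indicator {0..s} t * dint L u t \<partial>lebesgue_on {0..L})"
proof -
  have "(dint L u has_integral u s - u 0) {0..s}"
    by (rule fundamental_theorem_of_calculus, use s in simp,
        rule has_vector_derivative_within_subset[OF H2_deriv(1)[OF L u]]) (use s in auto)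
  then have "u s = u 0 + integral {0..s} (dint L u)" by (simp add: integral_unique)
  also have "integral {0..s} (dint L u) = (\<integral>t. dint L u t \<partial>lebesgue_on {0..s})"
    by (rule lebesgue_integral_eq_integral[symmetric],
        rule integrable_subinterval[OF L2_imp_L1(1)[OF H2_in_L2(2)[OF L u]]]) (use L s in auto)
  also have "\<dots> = (\<integral>t. (if t \<in> {0..s} then dint L u t else 0) \<partial>lebesgue_on {0..L})"
    by (rule integral_restrict[symmetric]) (use s in auto)
  also have "\<dots> = (\<integral>t. indicator {0..s} t * dint L u t \<partial>lebesgue_on {0..L})"
    by (rule Bochner_Integration.integral_cong) (auto simp: indicator_def)
  finally show ?thesis .
qed

lemma initial_interval_measurable:
  assumes "0 < L" "s \<in> {0..L::real}"
  shows "{0..s} \<in> sets (lebesgue_on {0..L})"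
  using assms by (subst sets_restrict_space_iff) auto

lemma indicator_L2:
  assumes "0 < L" "s \<in> {0..L}"
  shows "indicator {0..s} \<in> L2_carr L" "L2_sq L (indicator {0..s}) \<le> L"
proof -
  have m: "(indicator {0..s} :: real \<Rightarrow> complex) \<in> borel_measurable (lebesgue_on {0..L})"
    by (rule borel_measurable_indicator[OF initial_interval_measurable[OF assms]])
  have "cmod (indicator {0..s} t) \<le> 1" for t by (cases "t \<in> {0..s}") auto
  note * = L2_sup_bound[OF m less_imp_le[OF assms(1)] zero_le_one this]
  show "indicator {0..s} \<in> L2_carr L" by (rule *(1))
  show "L2_sq L (indicator {0..s}) \<le> L" using *(2) assms(1) by simp
qed

text \<open>One-dimensional Sobolev embedding. The oscillation from the point 0 is at most sqrt L
  times the norm of the derivative; averaging over the interval bounds the value at 0 by the norm of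
  \<open>u\<close> divided by sqrt L plus the same oscillation.\<close>

lemma H2_sup:
  assumes L: "0 < L"
  shows "\<exists>K\<ge>0. \<forall>u\<in>carr (H2_space L). \<forall>s\<in>{0..L}. cmod (u s) \<le> K * nrm (H2_space L) u"
proof -
  have "cmod (u s) \<le> (2 * sqrt L + 1 / sqrt L) * nrm (H2_space L) u"
    if u: "u \<in> carr (H2_space L)" and s: "s \<in> {0..L}" for u s
  proof -
    define N where "N = nrm (H2_space L) u"
    have N0: "0 \<le> N" by (simp add: N_def H2_nrm_nonneg)
    have sq: "sqrt (L2_sq L u) \<le> N" "sqrt (L2_sq L (dint L u)) \<le> N"
      unfolding N_def by (intro real_le_lsqrt H2_nrm_nonneg H2_components)+
    have diff: "cmod (u s - u 0) \<le> sqrt L * N" if s: "s \<in> {0..L}" for s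
    proof -
      have "cmod (u s - u 0) = cmod (\<integral>t. indicator {0..s} t * dint L u t \<partial>lebesgue_on {0..L})"
        using H2_integral_form[OF L u s] by simp
      also have "\<dots> \<le> sqrt (L2_sq L (indicator {0..s})) * sqrt (L2_sq L (dint L u))"
        by (intro L2_pairing(2) indicator_L2 H2_in_L2 L s u)
      also have "\<dots> \<le> sqrt L * N"
        using indicator_L2(2)[OF L s] sq N0 L by (intro mult_mono real_sqrt_le_mono) (auto simp: L2_sq_nonneg)
      finally show ?thesis .
    qed
    have "L * cmod (u 0) = (\<integral>t. cmod (u 0) \<partial>lebesgue_on {0..L})"
      using L by (simp add: measure_restrict_space)
    also have "\<dots> \<le> (\<integral>t. cmod (u t) + sqrt L * N \<partial>lebesgue_on {0..L})"
    proof (rule integral_mono)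
      show "integrable (lebesgue_on {0..L}) (\<lambda>t. cmod (u 0))"
        "integrable (lebesgue_on {0..L}) (\<lambda>t. cmod (u t) + sqrt L * N)"
        using finite_measure.integrable_const[OF finite_measure_interval] L2_imp_L1(1)[OF H2_in_L2(1)[OF L u]] L
        by auto
      show "cmod (u 0) \<le> cmod (u t) + sqrt L * N" if "t \<in> space (lebesgue_on {0..L})" for t
        using diff[of t] norm_triangle_ineq4[of "u t" "u t - u 0"] that by auto
    qed
    also have "\<dots> = (\<integral>t. cmod (u t) \<partial>lebesgue_on {0..L}) + L * (sqrt L * N)"
      using finite_measure.integrable_const[OF finite_measure_interval] L2_imp_L1(1)[OF H2_in_L2(1)[OF L u]] L
      by (simp add: measure_restrict_space)
    also have "\<dots> \<le> sqrt L * N + L * (sqrt L * N)"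
    proof -
      have "(\<integral>t. cmod (u t) \<partial>lebesgue_on {0..L}) \<le> sqrt L * sqrt (L2_sq L u)"
        by (rule L2_imp_L1(2)[OF H2_in_L2(1)[OF L u]]) (use L in simp)
      also have "\<dots> \<le> sqrt L * N" using sq L by (intro mult_left_mono) auto
      finally show ?thesis by simp
    qed
    also have "\<dots> = L * (N / sqrt L + sqrt L * N)"
    proof -
      have "L * (N / sqrt L) = sqrt L * N" using L by (simp add: real_div_sqrt field_simps)
      then show ?thesis by (simp add: distrib_left)
    qed
    finally have "cmod (u 0) \<le> N / sqrt L + sqrt L * N" using L by simp
    then have "cmod (u s) \<le> N / sqrt L + sqrt L * N + sqrt L * N"
    proof -
      have "cmod (u s) \<le> cmod (u 0) + cmod (u s - u 0)" by (metis add.commute diff_add_cancel norm_triangle_ineq)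
      then show ?thesis using diff[OF s] \<open>cmod (u 0) \<le> N / sqrt L + sqrt L * N\<close> by linarith
    qed
    also have "\<dots> = (2 * sqrt L + 1 / sqrt L) * N"
      unfolding distrib_right by simp
    finally show ?thesis by (simp only: N_def)
  qed
  then show ?thesis using L by (intro exI[of _ "2 * sqrt L + 1 / sqrt L"]) auto
qed

section \<open>The radial profile of the Helmholtz kernel\<close>

lemma entire_power_series_derivs:
  fixes c :: "nat \<Rightarrow> real"
  assumes "\<And>x. summable (\<lambda>n. c n * x ^ n)"
  shows "\<exists>F :: nat \<Rightarrow> real \<Rightarrow> real. F 0 = (\<lambda>x. \<Sum>n. c n * x ^ n) \<and>
    (\<forall>n x. (F n has_real_derivative F (Suc n) x) (at x))"
proof (intro exI conjI allI)
  let ?F = "\<lambda>m x. \<Sum>n. (diffs ^^ m) c n * x ^ n"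
  show "?F 0 = (\<lambda>x. \<Sum>n. c n * x ^ n)" by simp
  have s: "summable (\<lambda>n. (diffs ^^ m) c n * x ^ n)" for m x
    by (induction m arbitrary: x) (simp_all add: assms termdiff_converges_all)
  show "(?F m has_real_derivative ?F (Suc m) x) (at x)" for m x
    using termdiffs_strong_converges_everywhere[OF s[of m]] by simp
qed

text \<open>One of the two factorials absorbs the numerator, which leaves the exponential series.
  For the harmonic numbers in the second Bessel series this is \<open>harm_le_fact\<close>.\<close>

lemma summable_bessel_coeffs:
  fixes x :: real
  assumes "\<And>n. \<bar>e n\<bar> \<le> fact n"
  shows "summable (\<lambda>n. e n / (fact n)\<^sup>2 * x ^ n)"
proof (rule summable_comparison_test'[where N = 0])
  show "summable (\<lambda>n. inverse (fact n) * \<bar>x\<bar> ^ n)" by (rule summable_exp)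
  fix n
  have "\<bar>e n\<bar> / (fact n)\<^sup>2 \<le> fact n / (fact n)\<^sup>2"
    by (intro divide_right_mono assms) simp
  also have "fact n / (fact n)\<^sup>2 = (inverse (fact n) :: real)"
    by (simp add: power2_eq_square divide_inverse)
  finally have "\<bar>e n\<bar> / (fact n)\<^sup>2 \<le> inverse (fact n)" .
  from mult_right_mono[OF this, of "\<bar>x\<bar> ^ n"]
  show "norm (e n / (fact n)\<^sup>2 * x ^ n) \<le> inverse (fact n) * \<bar>x\<bar> ^ n"
    by (simp add: abs_mult power_abs)
qed

lemma harm_le_fact: "(harm n :: real) \<le> fact n"
proof -
  have "(harm n :: real) \<le> (\<Sum>k=1..n. 1)"
    unfolding harm_def by (intro sum_mono) (auto simp: field_simps)
  also have "\<dots> = real n" by simp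
  also have "\<dots> \<le> real (fact n)" unfolding of_nat_le_iff by (rule fact_ge_self)
  also have "\<dots> = fact n" by (rule of_nat_fact)
  finally show ?thesis .
qed

text \<open>The Helmholtz kernel as a function of the squared distance q, which is differentiable
  along a curve even where the distance itself is not. \<open>\<Phi> n\<close> is the
  \<open>n\<close>-th derivative in q. The logarithm is estimated by q to the power -1/8, that is,
  by the distance to the power -1/4; the derivatives have the true order of the derivatives of a
  logarithm.\<close>

definition profile :: "real \<Rightarrow> (nat \<Rightarrow> real \<Rightarrow> complex) \<Rightarrow> bool" where
  "profile k \<Phi> \<longleftrightarrow>
     (\<forall>x y. x \<noteq> y \<longrightarrow> Gfun k x y = \<Phi> 0 ((dist x y)\<^sup>2)) \<and>
     (\<forall>n<3. \<forall>q>0. (\<Phi> n has_vector_derivative \<Phi> (Suc n) q) (at q)) \<and>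
     continuous_on {0<..} (\<Phi> 3) \<and>
     (\<forall>Q. \<exists>C\<ge>0. \<forall>q. 0 < q \<and> q \<le> Q \<longrightarrow> cmod (\<Phi> 0 q) \<le> C * q powr (- (1/8)) \<and>
        (\<forall>n\<in>{1,2,3}. cmod (\<Phi> n q) \<le> C / q ^ n))"

lemma abs_ln_le:
  fixes q :: real
  assumes "0 < q"
  shows "\<bar>ln q\<bar> \<le> q + 1 / q"
proof -
  have "0 < 1 / q" "ln q \<le> q - 1" "ln (1 / q) \<le> 1 / q - 1" "ln (1 / q) = - ln q"
    using assms ln_le_minus_one[of q] ln_le_minus_one[of "1 / q"] by (auto simp: ln_div)
  then show ?thesis using assms by linarith
qed

text \<open>The Leibniz rule for ln q * a + b, written out up to order three. On a bounded range of
  q each term is at most a constant times q^(-n), since lower negative powers and |ln q| <= q + 1 /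
  q are dominated by the highest one.\<close>

lemma log_profile:
  fixes a b :: "nat \<Rightarrow> real \<Rightarrow> complex"
  assumes a: "\<And>n q. (a n has_vector_derivative a (Suc n) q) (at q)"
    and b: "\<And>n q. (b n has_vector_derivative b (Suc n) q) (at q)"
  shows "\<exists>\<Phi>. \<Phi> 0 = (\<lambda>q. ln q *\<^sub>R a 0 q + b 0 q) \<and>
     (\<forall>n<3. \<forall>q>0. (\<Phi> n has_vector_derivative \<Phi> (Suc n) q) (at q)) \<and>
     continuous_on {0<..} (\<Phi> 3) \<and>
     (\<forall>Q. \<exists>C\<ge>0. \<forall>q. 0 < q \<and> q \<le> Q \<longrightarrow> cmod (\<Phi> 0 q) \<le> C * q powr (- (1/8)) \<and>
        (\<forall>n\<in>{1,2,3::nat}. cmod (\<Phi> n q) \<le> C / q ^ n))"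
proof -
  define \<Phi> :: "nat \<Rightarrow> real \<Rightarrow> complex" where "\<Phi> = (\<lambda>n q.
    if n = 0 then ln q *\<^sub>R a 0 q + b 0 q
    else if n = 1 then ln q *\<^sub>R a 1 q + (1 / q) *\<^sub>R a 0 q + b 1 q
    else if n = 2 then ln q *\<^sub>R a 2 q + (2 / q) *\<^sub>R a 1 q + (- 1 / q\<^sup>2) *\<^sub>R a 0 q + b 2 q
    else ln q *\<^sub>R a 3 q + (3 / q) *\<^sub>R a 2 q + (- 3 / q\<^sup>2) *\<^sub>R a 1 q + (2 / q ^ 3) *\<^sub>R a 0 q + b 3 q)"
  have a': "(a 0 has_vector_derivative a 1 q) (at q)" "(a 1 has_vector_derivative a 2 q) (at q)"
    "(a 2 has_vector_derivative a 3 q) (at q)" for q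
    using a[of 0 q] a[of 1 q] a[of 2 q] by (simp_all add: numeral_2_eq_2 numeral_3_eq_3)
  have b': "(b 0 has_vector_derivative b 1 q) (at q)" "(b 1 has_vector_derivative b 2 q) (at q)"
    "(b 2 has_vector_derivative b 3 q) (at q)" for q
    using b[of 0 q] b[of 1 q] b[of 2 q] by (simp_all add: numeral_2_eq_2 numeral_3_eq_3)
  have ln': "(ln has_field_derivative 1 / q) (at q)" if "q > 0" for q :: real
    using that by (auto intro!: derivative_eq_intros)
  have q1: "((\<lambda>q. c / q) has_field_derivative - c / q\<^sup>2) (at q)" if "q > 0" for q c :: real
    using that by (auto intro!: derivative_eq_intros simp: power2_eq_square)
  have q2: "((\<lambda>q. c / q\<^sup>2) has_field_derivative - 2 * c / q ^ 3) (at q)" if "q > 0" for q c :: real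
    using that by (auto intro!: derivative_eq_intros simp: power2_eq_square power3_eq_cube mult_ac)
  have d0: "(\<Phi> 0 has_vector_derivative \<Phi> 1 q) (at q)" if q: "q > 0" for q
  proof -
    have "((\<lambda>q. ln q *\<^sub>R a 0 q + b 0 q) has_vector_derivative (ln q *\<^sub>R a 1 q + (1 / q) *\<^sub>R a 0 q) + b 1 q) (at q)"
      by (rule has_vector_derivative_add[OF has_vector_derivative_scaleR[OF ln'[OF q] a'(1)] b'(1)])
    then show ?thesis by (simp add: \<Phi>_def add_ac)
  qed
  have d1: "(\<Phi> 1 has_vector_derivative \<Phi> 2 q) (at q)" if q: "q > 0" for q
  proof -
    have "((\<lambda>q. ln q *\<^sub>R a 1 q + (1 / q) *\<^sub>R a 0 q + b 1 q) has_vector_derivative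
       (ln q *\<^sub>R a 2 q + (1 / q) *\<^sub>R a 1 q) + ((1 / q) *\<^sub>R a 1 q + (- 1 / q\<^sup>2) *\<^sub>R a 0 q) + b 2 q) (at q)"
      by (rule has_vector_derivative_add[OF has_vector_derivative_add[OF
            has_vector_derivative_scaleR[OF ln'[OF q] a'(2)]
            has_vector_derivative_scaleR[OF q1[OF q] a'(1)]] b'(2)])
    moreover have "(2 / q) *\<^sub>R a 1 q = (1 / q) *\<^sub>R a 1 q + (1 / q) *\<^sub>R a 1 q"
      by (simp flip: scaleR_add_left)
    ultimately show ?thesis by (simp add: \<Phi>_def add_ac)
  qed
  have d2: "(\<Phi> 2 has_vector_derivative \<Phi> 3 q) (at q)" if q: "q > 0" for q
  proof -
    have "((\<lambda>q. ln q *\<^sub>R a 2 q + (2 / q) *\<^sub>R a 1 q + (- 1 / q\<^sup>2) *\<^sub>R a 0 q + b 2 q) has_vector_derivative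
       (ln q *\<^sub>R a 3 q + (1 / q) *\<^sub>R a 2 q) + ((2 / q) *\<^sub>R a 2 q + (- 2 / q\<^sup>2) *\<^sub>R a 1 q) +
       ((- 1 / q\<^sup>2) *\<^sub>R a 1 q + (- 2 * (- 1) / q ^ 3) *\<^sub>R a 0 q) + b 3 q) (at q)"
      by (rule has_vector_derivative_add[OF has_vector_derivative_add[OF has_vector_derivative_add[OF
            has_vector_derivative_scaleR[OF ln'[OF q] a'(3)]
            has_vector_derivative_scaleR[OF q1[OF q] a'(2)]]
            has_vector_derivative_scaleR[OF q2[OF q] a'(1)]] b'(3)])
    moreover have e1: "(3 / q) *\<^sub>R a 2 q = (1 / q) *\<^sub>R a 2 q + (2 / q) *\<^sub>R a 2 q"
      unfolding scaleR_add_left[symmetric] add_divide_distrib[symmetric] by simp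
    moreover have e2: "(- 3 / q\<^sup>2) *\<^sub>R a 1 q = (- 2 / q\<^sup>2) *\<^sub>R a 1 q + (- 1 / q\<^sup>2) *\<^sub>R a 1 q"
      unfolding scaleR_add_left[symmetric] add_divide_distrib[symmetric] by simp
    moreover have e3: "- 2 * (- 1) / q ^ 3 = 2 / q ^ 3" by simp
    have "\<Phi> 2 = (\<lambda>q. ln q *\<^sub>R a 2 q + (2 / q) *\<^sub>R a 1 q + (- 1 / q\<^sup>2) *\<^sub>R a 0 q + b 2 q)"
      "\<Phi> 3 q = ln q *\<^sub>R a 3 q + (3 / q) *\<^sub>R a 2 q + (- 3 / q\<^sup>2) *\<^sub>R a 1 q + (2 / q ^ 3) *\<^sub>R a 0 q + b 3 q"
      by (simp_all add: \<Phi>_def)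
    ultimately show ?thesis by (simp only: e1 e2 e3 add_ac)
  qed
  have "\<exists>C\<ge>0. \<forall>q. 0 < q \<and> q \<le> Q0 \<longrightarrow> cmod (\<Phi> 0 q) \<le> C * q powr (- (1/8)) \<and>
        (\<forall>n\<in>{1,2,3::nat}. cmod (\<Phi> n q) \<le> C / q ^ n)" for Q0
  proof -
    \<comment> \<open>An upper end of at least 1 makes the powers of \<open>Q\<close> increasing in
      the exponent, so one power can replace all smaller ones.\<close>
    define Q where "Q = max Q0 1"
    have Q: "1 \<le> Q" "Q0 \<le> Q" by (auto simp: Q_def)
    have bdd: "\<exists>K. \<forall>q\<in>{0..Q}. norm (f q) \<le> K" if "\<And>q. (f has_vector_derivative f' q) (at q)" for f f' :: "real \<Rightarrow> complex"
    proof -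
      have "continuous_on {0..Q} f"
        using that by (meson continuous_at_imp_continuous_on has_vector_derivative_continuous)
      then have "compact (f ` {0..Q})" by (intro compact_continuous_image) auto
      then show ?thesis by (fastforce dest!: compact_imp_bounded simp: bounded_iff)
    qed
    have "\<exists>K. \<forall>n. (\<forall>q\<in>{0..Q}. norm (a n q) \<le> K n) \<and> (\<forall>q\<in>{0..Q}. norm (b n q) \<le> K n)"
    proof -
      have "\<forall>n. \<exists>k. (\<forall>q\<in>{0..Q}. norm (a n q) \<le> k) \<and> (\<forall>q\<in>{0..Q}. norm (b n q) \<le> k)"
      proof
        fix n
        obtain k1 k2 where "\<forall>q\<in>{0..Q}. norm (a n q) \<le> k1" "\<forall>q\<in>{0..Q}. norm (b n q) \<le> k2"
          using bdd[OF a] bdd[OF b] by metis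
        then show "\<exists>k. (\<forall>q\<in>{0..Q}. norm (a n q) \<le> k) \<and> (\<forall>q\<in>{0..Q}. norm (b n q) \<le> k)"
          by (intro exI[of _ "max k1 k2"]) (auto simp: le_max_iff_disj)
      qed
      then show ?thesis by (rule choice)
    qed
    then obtain k where k: "\<And>n q. q \<in> {0..Q} \<Longrightarrow> norm (a n q) \<le> k n" "\<And>n q. q \<in> {0..Q} \<Longrightarrow> norm (b n q) \<le> k n"
      by blast
    define K where "K = k 0 + k 1 + k 2 + k 3"
    have k0: "0 \<le> k n" for n using k(1)[of 0 n] Q order_trans[OF norm_ge_zero] by fastforce
    have K0: "0 \<le> K" using k0 by (simp add: K_def)
    have K: "norm (a n q) \<le> K" "norm (b n q) \<le> K" if "q \<in> {0..Q}" "n \<in> {0,1,2,3}" for n q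
      using k(1)[OF that(1), of n] k(2)[OF that(1), of n] that(2) k0[of 0] k0[of 1] k0[of 2] k0[of 3]
      by (auto simp: K_def)
    \<comment> \<open>\<open>K\<close> bounds all coefficient functions. The derivative estimates
      need 2 Q^5 + 10 Q^3, at most 12 Q^6, the function itself needs 17 Q^6; 24 covers both.\<close>
    define C where "C = 24 * Q ^ 6 * K"
    have C0: "0 \<le> C" using K0 Q by (simp add: C_def)
    have "cmod (\<Phi> 0 q) \<le> C * q powr (- (1/8)) \<and> (\<forall>n\<in>{1,2,3::nat}. cmod (\<Phi> n q) \<le> C / q ^ n)"
      if q: "0 < q" "q \<le> Q0" for q
    proof -
      have qQ: "q \<in> {0..Q}" using q Q by auto
      have scale: "\<bar>c\<bar> * norm z \<le> x * K" if "\<bar>c\<bar> \<le> x" "norm z \<le> K" for c x and z :: complex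
        using that K0 by (intro mult_mono) auto
      have qpow: "1 / q ^ j \<le> Q ^ 3 / q ^ n" if "j \<le> n" "n \<le> 3" for j n :: nat
      proof -
        have "1 / q ^ j = q ^ (n - j) / q ^ n"
          using q that by (simp add: power_diff field_simps)
        also have "q ^ (n - j) \<le> Q ^ (n - j)" using q Q by (intro power_mono) auto
        also have "Q ^ (n - j) \<le> Q ^ 3" using Q that by (intro power_increasing) auto
        finally show ?thesis using q by (simp add: divide_right_mono)
      qed
      have lnq: "\<bar>ln q\<bar> \<le> 2 * Q ^ 5 / q ^ n" if "n \<in> {1,2,3}" for n :: nat
      proof -
        have "q \<le> Q\<^sup>2 * (1 / q)" using q Q qQ mult_mono[of q Q q Q] by (simp add: field_simps power2_eq_square)
        moreover have "1 * (1 / q) \<le> Q\<^sup>2 * (1 / q)" using q Q by (intro mult_right_mono) (auto simp: one_le_power)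
        ultimately have "\<bar>ln q\<bar> \<le> 2 * Q\<^sup>2 * (1 / q ^ 1)" using abs_ln_le[OF q(1)] by simp
        also have "\<dots> \<le> 2 * Q\<^sup>2 * (Q ^ 3 / q ^ n)"
          using that Q by (intro mult_left_mono qpow) auto
        also have "\<dots> = 2 * Q ^ 5 / q ^ n" by (simp add: power_add[symmetric] field_simps)
        finally show ?thesis .
      qed
      have Qp: "Q ^ j \<le> Q ^ 6" if "j \<le> 6" for j using Q that by (intro power_increasing)
      have "cmod (\<Phi> n q) \<le> C / q ^ n" if n: "n \<in> {1,2,3}" for n :: nat
      proof -
        have qn: "0 < q ^ n" using q by simp
        have t1: "\<bar>ln q\<bar> * norm (a n q) \<le> 2 * Q ^ 5 / q ^ n * K" by (rule scale[OF lnq[OF n] K(1)[OF qQ]]) (use n in auto)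
        have t2: "\<bar>c / q ^ j\<bar> * norm (a i q) \<le> 3 * (Q ^ 3 / q ^ n) * K"
          if "\<bar>c\<bar> \<le> 3" "j \<le> n" "i \<in> {0,1,2,3}" for c j i
        proof (rule scale[OF _ K(1)[OF qQ that(3)]])
          have "\<bar>c / q ^ j\<bar> = \<bar>c\<bar> * (1 / q ^ j)" using q by simp
          also have "\<dots> \<le> 3 * (Q ^ 3 / q ^ n)" using that n q Q by (intro mult_mono qpow) auto
          finally show "\<bar>c / q ^ j\<bar> \<le> 3 * (Q ^ 3 / q ^ n)" .
        qed
        have t3: "norm (b n q) \<le> Q ^ 3 / q ^ n * K"
        proof -
          have "1 * norm (b n q) \<le> Q ^ 3 / q ^ n * K"
            using qpow[of 0 n] K(2)[OF qQ, of n] n q Q K0 by (intro mult_mono) auto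
          then show ?thesis by simp
        qed
        define T where "T = 3 * (Q ^ 3 / q ^ n) * K"
        have "cmod (\<Phi> n q) \<le> \<bar>ln q\<bar> * norm (a n q) + 3 * T + norm (b n q)"
        proof -
          have pos: "0 \<le> T" using K0 q Q by (simp add: T_def)
          have tri: "norm (x + y + z + w) \<le> norm x + norm y + norm z + norm w"
            "norm (x + y + z + w + v) \<le> norm x + norm y + norm z + norm w + norm v" for x y z w v :: complex
            by (intro norm_triangle_le add_mono norm_triangle_ineq order_refl)+
          from n consider "n = 1" | "n = 2" | "n = 3" by auto
          then show ?thesis
          proof cases
            case 1
            have "cmod (\<Phi> n q) \<le> norm (ln q *\<^sub>R a 1 q) + norm ((1 / q) *\<^sub>R a 0 q) + norm (b 1 q)"
              unfolding \<Phi>_def 1 by (auto intro!: norm_triangle_le add_mono norm_triangle_ineq)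
            moreover have "norm ((1 / q) *\<^sub>R a 0 q) \<le> T"
              using t2[of 1 1 0] 1 by (simp add: T_def)
            ultimately show ?thesis using pos unfolding 1 norm_scaleR by linarith
          next
            case 2
            have "cmod (\<Phi> n q) \<le> norm (ln q *\<^sub>R a 2 q) + norm ((2 / q) *\<^sub>R a 1 q) + norm ((- 1 / q\<^sup>2) *\<^sub>R a 0 q) + norm (b 2 q)"
            proof -
              have "\<Phi> n q = ln q *\<^sub>R a 2 q + (2 / q) *\<^sub>R a 1 q + (- 1 / q\<^sup>2) *\<^sub>R a 0 q + b 2 q" by (simp add: \<Phi>_def 2)
              then show ?thesis by (simp only: tri)
            qed
            moreover have "norm ((2 / q) *\<^sub>R a 1 q) \<le> T" "norm ((- 1 / q\<^sup>2) *\<^sub>R a 0 q) \<le> T"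
              using t2[of 2 1 1] t2[of "-1" 2 0] 2 by (simp_all add: T_def)
            ultimately show ?thesis using pos unfolding 2 norm_scaleR by linarith
          next
            case 3
            have "cmod (\<Phi> n q) \<le> norm (ln q *\<^sub>R a 3 q) + norm ((3 / q) *\<^sub>R a 2 q) + norm ((- 3 / q\<^sup>2) *\<^sub>R a 1 q) + norm ((2 / q ^ 3) *\<^sub>R a 0 q) + norm (b 3 q)"
            proof -
              have "\<Phi> n q = ln q *\<^sub>R a 3 q + (3 / q) *\<^sub>R a 2 q + (- 3 / q\<^sup>2) *\<^sub>R a 1 q + (2 / q ^ 3) *\<^sub>R a 0 q + b 3 q" by (simp add: \<Phi>_def 3)
              then show ?thesis by (simp only: tri)
            qed
            moreover have "norm ((3 / q) *\<^sub>R a 2 q) \<le> T" "norm ((- 3 / q\<^sup>2) *\<^sub>R a 1 q) \<le> T"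
              "norm ((2 / q ^ 3) *\<^sub>R a 0 q) \<le> T"
              using t2[of 3 1 2] t2[of "-3" 2 1] t2[of 2 3 0] 3 by (simp_all add: T_def)
            ultimately show ?thesis using pos unfolding 3 norm_scaleR by linarith
          qed
        qed
        also have "\<dots> \<le> 2 * Q ^ 5 / q ^ n * K + 3 * (3 * (Q ^ 3 / q ^ n) * K) + Q ^ 3 / q ^ n * K"
          using t1 t3 unfolding T_def by linarith
        also have "\<dots> = (2 * Q ^ 5 + 10 * Q ^ 3) * K / q ^ n" by (simp add: add_divide_distrib distrib_right)
        also have "\<dots> \<le> C / q ^ n"
        proof -
          have "Q ^ 5 \<le> Q ^ 6" "Q ^ 3 \<le> Q ^ 6" "0 \<le> Q ^ 6" using Qp[of 5] Qp[of 3] Q by auto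
          then have "2 * Q ^ 5 + 10 * Q ^ 3 \<le> 24 * Q ^ 6" by linarith
          then show ?thesis unfolding C_def using K0 qn by (intro divide_right_mono mult_right_mono) auto
        qed
        finally show ?thesis .
      qed
      moreover have "cmod (\<Phi> 0 q) \<le> C * q powr (- (1/8))"
      proof -
        define p where "p = q powr (- (1/8))"
        have p: "0 < p" using q by (simp add: p_def)
        have pw: "q powr e \<le> Q powr (e + 1/8) * p" if "e \<ge> -1/8" for e
        proof -
          have "q powr e = q powr (e + 1/8) * p" by (simp add: p_def flip: powr_add)
          also have "\<dots> \<le> Q powr (e + 1/8) * p" using that q Q p by (intro mult_right_mono powr_mono2) auto
          finally show ?thesis .
        qed
        have Qpw: "Q powr e \<le> Q ^ 6" if "e \<le> 6" for e
          using powr_mono[of e 6 Q] that Q by simp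
        have pq: "q powr e \<le> Q ^ 6 * p" if "- (1/8) \<le> e" "e \<le> 1" for e
        proof -
          have "q powr e \<le> Q powr (e + 1/8) * p" using that by (intro pw) simp
          also have "\<dots> \<le> Q ^ 6 * p" using that p by (intro mult_right_mono Qpw) auto
          finally show ?thesis .
        qed
        \<comment> \<open>The elementary bound |ln x| <= x + 1 / x at x = q^(1/8) trades the
          exponent -1 for -1/8 at the price of a factor 8.\<close>
        have "ln (q powr (1/8)) = ln q / 8" using q by (simp add: ln_powr)
        then have "\<bar>ln q\<bar> = 8 * \<bar>ln (q powr (1/8))\<bar>" by simp
        also have "\<dots> \<le> 8 * (q powr (1/8) + 1 / (q powr (1/8)))"
          using q by (intro mult_left_mono abs_ln_le) auto
        also have "1 / (q powr (1/8)) = q powr (- (1/8))" by (rule powr_minus_divide[symmetric])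
        finally have l0: "\<bar>ln q\<bar> \<le> 8 * (q powr (1/8) + q powr (- (1/8)))" .
        have "q powr (1/8) \<le> Q ^ 6 * p" "q powr (- (1/8)) \<le> Q ^ 6 * p" by (rule pq; simp)+
        then have "8 * (q powr (1/8) + q powr (- (1/8))) \<le> 8 * (Q ^ 6 * p + Q ^ 6 * p)"
          by (intro mult_left_mono add_mono) auto
        also have "\<dots> = 16 * (Q ^ 6 * p)" by simp
        finally have l: "\<bar>ln q\<bar> \<le> 16 * (Q ^ 6 * p)" using l0 by (rule order_trans[rotated])
        have one: "1 \<le> Q ^ 6 * p"
          using pq[of 0] q by simp
        have "cmod (\<Phi> 0 q) \<le> \<bar>ln q\<bar> * norm (a 0 q) + norm (b 0 q)"
          unfolding \<Phi>_def by (auto intro!: norm_triangle_le)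
        also have "\<dots> \<le> (16 * (Q ^ 6 * p)) * K + (Q ^ 6 * p) * K"
        proof (rule add_mono)
          show "\<bar>ln q\<bar> * norm (a 0 q) \<le> (16 * (Q ^ 6 * p)) * K" by (rule scale[OF l K(1)[OF qQ]]) simp
          have "1 * norm (b 0 q) \<le> (Q ^ 6 * p) * K" using one K(2)[OF qQ, of 0] K0 by (intro mult_mono) auto
          then show "norm (b 0 q) \<le> (Q ^ 6 * p) * K" by simp
        qed
        also have "\<dots> = 17 * (Q ^ 6 * p * K)" by simp
        also have "\<dots> \<le> 24 * (Q ^ 6 * p * K)" using p Q K0 by (intro mult_right_mono) auto
        also have "\<dots> = C * p" by (simp add: C_def)
        finally show ?thesis by (simp only: p_def)
      qed
      ultimately show ?thesis by blast
    qed
    then show ?thesis using C0 by blast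
  qed
  moreover have "(\<Phi> n has_vector_derivative \<Phi> (Suc n) q) (at q)" if "n < 3" "q > 0" for n q
  proof -
    from \<open>n < 3\<close> consider "n = 0" | "n = 1" | "n = 2" by linarith
    then show ?thesis
    proof cases
      case 1 show ?thesis using d0[OF that(2)] unfolding 1 by simp
    next
      case 2 show ?thesis using d1[OF that(2)] unfolding 2 by (simp only: one_add_one[symmetric] Suc_eq_plus1)
    next
      case 3 show ?thesis using d2[OF that(2)] unfolding 3 by (simp add: eval_nat_numeral)
    qed
  qed
  moreover have "\<Phi> 0 = (\<lambda>q. ln q *\<^sub>R a 0 q + b 0 q)" by (simp add: \<Phi>_def)
  moreover have "continuous_on {0<..} (\<Phi> 3)"
  proof -
    have c: "continuous_on A (a n)" "continuous_on A (b n)" for A n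
      using a b by (meson continuous_at_imp_continuous_on has_vector_derivative_continuous)+
    have "continuous_on {0<..} (\<lambda>q. ln q *\<^sub>R a 3 q + (3 / q) *\<^sub>R a 2 q + (- 3 / q\<^sup>2) *\<^sub>R a 1 q + (2 / q ^ 3) *\<^sub>R a 0 q + b 3 q)"
      by (intro continuous_intros c) auto
    then show ?thesis by (simp add: \<Phi>_def)
  qed
  ultimately show ?thesis by blast
qed

text \<open>Both Bessel series are entire functions of (r / 2)^2 = c * q with c = k^2 / 4. The
  logarithm ln (r / 2) equals (ln c + ln q) / 2; its constant part and the Euler constant form
  \<open>\<gamma>\<close>, and the coefficient of ln q is - J0 / (4 pi).\<close>

lemma profile_exists:
  assumes k: "0 < k"
  shows "\<exists>\<Phi>. profile k \<Phi>"
proof -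
  define cJ where "cJ m = ((-1) ^ m / (fact m)\<^sup>2 :: real)" for m :: nat
  define cH where "cH m = ((-1) ^ (m + 1) * harm m / (fact m)\<^sup>2 :: real)" for m :: nat
  have sJ: "summable (\<lambda>n. cJ n * x ^ n)" for x :: real
    unfolding cJ_def by (rule summable_bessel_coeffs) (simp add: fact_ge_1)
  have sH: "summable (\<lambda>n. cH n * x ^ n)" for x :: real
    unfolding cH_def
    by (rule summable_bessel_coeffs) (use harm_le_fact in \<open>simp add: abs_mult harm_nonneg\<close>)
  obtain J where J: "J 0 = (\<lambda>x. \<Sum>n. cJ n * x ^ n)" "\<And>n x. (J n has_real_derivative J (Suc n) x) (at x)"
    using entire_power_series_derivs[of cJ, OF sJ] by blast
  obtain H where H: "H 0 = (\<lambda>x. \<Sum>n. cH n * x ^ n)" "\<And>n x. (H n has_real_derivative H (Suc n) x) (at x)"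
    using entire_power_series_derivs[of cH, OF sH] by blast
  define c where "c = k\<^sup>2 / 4"
  have c: "0 < c" using k by (simp add: c_def)
  define Jc where "Jc n q = c ^ n * J n (c * q)" for n q
  define Hc where "Hc n q = c ^ n * H n (c * q)" for n q
  have dJ: "(Jc n has_real_derivative Jc (Suc n) q) (at q)" for n q
  proof -
    have 1: "((\<lambda>q. c ^ n * J n (c * q)) has_real_derivative c ^ n * (J (Suc n) (c * q) * c)) (at q)"
      by (intro DERIV_cmult DERIV_chain2[OF J(2)]) (auto intro!: derivative_eq_intros)
    have 2: "c ^ n * (J (Suc n) (c * q) * c) = Jc (Suc n) q" by (simp add: Jc_def mult_ac)
    have 3: "(\<lambda>q. c ^ n * J n (c * q)) = Jc n" by (auto simp: Jc_def)
    from 1[unfolded 2 3] show ?thesis .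
  qed
  have dH: "(Hc n has_real_derivative Hc (Suc n) q) (at q)" for n q
  proof -
    have 1: "((\<lambda>q. c ^ n * H n (c * q)) has_real_derivative c ^ n * (H (Suc n) (c * q) * c)) (at q)"
      by (intro DERIV_cmult DERIV_chain2[OF H(2)]) (auto intro!: derivative_eq_intros)
    have 2: "c ^ n * (H (Suc n) (c * q) * c) = Hc (Suc n) q" by (simp add: Hc_def mult_ac)
    have 3: "(\<lambda>q. c ^ n * H n (c * q)) = Hc n" by (auto simp: Hc_def)
    from 1[unfolded 2 3] show ?thesis .
  qed
  define \<gamma> where "\<gamma> = ln c / 2 + euler_mascheroni"
  define a where "a n q = complex_of_real (Jc n q) * (- (1 / (4 * pi)))" for n q
  define b where "b n q = complex_of_real (Jc n q) * (\<i> / 4 - \<gamma> / (2 * pi)) + complex_of_real (Hc n q) * (- (1 / (2 * pi)))" for n q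
  have "(a n has_vector_derivative a (Suc n) q) (at q)" for n q
    unfolding a_def[abs_def] by (intro has_vector_derivative_mult_left has_vector_derivative_of_real dJ)
  moreover have "(b n has_vector_derivative b (Suc n) q) (at q)" for n q
    unfolding b_def[abs_def]
    by (intro has_vector_derivative_add[OF has_vector_derivative_mult_left has_vector_derivative_mult_left]
        has_vector_derivative_of_real dJ dH)
  ultimately have "\<exists>\<Phi>. \<Phi> 0 = (\<lambda>q. ln q *\<^sub>R a 0 q + b 0 q) \<and>
     (\<forall>n<3. \<forall>q>0. (\<Phi> n has_vector_derivative \<Phi> (Suc n) q) (at q)) \<and>
     continuous_on {0<..} (\<Phi> 3) \<and>
     (\<forall>Q. \<exists>C\<ge>0. \<forall>q. 0 < q \<and> q \<le> Q \<longrightarrow> cmod (\<Phi> 0 q) \<le> C * q powr (- (1/8)) \<and>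
        (\<forall>n\<in>{1,2,3::nat}. cmod (\<Phi> n q) \<le> C / q ^ n))"
    by (rule log_profile)
  then obtain \<Phi> where \<Phi>: "\<Phi> 0 = (\<lambda>q. ln q *\<^sub>R a 0 q + b 0 q)"
    "\<forall>n<3. \<forall>q>0. (\<Phi> n has_vector_derivative \<Phi> (Suc n) q) (at q)" "continuous_on {0<..} (\<Phi> 3)"
    "\<forall>Q. \<exists>C\<ge>0. \<forall>q. 0 < q \<and> q \<le> Q \<longrightarrow> cmod (\<Phi> 0 q) \<le> C * q powr (- (1/8)) \<and>
        (\<forall>n\<in>{1,2,3::nat}. cmod (\<Phi> n q) \<le> C / q ^ n)"
    by blast
  have "Gfun k x y = \<Phi> 0 ((dist x y)\<^sup>2)" if xy: "x \<noteq> y" for x y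
  proof -
    define r where "r = k * dist x y"
    define q where "q = (dist x y)\<^sup>2"
    have r: "0 < r" using k xy by (simp add: r_def)
    have q: "0 < q" using xy by (simp add: q_def)
    have rq: "(r / 2)\<^sup>2 = c * q" by (simp add: r_def c_def q_def power_mult_distrib power_divide)
    have Jr: "bessel_J0 r = Jc 0 q"
      unfolding bessel_J0_def Jc_def J(1) cJ_def by (simp add: power_mult rq)
    have Hr: "(\<Sum>m. (-1) ^ (m + 1) * harm m / (fact m)\<^sup>2 * (r / 2) ^ (2 * m)) = Hc 0 q"
      unfolding Hc_def H(1) cH_def by (simp add: power_mult rq)
    have "2 * ln (r / 2) = ln ((r / 2)\<^sup>2)" using r by (simp add: ln_realpow)
    also have "\<dots> = ln c + ln q" unfolding rq using c q by (simp add: ln_mult)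
    finally have lnr: "ln (r / 2) + euler_mascheroni = ln q / 2 + \<gamma>" by (simp add: \<gamma>_def field_simps)
    have Yr: "bessel_Y0 r = 2 / pi * (ln q / 2 + \<gamma>) * Jc 0 q + 2 / pi * Hc 0 q"
      unfolding bessel_Y0_def Hr Jr lnr by simp
    have "Gfun k x y = \<i> / 4 * Complex (Jc 0 q) (bessel_Y0 r)"
      by (simp add: Gfun_def hankel_H0_def Jr r_def[symmetric])
    also have "\<dots> = ln q *\<^sub>R a 0 q + b 0 q"
      unfolding a_def b_def Yr
      by (rule complex_eqI) (simp_all add: field_simps)
    finally show ?thesis by (simp add: \<Phi>(1) q_def)
  qed
  then show ?thesis using \<Phi>(2-4) unfolding profile_def by blast
qed

section \<open>The layer kernels along a curve\<close>

lemma profileD: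
  assumes "profile k \<Phi>"
  shows "x \<noteq> y \<Longrightarrow> Gfun k x y = \<Phi> 0 ((dist x y)\<^sup>2)"
    "n < 3 \<Longrightarrow> 0 < q \<Longrightarrow> (\<Phi> n has_vector_derivative \<Phi> (Suc n) q) (at q)"
    "continuous_on {0<..} (\<Phi> 3)"
  using assms unfolding profile_def by blast+

lemma profile_bound:
  assumes "profile k \<Phi>"
  obtains C where "0 \<le> C" "\<And>q. 0 < q \<Longrightarrow> q \<le> Q \<Longrightarrow> cmod (\<Phi> 0 q) \<le> C * q powr (- (1/8))"
    "\<And>q n. 0 < q \<Longrightarrow> q \<le> Q \<Longrightarrow> n \<in> {1,2,3} \<Longrightarrow> cmod (\<Phi> n q) \<le> C / q ^ n"
  using assms unfolding profile_def by meson

lemma profile_continuous: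
  assumes "profile k \<Phi>" "n \<le> 3" "continuous_on A q" "\<And>x. x \<in> A \<Longrightarrow> 0 < q x"
  shows "continuous_on A (\<lambda>x. \<Phi> n (q x))"
proof -
  have "continuous_on {0<..} (\<Phi> n)"
  proof (cases "n = 3")
    case True
    then show ?thesis using profileD(3)[OF assms(1)] by simp
  next
    case False
    then have "n < 3" using assms(2) by simp
    then show ?thesis
      using profileD(2)[OF assms(1)] has_vector_derivative_continuous
      by (intro continuous_at_imp_continuous_on) blast
  qed
  then show ?thesis
    by (rule continuous_on_compose2[OF _ assms(3)]) (use assms(4) in auto)
qed

lemma profile_chain:
  assumes "profile k \<Phi>" "n < 3" "(q has_real_derivative q') (at s within S)" "0 < q s"
  shows "((\<lambda>s. \<Phi> n (q s)) has_vector_derivative q' *\<^sub>R \<Phi> (Suc n) (q s)) (at s within S)"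
proof -
  have "(\<Phi> n has_vector_derivative \<Phi> (Suc n) (q s)) (at (q s) within q ` S)"
    by (rule has_vector_derivative_at_within[OF profileD(2)[OF assms(1,2,4)]])
  from vector_diff_chain_within[OF assms(3)[unfolded has_real_derivative_iff_has_vector_derivative] this]
  show ?thesis by (simp add: o_def)
qed

lemma dist_sq_inner: "(dist x y)\<^sup>2 = (x - y) \<bullet> (x - y)" for x y :: complex
  by (simp add: dist_norm power2_norm_eq_inner)

lemma dist_sq_deriv:
  fixes x :: "real \<Rightarrow> complex"
  assumes "(x has_vector_derivative x') (at s within S)"
  shows "((\<lambda>s. (dist (x s) y)\<^sup>2) has_real_derivative 2 * ((x s - y) \<bullet> x')) (at s within S)"
proof -
  have d: "((\<lambda>s. x s - y) has_vector_derivative x') (at s within S)"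
    using has_vector_derivative_diff[OF assms has_vector_derivative_const[of y]] by simp
  from bounded_bilinear.has_vector_derivative[OF bounded_bilinear_inner d d]
  show ?thesis
    unfolding dist_sq_inner has_real_derivative_iff_has_vector_derivative by (simp add: inner_commute)
qed

lemma inner_deriv:
  fixes x :: "real \<Rightarrow> complex"
  assumes "(x has_vector_derivative x') (at s within S)"
  shows "((\<lambda>s. x s \<bullet> v) has_real_derivative x' \<bullet> v) (at s within S)"
  using bounded_linear.has_vector_derivative[OF bounded_linear_inner_left assms]
  unfolding has_real_derivative_iff_has_vector_derivative .

lemma ray_deriv: "((\<lambda>t. x + t *\<^sub>R v) has_vector_derivative v) (at t within S)" for v :: complex
  using has_vector_derivative_add[OF has_vector_derivative_const[of x]
      has_vector_derivative_scaleR[OF DERIV_ident has_vector_derivative_const[of v]]] by simp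

lemma open_ray_avoid:
  fixes x y v :: complex
  shows "open {t :: real. x + t *\<^sub>R v \<noteq> y}"
  by (intro open_Collect_neq continuous_intros)

lemma kerS_eq:
  assumes "profile k \<Phi>" "x \<noteq> y"
  shows "kerS k x nx y ny = \<Phi> 0 ((dist x y)\<^sup>2)"
  using profileD(1)[OF assms] by (simp add: kerS_def)

text \<open>Moving \<open>x\<close> along \<open>v\<close> changes the squared distance at the rate
  2 (x - y) . v. The profile represents the kernel only off the diagonal, so the identity is
  transferred on the open set of times at which the ray misses \<open>y\<close>.\<close>

lemma dird_profile:
  assumes p: "profile k \<Phi>" and xy: "x \<noteq> y"
  shows "dird v (\<lambda>z. Gfun k z y) x = (2 * ((x - y) \<bullet> v)) *\<^sub>R \<Phi> 1 ((dist x y)\<^sup>2)"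
proof -
  have "((\<lambda>t. \<Phi> 0 ((dist (x + t *\<^sub>R v) y)\<^sup>2)) has_vector_derivative
      (2 * ((x + 0 *\<^sub>R v - y) \<bullet> v)) *\<^sub>R \<Phi> (Suc 0) ((dist (x + 0 *\<^sub>R v) y)\<^sup>2)) (at 0)"
    by (rule profile_chain[OF p _ dist_sq_deriv[OF ray_deriv]]) (use xy in auto)
  then have "((\<lambda>t. \<Phi> 0 ((dist (x + t *\<^sub>R v) y)\<^sup>2)) has_vector_derivative
      (2 * ((x - y) \<bullet> v)) *\<^sub>R \<Phi> 1 ((dist x y)\<^sup>2)) (at 0)" by simp
  from has_vector_derivative_transform_within_open[OF this open_ray_avoid[of x v y]]
  have "((\<lambda>t. Gfun k (x + t *\<^sub>R v) y) has_vector_derivative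
      (2 * ((x - y) \<bullet> v)) *\<^sub>R \<Phi> 1 ((dist x y)\<^sup>2)) (at 0)"
    using xy profileD(1)[OF p] by simp
  then show ?thesis unfolding dird_def by (rule vector_derivative_at)
qed

lemma kerS'_eq:
  assumes "profile k \<Phi>" "x \<noteq> y"
  shows "kerS' k x nx y ny = (2 * ((x - y) \<bullet> nx)) *\<^sub>R \<Phi> 1 ((dist x y)\<^sup>2)"
  unfolding kerS'_def by (rule dird_profile[OF assms])

lemma Gfun_commute: "Gfun k x y = Gfun k y x"
  by (simp add: Gfun_def dist_commute)

lemma kerD_eq:
  assumes "profile k \<Phi>" "x \<noteq> y"
  shows "kerD k x nx y ny = (2 * ((y - x) \<bullet> ny)) *\<^sub>R \<Phi> 1 ((dist x y)\<^sup>2)"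
  using dird_profile[OF assms(1), of y x ny] assms(2)
  unfolding kerD_def Gfun_commute[of k x] by (auto simp: dist_commute)

lemma kerD'_eq:
  assumes p: "profile k \<Phi>" and xy: "x \<noteq> y"
  shows "kerD' k x nx y ny = (- 2 * (nx \<bullet> ny)) *\<^sub>R \<Phi> 1 ((dist x y)\<^sup>2) +
    (2 * ((x - y) \<bullet> nx) * (2 * ((y - x) \<bullet> ny))) *\<^sub>R \<Phi> 2 ((dist x y)\<^sup>2)"
proof -
  let ?r = "\<lambda>t. x + t *\<^sub>R nx"
  have c: "((\<lambda>t. \<Phi> 1 ((dist (?r t) y)\<^sup>2)) has_vector_derivative
      (2 * ((x - y) \<bullet> nx)) *\<^sub>R \<Phi> 2 ((dist x y)\<^sup>2)) (at 0)"
    using profile_chain[OF p, of 1 "\<lambda>t. (dist (?r t) y)\<^sup>2" _ 0 UNIV, OF _ dist_sq_deriv[OF ray_deriv]] xy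
    by (simp add: numeral_2_eq_2)
  have "((\<lambda>t. (?r t) \<bullet> ny) has_real_derivative nx \<bullet> ny) (at 0)"
    by (rule inner_deriv[OF ray_deriv])
  then have i: "((\<lambda>t. 2 * ((y - ?r t) \<bullet> ny)) has_real_derivative - 2 * (nx \<bullet> ny)) (at 0)"
    unfolding inner_diff_left by (auto intro!: derivative_eq_intros)
  have "((\<lambda>t. (2 * ((y - ?r t) \<bullet> ny)) *\<^sub>R \<Phi> 1 ((dist (?r t) y)\<^sup>2)) has_vector_derivative
      (2 * ((y - ?r 0) \<bullet> ny)) *\<^sub>R ((2 * ((x - y) \<bullet> nx)) *\<^sub>R \<Phi> 2 ((dist x y)\<^sup>2)) +
      (- 2 * (nx \<bullet> ny)) *\<^sub>R \<Phi> 1 ((dist (?r 0) y)\<^sup>2)) (at 0)"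
    by (rule has_vector_derivative_scaleR[OF i c])
  then have "((\<lambda>t. kerD k (?r t) nx y ny) has_vector_derivative
      (2 * ((y - ?r 0) \<bullet> ny)) *\<^sub>R ((2 * ((x - y) \<bullet> nx)) *\<^sub>R \<Phi> 2 ((dist x y)\<^sup>2)) +
      (- 2 * (nx \<bullet> ny)) *\<^sub>R \<Phi> 1 ((dist (?r 0) y)\<^sup>2)) (at 0)"
    by (rule has_vector_derivative_transform_within_open[OF _ open_ray_avoid[of x nx y]])
      (use xy kerD_eq[OF p] in auto)
  from vector_derivative_at[OF this]
  show ?thesis unfolding kerD'_def dird_def[of nx] kerD_def[symmetric, of k _ nx y ny]
    by (simp add: add.commute mult.commute kerD_def)
qed

text \<open>First and second derivatives along the target curve of the kernels \<open>\<Phi>\<^sub>0(|x - y|\<^sup>2)\<close>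
  and \<open>2 (y - x)\<bullet>n \<Phi>\<^sub>1(|x - y|\<^sup>2)\<close>.\<close>

definition kap1 :: "(nat \<Rightarrow> real \<Rightarrow> complex) \<Rightarrow> complex \<Rightarrow> complex \<Rightarrow> complex \<Rightarrow> complex" where
  "kap1 \<Phi> x x' y = (2 * ((x - y) \<bullet> x')) *\<^sub>R \<Phi> 1 ((dist x y)\<^sup>2)"

definition kap2 :: "(nat \<Rightarrow> real \<Rightarrow> complex) \<Rightarrow> complex \<Rightarrow> complex \<Rightarrow> complex \<Rightarrow> complex \<Rightarrow> complex" where
  "kap2 \<Phi> x x' x'' y = (2 * ((x - y) \<bullet> x'))\<^sup>2 *\<^sub>R \<Phi> 2 ((dist x y)\<^sup>2) +
     (2 * (x' \<bullet> x') + 2 * ((x - y) \<bullet> x'')) *\<^sub>R \<Phi> 1 ((dist x y)\<^sup>2)"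

definition del0 :: "(nat \<Rightarrow> real \<Rightarrow> complex) \<Rightarrow> complex \<Rightarrow> complex \<Rightarrow> complex \<Rightarrow> complex" where
  "del0 \<Phi> x y n = (2 * ((y - x) \<bullet> n)) *\<^sub>R \<Phi> 1 ((dist x y)\<^sup>2)"

definition del1 :: "(nat \<Rightarrow> real \<Rightarrow> complex) \<Rightarrow> complex \<Rightarrow> complex \<Rightarrow> complex \<Rightarrow> complex \<Rightarrow> complex" where
  "del1 \<Phi> x x' y n = (- 2 * (x' \<bullet> n)) *\<^sub>R \<Phi> 1 ((dist x y)\<^sup>2) +
     (2 * ((y - x) \<bullet> n) * (2 * ((x - y) \<bullet> x'))) *\<^sub>R \<Phi> 2 ((dist x y)\<^sup>2)"

definition del2 :: "(nat \<Rightarrow> real \<Rightarrow> complex) \<Rightarrow> complex \<Rightarrow> complex \<Rightarrow> complex \<Rightarrow> complex \<Rightarrow> complex \<Rightarrow> complex" where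
  "del2 \<Phi> x x' x'' y n = (- 2 * (x'' \<bullet> n)) *\<^sub>R \<Phi> 1 ((dist x y)\<^sup>2) +
     (2 * (- 2 * (x' \<bullet> n) * (2 * ((x - y) \<bullet> x'))) +
       2 * ((y - x) \<bullet> n) * (2 * (x' \<bullet> x') + 2 * ((x - y) \<bullet> x''))) *\<^sub>R \<Phi> 2 ((dist x y)\<^sup>2) +
     (2 * ((y - x) \<bullet> n) * (2 * ((x - y) \<bullet> x'))\<^sup>2) *\<^sub>R \<Phi> 3 ((dist x y)\<^sup>2)"

lemma kernel_curve_derivs:
  assumes p: "profile k \<Phi>" and dx: "(x has_vector_derivative x' s) (at s within S)"
    and dx': "(x' has_vector_derivative x'' s) (at s within S)" and xy: "x s \<noteq> y"
  shows "((\<lambda>s. \<Phi> 0 ((dist (x s) y)\<^sup>2)) has_vector_derivative kap1 \<Phi> (x s) (x' s) y) (at s within S)"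
    "((\<lambda>s. kap1 \<Phi> (x s) (x' s) y) has_vector_derivative kap2 \<Phi> (x s) (x' s) (x'' s) y) (at s within S)"
    "((\<lambda>s. del0 \<Phi> (x s) y n) has_vector_derivative del1 \<Phi> (x s) (x' s) y n) (at s within S)"
    "((\<lambda>s. del1 \<Phi> (x s) (x' s) y n) has_vector_derivative del2 \<Phi> (x s) (x' s) (x'' s) y n) (at s within S)"
proof -
  have q0: "0 < (dist (x s) y)\<^sup>2" using xy by simp
  note dq = dist_sq_deriv[OF dx, of y]
  have c: "((\<lambda>s. \<Phi> n ((dist (x s) y)\<^sup>2)) has_vector_derivative
      (2 * ((x s - y) \<bullet> x' s)) *\<^sub>R \<Phi> (Suc n) ((dist (x s) y)\<^sup>2)) (at s within S)" if "n < 3" for n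
    by (rule profile_chain[OF p that dq]) (use xy in simp)
  have c0: "((\<lambda>s. \<Phi> 0 ((dist (x s) y)\<^sup>2)) has_vector_derivative
      (2 * ((x s - y) \<bullet> x' s)) *\<^sub>R \<Phi> 1 ((dist (x s) y)\<^sup>2)) (at s within S)" using c[of 0] by simp
  have c1: "((\<lambda>s. \<Phi> 1 ((dist (x s) y)\<^sup>2)) has_vector_derivative
      (2 * ((x s - y) \<bullet> x' s)) *\<^sub>R \<Phi> 2 ((dist (x s) y)\<^sup>2)) (at s within S)" using c[of 1] by (simp add: numeral_2_eq_2)
  have c2: "((\<lambda>s. \<Phi> 2 ((dist (x s) y)\<^sup>2)) has_vector_derivative
      (2 * ((x s - y) \<bullet> x' s)) *\<^sub>R \<Phi> 3 ((dist (x s) y)\<^sup>2)) (at s within S)" using c[of 2] by (simp add: numeral_3_eq_3)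
  have dd: "((\<lambda>s. x s - y) has_vector_derivative x' s) (at s within S)"
    using has_vector_derivative_diff[OF dx has_vector_derivative_const[of y]] by simp
  have "((\<lambda>s. (x s - y) \<bullet> x' s) has_real_derivative x' s \<bullet> x' s + (x s - y) \<bullet> x'' s) (at s within S)"
    using bounded_bilinear.has_vector_derivative[OF bounded_bilinear_inner dd dx']
    unfolding has_real_derivative_iff_has_vector_derivative by (simp add: add.commute)
  from DERIV_cmult[OF this, of 2]
  have q1: "((\<lambda>s. 2 * ((x s - y) \<bullet> x' s)) has_real_derivative 2 * (x' s \<bullet> x' s) + 2 * ((x s - y) \<bullet> x'' s)) (at s within S)"
    by (simp add: distrib_left)
  have "((\<lambda>s. 2 * ((y - x s) \<bullet> n)) has_real_derivative 2 * (0 - x' s \<bullet> n)) (at s within S)"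
    unfolding inner_diff_left by (intro DERIV_cmult DERIV_diff DERIV_const inner_deriv dx)
  then have p0: "((\<lambda>s. 2 * ((y - x s) \<bullet> n)) has_real_derivative - 2 * (x' s \<bullet> n)) (at s within S)" by simp
  have p1: "((\<lambda>s. - 2 * (x' s \<bullet> n)) has_real_derivative - 2 * (x'' s \<bullet> n)) (at s within S)"
    by (intro DERIV_cmult inner_deriv dx')
  show "((\<lambda>s. \<Phi> 0 ((dist (x s) y)\<^sup>2)) has_vector_derivative kap1 \<Phi> (x s) (x' s) y) (at s within S)"
    unfolding kap1_def by (rule c0)
  have "((\<lambda>s. (2 * ((x s - y) \<bullet> x' s)) *\<^sub>R \<Phi> 1 ((dist (x s) y)\<^sup>2)) has_vector_derivative
     (2 * ((x s - y) \<bullet> x' s)) *\<^sub>R ((2 * ((x s - y) \<bullet> x' s)) *\<^sub>R \<Phi> 2 ((dist (x s) y)\<^sup>2)) +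
     (2 * (x' s \<bullet> x' s) + 2 * ((x s - y) \<bullet> x'' s)) *\<^sub>R \<Phi> 1 ((dist (x s) y)\<^sup>2)) (at s within S)"
    by (rule has_vector_derivative_scaleR[OF q1 c1])
  then show "((\<lambda>s. kap1 \<Phi> (x s) (x' s) y) has_vector_derivative kap2 \<Phi> (x s) (x' s) (x'' s) y) (at s within S)"
    unfolding kap1_def kap2_def scaleR_scaleR power2_eq_square .
  have "((\<lambda>s. (2 * ((y - x s) \<bullet> n)) *\<^sub>R \<Phi> 1 ((dist (x s) y)\<^sup>2)) has_vector_derivative
     (2 * ((y - x s) \<bullet> n)) *\<^sub>R ((2 * ((x s - y) \<bullet> x' s)) *\<^sub>R \<Phi> 2 ((dist (x s) y)\<^sup>2)) +
     (- 2 * (x' s \<bullet> n)) *\<^sub>R \<Phi> 1 ((dist (x s) y)\<^sup>2)) (at s within S)"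
    by (rule has_vector_derivative_scaleR[OF p0 c1])
  then show "((\<lambda>s. del0 \<Phi> (x s) y n) has_vector_derivative del1 \<Phi> (x s) (x' s) y n) (at s within S)"
    unfolding del0_def del1_def scaleR_scaleR by (simp only: add.commute)
  have "((\<lambda>s. (- 2 * (x' s \<bullet> n)) *\<^sub>R \<Phi> 1 ((dist (x s) y)\<^sup>2) +
     (2 * ((y - x s) \<bullet> n) * (2 * ((x s - y) \<bullet> x' s))) *\<^sub>R \<Phi> 2 ((dist (x s) y)\<^sup>2)) has_vector_derivative
     ((- 2 * (x' s \<bullet> n)) *\<^sub>R ((2 * ((x s - y) \<bullet> x' s)) *\<^sub>R \<Phi> 2 ((dist (x s) y)\<^sup>2)) +
       (- 2 * (x'' s \<bullet> n)) *\<^sub>R \<Phi> 1 ((dist (x s) y)\<^sup>2)) +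
     ((2 * ((y - x s) \<bullet> n) * (2 * ((x s - y) \<bullet> x' s))) *\<^sub>R ((2 * ((x s - y) \<bullet> x' s)) *\<^sub>R \<Phi> 3 ((dist (x s) y)\<^sup>2)) +
       ((- 2 * (x' s \<bullet> n)) * (2 * ((x s - y) \<bullet> x' s)) +
         (2 * (x' s \<bullet> x' s) + 2 * ((x s - y) \<bullet> x'' s)) * (2 * ((y - x s) \<bullet> n))) *\<^sub>R \<Phi> 2 ((dist (x s) y)\<^sup>2))) (at s within S)"
    by (rule has_vector_derivative_add[OF has_vector_derivative_scaleR[OF p1 c1]
          has_vector_derivative_scaleR[OF DERIV_mult[OF p0 q1] c2]])
  moreover have id: "(u *\<^sub>R (v *\<^sub>R f2) + a *\<^sub>R f1) + ((b * v) *\<^sub>R (v *\<^sub>R f3) + (u * v + c * b) *\<^sub>R f2) =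
     a *\<^sub>R f1 + (2 * (u * v) + b * c) *\<^sub>R f2 + (b * v\<^sup>2) *\<^sub>R f3" for u v a b c :: real and f1 f2 f3 :: complex
    by (simp add: power2_eq_square scaleR_add_left algebra_simps scaleR_conv_of_real)
  ultimately show "((\<lambda>s. del1 \<Phi> (x s) (x' s) y n) has_vector_derivative del2 \<Phi> (x s) (x' s) (x'' s) y n) (at s within S)"
    unfolding del1_def del2_def by (simp only: id)
qed

section \<open>Separation of curves and fins\<close>

text \<open>A finite subcover reduces the constants to the smallest of them. Neighbourhoods are
  required at all points of the compact set \<open>K\<close>, also at limit points outside
  \<open>D\<close>. Besides lower bounds on distances it yields upper bounds, with \<open>f\<close>
  constant and \<open>m\<close> the function to be bounded.\<close>

lemma compact_local_to_global:
  fixes m f :: "'a :: topological_space \<Rightarrow> real"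
  assumes K: "compact K" and D: "D \<subseteq> K" and m: "\<And>z. z \<in> D \<Longrightarrow> 0 \<le> m z"
    and loc: "\<And>p. p \<in> K \<Longrightarrow> \<exists>U c. open U \<and> p \<in> U \<and> 0 < c \<and> (\<forall>z\<in>U \<inter> D. c * m z \<le> f z)"
  shows "\<exists>c>0. \<forall>z\<in>D. c * m z \<le> f z"
proof -
  define \<U> where "\<U> = {U. open U \<and> (\<exists>c>0. \<forall>z\<in>U \<inter> D. c * m z \<le> f z)}"
  have "K \<subseteq> \<Union>\<U>"
  proof
    fix p assume "p \<in> K"
    from loc[OF this] show "p \<in> \<Union>\<U>" unfolding \<U>_def by blast
  qed
  then obtain T where T: "T \<subseteq> \<U>" "finite T" "K \<subseteq> \<Union>T"
    using compactE[OF K, of \<U>] unfolding \<U>_def by blast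
  have "\<forall>U\<in>T. \<exists>c>0. \<forall>z\<in>U \<inter> D. c * m z \<le> f z" using T(1) unfolding \<U>_def by blast
  then obtain c where c: "\<And>U. U \<in> T \<Longrightarrow> 0 < c U" "\<And>U z. U \<in> T \<Longrightarrow> z \<in> U \<inter> D \<Longrightarrow> c U * m z \<le> f z"
    by metis
  define C where "C = Min (insert 1 (c ` T))"
  have C: "0 < C" "\<And>U. U \<in> T \<Longrightarrow> C \<le> c U"
    unfolding C_def using T(2) c(1) by (auto simp: Min_gr_iff)
  have "C * m z \<le> f z" if z: "z \<in> D" for z
  proof -
    obtain U where U: "U \<in> T" "z \<in> U" using T(3) D z by blast
    have "C * m z \<le> c U * m z" using C(2)[OF U(1)] m[OF z] by (rule mult_right_mono)
    also have "\<dots> \<le> f z" using c(2)[OF U(1)] U(2) z by blast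
    finally show ?thesis .
  qed
  then show ?thesis using C(1) by blast
qed

lemma derivative_linearization:
  fixes x :: "real \<Rightarrow> complex"
  assumes "(x has_vector_derivative X) (at s0 within S)" "0 < e"
  shows "\<exists>d>0. \<forall>s\<in>S. \<bar>s - s0\<bar> < d \<longrightarrow> norm (x s - x s0 - (s - s0) *\<^sub>R X) \<le> e * \<bar>s - s0\<bar>"
  using assms unfolding has_vector_derivative_def has_derivative_within_alt real_norm_def by blast

text \<open>The linearisation error of each curve is at most \<open>c / 2\<close> times its
  parameter increment, so half of the separation of the two tangent lines survives.\<close>

lemma local_separation:
  fixes x y :: "real \<Rightarrow> complex"
  assumes x: "(x has_vector_derivative X) (at s0 within S)" and y: "(y has_vector_derivative Y) (at t0 within T)"
    and xy: "x s0 = y t0" and c: "0 < c"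
    and lin: "\<And>s t. s \<in> S \<Longrightarrow> t \<in> T \<Longrightarrow> c * (\<bar>s - s0\<bar> + \<bar>t - t0\<bar>) \<le> norm ((s - s0) *\<^sub>R X - (t - t0) *\<^sub>R Y)"
  shows "\<exists>d>0. \<forall>s\<in>S. \<forall>t\<in>T. \<bar>s - s0\<bar> < d \<longrightarrow> \<bar>t - t0\<bar> < d \<longrightarrow>
    c / 2 * (\<bar>s - s0\<bar> + \<bar>t - t0\<bar>) \<le> dist (x s) (y t)"
proof -
  have c2: "0 < c / 2" using c by simp
  obtain d1 where d1: "d1 > 0" "\<And>s. s \<in> S \<Longrightarrow> \<bar>s - s0\<bar> < d1 \<Longrightarrow> norm (x s - x s0 - (s - s0) *\<^sub>R X) \<le> c / 2 * \<bar>s - s0\<bar>"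
    using derivative_linearization[OF x c2] by blast
  obtain d2 where d2: "d2 > 0" "\<And>t. t \<in> T \<Longrightarrow> \<bar>t - t0\<bar> < d2 \<Longrightarrow> norm (y t - y t0 - (t - t0) *\<^sub>R Y) \<le> c / 2 * \<bar>t - t0\<bar>"
    using derivative_linearization[OF y c2] by blast
  have "c / 2 * (\<bar>s - s0\<bar> + \<bar>t - t0\<bar>) \<le> dist (x s) (y t)"
    if s: "s \<in> S" "\<bar>s - s0\<bar> < min d1 d2" and t: "t \<in> T" "\<bar>t - t0\<bar> < min d1 d2" for s t
  proof -
    define a where "a = x s - x s0 - (s - s0) *\<^sub>R X"
    define b where "b = y t - y t0 - (t - t0) *\<^sub>R Y"
    have ab: "norm a \<le> c / 2 * \<bar>s - s0\<bar>" "norm b \<le> c / 2 * \<bar>t - t0\<bar>"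
      using d1(2)[of s] d2(2)[of t] s t by (auto simp: a_def b_def)
    have "(s - s0) *\<^sub>R X - (t - t0) *\<^sub>R Y = (x s - y t) - a + b"
      using xy by (simp add: a_def b_def)
    then have "norm ((s - s0) *\<^sub>R X - (t - t0) *\<^sub>R Y) \<le> dist (x s) (y t) + norm a + norm b"
      using norm_triangle_ineq[of "(x s - y t) - a" b] norm_triangle_ineq4[of "x s - y t" a]
      by (simp add: dist_norm)
    with lin[OF s(1) t(1)] ab
    have "c * (\<bar>s - s0\<bar> + \<bar>t - t0\<bar>) \<le> dist (x s) (y t) + c / 2 * \<bar>s - s0\<bar> + c / 2 * \<bar>t - t0\<bar>" by linarith
    then show ?thesis by (simp add: field_simps)
  qed
  then show ?thesis using d1(1) d2(1) by (intro exI[of _ "min d1 d2"]) auto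
qed

text \<open>Pythagoras, with the sum of the two legs at most twice the hypotenuse.\<close>

lemma orthogonal_separation:
  fixes X Y :: complex
  assumes "norm X = 1" "norm Y = 1" "X \<bullet> Y = 0"
  shows "1 / 2 * (\<bar>a\<bar> + \<bar>b\<bar>) \<le> norm (a *\<^sub>R X - b *\<^sub>R Y)"
proof -
  have "X \<bullet> X = 1" "Y \<bullet> Y = 1" using assms by (simp_all flip: power2_norm_eq_inner)
  then have "(norm (a *\<^sub>R X - b *\<^sub>R Y))\<^sup>2 = a\<^sup>2 + b\<^sup>2"
    unfolding power2_norm_eq_inner using assms(3)
    by (simp add: inner_diff_left inner_diff_right inner_commute[of Y X] power2_eq_square)
  moreover have "(1 / 2 * (\<bar>a\<bar> + \<bar>b\<bar>))\<^sup>2 \<le> a\<^sup>2 + b\<^sup>2"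
  proof -
    have "(1 / 2 * (\<bar>a\<bar> + \<bar>b\<bar>))\<^sup>2 = (a\<^sup>2 + 2 * (\<bar>a\<bar> * \<bar>b\<bar>) + b\<^sup>2) / 4"
      by (simp add: power_mult_distrib power_divide power2_sum)
    moreover have "2 * (\<bar>a\<bar> * \<bar>b\<bar>) \<le> a\<^sup>2 + b\<^sup>2"
      using zero_le_power2[of "\<bar>a\<bar> - \<bar>b\<bar>"] by (simp add: power2_diff)
    ultimately show ?thesis using zero_le_power2[of a] zero_le_power2[of b] by argo
  qed
  ultimately have "(1 / 2 * (\<bar>a\<bar> + \<bar>b\<bar>))\<^sup>2 \<le> (norm (a *\<^sub>R X - b *\<^sub>R Y))\<^sup>2" by simp
  then show ?thesis by (rule power2_le_imp_le) simp
qed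

lemma lrefl_isometry:
  assumes "norm d = 1"
  shows "norm (lrefl d v) = norm v"
proof -
  have dd: "d \<bullet> d = 1" using assms by (simp flip: power2_norm_eq_inner)
  define k where "k = v \<bullet> d"
  have dv: "d \<bullet> v = k" by (simp add: k_def inner_commute)
  have "lrefl d v \<bullet> lrefl d v = v \<bullet> v"
    unfolding lrefl_def k_def[symmetric]
    by (simp add: inner_diff_left inner_diff_right dd dv k_def[symmetric])
  then show ?thesis by (simp add: norm_eq_sqrt_inner)
qed

lemma bounded_linear_lrefl: "bounded_linear (lrefl d)"
  unfolding lrefl_def[abs_def]
  by (intro bounded_linear_sub bounded_linear_ident bounded_linear_compose[OF bounded_linear_scaleR_left[of d]]
      bounded_linear_compose[OF bounded_linear_mult_right] bounded_linear_inner_left)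

lemma lrefl_perp: "v \<bullet> d = 0 \<Longrightarrow> lrefl d v = - v"
  by (simp add: lrefl_def)

text \<open>\<open>None\<close> stands for the curve itself and \<open>Some e\<close> for its fin at
  the end with parameter \<open>e\<close>. All pieces are parametrised by the original curve, so one
  density serves them all and the reflection enters only through points, normals and signs.\<close>

definition pieces :: "waveguide \<Rightarrow> curve \<Rightarrow> real option set" where
  "pieces W C = {None, Some 0, Some (len W C)}"

definition src_dom :: "waveguide \<Rightarrow> curve \<Rightarrow> real option \<Rightarrow> real set" where
  "src_dom W C p = (case p of None \<Rightarrow> {0..len W C} | Some e \<Rightarrow> fin_dom W C e)"

definition src_pt :: "waveguide \<Rightarrow> curve \<Rightarrow> real option \<Rightarrow> real \<Rightarrow> complex" where
  "src_pt W C p = (case p of None \<Rightarrow> gam W C | Some e \<Rightarrow> fin_pt W C e)"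

definition src_nml :: "waveguide \<Rightarrow> curve \<Rightarrow> real option \<Rightarrow> real \<Rightarrow> complex" where
  "src_nml W C p = (case p of None \<Rightarrow> nml W C | Some e \<Rightarrow> fin_nml W C e)"

definition src_sgn :: "curve \<Rightarrow> real option \<Rightarrow> complex" where
  "src_sgn C p = (case p of None \<Rightarrow> 1 | Some e \<Rightarrow> parity C)"

definition acc :: "waveguide \<Rightarrow> curve \<Rightarrow> real \<Rightarrow> complex" where
  "acc W C s = vector_derivative (tang W C) (at s within {0..len W C})"

lemma src_sgn_norm: "cmod (src_sgn C p) = 1"
  by (cases C; cases p) (auto simp: src_sgn_def)

section \<open>Contact and separation of the curves and their fins\<close>

locale waveguide_setting =
  fixes W :: waveguide
  assumes geometry: "waveguide_geometry W" and small: "small_fins W"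
begin

lemma geometry_parts:
  shows boundary: "frontier (region W) = (\<Union>C. arc_of W C)"
    and curves: "\<forall>C. 0 < len W C \<and> smooth_curve (len W C) (gam W C) \<and> inj_on (gam W C) {0..len W C} \<and>
        (\<forall>s\<in>{0..len W C}. norm (tang W C s) = 1)"
    and stars_disjoint: "\<forall>i. arc_of W (Star i) \<inter> arc_of W (Star (\<not> i)) = {}"
    and circs_disjoint: "\<forall>j. arc_of W (Circ j) \<inter> arc_of W (Circ (\<not> j)) = {}"
    and corners: "(\<Union>i. arc_of W (Star i)) \<inter> (\<Union>j. arc_of W (Circ j)) = (\<Union>i. endpts W (Star i))"
      "(\<Union>i. endpts W (Star i)) = (\<Union>j. endpts W (Circ j))"
    and right_angles: "\<forall>i j. \<forall>e\<in>{0, len W (Star i)}. \<forall>e'\<in>{0, len W (Circ j)}.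
        gam W (Star i) e = gam W (Circ j) e' \<longrightarrow> tang W (Star i) e \<bullet> tang W (Circ j) e' = 0"
  by (insert geometry, unfold waveguide_geometry_def, (elim conjE, assumption)+)

lemma len_pos: "0 < len W C"
  using curves by simp

lemma finite_pieces: "finite (pieces W C)"
  by (simp add: pieces_def)

lemma gam_inj: "inj_on (gam W C) {0..len W C}"
  using curves by simp

lemma tang_norm: "s \<in> {0..len W C} \<Longrightarrow> norm (tang W C s) = 1"
  using curves by simp

lemma nml_norm: "s \<in> {0..len W C} \<Longrightarrow> norm (nml W C s) = 1"
  using tang_norm[of s C] by (simp add: nml_def norm_mult)

lemma gam_derivs:
  assumes s: "s \<in> {0..len W C}"
  shows "(gam W C has_vector_derivative tang W C s) (at s within {0..len W C})"
    "(tang W C has_vector_derivative acc W C s) (at s within {0..len W C})"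
proof -
  have "smooth_curve (len W C) (gam W C)" using curves by simp
  then obtain D where D: "D 0 = gam W C"
    "\<And>m s. s \<in> {0..len W C} \<Longrightarrow> (D m has_vector_derivative D (Suc m) s) (at s within {0..len W C})"
    unfolding smooth_curve_def by blast
  have t: "tang W C s = D 1 s" if "s \<in> {0..len W C}" for s
    unfolding tang_def using D(2)[OF that, of 0] D(1)
    by (intro vector_derivative_within_closed_interval[OF len_pos that]) simp
  show "(gam W C has_vector_derivative tang W C s) (at s within {0..len W C})"
    using D(2)[OF s, of 0] D(1) t[OF s] by simp
  have "(tang W C has_vector_derivative D 2 s) (at s within {0..len W C})"
    by (rule has_vector_derivative_transform[OF s t]) (use D(2)[OF s, of 1] in \<open>simp_all add: numeral_2_eq_2\<close>)
  then show "(tang W C has_vector_derivative acc W C s) (at s within {0..len W C})"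
    unfolding acc_def using vector_derivative_within_closed_interval[OF len_pos s] by metis
qed

lemma acc_continuous: "continuous_on {0..len W C} (acc W C)"
proof -
  have "smooth_curve (len W C) (gam W C)" using curves by simp
  then obtain D where D: "D 0 = gam W C"
    "\<And>m s. s \<in> {0..len W C} \<Longrightarrow> (D m has_vector_derivative D (Suc m) s) (at s within {0..len W C})"
    unfolding smooth_curve_def by blast
  have t: "tang W C s = D 1 s" if "s \<in> {0..len W C}" for s
    unfolding tang_def using D(2)[OF that, of 0] D(1)
    by (intro vector_derivative_within_closed_interval[OF len_pos that]) simp
  have a: "D 2 s = acc W C s" if s: "s \<in> {0..len W C}" for s
  proof -
    have "(tang W C has_vector_derivative D 2 s) (at s within {0..len W C})"
      by (rule has_vector_derivative_transform[OF s t]) (use D(2)[OF s, of 1] in \<open>simp_all add: numeral_2_eq_2\<close>)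
    then show ?thesis
      unfolding acc_def using vector_derivative_within_closed_interval[OF len_pos s] by metis
  qed
  have "continuous_on {0..len W C} (D 2)"
    unfolding continuous_on_eq_continuous_within
    using D(2)[of _ 2] has_vector_derivative_continuous by blast
  then show ?thesis by (rule continuous_on_eq) (rule a)
qed

lemma gam_continuous: "continuous_on {0..len W C} (gam W C)"
  unfolding continuous_on_eq_continuous_within
  using gam_derivs(1) has_vector_derivative_continuous by blast

lemma tang_continuous: "continuous_on {0..len W C} (tang W C)"
  unfolding continuous_on_eq_continuous_within
  using gam_derivs(2) has_vector_derivative_continuous by blast

lemma nml_continuous: "continuous_on {0..len W C} (nml W C)"
  unfolding nml_def by (intro continuous_intros tang_continuous)

lemma acc_bounded: "\<exists>A\<ge>0. \<forall>s\<in>{0..len W C}. norm (acc W C s) \<le> A"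
proof -
  have "compact (acc W C ` {0..len W C})" by (intro compact_continuous_image acc_continuous) simp
  then obtain A where "\<And>s. s \<in> {0..len W C} \<Longrightarrow> norm (acc W C s) \<le> A"
    by (fastforce dest!: compact_imp_bounded simp: bounded_iff)
  then show ?thesis by (intro exI[of _ "\<bar>A\<bar>"]) (auto intro: order_trans[OF _ abs_ge_self])
qed

lemma gam_lipschitz:
  assumes "s \<in> {0..len W C}" "t \<in> {0..len W C}"
  shows "norm (gam W C s - gam W C t) \<le> \<bar>s - t\<bar>"
  using real_mvt_bound[of "{0..len W C}" "gam W C" "tang W C" 1 s t] gam_derivs(1) tang_norm assms by simp

lemma fin_dom_subset: "fin_dom W C e \<subseteq> {0..len W C}"
  by (auto simp: fin_dom_def)

lemma src_dom_subset: "src_dom W C p \<subseteq> {0..len W C}"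
  using fin_dom_subset by (auto simp: src_dom_def split: option.splits)

lemma closure_src_dom_subset: "closure (src_dom W C p) \<subseteq> {0..len W C}"
  using closure_mono[OF src_dom_subset[of C p]] by simp

lemma src_dom_measurable: "src_dom W C p \<in> sets lebesgue"
proof (cases p)
  case None
  then show ?thesis by (simp add: src_dom_def)
next
  case (Some e)
  have "continuous_on {0..len W C} (\<lambda>s. dist (gam W C s) (gam W C e))"
    by (intro continuous_intros gam_continuous)
  then obtain A where A: "open A" "A \<inter> {0..len W C} = (\<lambda>s. dist (gam W C s) (gam W C e)) -` {..<finR W} \<inter> {0..len W C}"
    unfolding continuous_on_open_invariant by (meson open_lessThan)
  have "fin_dom W C e = A \<inter> {0..len W C}" unfolding A(2) by (auto simp: fin_dom_def)
  moreover have "A \<in> sets lebesgue" using A(1) by (simp add: borel_open sets_completionI_sets)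
  then have "A \<inter> {0..len W C} \<in> sets lebesgue" by (intro sets.Int) auto
  ultimately show ?thesis using Some by (simp add: src_dom_def)
qed

lemma src_pt_continuous: "continuous_on {0..len W C} (src_pt W C p)"
proof (cases p)
  case None
  then show ?thesis using gam_continuous by (simp add: src_pt_def)
next
  case (Some e)
  then show ?thesis
    unfolding src_pt_def option.case fin_pt_def[abs_def] refl_pt_def
    by (simp, intro continuous_intros bounded_linear.continuous_on[OF bounded_linear_lrefl] gam_continuous)
qed

lemma src_nml_continuous: "continuous_on {0..len W C} (src_nml W C p)"
proof (cases p)
  case None
  then show ?thesis using nml_continuous by (simp add: src_nml_def)
next
  case (Some e)
  then show ?thesis
    unfolding src_nml_def option.case fin_nml_def[abs_def]
    by (simp, intro bounded_linear.continuous_on[OF bounded_linear_lrefl] nml_continuous)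
qed

lemma pieces_endpoint: "Some e \<in> pieces W C \<Longrightarrow> e \<in> {0, len W C}"
  by (auto simp: pieces_def)

lemma endpoint_in: "e \<in> {0, len W C} \<Longrightarrow> e \<in> {0..len W C}"
  using len_pos[of C] by auto

lemma src_nml_norm:
  assumes "p \<in> pieces W C" "t \<in> {0..len W C}"
  shows "norm (src_nml W C p t) = 1"
proof (cases p)
  case None
  then show ?thesis using nml_norm assms(2) by (simp add: src_nml_def)
next
  case (Some e)
  then have "e \<in> {0..len W C}" using assms(1) pieces_endpoint endpoint_in by blast
  then show ?thesis
    using nml_norm assms(2) Some by (simp add: src_nml_def fin_nml_def lrefl_isometry)
qed

lemma fin_pt_dist:
  assumes "e \<in> {0, len W C}"
  shows "norm (fin_pt W C e t - gam W C e) = norm (gam W C t - gam W C e)"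
  using nml_norm[OF endpoint_in[OF assms]] by (simp add: fin_pt_def refl_pt_def lrefl_isometry)

lemma src_pt_deriv:
  assumes p: "p \<in> pieces W C" and t: "t \<in> {0..len W C}"
  shows "(src_pt W C p has_vector_derivative
      (case p of None \<Rightarrow> tang W C t | Some e \<Rightarrow> lrefl (nml W C e) (tang W C t))) (at t within {0..len W C})"
proof (cases p)
  case None
  then show ?thesis using gam_derivs(1)[OF t] by (simp add: src_pt_def)
next
  case (Some e)
  have "((\<lambda>s. gam W C s - gam W C e) has_vector_derivative tang W C t) (at t within {0..len W C})"
    using has_vector_derivative_diff[OF gam_derivs(1)[OF t] has_vector_derivative_const[of "gam W C e"]] by simp
  from bounded_linear.has_vector_derivative[OF bounded_linear_lrefl this, of "nml W C e"]
  have "((\<lambda>s. gam W C e + lrefl (nml W C e) (gam W C s - gam W C e)) has_vector_derivative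
      0 + lrefl (nml W C e) (tang W C t)) (at t within {0..len W C})"
    by (rule has_vector_derivative_add[OF has_vector_derivative_const])
  then show ?thesis using Some by (simp add: src_pt_def fin_pt_def[abs_def] refl_pt_def)
qed

lemma tang_nml_perp: "tang W C e \<bullet> nml W C e = 0"
  by (simp add: nml_def inner_complex_def)

lemma lrefl_tang: "lrefl (nml W C e) (tang W C e) = - tang W C e"
  by (rule lrefl_perp[OF tang_nml_perp])

text \<open>A common point of the walls and the end caps is an end of some wall and of some end cap.
  Disjointness of the two walls and of the two caps identifies which ones, and injectivity of the
  parametrisation identifies the parameters.\<close>

lemma star_circ_touch:
  assumes s: "s \<in> {0..len W (Star i)}" and t: "t \<in> {0..len W (Circ j)}" and eq: "gam W (Star i) s = gam W (Circ j) t"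
  shows "s \<in> {0, len W (Star i)}" "t \<in> {0, len W (Circ j)}" "tang W (Star i) s \<bullet> tang W (Circ j) t = 0"
proof -
  note SC = corners(1) and E = corners(2) and S = stars_disjoint[rule_format] and C = circs_disjoint[rule_format]
    and T = right_angles[rule_format, of _ i _ j]
  have sub: "endpts W X \<subseteq> arc_of W X" for X
    using len_pos[of X] by (auto simp: endpts_def arc_of_def)
  let ?z = "gam W (Star i) s"
  have zs: "?z \<in> arc_of W (Star i)" using s by (auto simp: arc_of_def)
  have zc: "?z \<in> arc_of W (Circ j)" unfolding eq using t by (auto simp: arc_of_def)
  have "?z \<in> (\<Union>i. endpts W (Star i))" using zs zc SC by blast
  then obtain i' where i': "?z \<in> endpts W (Star i')" by blast
  have "i' = i"
  proof (rule ccontr)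
    assume "i' \<noteq> i"
    then have "i' = (\<not> i)" by auto
    then show False using S[of i] zs i' sub by blast
  qed
  with i' obtain e where e: "e \<in> {0, len W (Star i)}" "?z = gam W (Star i) e" by (auto simp: endpts_def)
  have "s = e" using inj_onD[OF gam_inj e(2) s] endpoint_in[OF e(1)] by simp
  then show s': "s \<in> {0, len W (Star i)}" using e(1) by simp
  have "?z \<in> (\<Union>j. endpts W (Circ j))" using zs zc SC E by blast
  then obtain j' where j': "?z \<in> endpts W (Circ j')" by blast
  have "j' = j"
  proof (rule ccontr)
    assume "j' \<noteq> j"
    then have "j' = (\<not> j)" by auto
    then show False using C[of j] zc j' sub by blast
  qed
  with j' obtain f where f: "f \<in> {0, len W (Circ j)}" "?z = gam W (Circ j) f" by (auto simp: endpts_def)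
  have "t = f" using inj_onD[OF gam_inj _ t endpoint_in[OF f(1)]] f(2) eq by simp
  then show t': "t \<in> {0, len W (Circ j)}" using f(1) by simp
  show "tang W (Star i) s \<bullet> tang W (Circ j) t = 0" by (rule T[OF s' t' eq])
qed

lemma curves_touch:
  assumes "T \<noteq> C" and s: "s \<in> {0..len W T}" and t: "t \<in> {0..len W C}" and eq: "gam W T s = gam W C t"
  shows "s \<in> {0, len W T} \<and> t \<in> {0, len W C} \<and> tang W T s \<bullet> tang W C t = 0"
proof -
  have S: "\<And>i. arc_of W (Star i) \<inter> arc_of W (Star (\<not> i)) = {}"
    and Ci: "\<And>j. arc_of W (Circ j) \<inter> arc_of W (Circ (\<not> j)) = {}"
    using stars_disjoint circs_disjoint by simp_all
  have in_arcs: "gam W T s \<in> arc_of W T" "gam W T s \<in> arc_of W C"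
    using s apply (simp add: arc_of_def)
    unfolding eq using t by (simp add: arc_of_def)
  show ?thesis
  proof (cases T; cases C)
    fix i i' assume c: "T = Star i" "C = Star i'"
    then have "i' = (\<not> i)" using \<open>T \<noteq> C\<close> by auto
    then show ?thesis using S[of i] in_arcs c by blast
  next
    fix i i' assume c: "T = Circ i" "C = Circ i'"
    then have "i' = (\<not> i)" using \<open>T \<noteq> C\<close> by auto
    then show ?thesis using Ci[of i] in_arcs c by blast
  next
    fix i j assume "T = Star i" "C = Circ j"
    then show ?thesis using star_circ_touch[of s i t j] s t eq by auto
  next
    fix i j assume "T = Circ j" "C = Star i"
    then show ?thesis using star_circ_touch[of t i s j] s t eq by (auto simp: inner_commute)
  qed
qed

text \<open>A fin meets the boundary only in its own corner. Reflection preserves the distance to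
  the corner, so the parameter of the contact is the end itself. The closure of the parameter set
  appears because a fin is open at its far end while the compactness arguments run over
  limits.\<close>

lemma piece_touch:
  assumes p: "p \<in> pieces W C" and TC: "T \<noteq> C \<or> p \<noteq> None"
    and s: "s \<in> {0..len W T}" and t: "t \<in> closure (src_dom W C p)" and eq: "gam W T s = src_pt W C p t"
  shows "s \<in> {0, len W T}" "t \<in> {0, len W C}" "gam W T s = gam W C t" "p \<noteq> None \<Longrightarrow> p = Some t"
    "T = C \<Longrightarrow> s = t" "T \<noteq> C \<Longrightarrow> tang W T s \<bullet> tang W C t = 0"
proof -
  have t': "t \<in> {0..len W C}" using t closure_src_dom_subset by blast
  have "s \<in> {0, len W T} \<and> t \<in> {0, len W C} \<and> gam W T s = gam W C t \<and> (p \<noteq> None \<longrightarrow> p = Some t) \<and>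
    (T = C \<longrightarrow> s = t) \<and> (T \<noteq> C \<longrightarrow> tang W T s \<bullet> tang W C t = 0)"
  proof (cases p)
    case None
    then have "gam W T s = gam W C t" "T \<noteq> C" using eq TC by (auto simp: src_pt_def)
    then show ?thesis using curves_touch[OF _ s t'] None by blast
  next
    case (Some e)
    have e: "e \<in> {0, len W C}" using p Some pieces_endpoint by blast
    note e' = endpoint_in[OF e]
    have "closure (fin_pt W C e ` fin_dom W C e) \<inter> frontier (region W) = {gam W C e}"
      using small e unfolding small_fins_def by blast
    moreover have "gam W T s \<in> frontier (region W)"
    proof -
      have "gam W T s \<in> arc_of W T" using s by (simp add: arc_of_def)
      then show ?thesis unfolding boundary by blast
    qed
    moreover have "fin_pt W C e t \<in> closure (fin_pt W C e ` fin_dom W C e)"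
    proof -
      have "continuous_on (closure (fin_dom W C e)) (fin_pt W C e)"
        using continuous_on_subset[OF src_pt_continuous[of C "Some e"] closure_src_dom_subset[of C "Some e"]]
        by (simp add: src_pt_def src_dom_def)
      then have "fin_pt W C e ` closure (fin_dom W C e) \<subseteq> closure (fin_pt W C e ` fin_dom W C e)"
        by (rule image_closure_subset) (auto intro: closure_subset[THEN subsetD])
      then show ?thesis using t Some by (auto simp: src_dom_def)
    qed
    ultimately have g: "gam W T s = gam W C e" "fin_pt W C e t = gam W C e"
      using eq Some by (auto simp: src_pt_def)
    then have "norm (gam W C t - gam W C e) = 0" using fin_pt_dist[OF e, of t] by simp
    then have te: "t = e" using inj_onD[OF gam_inj _ t' e'] by simp
    show ?thesis
    proof (cases "T = C")
      case True
      then have "s = e" using inj_onD[OF gam_inj, of C s e] g(1) s e' by simp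
      then show ?thesis using True te e g Some by simp
    next
      case False
      then show ?thesis using curves_touch[OF False s t'] g te Some by simp
    qed
  qed
  then show "s \<in> {0, len W T}" "t \<in> {0, len W C}" "gam W T s = gam W C t" "p \<noteq> None \<Longrightarrow> p = Some t"
    "T = C \<Longrightarrow> s = t" "T \<noteq> C \<Longrightarrow> tang W T s \<bullet> tang W C t = 0" by blast+
qed

text \<open>At a contact the directions are orthogonal if the curves differ. If a curve meets its
  own fin, reflection has reversed the tangent there, so target and source run away from each other
  along one line.\<close>

lemma local_piece_separation:
  assumes p: "p \<in> pieces W C" and TC: "T \<noteq> C \<or> p \<noteq> None"
    and s0: "s0 \<in> {0..len W T}" and t0: "t0 \<in> closure (src_dom W C p)" and eq: "gam W T s0 = src_pt W C p t0"
  shows "\<exists>d>0. \<forall>s\<in>{0..len W T}. \<forall>t\<in>{0..len W C}. \<bar>s - s0\<bar> < d \<longrightarrow> \<bar>t - t0\<bar> < d \<longrightarrow>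
    1 / 4 * (\<bar>s - s0\<bar> + \<bar>t - t0\<bar>) \<le> dist (gam W T s) (src_pt W C p t)"
proof -
  note touch = piece_touch[OF p TC s0 t0 eq]
  have t0': "t0 \<in> {0..len W C}" using t0 closure_src_dom_subset by blast
  define Y where "Y = (case p of None \<Rightarrow> tang W C t0 | Some e \<Rightarrow> lrefl (nml W C e) (tang W C t0))"
  have Y: "Y = (if p = None then tang W C t0 else - tang W C t0)"
    using touch(4) lrefl_tang[of C t0] by (cases p) (auto simp: Y_def)
  have lin: "1 / 2 * (\<bar>s - s0\<bar> + \<bar>t - t0\<bar>) \<le> norm ((s - s0) *\<^sub>R tang W T s0 - (t - t0) *\<^sub>R Y)"
    if "s \<in> {0..len W T}" "t \<in> {0..len W C}" for s t
  proof (cases "T = C")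
    case False
    show ?thesis
      by (rule orthogonal_separation)
        (use Y touch(6)[OF False] tang_norm[OF s0] tang_norm[OF t0'] in auto)
  next
    case True
    then have "p \<noteq> None" using TC by simp
    then have "Y = - tang W C t0" unfolding Y by (simp only: if_False)
    moreover have st: "s0 = t0" by (rule touch(5)[OF True])
    ultimately have "norm ((s - s0) *\<^sub>R tang W T s0 - (t - t0) *\<^sub>R Y) = norm (((s - t0) + (t - t0)) *\<^sub>R tang W C t0)"
      unfolding True by (simp only: scaleR_minus_right diff_minus_eq_add scaleR_add_left)
    also have "\<dots> = \<bar>(s - t0) + (t - t0)\<bar>" unfolding norm_scaleR tang_norm[OF t0'] by simp
    \<comment> \<open>The contact is at an end of the parameter interval, so both increments have
      the same sign and nothing cancels.\<close>
    also have "\<dots> = \<bar>s - s0\<bar> + \<bar>t - t0\<bar>"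
    proof -
      have "t0 = 0 \<or> t0 = len W C" using touch(2) by simp
      moreover have "0 \<le> s" "s \<le> len W C" "0 \<le> t" "t \<le> len W C" using that True by auto
      ultimately show ?thesis unfolding st by (elim disjE) (simp_all add: abs_if)
    qed
    finally show ?thesis by simp
  qed
  have "\<exists>d>0. \<forall>s\<in>{0..len W T}. \<forall>t\<in>{0..len W C}. \<bar>s - s0\<bar> < d \<longrightarrow> \<bar>t - t0\<bar> < d \<longrightarrow>
    (1 / 2) / 2 * (\<bar>s - s0\<bar> + \<bar>t - t0\<bar>) \<le> dist (gam W T s) (src_pt W C p t)"
    by (rule local_separation[OF gam_derivs(1)[OF s0] src_pt_deriv[OF p t0', folded Y_def] eq _ lin]) auto
  then show ?thesis by simp
qed

lemma edge_le_dist_endpoint: "e \<in> {0, L} \<Longrightarrow> s \<in> {0..L} \<Longrightarrow> edge L s \<le> \<bar>s - e\<bar>"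
  by (auto simp: edge_def)

lemma edge_le_len: "s \<in> {0..L} \<Longrightarrow> edge L s \<le> L"
  by (auto simp: edge_def)

text \<open>Near a contact the linearisation gives a distance comparable to the parameter
  increments, which dominate the distances to the nearest ends; elsewhere the distance is locally
  bounded below. Compactness makes the constant uniform.\<close>

lemma piece_separation:
  assumes p: "p \<in> pieces W C" and TC: "T \<noteq> C \<or> p \<noteq> None"
  shows "\<exists>c>0. \<forall>s\<in>{0..len W T}. \<forall>t\<in>src_dom W C p.
    c * (edge (len W T) s + edge (len W C) t) \<le> dist (gam W T s) (src_pt W C p t)"
proof -
  let ?m = "\<lambda>(s, t). edge (len W T) s + edge (len W C) t"
  let ?f = "\<lambda>(s, t). dist (gam W T s) (src_pt W C p t)"
  let ?K = "{0..len W T} \<times> closure (src_dom W C p)"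
  let ?D = "{0..len W T} \<times> src_dom W C p"
  have "bounded (src_dom W C p)" by (rule bounded_subset[OF bounded_closed_interval src_dom_subset])
  then have "compact ?K" by (intro compact_Times) (auto simp: compact_closure)
  moreover have "?D \<subseteq> ?K" using closure_subset by auto
  moreover have "0 \<le> ?m z" if "z \<in> ?D" for z
    using that src_dom_subset[of C p] by (auto intro!: add_nonneg_nonneg edge_nonneg)
  moreover have "\<exists>U c. open U \<and> z0 \<in> U \<and> 0 < c \<and> (\<forall>z\<in>U \<inter> ?D. c * ?m z \<le> ?f z)" if "z0 \<in> ?K" for z0
  proof -
    obtain s0 t0 where z0: "z0 = (s0, t0)" by (cases z0)
    have s0: "s0 \<in> {0..len W T}" and t0: "t0 \<in> closure (src_dom W C p)" using that z0 by auto
    show ?thesis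
    proof (cases "gam W T s0 = src_pt W C p t0")
      case True
      note touch = piece_touch[OF p TC s0 t0 True]
      obtain d where d: "d > 0" "\<And>s t. s \<in> {0..len W T} \<Longrightarrow> t \<in> {0..len W C} \<Longrightarrow> \<bar>s - s0\<bar> < d \<Longrightarrow> \<bar>t - t0\<bar> < d \<Longrightarrow>
          1 / 4 * (\<bar>s - s0\<bar> + \<bar>t - t0\<bar>) \<le> dist (gam W T s) (src_pt W C p t)"
        using local_piece_separation[OF p TC s0 t0 True] by blast
      have "1 / 4 * ?m z \<le> ?f z" if "z \<in> (ball s0 d \<times> ball t0 d) \<inter> ?D" for z
      proof -
        obtain s t where z: "z = (s, t)" by (cases z)
        have st: "s \<in> {0..len W T}" "t \<in> {0..len W C}" "\<bar>s - s0\<bar> < d" "\<bar>t - t0\<bar> < d"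
          using that src_dom_subset[of C p] by (auto simp: z dist_real_def abs_minus_commute)
        have "1 / 4 * ?m z \<le> 1 / 4 * (\<bar>s - s0\<bar> + \<bar>t - t0\<bar>)"
          using edge_le_dist_endpoint[OF touch(1) st(1)] edge_le_dist_endpoint[OF touch(2) st(2)] by (simp add: z)
        also have "\<dots> \<le> ?f z" using d(2)[OF st] by (simp add: z)
        finally show ?thesis .
      qed
      then show ?thesis using d(1) z0
        by (intro exI[of _ "ball s0 d \<times> ball t0 d"] exI[of _ "1 / 4"]) (auto intro: open_Times)
    next
      case False
      define r where "r = dist (gam W T s0) (src_pt W C p t0)"
      have r: "r > 0" using False by (simp add: r_def)
      have "continuous_on ({0..len W T} \<times> {0..len W C}) ?f"
        unfolding case_prod_unfold
        by (intro continuous_on_dist continuous_on_compose2[OF gam_continuous] continuous_on_compose2[OF src_pt_continuous] continuous_intros) auto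
      then obtain U where U: "open U" "U \<inter> ({0..len W T} \<times> {0..len W C}) = ?f -` {r / 2<..} \<inter> ({0..len W T} \<times> {0..len W C})"
        unfolding continuous_on_open_invariant by (meson open_greaterThan)
      have "z0 \<in> ?f -` {r / 2<..} \<inter> ({0..len W T} \<times> {0..len W C})"
        using r s0 t0 closure_src_dom_subset[of C p] by (auto simp: z0 r_def)
      then have z0U: "z0 \<in> U" using U(2) by blast
      define M where "M = len W T + len W C"
      have M: "M > 0" using len_pos[of T] len_pos[of C] by (simp add: M_def)
      \<comment> \<open>Away from contacts the distance is at least \<open>r / 2\<close>, while the
        weights add up to at most \<open>M\<close>; this fixes the constant.\<close>
      have "r / 2 / M * ?m z \<le> ?f z" if z: "z \<in> U \<inter> ?D" for z
      proof -
        have "z \<in> ?f -` {r / 2<..}" using U(2) z src_dom_subset[of C p] by blast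
        then have "r / 2 \<le> ?f z" by auto
        moreover have "?m z \<le> M"
          using z src_dom_subset[of C p] by (auto simp: M_def intro!: add_mono edge_le_len)
        then have "r / 2 / M * ?m z \<le> r / 2 / M * M" using r M by (intro mult_left_mono) auto
        moreover have "r / 2 / M * M = r / 2" using M by simp
        ultimately show ?thesis by linarith
      qed
      then show ?thesis using U(1) z0U r M by (intro exI[of _ U] exI[of _ "r / 2 / M"]) auto
    qed
  qed
  ultimately have "\<exists>c>0. \<forall>z\<in>?D. c * ?m z \<le> ?f z" by (rule compact_local_to_global)
  then show ?thesis by auto
qed

text \<open>Chord-arc bound. Near the diagonal the tangent stays within 1/2 of a fixed unit vector,
  so the chord is at least half the arc; off the diagonal injectivity gives a positive
  distance.\<close>

lemma self_separation:
  "\<exists>c>0. \<forall>s\<in>{0..len W C}. \<forall>t\<in>{0..len W C}. c * \<bar>s - t\<bar> \<le> dist (gam W C s) (gam W C t)"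
proof -
  let ?I = "{0..len W C}"
  let ?m = "\<lambda>(s, t). \<bar>s - t\<bar>" and ?f = "\<lambda>(s, t). dist (gam W C s) (gam W C t)"
  have "\<exists>U c. open U \<and> z0 \<in> U \<and> 0 < c \<and> (\<forall>z\<in>U \<inter> (?I \<times> ?I). c * ?m z \<le> ?f z)" if "z0 \<in> ?I \<times> ?I" for z0
  proof -
    obtain s0 t0 where z0: "z0 = (s0, t0)" by (cases z0)
    have s0: "s0 \<in> ?I" and t0: "t0 \<in> ?I" using that z0 by auto
    show ?thesis
    proof (cases "s0 = t0")
      case True
      have "continuous (at s0 within ?I) (tang W C)"
        using tang_continuous s0 by (simp add: continuous_on_eq_continuous_within)
      then obtain d where d: "d > 0" "\<And>s. s \<in> ?I \<Longrightarrow> \<bar>s - s0\<bar> < d \<Longrightarrow> norm (tang W C s - tang W C s0) < 1 / 2"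
        unfolding continuous_within_eps_delta dist_real_def dist_norm by (metis half_gt_zero zero_less_one)
      let ?X = "?I \<inter> ball s0 d"
      have b: "norm (gam W C s - gam W C t - (s - t) *\<^sub>R tang W C s0) \<le> 1 / 2 * \<bar>s - t\<bar>" if "s \<in> ?X" "t \<in> ?X" for s t
      proof -
        have "norm ((gam W C s - s *\<^sub>R tang W C s0) - (gam W C t - t *\<^sub>R tang W C s0)) \<le> 1 / 2 * \<bar>s - t\<bar>"
        proof (rule real_mvt_bound[of ?X])
          show "convex ?X" by (intro convex_Int) auto
          show "((\<lambda>s. gam W C s - s *\<^sub>R tang W C s0) has_vector_derivative tang W C x - tang W C s0) (at x within ?X)"
            if "x \<in> ?X" for x
          proof -
            have "(gam W C has_vector_derivative tang W C x) (at x within ?X)"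
              by (rule has_vector_derivative_within_subset[OF gam_derivs(1)]) (use that in auto)
            moreover have "((\<lambda>s. s *\<^sub>R tang W C s0) has_vector_derivative tang W C s0) (at x within ?X)"
              using has_vector_derivative_scaleR[OF DERIV_ident has_vector_derivative_const] by simp
            ultimately show ?thesis by (rule has_vector_derivative_diff)
          qed
          show "norm (tang W C x - tang W C s0) \<le> 1 / 2" if "x \<in> ?X" for x
            using d(2)[of x] that by (simp add: dist_real_def abs_minus_commute)
        qed (use that in auto)
        then show ?thesis by (simp add: scaleR_diff_left algebra_simps)
      qed
      have "1 / 2 * ?m z \<le> ?f z" if "z \<in> (ball s0 d \<times> ball t0 d) \<inter> (?I \<times> ?I)" for z
      proof -
        obtain s t where z: "z = (s, t)" by (cases z)
        have "norm ((s - t) *\<^sub>R tang W C s0) \<le> norm (gam W C s - gam W C t) + norm (gam W C s - gam W C t - (s - t) *\<^sub>R tang W C s0)"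
          using norm_triangle_ineq4[of "gam W C s - gam W C t" "gam W C s - gam W C t - (s - t) *\<^sub>R tang W C s0"] by simp
        then have "\<bar>s - t\<bar> \<le> dist (gam W C s) (gam W C t) + 1 / 2 * \<bar>s - t\<bar>"
          using b[of s t] that True tang_norm[OF s0] by (simp add: z dist_norm)
        then show ?thesis by (simp add: z)
      qed
      then show ?thesis using d(1) z0
        by (intro exI[of _ "ball s0 d \<times> ball t0 d"] exI[of _ "1 / 2"]) (auto intro: open_Times)
    next
      case False
      define r where "r = dist (gam W C s0) (gam W C t0)"
      have r: "r > 0" using inj_onD[OF gam_inj _ s0 t0] False by (auto simp: r_def)
      have "continuous_on (?I \<times> ?I) ?f"
        unfolding case_prod_unfold
        by (intro continuous_on_dist continuous_on_compose2[OF gam_continuous] continuous_intros) auto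
      then obtain U where U: "open U" "U \<inter> (?I \<times> ?I) = ?f -` {r / 2<..} \<inter> (?I \<times> ?I)"
        unfolding continuous_on_open_invariant by (meson open_greaterThan)
      have "z0 \<in> ?f -` {r / 2<..} \<inter> (?I \<times> ?I)" using r s0 t0 by (auto simp: z0 r_def)
      then have z0U: "z0 \<in> U" using U(2) by blast
      have "r / 2 / len W C * ?m z \<le> ?f z" if z: "z \<in> U \<inter> (?I \<times> ?I)" for z
      proof -
        have "z \<in> ?f -` {r / 2<..}" using U(2) z by blast
        then have "r / 2 \<le> ?f z" by auto
        moreover have "?m z \<le> len W C" using z by auto
        then have "r / 2 / len W C * ?m z \<le> r / 2 / len W C * len W C"
          using r len_pos[of C] by (intro mult_left_mono) auto
        moreover have "r / 2 / len W C * len W C = r / 2" using len_pos[of C] by simp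
        ultimately show ?thesis by linarith
      qed
      then show ?thesis using U(1) z0U r len_pos[of C] by (intro exI[of _ U] exI[of _ "r / 2 / len W C"]) auto
    qed
  qed
  from compact_local_to_global[OF compact_Times[OF compact_Icc compact_Icc] subset_refl _ this]
  have "\<exists>c>0. \<forall>z\<in>?I \<times> ?I. c * ?m z \<le> ?f z" by auto
  then show ?thesis by auto
qed

text \<open>It confines all squared distances to one bounded range, where the constant of
  \<open>profile_bound\<close> is uniform.\<close>

lemma piece_dist_bounded:
  "\<exists>R>0. \<forall>T C. \<forall>p\<in>pieces W C. \<forall>s\<in>{0..len W T}. \<forall>t\<in>{0..len W C}. dist (gam W T s) (src_pt W C p t) \<le> R"
proof -
  have b: "bounded (gam W C ` {0..len W C})" for C
    by (intro compact_imp_bounded compact_continuous_image gam_continuous compact_Icc)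
  have c: "bounded (src_pt W C p ` {0..len W C})" for C p
    by (intro compact_imp_bounded compact_continuous_image src_pt_continuous compact_Icc)
  have fin: "finite (UNIV :: curve set)"
  proof -
    have "x \<in> range Star \<union> range Circ" for x :: curve by (cases x) auto
    then have "(UNIV :: curve set) \<subseteq> range Star \<union> range Circ" by blast
    then show ?thesis by (rule finite_subset) simp
  qed
  let ?S = "(\<Union>C. gam W C ` {0..len W C}) \<union> (\<Union>C. \<Union>p\<in>pieces W C. src_pt W C p ` {0..len W C})"
  have "bounded (\<Union>C. gam W C ` {0..len W C})" by (rule bounded_UN[OF fin]) (simp add: b)
  moreover have "bounded (\<Union>C. \<Union>p\<in>pieces W C. src_pt W C p ` {0..len W C})"
    by (rule bounded_UN[OF fin], rule ballI, rule bounded_UN[OF finite_pieces]) (simp add: c)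
  ultimately have "bounded ?S" by (simp only: bounded_Un)
  then have "\<exists>R. \<forall>z\<in>?S. norm z \<le> R" by (simp only: bounded_iff)
  then obtain R where R: "\<forall>z\<in>?S. norm z \<le> R" by (rule exE)
  have "dist (gam W T s) (src_pt W C p t) \<le> 2 * \<bar>R\<bar> + 1"
    if "p \<in> pieces W C" "s \<in> {0..len W T}" "t \<in> {0..len W C}" for T C p s t
  proof -
    have 1: "gam W T s \<in> ?S" by (rule UnI1, rule UN_I[OF UNIV_I], rule imageI, rule that(2))
    have 2: "src_pt W C p t \<in> ?S"
      by (rule UnI2, rule UN_I[OF UNIV_I], rule UN_I[OF that(1)], rule imageI, rule that(3))
    show ?thesis
      using norm_triangle_ineq4[of "gam W T s" "src_pt W C p t"] bspec[OF R 1] bspec[OF R 2]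
      by (simp add: dist_norm)
  qed
  then show ?thesis by (intro exI[of _ "2 * \<bar>R\<bar> + 1"]) auto
qed

end

section \<open>Classes of bounded operators\<close>

text \<open>Continuity inside the interval is included because the surface Green operator is
  differentiated classically, so its argument has to be continuous there.\<close>

definition L2_bounded :: "real \<Rightarrow> (real \<Rightarrow> complex) \<Rightarrow> real \<Rightarrow> bool" where
  "L2_bounded L f N \<longleftrightarrow> 0 \<le> N \<and> continuous_on {0<..<L} f \<and> f \<in> L2_carr L \<and> L2_sq L f \<le> N\<^sup>2"

lemma L2_bounded_scale: "L2_bounded L f N \<Longrightarrow> L2_bounded L (\<lambda>s. c * f s) (cmod c * N)"
  unfolding L2_bounded_def
  by (auto simp: L2_scale power_mult_distrib intro!: continuous_intros mult_left_mono)

lemma L2_bounded_add: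
  assumes "L2_bounded L f N" "L2_bounded L g N'"
  shows "L2_bounded L (\<lambda>s. f s + g s) (2 * (N + N'))"
proof -
  have f: "0 \<le> N" "continuous_on {0<..<L} f" "f \<in> L2_carr L" "L2_sq L f \<le> N\<^sup>2"
    and g: "0 \<le> N'" "continuous_on {0<..<L} g" "g \<in> L2_carr L" "L2_sq L g \<le> N'\<^sup>2"
    using assms by (simp_all add: L2_bounded_def)
  have "L2_sq L (\<lambda>s. f s + g s) \<le> (2 * (N + N'))\<^sup>2"
    using L2_add(2)[OF f(3) g(3)] sq_sum_le[OF f(4) g(4) f(1) g(1)] by linarith
  moreover have "continuous_on {0<..<L} (\<lambda>s. f s + g s)" by (intro continuous_on_add f g)
  ultimately show ?thesis
    using f(1) g(1) L2_add(1)[OF f(3) g(3)] by (simp add: L2_bounded_def)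
qed

lemma L2_bounded_cong:
  assumes "L2_bounded L f N" "\<And>s. s \<in> {0<..<L} \<Longrightarrow> g s = f s"
  shows "L2_bounded L g N"
proof -
  have "continuous_on {0<..<L} g"
    using assms continuous_on_eq[of "{0<..<L}" f g] by (simp add: L2_bounded_def)
  then show ?thesis
    using assms L2_cong_interior[of f L g] by (simp add: L2_bounded_def)
qed

lemma H2_bounded_imp_L2_bounded:
  assumes "H2_bounded L u N"
  shows "L2_bounded L u N"
proof -
  from assms obtain v w where *: "0 \<le> N" "continuous_on {0..L} u" "u \<in> L2_carr L" "L2_sq L u \<le> N\<^sup>2"
    by (rule H2_boundedE) (rule that)
  have "continuous_on {0<..<L} u" by (rule continuous_on_subset[OF *(2)]) auto
  then show ?thesis using * by (simp add: L2_bounded_def)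
qed

type_synonym oper = "(real \<Rightarrow> complex) \<Rightarrow> real \<Rightarrow> complex"

definition L2_to_L2 :: "real \<Rightarrow> real \<Rightarrow> oper \<Rightarrow> bool" where
  "L2_to_L2 M L Q \<longleftrightarrow> (\<exists>C\<ge>0. \<forall>\<sigma>\<in>L2_carr M. L2_bounded L (Q \<sigma>) (C * sqrt (L2_sq M \<sigma>)))"

definition L2_to_H2 :: "real \<Rightarrow> real \<Rightarrow> oper \<Rightarrow> bool" where
  "L2_to_H2 M L Q \<longleftrightarrow> (\<exists>C\<ge>0. \<forall>\<sigma>\<in>L2_carr M. H2_bounded L (Q \<sigma>) (C * sqrt (L2_sq M \<sigma>)))"

lemma L2_to_L2_scale: "L2_to_L2 M L Q \<Longrightarrow> L2_to_L2 M L (\<lambda>\<sigma> s. c * Q \<sigma> s)"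
  unfolding L2_to_L2_def
proof (elim exE conjE)
  fix C assume C: "0 \<le> C" "\<forall>\<sigma>\<in>L2_carr M. L2_bounded L (Q \<sigma>) (C * sqrt (L2_sq M \<sigma>))"
  show "\<exists>C\<ge>0. \<forall>\<sigma>\<in>L2_carr M. L2_bounded L (\<lambda>s. c * Q \<sigma> s) (C * sqrt (L2_sq M \<sigma>))"
    using C L2_bounded_scale[of L _ _ c]
    by (intro exI[of _ "cmod c * C"]) (auto simp: mult.assoc)
qed

lemma L2_to_H2_scale: "L2_to_H2 M L Q \<Longrightarrow> L2_to_H2 M L (\<lambda>\<sigma> s. c * Q \<sigma> s)"
  unfolding L2_to_H2_def
proof (elim exE conjE)
  fix C assume C: "0 \<le> C" "\<forall>\<sigma>\<in>L2_carr M. H2_bounded L (Q \<sigma>) (C * sqrt (L2_sq M \<sigma>))"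
  show "\<exists>C\<ge>0. \<forall>\<sigma>\<in>L2_carr M. H2_bounded L (\<lambda>s. c * Q \<sigma> s) (C * sqrt (L2_sq M \<sigma>))"
    using C H2_bounded_scale[of L _ _ c]
    by (intro exI[of _ "cmod c * C"]) (auto simp: mult.assoc)
qed

lemma L2_to_L2_add: "L2_to_L2 M L Q \<Longrightarrow> L2_to_L2 M L Q' \<Longrightarrow> L2_to_L2 M L (\<lambda>\<sigma> s. Q \<sigma> s + Q' \<sigma> s)"
  unfolding L2_to_L2_def
proof (elim exE conjE)
  fix C C' assume C: "0 \<le> C" "\<forall>\<sigma>\<in>L2_carr M. L2_bounded L (Q \<sigma>) (C * sqrt (L2_sq M \<sigma>))"
    "0 \<le> C'" "\<forall>\<sigma>\<in>L2_carr M. L2_bounded L (Q' \<sigma>) (C' * sqrt (L2_sq M \<sigma>))"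
  have "L2_bounded L (\<lambda>s. Q \<sigma> s + Q' \<sigma> s) (2 * (C + C') * sqrt (L2_sq M \<sigma>))" if "\<sigma> \<in> L2_carr M" for \<sigma>
    using L2_bounded_add[OF C(2)[rule_format, OF that] C(4)[rule_format, OF that]]
    by (simp only: distrib_right mult.assoc distrib_left)
  then show "\<exists>C\<ge>0. \<forall>\<sigma>\<in>L2_carr M. L2_bounded L (\<lambda>s. Q \<sigma> s + Q' \<sigma> s) (C * sqrt (L2_sq M \<sigma>))"
    using C(1,3) by (intro exI[of _ "2 * (C + C')"]) auto
qed

lemma L2_to_H2_add: "L2_to_H2 M L Q \<Longrightarrow> L2_to_H2 M L Q' \<Longrightarrow> L2_to_H2 M L (\<lambda>\<sigma> s. Q \<sigma> s + Q' \<sigma> s)"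
  unfolding L2_to_H2_def
proof (elim exE conjE)
  fix C C' assume C: "0 \<le> C" "\<forall>\<sigma>\<in>L2_carr M. H2_bounded L (Q \<sigma>) (C * sqrt (L2_sq M \<sigma>))"
    "0 \<le> C'" "\<forall>\<sigma>\<in>L2_carr M. H2_bounded L (Q' \<sigma>) (C' * sqrt (L2_sq M \<sigma>))"
  have "H2_bounded L (\<lambda>s. Q \<sigma> s + Q' \<sigma> s) (2 * (C + C') * sqrt (L2_sq M \<sigma>))" if "\<sigma> \<in> L2_carr M" for \<sigma>
    using H2_bounded_add[OF C(2)[rule_format, OF that] C(4)[rule_format, OF that]]
    by (simp only: distrib_right mult.assoc distrib_left)
  then show "\<exists>C\<ge>0. \<forall>\<sigma>\<in>L2_carr M. H2_bounded L (\<lambda>s. Q \<sigma> s + Q' \<sigma> s) (C * sqrt (L2_sq M \<sigma>))"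
    using C(1,3) by (intro exI[of _ "2 * (C + C')"]) auto
qed

lemma L2_to_L2_cong:
  assumes "L2_to_L2 M L Q" "\<And>\<sigma> s. \<sigma> \<in> L2_carr M \<Longrightarrow> s \<in> {0<..<L} \<Longrightarrow> Q' \<sigma> s = Q \<sigma> s"
  shows "L2_to_L2 M L Q'"
  using assms L2_bounded_cong unfolding L2_to_L2_def by metis

lemma L2_to_H2_cong:
  assumes "L2_to_H2 M L Q" "0 < L" "\<And>\<sigma> s. \<sigma> \<in> L2_carr M \<Longrightarrow> s \<in> {0..L} \<Longrightarrow> Q' \<sigma> s = Q \<sigma> s"
  shows "L2_to_H2 M L Q'"
  using assms H2_bounded_cong unfolding L2_to_H2_def by metis

lemma L2_to_H2_imp_L2_to_L2: "L2_to_H2 M L Q \<Longrightarrow> L2_to_L2 M L Q"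
  using H2_bounded_imp_L2_bounded unfolding L2_to_L2_def L2_to_H2_def by blast

lemma L2_to_H2_zero: "L2_to_H2 M L (\<lambda>\<sigma> s. 0)"
  unfolding L2_to_H2_def using H2_bounded_zero by (intro exI[of _ 0]) simp

lemma L2_to_H2_sum:
  assumes "finite P" "\<And>p. p \<in> P \<Longrightarrow> L2_to_H2 M L (Q p)"
  shows "L2_to_H2 M L (\<lambda>\<sigma> s. \<Sum>p\<in>P. Q p \<sigma> s)"
  using assms by (induction P rule: finite_induct) (auto intro: L2_to_H2_zero L2_to_H2_add)

lemma L2_to_L2_sum:
  assumes "finite P" "\<And>p. p \<in> P \<Longrightarrow> L2_to_L2 M L (Q p)"
  shows "L2_to_L2 M L (\<lambda>\<sigma> s. \<Sum>p\<in>P. Q p \<sigma> s)"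
  using assms
  by (induction P rule: finite_induct) (auto intro: L2_to_H2_imp_L2_to_L2[OF L2_to_H2_zero] L2_to_L2_add)

lemma L2_to_H2_green:
  assumes L: "0 < L" and kG: "kG \<noteq> 0" and green: "neumann_green kG L g" and Q: "L2_to_L2 M L Q"
  shows "L2_to_H2 M L (\<lambda>\<sigma> s. \<integral>s'. g s s' * Q \<sigma> s' \<partial>lebesgue_on {0..L})"
proof -
  obtain C where C: "0 \<le> C" "\<And>\<phi>. \<phi> \<in> L2_carr L \<Longrightarrow> continuous_on {0<..<L} \<phi> \<Longrightarrow>
      H2_bounded L (\<lambda>s. \<integral>s'. g s s' * \<phi> s' \<partial>lebesgue_on {0..L}) (C * sqrt (L2_sq L \<phi>))"
    using green_operator_bounded[OF L kG green] by blast
  obtain D where D: "0 \<le> D" "\<And>\<sigma>. \<sigma> \<in> L2_carr M \<Longrightarrow> L2_bounded L (Q \<sigma>) (D * sqrt (L2_sq M \<sigma>))"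
    using Q unfolding L2_to_L2_def by blast
  have "H2_bounded L (\<lambda>s. \<integral>s'. g s s' * Q \<sigma> s' \<partial>lebesgue_on {0..L}) (C * D * sqrt (L2_sq M \<sigma>))"
    if \<sigma>: "\<sigma> \<in> L2_carr M" for \<sigma>
  proof -
    have b: "0 \<le> D * sqrt (L2_sq M \<sigma>)" "continuous_on {0<..<L} (Q \<sigma>)" "Q \<sigma> \<in> L2_carr L"
      "L2_sq L (Q \<sigma>) \<le> (D * sqrt (L2_sq M \<sigma>))\<^sup>2"
      using D(2)[OF \<sigma>] by (simp_all add: L2_bounded_def)
    have "sqrt (L2_sq L (Q \<sigma>)) \<le> D * sqrt (L2_sq M \<sigma>)" by (rule real_le_lsqrt[OF b(1,4)])
    then have "C * sqrt (L2_sq L (Q \<sigma>)) \<le> C * (D * sqrt (L2_sq M \<sigma>))" by (rule mult_left_mono[OF _ C(1)])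
    then show ?thesis using H2_bounded_mono[OF C(2)[OF b(3,2)]] by (simp add: mult.assoc)
  qed
  then show ?thesis unfolding L2_to_H2_def using C(1) D(1) by (intro exI[of _ "C * D"]) auto
qed

section \<open>Integral operators with bounded kernels\<close>

lemma lebesgue_on_subset:
  fixes A B :: "real set"
  assumes "A \<in> sets lebesgue" "B \<in> sets lebesgue" "B \<subseteq> A"
  shows "lebesgue_on B = restrict_space (lebesgue_on A) B"
  using assms by (subst restrict_restrict_space) (auto simp: Int_absorb1)

lemma integrable_lebesgue_on_subset:
  fixes f :: "real \<Rightarrow> complex"
  assumes "integrable (lebesgue_on A) f" "A \<in> sets lebesgue" "B \<in> sets lebesgue" "B \<subseteq> A"
  shows "integrable (lebesgue_on B) f"
proof -
  have s: "B \<inter> space (lebesgue_on A) \<in> sets (lebesgue_on A)"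
    using assms by (auto simp: sets_restrict_space_iff Int_absorb2)
  have "integrable (lebesgue_on A) (\<lambda>x. indicator B x *\<^sub>R f x)"
    using integrable_mult_indicator[of B "lebesgue_on A" f] assms s by (simp add: Int_absorb2)
  then show ?thesis
    unfolding lebesgue_on_subset[OF assms(2-4)] integrable_restrict_space[OF s] .
qed

lemma integral_lebesgue_on_subset:
  fixes f :: "real \<Rightarrow> 'b :: euclidean_space"
  assumes "A \<in> sets lebesgue" "B \<in> sets lebesgue" "B \<subseteq> A"
  shows "(\<integral>x. f x \<partial>lebesgue_on B) = (\<integral>x. indicator B x *\<^sub>R f x \<partial>lebesgue_on A)"
proof -
  have s: "B \<inter> space (lebesgue_on A) \<in> sets (lebesgue_on A)"
    using assms by (auto simp: sets_restrict_space_iff Int_absorb2)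
  show ?thesis unfolding lebesgue_on_subset[OF assms] integral_restrict_space[OF s] ..
qed

lemma L1_subset_bound:
  fixes f :: "real \<Rightarrow> complex"
  assumes f: "f \<in> L2_carr M" and M: "0 < M" and B: "B \<in> sets lebesgue" "B \<subseteq> {0..M}"
  shows "integrable (lebesgue_on B) f" "(\<integral>t. cmod (f t) \<partial>lebesgue_on B) \<le> sqrt M * sqrt (L2_sq M f)"
proof -
  have i: "integrable (lebesgue_on {0..M}) f" by (rule L2_imp_L1[OF f]) (use M in simp)
  show "integrable (lebesgue_on B) f" by (rule integrable_lebesgue_on_subset[OF i _ B]) simp
  have "(\<integral>t. cmod (f t) \<partial>lebesgue_on B) = (\<integral>t. indicator B t *\<^sub>R cmod (f t) \<partial>lebesgue_on {0..M})"
    by (rule integral_lebesgue_on_subset[OF _ B]) simp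
  also have "\<dots> \<le> (\<integral>t. cmod (f t) \<partial>lebesgue_on {0..M})"
    by (rule integral_mono_AE'[OF integrable_norm[OF i]]) (auto simp: indicator_def)
  also have "\<dots> \<le> sqrt M * sqrt (L2_sq M f)" by (rule L2_imp_L1(2)[OF f]) (use M in simp)
  finally show "(\<integral>t. cmod (f t) \<partial>lebesgue_on B) \<le> sqrt M * sqrt (L2_sq M f)" .
qed

text \<open>It passes from the cut domains of \<open>layer_cut\<close> to fixed domains of interior
  parameters, which differ from them by finitely many points.\<close>

lemma integral_lebesgue_on_mod_finite:
  fixes f :: "real \<Rightarrow> complex"
  assumes "A \<in> sets lebesgue" "B \<in> sets lebesgue" "finite F" "A - B \<subseteq> F" "B - A \<subseteq> F"
  shows "(\<integral>x. f x \<partial>lebesgue_on A) = (\<integral>x. f x \<partial>lebesgue_on B)"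
proof -
  have "(\<integral>x. (if x \<in> A then f x else 0) \<partial>lebesgue) = (\<integral>x. (if x \<in> B then f x else 0) \<partial>lebesgue)"
    by (rule integral_discrete_difference[of F])
      (use assms in \<open>auto simp: countable_finite\<close>)
  then show ?thesis
    unfolding Lebesgue_Measure.integral_restrict_UNIV[OF assms(1)]
      Lebesgue_Measure.integral_restrict_UNIV[OF assms(2)] .
qed

text \<open>Two differentiations under the integral sign. The supremum bound in \<open>s\<close>
  costs sqrt L, and the passage from the L1 to the L2 norm of the density costs sqrt M.\<close>

lemma L2_to_H2_smooth_kernel:
  fixes k0 k1 k2 :: "real \<Rightarrow> real \<Rightarrow> complex"
  assumes L: "0 < L" and M: "0 < M" and D: "D \<in> sets lebesgue" "D \<subseteq> {0..M}" and B: "0 \<le> B"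
    and d: "\<And>s t. s \<in> {0..L} \<Longrightarrow> t \<in> D \<Longrightarrow> ((\<lambda>s. k0 s t) has_vector_derivative k1 s t) (at s within {0..L})"
      "\<And>s t. s \<in> {0..L} \<Longrightarrow> t \<in> D \<Longrightarrow> ((\<lambda>s. k1 s t) has_vector_derivative k2 s t) (at s within {0..L})"
    and c2: "\<And>t. t \<in> D \<Longrightarrow> continuous_on {0..L} (\<lambda>s. k2 s t)"
    and ct: "\<And>s. s \<in> {0..L} \<Longrightarrow> continuous_on D (k0 s)" "\<And>s. s \<in> {0..L} \<Longrightarrow> continuous_on D (k1 s)"
      "\<And>s. s \<in> {0..L} \<Longrightarrow> continuous_on D (k2 s)"
    and b: "\<And>s t. s \<in> {0..L} \<Longrightarrow> t \<in> D \<Longrightarrow> cmod (k0 s t) \<le> B \<and> cmod (k1 s t) \<le> B \<and> cmod (k2 s t) \<le> B"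
  shows "L2_to_H2 M L (\<lambda>\<sigma> s. \<integral>t. k0 s t * \<sigma> t \<partial>lebesgue_on D)"
proof -
  let ?\<mu> = "lebesgue_on D"
  have sp: "space ?\<mu> = D" by simp
  have H: "H2_bounded L (\<lambda>s. \<integral>t. k0 s t * \<sigma> t \<partial>?\<mu>) (sqrt L * (B * (sqrt M * sqrt (L2_sq M \<sigma>))))"
    if \<sigma>: "\<sigma> \<in> L2_carr M" for \<sigma>
  proof -
    note i = L1_subset_bound[OF \<sigma> M D]
    have m: "k0 s \<in> borel_measurable ?\<mu>" "k1 s \<in> borel_measurable ?\<mu>" "k2 s \<in> borel_measurable ?\<mu>" if "s \<in> {0..L}" for s
      using ct[OF that] D(1) by (auto intro: continuous_on_imp_measurable_lebesgue_on)
    have d0: "((\<lambda>s. \<integral>t. k0 s t * \<sigma> t \<partial>?\<mu>) has_vector_derivative (\<integral>t. k1 s t * \<sigma> t \<partial>?\<mu>)) (at s within {0..L})"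
      if s: "s \<in> {0..L}" for s
      by (rule kernel_derivative[OF convex_closed_interval s i(1), where B = B]) (use d(1) m b in auto)
    have d1: "((\<lambda>s. \<integral>t. k1 s t * \<sigma> t \<partial>?\<mu>) has_vector_derivative (\<integral>t. k2 s t * \<sigma> t \<partial>?\<mu>)) (at s within {0..L})"
      if s: "s \<in> {0..L}" for s
      by (rule kernel_derivative[OF convex_closed_interval s i(1), where B = B]) (use d(2) m b in auto)
    have c: "continuous_on {0..L} (\<lambda>s. \<integral>t. k2 s t * \<sigma> t \<partial>?\<mu>)"
      unfolding continuous_on_eq_continuous_within
    proof
      fix s assume s: "s \<in> {0..L}"
      show "continuous (at s within {0..L}) (\<lambda>s. \<integral>t. k2 s t * \<sigma> t \<partial>?\<mu>)"
        by (rule kernel_continuous[OF i(1) s, where B = B])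
          (use c2 s m b in \<open>auto simp: continuous_on_eq_continuous_within\<close>)
    qed
    have nb: "cmod (\<integral>t. k t * \<sigma> t \<partial>?\<mu>) \<le> B * (sqrt M * sqrt (L2_sq M \<sigma>))"
      if "k \<in> borel_measurable ?\<mu>" "\<And>t. t \<in> D \<Longrightarrow> cmod (k t) \<le> B" for k
      using kernel_norm(2)[OF i(1) that(1), of B] that(2) mult_left_mono[OF i(2) B] by simp
    show ?thesis
    proof (rule H2_bounded_sup[OF L, where v = "\<lambda>s. \<integral>t. k1 s t * \<sigma> t \<partial>?\<mu>" and w = "\<lambda>s. \<integral>t. k2 s t * \<sigma> t \<partial>?\<mu>"])
      show "0 \<le> B * (sqrt M * sqrt (L2_sq M \<sigma>))" using B M by (simp add: L2_sq_nonneg)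
      show "continuous_on {0..L} (\<lambda>s. \<integral>t. k0 s t * \<sigma> t \<partial>?\<mu>)"
        unfolding continuous_on_eq_continuous_within using d0 has_vector_derivative_continuous by blast
      show "continuous_on {0<..<L} (\<lambda>s. \<integral>t. k2 s t * \<sigma> t \<partial>?\<mu>)"
        by (rule continuous_on_subset[OF c]) auto
      fix s assume s: "s \<in> {0<..<L}"
      then have s': "s \<in> {0..L}" by auto
      have at: "at s within {0..L} = at s" using s by (simp add: at_within_Icc_at)
      show "((\<lambda>s. \<integral>t. k0 s t * \<sigma> t \<partial>?\<mu>) has_vector_derivative (\<integral>t. k1 s t * \<sigma> t \<partial>?\<mu>)) (at s)"
        using d0[OF s'] unfolding at .
      show "((\<lambda>s. \<integral>t. k1 s t * \<sigma> t \<partial>?\<mu>) has_vector_derivative (\<integral>t. k2 s t * \<sigma> t \<partial>?\<mu>)) (at s)"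
        using d1[OF s'] unfolding at .
      show "cmod (\<integral>t. k0 s t * \<sigma> t \<partial>?\<mu>) \<le> B * (sqrt M * sqrt (L2_sq M \<sigma>))"
        "cmod (\<integral>t. k1 s t * \<sigma> t \<partial>?\<mu>) \<le> B * (sqrt M * sqrt (L2_sq M \<sigma>))"
        "cmod (\<integral>t. k2 s t * \<sigma> t \<partial>?\<mu>) \<le> B * (sqrt M * sqrt (L2_sq M \<sigma>))"
        using m[OF s'] b[OF s'] by (auto intro!: nb)
    qed
  qed
  show ?thesis
    unfolding L2_to_H2_def
  proof (intro exI[of _ "sqrt L * B * sqrt M"] conjI ballI)
    show "0 \<le> sqrt L * B * sqrt M" using L M B by simp
    fix \<sigma> assume "\<sigma> \<in> L2_carr M"
    from H[OF this] show "H2_bounded L (\<lambda>s. \<integral>t. k0 s t * \<sigma> t \<partial>?\<mu>) (sqrt L * B * sqrt M * sqrt (L2_sq M \<sigma>))"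
      by (simp only: mult.assoc)
  qed
qed

lemma L2_to_L2_bounded_kernel:
  fixes k :: "real \<Rightarrow> real \<Rightarrow> complex"
  assumes L: "0 < L" and M: "0 < M" and D: "D \<in> sets lebesgue" "D \<subseteq> {0..M}" and B: "0 \<le> B"
    and cs: "\<And>t. t \<in> D \<Longrightarrow> continuous_on {0..L} (\<lambda>s. k s t)"
    and ct: "\<And>s. s \<in> {0..L} \<Longrightarrow> continuous_on D (k s)"
    and b: "\<And>s t. s \<in> {0..L} \<Longrightarrow> t \<in> D \<Longrightarrow> cmod (k s t) \<le> B"
  shows "L2_to_L2 M L (\<lambda>\<sigma> s. \<integral>t. k s t * \<sigma> t \<partial>lebesgue_on D)"
proof -
  let ?\<mu> = "lebesgue_on D"
  have H: "L2_bounded L (\<lambda>s. \<integral>t. k s t * \<sigma> t \<partial>?\<mu>) (sqrt L * (B * (sqrt M * sqrt (L2_sq M \<sigma>))))"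
    if \<sigma>: "\<sigma> \<in> L2_carr M" for \<sigma>
  proof -
    note i = L1_subset_bound[OF \<sigma> M D]
    have m: "k s \<in> borel_measurable ?\<mu>" if "s \<in> {0..L}" for s
      using ct[OF that] D(1) by (rule continuous_on_imp_measurable_lebesgue_on)
    have "continuous_on {0..L} (\<lambda>s. \<integral>t. k s t * \<sigma> t \<partial>?\<mu>)"
      unfolding continuous_on_eq_continuous_within
    proof
      fix s assume s: "s \<in> {0..L}"
      show "continuous (at s within {0..L}) (\<lambda>s. \<integral>t. k s t * \<sigma> t \<partial>?\<mu>)"
        by (rule kernel_continuous[OF i(1) s, where B = B])
          (use cs s m b in \<open>auto simp: continuous_on_eq_continuous_within\<close>)
    qed
    then have c: "continuous_on {0<..<L} (\<lambda>s. \<integral>t. k s t * \<sigma> t \<partial>?\<mu>)"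
      by (rule continuous_on_subset) auto
    have N: "0 \<le> B * (sqrt M * sqrt (L2_sq M \<sigma>))" using B M by (simp add: L2_sq_nonneg)
    have nb: "cmod (\<integral>t. k s t * \<sigma> t \<partial>?\<mu>) \<le> B * (sqrt M * sqrt (L2_sq M \<sigma>))" if "s \<in> {0<..<L}" for s
    proof -
      have s: "s \<in> {0..L}" using that by auto
      have "cmod (\<integral>t. k s t * \<sigma> t \<partial>?\<mu>) \<le> B * (\<integral>t. cmod (\<sigma> t) \<partial>?\<mu>)"
        by (rule kernel_norm(2)[OF i(1) m[OF s]]) (use b[OF s] in simp)
      then show ?thesis using mult_left_mono[OF i(2) B] by linarith
    qed
    note * = L2_sup_bound[OF continuous_on_imp_measurable_interval[OF c] less_imp_le[OF L] N nb]
    show ?thesis unfolding L2_bounded_def using c * N L by simp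
  qed
  show ?thesis
    unfolding L2_to_L2_def
  proof (intro exI[of _ "sqrt L * B * sqrt M"] conjI ballI)
    show "0 \<le> sqrt L * B * sqrt M" using L M B by simp
    fix \<sigma> assume "\<sigma> \<in> L2_carr M"
    from H[OF this] show "L2_bounded L (\<lambda>s. \<integral>t. k s t * \<sigma> t \<partial>?\<mu>) (sqrt L * B * sqrt M * sqrt (L2_sq M \<sigma>))"
      by (simp only: mult.assoc)
  qed
qed

section \<open>Bounds and continuity of the layer kernels\<close>

text \<open>Counting of orders: \<open>\<Phi> n\<close> has the order -2n in the distance, and every
  inner product of x - y with a bounded vector restores one order. Each derivative along the target
  thus costs one power of the distance; the acceleration terms are of lower order and bring in
  \<open>A\<close>.\<close>

lemma kernel_bounds:
  assumes prof: "profile k \<Phi>" and R: "0 < R" and A: "0 \<le> A"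
  obtains K where "0 \<le> K" "\<And>x y :: complex. 0 < dist x y \<Longrightarrow> dist x y \<le> R \<Longrightarrow>
      cmod (\<Phi> 0 ((dist x y)\<^sup>2)) \<le> K * dist x y powr (- (1/4))"
    "\<And>x x' y. 0 < dist x y \<Longrightarrow> dist x y \<le> R \<Longrightarrow> norm x' = 1 \<Longrightarrow> cmod (kap1 \<Phi> x x' y) \<le> K / dist x y"
    "\<And>x x' x'' y. 0 < dist x y \<Longrightarrow> dist x y \<le> R \<Longrightarrow> norm x' = 1 \<Longrightarrow> norm x'' \<le> A \<Longrightarrow>
      cmod (kap2 \<Phi> x x' x'' y) \<le> K / (dist x y)\<^sup>2"
    "\<And>x y n. 0 < dist x y \<Longrightarrow> dist x y \<le> R \<Longrightarrow> norm n = 1 \<Longrightarrow> cmod (del0 \<Phi> x y n) \<le> K / dist x y"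
    "\<And>x x' y n. 0 < dist x y \<Longrightarrow> dist x y \<le> R \<Longrightarrow> norm x' = 1 \<Longrightarrow> norm n = 1 \<Longrightarrow>
      cmod (del1 \<Phi> x x' y n) \<le> K / (dist x y)\<^sup>2"
    "\<And>x x' x'' y n. 0 < dist x y \<Longrightarrow> dist x y \<le> R \<Longrightarrow> norm x' = 1 \<Longrightarrow> norm x'' \<le> A \<Longrightarrow> norm n = 1 \<Longrightarrow>
      cmod (del2 \<Phi> x x' x'' y n) \<le> K / (dist x y) ^ 3"
proof -
  obtain C where C: "0 \<le> C" "\<And>q. 0 < q \<Longrightarrow> q \<le> R\<^sup>2 \<Longrightarrow> cmod (\<Phi> 0 q) \<le> C * q powr (- (1/8))"
    "\<And>q n. 0 < q \<Longrightarrow> q \<le> R\<^sup>2 \<Longrightarrow> n \<in> {1,2,3} \<Longrightarrow> cmod (\<Phi> n q) \<le> C / q ^ n"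
    using profile_bound[OF prof, of "R\<^sup>2"] by blast
  \<comment> \<open>The largest coefficient that occurs below is 20 + 6 A R, in the bound for
    \<open>del2\<close>; the sum here leaves room above it.\<close>
  define K where "K = C * (26 + 2 * A * R + 6 * A * R)"
  have AR: "0 \<le> A * R" using A R by simp
  have K0: "0 \<le> K" and CK: "C * c \<le> K" if "c \<le> 26 + 8 * (A * R)" for c
    using C(1) AR that unfolding K_def by (auto intro!: mult_left_mono)
  have Phi: "cmod (\<Phi> n ((dist x y)\<^sup>2)) \<le> C / (dist x y) ^ (2 * n)"
    if "0 < dist x y" "dist x y \<le> R" "n \<in> {1,2,3}" for x y :: complex and n
    using C(3)[of "(dist x y)\<^sup>2" n] that by (simp add: power_mult power_mono)
  \<comment> \<open>A coefficient of order \<open>j\<close> in the distance times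
    \<open>\<Phi> n\<close> has the order j - 2n = - m.\<close>
  have sc: "cmod (a *\<^sub>R \<Phi> n ((dist x y)\<^sup>2)) \<le> C * c / (dist x y) ^ m"
    if r: "0 < dist x y" "dist x y \<le> R" and n: "n \<in> {1,2,3}" and a: "\<bar>a\<bar> \<le> c * (dist x y) ^ j" and m: "m + j = 2 * n"
    for a c and x y :: complex and n m j
  proof -
    have "cmod (a *\<^sub>R \<Phi> n ((dist x y)\<^sup>2)) \<le> (c * (dist x y) ^ j) * (C / (dist x y) ^ (2 * n))"
      unfolding norm_scaleR
      by (intro mult_mono a Phi r n) (use a in \<open>auto intro: order_trans[OF abs_ge_zero]\<close>)
    also have "\<dots> = C * c / (dist x y) ^ m"
    proof -
      have "(dist x y) ^ (2 * n) = (dist x y) ^ m * (dist x y) ^ j" by (simp only: m[symmetric] power_add)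
      then show ?thesis using r(1) by simp
    qed
    finally show ?thesis .
  qed
  have ip: "\<bar>(x - y) \<bullet> v\<bar> \<le> norm v * dist x y" "\<bar>(y - x) \<bullet> v\<bar> \<le> norm v * dist x y" for x y v :: complex
    using Cauchy_Schwarz_ineq2[of "x - y" v] Cauchy_Schwarz_ineq2[of "y - x" v]
    by (simp_all add: dist_norm norm_minus_commute mult.commute)
  show ?thesis
  proof (rule that[of K])
    show "0 \<le> K" using K0[of 0] AR by simp
    fix x x' x'' y n :: complex
    assume r: "0 < dist x y" "dist x y \<le> R"
    let ?r = "dist x y"
    have div: "C * c / ?r ^ m \<le> K / ?r ^ m" if "c \<le> 26 + 8 * (A * R)" for c m
      using r(1) CK[OF that] by (intro divide_right_mono) auto
    show "cmod (\<Phi> 0 (?r\<^sup>2)) \<le> K * ?r powr (- (1/4))"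
    proof -
      have "(?r\<^sup>2) powr (- (1/8)) = ?r powr (- (1/4))"
        using r(1) by (simp add: powr_powr flip: powr_numeral)
      then have "cmod (\<Phi> 0 (?r\<^sup>2)) \<le> C * ?r powr (- (1/4))"
        using C(2)[of "?r\<^sup>2"] r by (simp add: power_mono)
      also have "\<dots> \<le> K * ?r powr (- (1/4))"
        using CK[of 1] AR by (intro mult_right_mono) auto
      finally show ?thesis .
    qed
    {
      assume x': "norm x' = 1"
      have a1: "\<bar>2 * ((x - y) \<bullet> x')\<bar> \<le> 2 * ?r ^ 1" using ip(1)[of x y x'] x' by simp
      have "cmod (kap1 \<Phi> x x' y) \<le> C * 2 / ?r ^ 1"
        unfolding kap1_def by (rule sc[OF r _ a1]) auto
      also have "\<dots> \<le> K / ?r ^ 1" by (rule div) (use AR in simp)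
      finally show "cmod (kap1 \<Phi> x x' y) \<le> K / ?r" by simp
      have a2: "\<bar>(2 * ((x - y) \<bullet> x'))\<^sup>2\<bar> \<le> 4 * ?r ^ 2"
        using power_mono[OF a1 abs_ge_zero, of 2] by (simp add: power_mult_distrib)
      {
        assume x'': "norm x'' \<le> A"
        have i2: "\<bar>(x - y) \<bullet> x''\<bar> \<le> A * R"
        proof -
          have "\<bar>(x - y) \<bullet> x''\<bar> \<le> norm x'' * ?r" by (rule ip)
          also have "\<dots> \<le> A * R" using x'' r A by (intro mult_mono) auto
          finally show ?thesis .
        qed
        have xx: "x' \<bullet> x' = 1" using x' by (simp flip: power2_norm_eq_inner)
        have b: "\<bar>2 * (x' \<bullet> x') + 2 * ((x - y) \<bullet> x'')\<bar> \<le> 2 + 2 * (A * R)"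
          using i2 xx by (auto simp: abs_le_iff)
        have "cmod (kap2 \<Phi> x x' x'' y) \<le> C * 4 / ?r ^ 2 + C * (2 + 2 * (A * R)) / ?r ^ 2"
          unfolding kap2_def
          by (intro norm_triangle_le add_mono; (rule sc[OF r _ a2] | rule sc[OF r, where j = 0])) (use b in auto)
        also have "\<dots> = C * (6 + 2 * (A * R)) / ?r ^ 2" by (simp add: add_divide_distrib distrib_left)
        also have "\<dots> \<le> K / ?r ^ 2" by (rule div) (use AR in simp)
        finally show "cmod (kap2 \<Phi> x x' x'' y) \<le> K / ?r\<^sup>2" .
        assume n: "norm n = 1"
        have p: "\<bar>2 * ((y - x) \<bullet> n)\<bar> \<le> 2 * ?r" using ip(2)[of y x n] n by simp
        have p1: "\<bar>x' \<bullet> n\<bar> \<le> 1" using Cauchy_Schwarz_ineq2[of x' n] x' n by simp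
        have p2: "\<bar>x'' \<bullet> n\<bar> \<le> A" using Cauchy_Schwarz_ineq2[of x'' n] x'' n by simp
        have t1: "cmod ((- 2 * (x'' \<bullet> n)) *\<^sub>R \<Phi> 1 (?r\<^sup>2)) \<le> C * (2 * (A * R)) / ?r ^ 3"
        proof -
          have "cmod ((- 2 * (x'' \<bullet> n)) *\<^sub>R \<Phi> 1 (?r\<^sup>2)) \<le> C * (2 * A) / ?r ^ 2"
            by (rule sc[OF r, where j = 0]) (use p2 in auto)
          also have "\<dots> = C * (2 * A * ?r) / ?r ^ 3" using r(1) by (simp add: eval_nat_numeral)
          also have "\<dots> \<le> C * (2 * (A * R)) / ?r ^ 3"
            using r A C(1) by (intro divide_right_mono mult_left_mono) (auto simp: mult.assoc intro!: mult_left_mono)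
          finally show ?thesis .
        qed
        have t2: "cmod ((2 * (- 2 * (x' \<bullet> n) * (2 * ((x - y) \<bullet> x'))) +
            2 * ((y - x) \<bullet> n) * (2 * (x' \<bullet> x') + 2 * ((x - y) \<bullet> x''))) *\<^sub>R \<Phi> 2 (?r\<^sup>2)) \<le> C * (12 + 4 * (A * R)) / ?r ^ 3"
        proof (rule sc[OF r, where j = 1])
          have "\<bar>(x' \<bullet> n) * (2 * ((x - y) \<bullet> x'))\<bar> \<le> 1 * (2 * ?r ^ 1)"
            unfolding abs_mult[of "x' \<bullet> n"] by (intro mult_mono p1 a1) auto
          then have "\<bar>2 * (- 2 * (x' \<bullet> n) * (2 * ((x - y) \<bullet> x')))\<bar> \<le> 8 * ?r" by (simp add: abs_mult)
          moreover have "\<bar>2 * ((y - x) \<bullet> n) * (2 * (x' \<bullet> x') + 2 * ((x - y) \<bullet> x''))\<bar> \<le> (2 * ?r) * (2 + 2 * (A * R))"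
            unfolding abs_mult[of "2 * ((y - x) \<bullet> n)"] using r(1) by (intro mult_mono p b) auto
          ultimately have "\<bar>2 * (- 2 * (x' \<bullet> n) * (2 * ((x - y) \<bullet> x'))) +
            2 * ((y - x) \<bullet> n) * (2 * (x' \<bullet> x') + 2 * ((x - y) \<bullet> x''))\<bar> \<le> 8 * ?r + (2 * ?r) * (2 + 2 * (A * R))"
            by (intro order_trans[OF abs_triangle_ineq] add_mono)
          also have "\<dots> = (12 + 4 * (A * R)) * ?r ^ 1" by (simp add: algebra_simps)
          finally show "\<bar>2 * (- 2 * (x' \<bullet> n) * (2 * ((x - y) \<bullet> x'))) +
            2 * ((y - x) \<bullet> n) * (2 * (x' \<bullet> x') + 2 * ((x - y) \<bullet> x''))\<bar> \<le> (12 + 4 * (A * R)) * ?r ^ 1" .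
        qed auto
        have t3: "cmod ((2 * ((y - x) \<bullet> n) * (2 * ((x - y) \<bullet> x'))\<^sup>2) *\<^sub>R \<Phi> 3 (?r\<^sup>2)) \<le> C * 8 / ?r ^ 3"
        proof (rule sc[OF r, where j = 3])
          have "\<bar>2 * ((y - x) \<bullet> n) * (2 * ((x - y) \<bullet> x'))\<^sup>2\<bar> \<le> (2 * ?r) * (4 * ?r ^ 2)"
            unfolding abs_mult[of "2 * ((y - x) \<bullet> n)"] using r(1) by (intro mult_mono p a2) auto
          then show "\<bar>2 * ((y - x) \<bullet> n) * (2 * ((x - y) \<bullet> x'))\<^sup>2\<bar> \<le> 8 * ?r ^ 3"
            by (simp add: eval_nat_numeral)
        qed auto
        have "cmod (del2 \<Phi> x x' x'' y n) \<le> C * (2 * (A * R)) / ?r ^ 3 + C * (12 + 4 * (A * R)) / ?r ^ 3 + C * 8 / ?r ^ 3"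
          unfolding del2_def by (intro norm_triangle_le add_mono t1 t2 t3)
        also have "\<dots> = C * (20 + 6 * (A * R)) / ?r ^ 3"
          unfolding add_divide_distrib[symmetric] distrib_left[symmetric] by simp
        also have "\<dots> \<le> K / ?r ^ 3" by (rule div) (use AR in simp)
        finally show "cmod (del2 \<Phi> x x' x'' y n) \<le> K / ?r ^ 3" .
      }
      assume n: "norm n = 1"
      have p: "\<bar>2 * ((y - x) \<bullet> n)\<bar> \<le> 2 * ?r" using ip(2)[of y x n] n by simp
      have p1: "\<bar>x' \<bullet> n\<bar> \<le> 1" using Cauchy_Schwarz_ineq2[of x' n] x' n by simp
      have t1: "cmod ((- 2 * (x' \<bullet> n)) *\<^sub>R \<Phi> 1 (?r\<^sup>2)) \<le> C * 2 / ?r ^ 2"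
        by (rule sc[OF r, where j = 0]) (use p1 in auto)
      have t2: "cmod ((2 * ((y - x) \<bullet> n) * (2 * ((x - y) \<bullet> x'))) *\<^sub>R \<Phi> 2 (?r\<^sup>2)) \<le> C * 4 / ?r ^ 2"
      proof (rule sc[OF r, where j = 2])
        have "\<bar>2 * ((y - x) \<bullet> n) * (2 * ((x - y) \<bullet> x'))\<bar> \<le> (2 * ?r) * (2 * ?r ^ 1)"
          unfolding abs_mult[of "2 * ((y - x) \<bullet> n)"] using r(1) by (intro mult_mono p a1) auto
        then show "\<bar>2 * ((y - x) \<bullet> n) * (2 * ((x - y) \<bullet> x'))\<bar> \<le> 4 * ?r ^ 2"
          by (simp add: power2_eq_square)
      qed auto
      have "cmod (del1 \<Phi> x x' y n) \<le> C * 2 / ?r ^ 2 + C * 4 / ?r ^ 2"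
        unfolding del1_def by (intro norm_triangle_le add_mono t1 t2)
      also have "\<dots> = C * 6 / ?r ^ 2" by simp
      also have "\<dots> \<le> K / ?r ^ 2" by (rule div) (use AR in simp)
      finally show "cmod (del1 \<Phi> x x' y n) \<le> K / ?r\<^sup>2" .
    }
    assume n: "norm n = 1"
    have p: "\<bar>2 * ((y - x) \<bullet> n)\<bar> \<le> 2 * ?r ^ 1" using ip(2)[of y x n] n by simp
    have "cmod (del0 \<Phi> x y n) \<le> C * 2 / ?r ^ 1"
      unfolding del0_def by (rule sc[OF r _ p]) auto
    also have "\<dots> \<le> K / ?r ^ 1" by (rule div) (use AR in simp)
    finally show "cmod (del0 \<Phi> x y n) \<le> K / ?r" by simp
  qed
qed

lemma kernels_continuous:
  fixes x x' x'' y n :: "'a :: topological_space \<Rightarrow> complex"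
  assumes prof: "profile k \<Phi>" and c: "continuous_on A x" "continuous_on A y"
    and ne: "\<And>a. a \<in> A \<Longrightarrow> x a \<noteq> y a"
  shows "continuous_on A (\<lambda>a. \<Phi> 0 ((dist (x a) (y a))\<^sup>2))"
    "continuous_on A x' \<Longrightarrow> continuous_on A (\<lambda>a. kap1 \<Phi> (x a) (x' a) (y a))"
    "continuous_on A x' \<Longrightarrow> continuous_on A x'' \<Longrightarrow> continuous_on A (\<lambda>a. kap2 \<Phi> (x a) (x' a) (x'' a) (y a))"
    "continuous_on A n \<Longrightarrow> continuous_on A (\<lambda>a. del0 \<Phi> (x a) (y a) (n a))"
    "continuous_on A x' \<Longrightarrow> continuous_on A n \<Longrightarrow> continuous_on A (\<lambda>a. del1 \<Phi> (x a) (x' a) (y a) (n a))"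
    "continuous_on A x' \<Longrightarrow> continuous_on A x'' \<Longrightarrow> continuous_on A n \<Longrightarrow>
      continuous_on A (\<lambda>a. del2 \<Phi> (x a) (x' a) (x'' a) (y a) (n a))"
proof -
  have q: "continuous_on A (\<lambda>a. (dist (x a) (y a))\<^sup>2)" by (intro continuous_intros c)
  have P: "continuous_on A (\<lambda>a. \<Phi> m ((dist (x a) (y a))\<^sup>2))" if "m \<le> 3" for m
    by (rule profile_continuous[OF prof that q]) (use ne in simp)
  show "continuous_on A (\<lambda>a. \<Phi> 0 ((dist (x a) (y a))\<^sup>2))" by (rule P) simp
  show "continuous_on A x' \<Longrightarrow> continuous_on A (\<lambda>a. kap1 \<Phi> (x a) (x' a) (y a))"
    unfolding kap1_def by (intro continuous_intros c P) auto
  show "continuous_on A x' \<Longrightarrow> continuous_on A x'' \<Longrightarrow> continuous_on A (\<lambda>a. kap2 \<Phi> (x a) (x' a) (x'' a) (y a))"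
    unfolding kap2_def by (intro continuous_intros c P) auto
  show "continuous_on A n \<Longrightarrow> continuous_on A (\<lambda>a. del0 \<Phi> (x a) (y a) (n a))"
    unfolding del0_def by (intro continuous_intros c P) auto
  show "continuous_on A x' \<Longrightarrow> continuous_on A n \<Longrightarrow> continuous_on A (\<lambda>a. del1 \<Phi> (x a) (x' a) (y a) (n a))"
    unfolding del1_def by (intro continuous_intros c P) auto
  show "continuous_on A x' \<Longrightarrow> continuous_on A x'' \<Longrightarrow> continuous_on A n \<Longrightarrow>
      continuous_on A (\<lambda>a. del2 \<Phi> (x a) (x' a) (x'' a) (y a) (n a))"
    unfolding del2_def by (intro continuous_intros c P) auto
qed

text \<open>The norm bound is \<open>hilbert_bound\<close>. Continuity of the image is a local
  matter: near an interior \<open>s\<close> the distance to the ends is bounded below, so the kernel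
  is bounded uniformly in \<open>t\<close>.\<close>

lemma L2_to_L2_hilbert_kernel:
  fixes k :: "real \<Rightarrow> real \<Rightarrow> complex"
  assumes L: "0 < L" and M: "0 < M" and D: "D \<in> sets lebesgue" "D \<subseteq> {0..M}" and B: "0 \<le> B"
    and cs: "\<And>t. t \<in> D \<Longrightarrow> continuous_on {0<..<L} (\<lambda>s. k s t)"
    and mt: "\<And>s. s \<in> {0<..<L} \<Longrightarrow> k s \<in> borel_measurable (lebesgue_on D)"
    and b: "\<And>s t. s \<in> {0<..<L} \<Longrightarrow> t \<in> D \<Longrightarrow> cmod (k s t) \<le> B / (edge L s + edge M t)"
  shows "L2_to_L2 M L (\<lambda>\<sigma> s. \<integral>t. k s t * \<sigma> t \<partial>lebesgue_on D)"
proof -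
  have sp: "space (lebesgue_on D) = D" by simp
  have bb: "cmod (k s t) \<le> B / e" if "s \<in> {0<..<L}" "t \<in> D" "0 < e" "e \<le> edge L s" for s t e
  proof -
    have "0 \<le> edge M t" using that D by (intro edge_nonneg) auto
    then have "B / (edge L s + edge M t) \<le> B / e" using that B by (intro divide_left_mono) auto
    then show ?thesis using b[OF that(1,2)] by linarith
  qed
  have H: "L2_bounded L (\<lambda>s. \<integral>t. k s t * \<sigma> t \<partial>lebesgue_on D) (2 * pi * B * sqrt (L2_sq M \<sigma>))"
    if \<sigma>: "\<sigma> \<in> L2_carr M" for \<sigma>
  proof -
    let ?U = "\<lambda>s. \<integral>t. k s t * \<sigma> t \<partial>lebesgue_on D"
    note i = L1_subset_bound[OF \<sigma> M D]
    have "continuous (at s0) ?U" if s0: "s0 \<in> {0<..<L}" for s0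
    proof -
      \<comment> \<open>On this window the distance to either end is at least half of its value at
        \<open>s0\<close>.\<close>
      let ?X = "{s0 / 2<..<(s0 + L) / 2}"
      have e: "0 < edge L s0 / 2" using edge_pos[OF s0] by simp
      have X: "s \<in> {0<..<L}" "edge L s0 / 2 \<le> edge L s" if "s \<in> ?X" for s
        using that s0 by (auto simp: edge_def)
      have "continuous (at s0 within ?X) ?U"
      proof (rule kernel_continuous[OF i(1), where B = "B / (edge L s0 / 2)"])
        show "s0 \<in> ?X" using s0 by auto
        show "continuous (at s0 within ?X) (\<lambda>s. k s t)" if "t \<in> space (lebesgue_on D)" for t
        proof -
          have "continuous_on ?X (\<lambda>s. k s t)"
            using cs that X(1) unfolding sp by (meson continuous_on_subset subsetI)
          then show ?thesis using \<open>s0 \<in> ?X\<close> by (simp add: continuous_on_eq_continuous_within)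
        qed
        show "k s \<in> borel_measurable (lebesgue_on D)" if "s \<in> ?X" for s using mt X(1)[OF that] by blast
        show "norm (k s t) \<le> B / (edge L s0 / 2)" if "s \<in> ?X" "t \<in> space (lebesgue_on D)" for s t
          using bb[OF X(1)[OF that(1)] _ e X(2)[OF that(1)]] that(2) unfolding sp by blast
      qed
      moreover have "s0 \<in> ?X" using s0 by auto
      ultimately show ?thesis using continuous_within_open[of s0 ?X ?U] by auto
    qed
    then have c: "continuous_on {0<..<L} ?U" by (simp add: continuous_at_imp_continuous_on)
    have le: "cmod (?U s) \<le> B * (\<integral>t. cmod (\<sigma> t) / (edge L s + edge M t) \<partial>lebesgue_on {0..M})"
      if s: "s \<in> {0<..<L}" for s
    proof -
      let ?h = "\<lambda>t. complex_of_real (1 / (edge L s + edge M t)) * \<sigma> t"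
      have ep: "0 < edge L s" by (rule edge_pos[OF s])
      have pos: "0 < edge L s + edge M t" if "t \<in> {0..M}" for t
        using ep edge_nonneg[OF that] by linarith
      have "continuous_on {0..M} (\<lambda>t. complex_of_real (1 / (edge L s + edge M t)))"
        using pos by (intro continuous_intros) (auto simp: less_imp_neq[symmetric] dest!: pos)
      then have mh: "(\<lambda>t. complex_of_real (1 / (edge L s + edge M t))) \<in> borel_measurable (lebesgue_on {0..M})"
        by (rule continuous_on_imp_measurable_lebesgue_on) simp
      have ih: "integrable (lebesgue_on {0..M}) ?h"
      proof (rule kernel_norm(1)[OF L2_imp_L1(1)[OF \<sigma> less_imp_le[OF M]] mh, where B = "1 / edge L s"])
        fix t assume "t \<in> space (lebesgue_on {0..M})"
        then have t: "t \<in> {0..M}" by simp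
        show "norm (complex_of_real (1 / (edge L s + edge M t))) \<le> 1 / edge L s"
          using pos[OF t] ep edge_nonneg[OF t] unfolding norm_of_real
          by (simp add: frac_le)
      qed
      have ihD: "integrable (lebesgue_on D) ?h"
        by (rule integrable_lebesgue_on_subset[OF ih _ D]) simp
      have ik: "integrable (lebesgue_on D) (\<lambda>t. k s t * \<sigma> t)"
        by (rule kernel_norm(1)[OF i(1) mt[OF s], where B = "B / edge L s"])
          (use bb[OF s _ ep order_refl] in simp)
      have "cmod (?U s) \<le> (\<integral>t. B * cmod (?h t) \<partial>lebesgue_on D)"
      proof (rule order_trans[OF integral_norm_bound integral_mono[OF integrable_norm[OF ik]]])
        show "integrable (lebesgue_on D) (\<lambda>t. B * cmod (?h t))"
          by (rule integrable_mult_right[OF integrable_norm[OF ihD]])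
        fix t assume "t \<in> space (lebesgue_on D)"
        then have t: "t \<in> D" by simp
        then have t': "t \<in> {0..M}" using D by auto
        have "cmod (?h t) = 1 / (edge L s + edge M t) * cmod (\<sigma> t)"
          using pos[OF t'] by (simp only: norm_mult norm_of_real) simp
        then show "norm (k s t * \<sigma> t) \<le> B * cmod (?h t)"
          using mult_right_mono[OF b[OF s t] norm_ge_zero[of "\<sigma> t"]] by (simp add: norm_mult)
      qed
      also have "\<dots> = B * (\<integral>t. indicator D t *\<^sub>R cmod (?h t) \<partial>lebesgue_on {0..M})"
        by (simp add: integral_lebesgue_on_subset[OF _ D])
      also have "\<dots> \<le> B * (\<integral>t. cmod (?h t) \<partial>lebesgue_on {0..M})"
      proof (intro mult_left_mono integral_mono B)
        have "D \<in> sets (lebesgue_on {0..M})" using D by (simp add: sets_restrict_space_iff)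
        then show "integrable (lebesgue_on {0..M}) (\<lambda>t. indicator D t *\<^sub>R cmod (?h t))"
          by (rule integrable_mult_indicator[OF _ integrable_norm[OF ih]])
        show "integrable (lebesgue_on {0..M}) (\<lambda>t. cmod (?h t))" by (rule integrable_norm[OF ih])
      qed (auto simp: indicator_def)
      also have "(\<integral>t. cmod (?h t) \<partial>lebesgue_on {0..M}) =
          (\<integral>t. cmod (\<sigma> t) / (edge L s + edge M t) \<partial>lebesgue_on {0..M})"
      proof (rule Bochner_Integration.integral_cong[OF refl])
        fix t assume "t \<in> space (lebesgue_on {0..M})"
        then have t: "t \<in> {0..M}" by simp
        show "cmod (?h t) = cmod (\<sigma> t) / (edge L s + edge M t)"
          using pos[OF t] by (simp only: norm_mult norm_of_real) simp
      qed
      finally show ?thesis .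
    qed
    note * = hilbert_bound[OF L M B \<sigma> continuous_on_imp_measurable_interval[OF c] le]
    have "(2 * pi * B * sqrt (L2_sq M \<sigma>))\<^sup>2 = (2 * pi * B)\<^sup>2 * L2_sq M \<sigma>"
      by (simp add: power_mult_distrib L2_sq_nonneg)
    then show ?thesis unfolding L2_bounded_def using c * B by (simp add: L2_sq_nonneg)
  qed
  show ?thesis
    unfolding L2_to_L2_def
    by (intro exI[of _ "2 * pi * B"] conjI ballI H) (use B in auto)
qed

section \<open>Layer potentials as sums over pieces, and the operators between the two walls\<close>

locale waveguide_kernels = waveguide_setting +
  fixes \<Phi> :: "nat \<Rightarrow> real \<Rightarrow> complex"
  assumes prof: "profile (wnum W) \<Phi>" and constants_W: "waveguide_constants W"
begin

text \<open>Source parameters strictly inside the curve. They never meet a target on another curve,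
  nor does a fin over them meet its own curve, so the kernels are continuous there; only a null set
  is given up.\<close>

definition idom :: "curve \<Rightarrow> real option \<Rightarrow> real set" where
  "idom C p = src_dom W C p \<inter> {0<..<len W C}"

lemma idom_sets: "idom C p \<in> sets lebesgue"
  unfolding idom_def using src_dom_measurable by (intro sets.Int) auto

lemma idom_subset: "idom C p \<subseteq> {0..len W C}" "idom C p \<subseteq> {0<..<len W C}" "idom C p \<subseteq> src_dom W C p"
  unfolding idom_def by auto

lemma layer_cut_pieces:
  "layer_cut W K C \<sigma> x nx \<epsilon> = (\<Sum>p\<in>pieces W C. \<integral>t. K x nx (src_pt W C p t) (src_nml W C p t) * (src_sgn C p * \<sigma> t)
     \<partial>lebesgue_on {t \<in> src_dom W C p. \<epsilon> < dist x (src_pt W C p t)})"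
proof -
  have P: "pieces W C = insert None (Some ` {0, len W C})" by (auto simp: pieces_def)
  have inj: "inj_on Some {0, len W C}" by (rule inj_onI) simp
  then have sp: "(\<Sum>p\<in>pieces W C. F p) = F None + (\<Sum>e\<in>{0, len W C}. F (Some e))" for F :: "real option \<Rightarrow> complex"
  proof -
    have "finite (Some ` {0, len W C})" "None \<notin> Some ` {0, len W C}" by auto
    from sum.insert[OF this, of F] show ?thesis
      unfolding P using sum.reindex[OF inj, of F] by (simp only: o_def)
  qed
  then show ?thesis
    unfolding layer_cut_def src_pt_def src_nml_def src_sgn_def src_dom_def by (simp only: option.case mult_1_left)
qed

lemma cut_set_measurable: "{t \<in> src_dom W C p. \<epsilon> < dist x (src_pt W C p t)} \<in> sets lebesgue"
proof -
  have "closed ({0..len W C} \<inter> (\<lambda>t. dist x (src_pt W C p t)) -` {..\<epsilon>})"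
    by (intro continuous_closed_preimage continuous_on_dist continuous_on_const src_pt_continuous) auto
  then have "src_dom W C p - ({0..len W C} \<inter> (\<lambda>t. dist x (src_pt W C p t)) -` {..\<epsilon>}) \<in> sets lebesgue"
    using src_dom_measurable by (intro sets.Diff) auto
  moreover have "src_dom W C p - ({0..len W C} \<inter> (\<lambda>t. dist x (src_pt W C p t)) -` {..\<epsilon>}) =
      {t \<in> src_dom W C p. \<epsilon> < dist x (src_pt W C p t)}"
    using src_dom_subset[of C p] by auto
  ultimately show ?thesis by simp
qed

text \<open>The ends account for corners and fins, the parameter \<open>s\<close> for a target on
  the source curve itself.\<close>

lemma touch_finite:
  assumes p: "p \<in> pieces W C" and s: "s \<in> {0..len W T}" and t: "t \<in> src_dom W C p"
    and eq: "gam W T s = src_pt W C p t"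
  shows "t \<in> {0, len W C, s}"
proof (cases "T \<noteq> C \<or> p \<noteq> None")
  case True
  then show ?thesis using piece_touch(2)[OF p True s _ eq] t closure_subset[of "src_dom W C p"] by auto
next
  case False
  then have "gam W C s = gam W C t" "t \<in> {0..len W C}" using eq t by (auto simp: src_pt_def src_dom_def)
  then show ?thesis using inj_onD[OF gam_inj[of C], of s t] s False by auto
qed

text \<open>A cut at distance 0 removes precisely the contacts of source and target, which are
  finitely many, and off them the kernel is given by the profile.\<close>

lemma layer_interior:
  assumes K: "\<And>x y ny. x \<noteq> y \<Longrightarrow> K x nx y ny = K' x y ny" and s: "s \<in> {0..len W T}"
  shows "layer_cut W K C \<sigma> (gam W T s) nx 0 = (\<Sum>p\<in>pieces W C. src_sgn C p *
     (\<integral>t. K' (gam W T s) (src_pt W C p t) (src_nml W C p t) * \<sigma> t \<partial>lebesgue_on (idom C p)))"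
  unfolding layer_cut_pieces
proof (rule sum.cong[OF refl])
  fix p assume p: "p \<in> pieces W C"
  let ?A = "{t \<in> src_dom W C p. 0 < dist (gam W T s) (src_pt W C p t)}"
  let ?f = "\<lambda>t. K' (gam W T s) (src_pt W C p t) (src_nml W C p t) * \<sigma> t"
  have "(\<integral>t. K (gam W T s) nx (src_pt W C p t) (src_nml W C p t) * (src_sgn C p * \<sigma> t) \<partial>lebesgue_on ?A)
      = (\<integral>t. src_sgn C p * ?f t \<partial>lebesgue_on ?A)"
  proof (rule Bochner_Integration.integral_cong[OF refl])
    fix t assume "t \<in> space (lebesgue_on ?A)"
    then have "gam W T s \<noteq> src_pt W C p t" by auto
    from K[OF this] show "K (gam W T s) nx (src_pt W C p t) (src_nml W C p t) * (src_sgn C p * \<sigma> t) = src_sgn C p * ?f t"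
      by simp
  qed
  also have "\<dots> = src_sgn C p * (\<integral>t. ?f t \<partial>lebesgue_on ?A)" by simp
  also have "(\<integral>t. ?f t \<partial>lebesgue_on ?A) = (\<integral>t. ?f t \<partial>lebesgue_on (idom C p))"
  proof (rule integral_lebesgue_on_mod_finite[OF cut_set_measurable idom_sets, where F = "{0, len W C, s}"])
    show "?A - idom C p \<subseteq> {0, len W C, s}" using src_dom_subset[of C p] by (auto simp: idom_def)
    show "idom C p - ?A \<subseteq> {0, len W C, s}"
    proof
      fix t assume "t \<in> idom C p - ?A"
      then have "t \<in> src_dom W C p" "gam W T s = src_pt W C p t" by (auto simp: idom_def)
      then show "t \<in> {0, len W C, s}" using touch_finite[OF p s] by blast
    qed
  qed simp
  finally show "(\<integral>t. K (gam W T s) nx (src_pt W C p t) (src_nml W C p t) * (src_sgn C p * \<sigma> t) \<partial>lebesgue_on ?A) =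
      src_sgn C p * (\<integral>t. ?f t \<partial>lebesgue_on (idom C p))" .
qed

lemma Sop_pieces:
  assumes "s \<in> {0..len W T}"
  shows "Sop W T C \<sigma> s = (\<Sum>p\<in>pieces W C. src_sgn C p *
     (\<integral>t. \<Phi> 0 ((dist (gam W T s) (src_pt W C p t))\<^sup>2) * \<sigma> t \<partial>lebesgue_on (idom C p)))"
  unfolding Sop_def
  by (rule layer_interior[where K' = "\<lambda>x y ny. \<Phi> 0 ((dist x y)\<^sup>2)", OF _ assms]) (rule kerS_eq[OF prof])

text \<open>\<open>kap1\<close> is the directional derivative of the kernel in its second vector
  argument: with the tangent it differentiates along the target, with the normal, as here, it is the
  kernel of \<open>Sop'\<close>. The same holds for \<open>del1\<close> and
  \<open>Dop'\<close>.\<close>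

lemma Sop'_pieces:
  assumes "s \<in> {0..len W T}"
  shows "Sop' W T C \<sigma> s = (\<Sum>p\<in>pieces W C. src_sgn C p *
     (\<integral>t. kap1 \<Phi> (gam W T s) (nml W T s) (src_pt W C p t) * \<sigma> t \<partial>lebesgue_on (idom C p)))"
  unfolding Sop'_def
  by (rule layer_interior[where K' = "\<lambda>x y ny. kap1 \<Phi> x (nml W T s) y", OF _ assms])
    (simp add: kap1_def kerS'_eq[OF prof])

lemma Dop_pieces:
  assumes "s \<in> {0..len W T}"
  shows "Dop W T C \<sigma> s = (\<Sum>p\<in>pieces W C. src_sgn C p *
     (\<integral>t. del0 \<Phi> (gam W T s) (src_pt W C p t) (src_nml W C p t) * \<sigma> t \<partial>lebesgue_on (idom C p)))"
  unfolding Dop_def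
  by (rule layer_interior[where K' = "\<lambda>x y ny. del0 \<Phi> x y ny", OF _ assms])
    (simp add: del0_def kerD_eq[OF prof])

text \<open>Multiplication by the cut radius shows that the coefficient \<open>b\<close> of the
  divergent term is 0; then the function is constant.\<close>

lemma finite_part_unique:
  fixes v b c :: complex
  assumes "((\<lambda>\<epsilon>. v - b / of_real \<epsilon>) \<longlongrightarrow> c) (at_right 0)"
  shows "c = v"
proof -
  have e: "((\<lambda>\<epsilon>::real. complex_of_real \<epsilon>) \<longlongrightarrow> of_real 0) (at_right 0)" by (intro tendsto_intros)
  have "((\<lambda>\<epsilon>. of_real \<epsilon> * (v - b / of_real \<epsilon>)) \<longlongrightarrow> 0) (at_right 0)"
    using tendsto_mult[OF e assms] by simp
  moreover have "((\<lambda>\<epsilon>. of_real \<epsilon> * v - b) \<longlongrightarrow> - b) (at_right 0)"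
    using tendsto_diff[OF tendsto_mult[OF e tendsto_const] tendsto_const] by simp
  moreover have "\<forall>\<^sub>F \<epsilon> in at_right (0::real). of_real \<epsilon> * (v - b / of_real \<epsilon>) = of_real \<epsilon> * v - b"
    unfolding eventually_at_right_field by (intro exI[of _ 1]) (auto simp: right_diff_distrib)
  ultimately have "0 = - b"
    by (intro tendsto_unique[OF trivial_limit_at_right_real]) (auto elim: Lim_transform_eventually)
  then have "((\<lambda>_ :: real. v) \<longlongrightarrow> c) (at_right 0)" using assms by simp
  then show ?thesis
    using tendsto_unique[OF trivial_limit_at_right_real _ tendsto_const] by blast
qed

text \<open>For cut radii below the distance of the target from the source nothing is removed, so
  the cut integral is eventually constant and its finite part is that constant.\<close>

lemma layer_fp_regular:
  assumes "0 < c" and c: "\<And>p t. p \<in> pieces W C \<Longrightarrow> t \<in> src_dom W C p \<Longrightarrow> c \<le> dist x (src_pt W C p t)"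
  shows "layer_fp W K C \<sigma> x nx = layer_cut W K C \<sigma> x nx 0"
proof -
  let ?v = "layer_cut W K C \<sigma> x nx 0"
  have "layer_cut W K C \<sigma> x nx \<epsilon> = ?v" if "0 < \<epsilon>" "\<epsilon> < c" for \<epsilon>
  proof -
    have "{t \<in> src_dom W C p. \<epsilon> < dist x (src_pt W C p t)} = {t \<in> src_dom W C p. 0 < dist x (src_pt W C p t)}"
      if "p \<in> pieces W C" for p
      using c[OF that] \<open>0 < \<epsilon>\<close> \<open>\<epsilon> < c\<close> by fastforce
    then show ?thesis unfolding layer_cut_pieces by (intro sum.cong) auto
  qed
  then have ev: "\<forall>\<^sub>F \<epsilon> in at_right 0. layer_cut W K C \<sigma> x nx \<epsilon> - b / of_real \<epsilon> = ?v - b / of_real \<epsilon>" for b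
    unfolding eventually_at_right_field using assms(1) by (intro exI[of _ c]) auto
  show ?thesis
    unfolding layer_fp_def
  proof (rule the_equality)
    show "\<exists>b. ((\<lambda>\<epsilon>. layer_cut W K C \<sigma> x nx \<epsilon> - b / of_real \<epsilon>) \<longlongrightarrow> ?v) (at_right 0)"
      using tendsto_cong[OF ev[of 0]] by (intro exI[of _ 0]) simp
    fix d assume "\<exists>b. ((\<lambda>\<epsilon>. layer_cut W K C \<sigma> x nx \<epsilon> - b / of_real \<epsilon>) \<longlongrightarrow> d) (at_right 0)"
    then obtain b where "((\<lambda>\<epsilon>. layer_cut W K C \<sigma> x nx \<epsilon> - b / of_real \<epsilon>) \<longlongrightarrow> d) (at_right 0)" by blast
    then have "((\<lambda>\<epsilon>. ?v - b / of_real \<epsilon>) \<longlongrightarrow> d) (at_right 0)" using tendsto_cong[OF ev[of b]] by simp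
    then show "d = ?v" by (rule finite_part_unique)
  qed
qed

lemma Dop'_pieces:
  assumes s: "s \<in> {0..len W T}" and "0 < c"
    and c: "\<And>p t. p \<in> pieces W C \<Longrightarrow> t \<in> src_dom W C p \<Longrightarrow> c \<le> dist (gam W T s) (src_pt W C p t)"
  shows "Dop' W T C \<sigma> s = (\<Sum>p\<in>pieces W C. src_sgn C p *
     (\<integral>t. del1 \<Phi> (gam W T s) (nml W T s) (src_pt W C p t) (src_nml W C p t) * \<sigma> t \<partial>lebesgue_on (idom C p)))"
proof -
  have "layer_fp W K C \<sigma> (gam W T s) nx = layer_cut W K C \<sigma> (gam W T s) nx 0" for K nx
    by (rule layer_fp_regular[OF assms(2) c])
  then show ?thesis
    unfolding Dop'_def
    by (simp only:, intro layer_interior[where K' = "\<lambda>x y ny. del1 \<Phi> x (nml W T s) y ny", OF _ s])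
      (simp add: del1_def kerD'_eq[OF prof] mult.commute)
qed

lemma no_touch_interior:
  assumes p: "p \<in> pieces W C" and TC: "T \<noteq> C \<or> p \<noteq> None"
    and s: "s \<in> {0..len W T}" and t: "t \<in> src_dom W C p"
    and st: "s \<in> {0<..<len W T} \<or> t \<in> {0<..<len W C}"
  shows "gam W T s \<noteq> src_pt W C p t"
  using piece_touch(1,2)[OF p TC s, of t] t closure_subset[of "src_dom W C p"] st by auto

lemma src_continuous_idom:
  "continuous_on (idom C p) (src_pt W C p)" "continuous_on (idom C p) (src_nml W C p)"
  using src_pt_continuous src_nml_continuous idom_subset(1) by (meson continuous_on_subset)+

text \<open>The minimum of the distance is attained on a compact set that includes the closed fins.
  A contact would lie on the source curve even if it came from a fin, because a fin meets the
  boundary only in its corner; disjoint arcs exclude it.\<close>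

lemma separated_curves:
  assumes p: "p \<in> pieces W C" and TC: "T \<noteq> C" and disj: "arc_of W T \<inter> arc_of W C = {}"
  shows "\<exists>c>0. \<forall>s\<in>{0..len W T}. \<forall>t\<in>src_dom W C p. c \<le> dist (gam W T s) (src_pt W C p t)"
proof (cases "src_dom W C p = {}")
  case True
  then show ?thesis by (intro exI[of _ 1]) auto
next
  case False
  let ?K = "{0..len W T} \<times> closure (src_dom W C p)"
  have "bounded (src_dom W C p)" by (rule bounded_subset[OF bounded_closed_interval src_dom_subset])
  then have cK: "compact ?K" by (intro compact_Times) (auto simp: compact_closure)
  have K: "?K \<noteq> {}" using False len_pos[of T] by (auto simp: order.strict_implies_order)
  have "continuous_on ?K (\<lambda>z. dist (gam W T (fst z)) (src_pt W C p (snd z)))"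
    using closure_src_dom_subset[of C p]
    by (intro continuous_on_dist continuous_on_compose2[OF gam_continuous] continuous_on_compose2[OF src_pt_continuous] continuous_intros) auto
  from continuous_attains_inf[OF cK K this]
  obtain z where z: "z \<in> ?K" and min: "\<And>y. y \<in> ?K \<Longrightarrow> dist (gam W T (fst z)) (src_pt W C p (snd z)) \<le> dist (gam W T (fst y)) (src_pt W C p (snd y))"
    by blast
  have s: "fst z \<in> {0..len W T}" and t: "snd z \<in> closure (src_dom W C p)" using z by auto
  have "gam W T (fst z) \<noteq> src_pt W C p (snd z)"
  proof
    assume eq: "gam W T (fst z) = src_pt W C p (snd z)"
    have "gam W T (fst z) = gam W C (snd z)" using piece_touch(3)[OF p _ s t eq] TC by blast
    moreover have "snd z \<in> {0..len W C}" using t closure_src_dom_subset by blast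
    ultimately have "gam W T (fst z) \<in> gam W C ` {0..len W C}" by (metis imageI)
    then have "gam W T (fst z) \<in> arc_of W T \<inter> arc_of W C" using imageI[OF s, of "gam W T"] unfolding arc_of_def by blast
    then show False using disj by blast
  qed
  then show ?thesis
    using min closure_subset[of "src_dom W C p"]
    by (intro exI[of _ "dist (gam W T (fst z)) (src_pt W C p (snd z))"]) force
qed

text \<open>At distance at least \<open>c\<close> every kernel and its first two derivatives along
  the target are continuous and bounded by negative powers of \<open>c\<close>, so the single and
  double layers gain two derivatives.\<close>

lemma separated_piece_operators:
  assumes p: "p \<in> pieces W C" and c: "0 < c"
    and sep: "\<And>s t. s \<in> {0..len W T} \<Longrightarrow> t \<in> src_dom W C p \<Longrightarrow> c \<le> dist (gam W T s) (src_pt W C p t)"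
  shows "L2_to_H2 (len W C) (len W T) (\<lambda>\<sigma> s. \<integral>t. \<Phi> 0 ((dist (gam W T s) (src_pt W C p t))\<^sup>2) * \<sigma> t \<partial>lebesgue_on (idom C p))"
    "L2_to_H2 (len W C) (len W T) (\<lambda>\<sigma> s. \<integral>t. del0 \<Phi> (gam W T s) (src_pt W C p t) (src_nml W C p t) * \<sigma> t \<partial>lebesgue_on (idom C p))"
    "L2_to_L2 (len W C) (len W T) (\<lambda>\<sigma> s. \<integral>t. kap1 \<Phi> (gam W T s) (nml W T s) (src_pt W C p t) * \<sigma> t \<partial>lebesgue_on (idom C p))"
    "L2_to_L2 (len W C) (len W T) (\<lambda>\<sigma> s. \<integral>t. del1 \<Phi> (gam W T s) (nml W T s) (src_pt W C p t) (src_nml W C p t) * \<sigma> t \<partial>lebesgue_on (idom C p))"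
proof -
  obtain A where A: "A \<ge> 0" "\<And>s. s \<in> {0..len W T} \<Longrightarrow> norm (acc W T s) \<le> A" using acc_bounded by blast
  obtain R where R: "R > 0" "\<And>s t. s \<in> {0..len W T} \<Longrightarrow> t \<in> {0..len W C} \<Longrightarrow> dist (gam W T s) (src_pt W C p t) \<le> R"
    using piece_dist_bounded p by blast
  obtain K where K: "0 \<le> K" "\<And>x y :: complex. 0 < dist x y \<Longrightarrow> dist x y \<le> R \<Longrightarrow>
      cmod (\<Phi> 0 ((dist x y)\<^sup>2)) \<le> K * dist x y powr (- (1/4))"
    "\<And>x x' y. 0 < dist x y \<Longrightarrow> dist x y \<le> R \<Longrightarrow> norm x' = 1 \<Longrightarrow> cmod (kap1 \<Phi> x x' y) \<le> K / dist x y"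
    "\<And>x x' x'' y. 0 < dist x y \<Longrightarrow> dist x y \<le> R \<Longrightarrow> norm x' = 1 \<Longrightarrow> norm x'' \<le> A \<Longrightarrow>
      cmod (kap2 \<Phi> x x' x'' y) \<le> K / (dist x y)\<^sup>2"
    "\<And>x y n. 0 < dist x y \<Longrightarrow> dist x y \<le> R \<Longrightarrow> norm n = 1 \<Longrightarrow> cmod (del0 \<Phi> x y n) \<le> K / dist x y"
    "\<And>x x' y n. 0 < dist x y \<Longrightarrow> dist x y \<le> R \<Longrightarrow> norm x' = 1 \<Longrightarrow> norm n = 1 \<Longrightarrow>
      cmod (del1 \<Phi> x x' y n) \<le> K / (dist x y)\<^sup>2"
    "\<And>x x' x'' y n. 0 < dist x y \<Longrightarrow> dist x y \<le> R \<Longrightarrow> norm x' = 1 \<Longrightarrow> norm x'' \<le> A \<Longrightarrow> norm n = 1 \<Longrightarrow>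
      cmod (del2 \<Phi> x x' x'' y n) \<le> K / (dist x y) ^ 3"
    by (rule kernel_bounds[OF prof R(1) A(1)]) (rule that)
  let ?D = "idom C p"
  have tD: "t \<in> src_dom W C p" "t \<in> {0..len W C}" if "t \<in> ?D" for t using subsetD[OF idom_subset(3) that] subsetD[OF idom_subset(1) that] by blast+
  define B where "B = K * c powr (- (1/4)) + K / c + K / c\<^sup>2 + K / c ^ 3"
  have parts: "0 \<le> K * c powr (- (1/4))" "0 \<le> K / c" "0 \<le> K / c\<^sup>2" "0 \<le> K / c ^ 3" using K(1) c by auto
  then have B: "0 \<le> B" unfolding B_def by linarith
  have d: "0 < dist (gam W T s) (src_pt W C p t)" "dist (gam W T s) (src_pt W C p t) \<le> R"
    "norm (src_nml W C p t) = 1" "norm (tang W T s) = 1" "norm (nml W T s) = 1" "norm (acc W T s) \<le> A"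
    "K * dist (gam W T s) (src_pt W C p t) powr (- (1/4)) \<le> B"
    "K / dist (gam W T s) (src_pt W C p t) \<le> B"
    "K / (dist (gam W T s) (src_pt W C p t))\<^sup>2 \<le> B"
    "K / dist (gam W T s) (src_pt W C p t) ^ 3 \<le> B"
    if s: "s \<in> {0..len W T}" and t: "t \<in> ?D" for s t
  proof -
    let ?r = "dist (gam W T s) (src_pt W C p t)"
    have r: "c \<le> ?r" using sep[OF s tD(1)[OF t]] .
    show "0 < ?r" using r c by linarith
    show "?r \<le> R" by (rule R(2)[OF s tD(2)[OF t]])
    show "norm (src_nml W C p t) = 1" by (rule src_nml_norm[OF p tD(2)[OF t]])
    show "norm (tang W T s) = 1" "norm (nml W T s) = 1" "norm (acc W T s) \<le> A"
      using tang_norm nml_norm A(2) s by auto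
    have "?r powr (- (1/4)) \<le> c powr (- (1/4))" by (rule powr_mono2') (use r c in auto)
    then have "K * ?r powr (- (1/4)) \<le> K * c powr (- (1/4))" by (rule mult_left_mono[OF _ K(1)])
    then show "K * ?r powr (- (1/4)) \<le> B" unfolding B_def using parts by linarith
    have q: "K / ?r ^ n \<le> K / c ^ n" for n
      by (intro divide_left_mono power_mono mult_pos_pos zero_less_power) (use r c K(1) in auto)
    show "K / ?r \<le> B" "K / ?r\<^sup>2 \<le> B" "K / ?r ^ 3 \<le> B"
      using q[of 1] q[of 2] q[of 3] parts unfolding B_def by auto
  qed
  have ne: "gam W T s \<noteq> src_pt W C p t" if "s \<in> {0..len W T}" "t \<in> ?D" for s t
    using d(1)[OF that] by auto
  have kd: "((\<lambda>s. \<Phi> 0 ((dist (gam W T s) (src_pt W C p t))\<^sup>2)) has_vector_derivative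
      kap1 \<Phi> (gam W T s) (tang W T s) (src_pt W C p t)) (at s within {0..len W T})"
    "((\<lambda>s. kap1 \<Phi> (gam W T s) (tang W T s) (src_pt W C p t)) has_vector_derivative
      kap2 \<Phi> (gam W T s) (tang W T s) (acc W T s) (src_pt W C p t)) (at s within {0..len W T})"
    "((\<lambda>s. del0 \<Phi> (gam W T s) (src_pt W C p t) (src_nml W C p t)) has_vector_derivative
      del1 \<Phi> (gam W T s) (tang W T s) (src_pt W C p t) (src_nml W C p t)) (at s within {0..len W T})"
    "((\<lambda>s. del1 \<Phi> (gam W T s) (tang W T s) (src_pt W C p t) (src_nml W C p t)) has_vector_derivative
      del2 \<Phi> (gam W T s) (tang W T s) (acc W T s) (src_pt W C p t) (src_nml W C p t)) (at s within {0..len W T})"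
    if "s \<in> {0..len W T}" "t \<in> ?D" for s t
    by (rule kernel_curve_derivs[where x = "gam W T" and x' = "tang W T" and x'' = "acc W T",
        OF prof gam_derivs(1)[OF that(1)] gam_derivs(2)[OF that(1)] ne[OF that]])+
  have ks: "continuous_on {0..len W T} (\<lambda>s. kap2 \<Phi> (gam W T s) (tang W T s) (acc W T s) (src_pt W C p t))"
    "continuous_on {0..len W T} (\<lambda>s. del2 \<Phi> (gam W T s) (tang W T s) (acc W T s) (src_pt W C p t) (src_nml W C p t))"
    "continuous_on {0..len W T} (\<lambda>s. kap1 \<Phi> (gam W T s) (nml W T s) (src_pt W C p t))"
    "continuous_on {0..len W T} (\<lambda>s. del1 \<Phi> (gam W T s) (nml W T s) (src_pt W C p t) (src_nml W C p t))"
    if "t \<in> ?D" for t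
  proof -
    note * = kernels_continuous[where x = "gam W T" and y = "\<lambda>_. src_pt W C p t",
        OF prof gam_continuous continuous_on_const ne[OF _ that]]
    show "continuous_on {0..len W T} (\<lambda>s. kap2 \<Phi> (gam W T s) (tang W T s) (acc W T s) (src_pt W C p t))"
      by (rule *(3)[OF _ tang_continuous acc_continuous]) 
    show "continuous_on {0..len W T} (\<lambda>s. del2 \<Phi> (gam W T s) (tang W T s) (acc W T s) (src_pt W C p t) (src_nml W C p t))"
      by (rule *(6)[OF _ tang_continuous acc_continuous continuous_on_const])
    show "continuous_on {0..len W T} (\<lambda>s. kap1 \<Phi> (gam W T s) (nml W T s) (src_pt W C p t))"
      by (rule *(2)[OF _ nml_continuous])
    show "continuous_on {0..len W T} (\<lambda>s. del1 \<Phi> (gam W T s) (nml W T s) (src_pt W C p t) (src_nml W C p t))"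
      by (rule *(5)[OF _ nml_continuous continuous_on_const])
  qed
  have kt: "continuous_on ?D (\<lambda>t. \<Phi> 0 ((dist (gam W T s) (src_pt W C p t))\<^sup>2))"
    "continuous_on ?D (\<lambda>t. kap1 \<Phi> (gam W T s) v (src_pt W C p t))"
    "continuous_on ?D (\<lambda>t. kap2 \<Phi> (gam W T s) v w (src_pt W C p t))"
    "continuous_on ?D (\<lambda>t. del0 \<Phi> (gam W T s) (src_pt W C p t) (src_nml W C p t))"
    "continuous_on ?D (\<lambda>t. del1 \<Phi> (gam W T s) v (src_pt W C p t) (src_nml W C p t))"
    "continuous_on ?D (\<lambda>t. del2 \<Phi> (gam W T s) v w (src_pt W C p t) (src_nml W C p t))"
    if "s \<in> {0..len W T}" for s v w
  proof -
    note * = kernels_continuous[where x = "\<lambda>_. gam W T s" and y = "src_pt W C p",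
        OF prof continuous_on_const src_continuous_idom(1) ne[OF that]]
    show "continuous_on ?D (\<lambda>t. \<Phi> 0 ((dist (gam W T s) (src_pt W C p t))\<^sup>2))" by (rule *(1))
    show "continuous_on ?D (\<lambda>t. kap1 \<Phi> (gam W T s) v (src_pt W C p t))" by (rule *(2)[OF _ continuous_on_const])
    show "continuous_on ?D (\<lambda>t. kap2 \<Phi> (gam W T s) v w (src_pt W C p t))"
      by (rule *(3)[OF _ continuous_on_const continuous_on_const])
    show "continuous_on ?D (\<lambda>t. del0 \<Phi> (gam W T s) (src_pt W C p t) (src_nml W C p t))"
      by (rule *(4)[OF _ src_continuous_idom(2)])
    show "continuous_on ?D (\<lambda>t. del1 \<Phi> (gam W T s) v (src_pt W C p t) (src_nml W C p t))"
      by (rule *(5)[OF _ continuous_on_const src_continuous_idom(2)])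
    show "continuous_on ?D (\<lambda>t. del2 \<Phi> (gam W T s) v w (src_pt W C p t) (src_nml W C p t))"
      by (rule *(6)[OF _ continuous_on_const continuous_on_const src_continuous_idom(2)])
  qed
  have bd: "cmod (\<Phi> 0 ((dist (gam W T s) (src_pt W C p t))\<^sup>2)) \<le> B \<and> cmod (kap1 \<Phi> (gam W T s) (tang W T s) (src_pt W C p t)) \<le> B \<and>
      cmod (kap2 \<Phi> (gam W T s) (tang W T s) (acc W T s) (src_pt W C p t)) \<le> B"
    "cmod (del0 \<Phi> (gam W T s) (src_pt W C p t) (src_nml W C p t)) \<le> B \<and>
      cmod (del1 \<Phi> (gam W T s) (tang W T s) (src_pt W C p t) (src_nml W C p t)) \<le> B \<and>
      cmod (del2 \<Phi> (gam W T s) (tang W T s) (acc W T s) (src_pt W C p t) (src_nml W C p t)) \<le> B"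
    "cmod (kap1 \<Phi> (gam W T s) (nml W T s) (src_pt W C p t)) \<le> B"
    "cmod (del1 \<Phi> (gam W T s) (nml W T s) (src_pt W C p t) (src_nml W C p t)) \<le> B"
    if "s \<in> {0..len W T}" "t \<in> ?D" for s t
  proof -
    note d = d[OF that]
    note * = order_trans[OF K(2)[OF d(1,2)] d(7)] order_trans[OF K(3)[OF d(1,2,4)] d(8)]
      order_trans[OF K(4)[OF d(1,2,4,6)] d(9)] order_trans[OF K(5)[OF d(1,2,3)] d(8)]
      order_trans[OF K(6)[OF d(1,2,4,3)] d(9)] order_trans[OF K(7)[OF d(1,2,4,6,3)] d(10)]
      order_trans[OF K(3)[OF d(1,2,5)] d(8)] order_trans[OF K(6)[OF d(1,2,5,3)] d(9)]
    show "cmod (\<Phi> 0 ((dist (gam W T s) (src_pt W C p t))\<^sup>2)) \<le> B \<and> cmod (kap1 \<Phi> (gam W T s) (tang W T s) (src_pt W C p t)) \<le> B \<and>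
        cmod (kap2 \<Phi> (gam W T s) (tang W T s) (acc W T s) (src_pt W C p t)) \<le> B"
      by (intro conjI *)
    show "cmod (del0 \<Phi> (gam W T s) (src_pt W C p t) (src_nml W C p t)) \<le> B \<and>
        cmod (del1 \<Phi> (gam W T s) (tang W T s) (src_pt W C p t) (src_nml W C p t)) \<le> B \<and>
        cmod (del2 \<Phi> (gam W T s) (tang W T s) (acc W T s) (src_pt W C p t) (src_nml W C p t)) \<le> B"
      by (intro conjI *)
    show "cmod (kap1 \<Phi> (gam W T s) (nml W T s) (src_pt W C p t)) \<le> B"
      "cmod (del1 \<Phi> (gam W T s) (nml W T s) (src_pt W C p t) (src_nml W C p t)) \<le> B" by (rule *)+
  qed
  note smooth = L2_to_H2_smooth_kernel[OF len_pos len_pos idom_sets idom_subset(1) B]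
    and bdd = L2_to_L2_bounded_kernel[OF len_pos len_pos idom_sets idom_subset(1) B]
  show "L2_to_H2 (len W C) (len W T) (\<lambda>\<sigma> s. \<integral>t. \<Phi> 0 ((dist (gam W T s) (src_pt W C p t))\<^sup>2) * \<sigma> t \<partial>lebesgue_on ?D)"
    by (rule smooth[OF kd(1) kd(2) ks(1) kt(1) kt(2) kt(3) bd(1)])
  show "L2_to_H2 (len W C) (len W T) (\<lambda>\<sigma> s. \<integral>t. del0 \<Phi> (gam W T s) (src_pt W C p t) (src_nml W C p t) * \<sigma> t \<partial>lebesgue_on ?D)"
    by (rule smooth[OF kd(3) kd(4) ks(2) kt(4) kt(5) kt(6) bd(2)])
  show "L2_to_L2 (len W C) (len W T) (\<lambda>\<sigma> s. \<integral>t. kap1 \<Phi> (gam W T s) (nml W T s) (src_pt W C p t) * \<sigma> t \<partial>lebesgue_on ?D)"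
    by (rule bdd[OF ks(3) kt(2) bd(3)])
  show "L2_to_L2 (len W C) (len W T) (\<lambda>\<sigma> s. \<integral>t. del1 \<Phi> (gam W T s) (nml W T s) (src_pt W C p t) (src_nml W C p t) * \<sigma> t \<partial>lebesgue_on ?D)"
    by (rule bdd[OF ks(4) kt(5) bd(4)])
qed

lemma constants: "0 < wnum W" "c1 W \<noteq> 0" "kGam W \<noteq> 0" "neumann_green (kGam W) (len W (Star i)) (greenF W i)"
proof -
  show "0 < wnum W" "c1 W \<noteq> 0" "neumann_green (kGam W) (len W (Star i)) (greenF W i)"
    using constants_W by (simp_all add: waveguide_constants_def)
  have "0 < Im (kGam W)" using constants_W by (simp add: waveguide_constants_def)
  then show "kGam W \<noteq> 0" by force
qed

lemma L2_to_H2_Gop: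
  assumes "L2_to_L2 M (len W (Star i)) Q"
  shows "L2_to_H2 M (len W (Star i)) (\<lambda>\<sigma> s. Gop W i (Q \<sigma>) s)"
  unfolding Gop_def by (rule L2_to_H2_green[OF len_pos constants(3) constants(4) assms])

text \<open>The two walls are disjoint, fins included, so all kernels are regular and
  \<open>Dop'\<close> is an ordinary integral here.\<close>

lemma L2_to_H2_K_star_cross:
  "L2_to_H2 (len W (Star i)) (len W (Star (\<not> i))) (K_star_cross W i)"
proof -
  let ?T = "Star (\<not> i)" and ?C = "Star i"
  let ?M = "len W ?C" and ?L = "len W ?T"
  have TC: "?T \<noteq> ?C" by simp
  have "arc_of W ?T \<inter> arc_of W ?C = {}" using stars_disjoint by blast
  note sep = separated_curves[OF _ TC this]
  have "\<forall>p\<in>pieces W ?C. \<exists>c>0. \<forall>s\<in>{0..?L}. \<forall>t\<in>src_dom W ?C p. c \<le> dist (gam W ?T s) (src_pt W ?C p t)"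
    using sep by blast
  from bchoice[OF this] obtain c where c: "\<And>p. p \<in> pieces W ?C \<Longrightarrow> 0 < c p"
    "\<And>p s t. p \<in> pieces W ?C \<Longrightarrow> s \<in> {0..?L} \<Longrightarrow> t \<in> src_dom W ?C p \<Longrightarrow> c p \<le> dist (gam W ?T s) (src_pt W ?C p t)"
    by blast
  \<comment> \<open>One distance valid for all pieces, since the finite part in \<open>Dop'\<close>
    is taken of their sum.\<close>
  define m where "m = Min (c ` pieces W ?C)"
  have ne: "pieces W ?C \<noteq> {}" by (simp add: pieces_def)
  have m: "0 < m" using c(1) finite_pieces ne by (simp add: m_def)
  have mle: "m \<le> dist (gam W ?T s) (src_pt W ?C p t)" if "p \<in> pieces W ?C" "s \<in> {0..?L}" "t \<in> src_dom W ?C p" for p s t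
  proof -
    have "m \<le> c p" unfolding m_def using finite_pieces that(1) by (intro Min_le) auto
    then show ?thesis using c(2)[OF that] by linarith
  qed
  note so = separated_piece_operators[OF _ m mle]
  have S: "L2_to_H2 ?M ?L (Sop W ?T ?C)"
    by (rule L2_to_H2_cong[OF L2_to_H2_sum[OF finite_pieces L2_to_H2_scale[OF so(1)]] len_pos Sop_pieces]) assumption+
  have D: "L2_to_H2 ?M ?L (Dop W ?T ?C)"
    by (rule L2_to_H2_cong[OF L2_to_H2_sum[OF finite_pieces L2_to_H2_scale[OF so(2)]] len_pos Dop_pieces]) assumption+
  have S': "L2_to_L2 ?M ?L (Sop' W ?T ?C)"
    by (rule L2_to_L2_cong[OF L2_to_L2_sum[OF finite_pieces L2_to_L2_scale[OF so(3)]] Sop'_pieces]) (assumption | simp)+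
  have D': "L2_to_L2 ?M ?L (Dop' W ?T ?C)"
  proof (rule L2_to_L2_cong[OF L2_to_L2_sum[OF finite_pieces L2_to_L2_scale]])
    show "L2_to_L2 ?M ?L (\<lambda>\<sigma> s. \<integral>t. del1 \<Phi> (gam W ?T s) (nml W ?T s) (src_pt W ?C p t) (src_nml W ?C p t) * \<sigma> t \<partial>lebesgue_on (idom ?C p))"
      if "p \<in> pieces W ?C" for p
      by (rule separated_piece_operators(4)[OF that m mle[OF that]])
    fix \<sigma> s assume "s \<in> {0<..<?L}"
    then have s: "s \<in> {0..?L}" by auto
    show "Dop' W ?T ?C \<sigma> s = (\<Sum>p\<in>pieces W ?C. src_sgn ?C p *
        (\<integral>t. del1 \<Phi> (gam W ?T s) (nml W ?T s) (src_pt W ?C p t) (src_nml W ?C p t) * \<sigma> t \<partial>lebesgue_on (idom ?C p)))"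
      by (rule Dop'_pieces[OF s m mle[OF _ s]])
  qed
  have E: "L2_to_H2 ?M ?L (\<lambda>\<sigma> s. Dop W ?T ?C \<sigma> s + (- (1 / c1 W)) * Sop W ?T ?C \<sigma> s)"
    by (rule L2_to_H2_add[OF D L2_to_H2_scale[OF S]])
  have E': "L2_to_L2 ?M ?L (\<lambda>\<sigma> s. Dop' W ?T ?C \<sigma> s + (- (1 / c1 W)) * Sop' W ?T ?C \<sigma> s)"
    by (rule L2_to_L2_add[OF D' L2_to_L2_scale[OF S']])
  have "L2_to_H2 ?M ?L (\<lambda>\<sigma> s.
      (c1 W * (Dop W ?T ?C \<sigma> s + (- (1 / c1 W)) * Sop W ?T ?C \<sigma> s)
      + (- (1 / c1 W)) * Gop W (\<not> i) (\<lambda>s. Dop W ?T ?C \<sigma> s + (- (1 / c1 W)) * Sop W ?T ?C \<sigma> s) s)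
      + Gop W (\<not> i) (\<lambda>s. Dop' W ?T ?C \<sigma> s + (- (1 / c1 W)) * Sop' W ?T ?C \<sigma> s) s)"
    by (rule L2_to_H2_add, rule L2_to_H2_add, rule L2_to_H2_scale, rule E, rule L2_to_H2_scale,
      rule L2_to_H2_Gop, rule L2_to_H2_imp_L2_to_L2, rule E, rule L2_to_H2_Gop, rule E')
  then show ?thesis
    by (rule L2_to_H2_cong[OF _ len_pos])
      (simp only: K_star_cross_def Let_def mult_minus_left add_uminus_conv_diff)
qed

end

text \<open>Extension by 0 turns a kernel that lives on part of the interval into one square
  integrable function. Cauchy-Schwarz and weak convergence are then applied to this
  function.\<close>

lemma L2_extension:
  fixes k :: "real \<Rightarrow> complex"
  assumes D: "D \<in> sets lebesgue" "D \<subseteq> {0..M}" and k: "k \<in> borel_measurable (lebesgue_on D)"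
    and h: "sqi (lebesgue_on {0..M}) h" and le: "\<And>t. t \<in> D \<Longrightarrow> cmod (k t) \<le> \<bar>h t\<bar>"
  shows "(\<lambda>t. if t \<in> D then k t else 0) \<in> L2_carr M"
    "\<sigma> \<in> L2_carr M \<Longrightarrow> integrable (lebesgue_on D) (\<lambda>t. k t * \<sigma> t)"
    "\<sigma> \<in> L2_carr M \<Longrightarrow> (\<integral>t. k t * \<sigma> t \<partial>lebesgue_on D) =
       (\<integral>t. (if t \<in> D then k t else 0) * \<sigma> t \<partial>lebesgue_on {0..M})"
    "\<sigma> \<in> L2_carr M \<Longrightarrow> cmod (\<integral>t. k t * \<sigma> t \<partial>lebesgue_on D) \<le>
       sqrt (\<integral>t. (h t)\<^sup>2 \<partial>lebesgue_on {0..M}) * sqrt (L2_sq M \<sigma>)"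
proof -
  let ?k = "\<lambda>t. if t \<in> D then k t else 0"
  have "?k \<in> borel_measurable lebesgue" by (rule borel_measurable_if_I[OF k D(1)])
  then have m: "?k \<in> borel_measurable (lebesgue_on {0..M})" by (rule measurable_restrict_space1)
  note b = L2_bound[OF h m]
  show L2: "?k \<in> L2_carr M" by (rule b(1)) (use le in auto)
  have sq: "L2_sq M ?k \<le> (\<integral>t. (h t)\<^sup>2 \<partial>lebesgue_on {0..M})" by (rule b(2)) (use le in auto)
  assume \<sigma>: "\<sigma> \<in> L2_carr M"
  note p = L2_pairing[OF L2 \<sigma>]
  have "integrable (lebesgue_on D) (\<lambda>t. ?k t * \<sigma> t)"
    by (rule integrable_lebesgue_on_subset[OF p(1) _ D]) simp
  moreover have "integrable (lebesgue_on D) (\<lambda>t. ?k t * \<sigma> t) \<longleftrightarrow> integrable (lebesgue_on D) (\<lambda>t. k t * \<sigma> t)"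
    by (rule Bochner_Integration.integrable_cong) auto
  ultimately show "integrable (lebesgue_on D) (\<lambda>t. k t * \<sigma> t)" by blast
  have "(\<integral>t. k t * \<sigma> t \<partial>lebesgue_on D) = (\<integral>t. indicator D t *\<^sub>R (k t * \<sigma> t) \<partial>lebesgue_on {0..M})"
    by (rule integral_lebesgue_on_subset[OF _ D]) simp
  also have "\<dots> = (\<integral>t. ?k t * \<sigma> t \<partial>lebesgue_on {0..M})"
    by (rule Bochner_Integration.integral_cong) (auto simp: indicator_def)
  finally show eq: "(\<integral>t. k t * \<sigma> t \<partial>lebesgue_on D) = (\<integral>t. ?k t * \<sigma> t \<partial>lebesgue_on {0..M})" .
  have "sqrt (L2_sq M ?k) * sqrt (L2_sq M \<sigma>) \<le> sqrt (\<integral>t. (h t)\<^sup>2 \<partial>lebesgue_on {0..M}) * sqrt (L2_sq M \<sigma>)"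
    using sq by (intro mult_right_mono) (auto simp: L2_sq_nonneg)
  then show "cmod (\<integral>t. k t * \<sigma> t \<partial>lebesgue_on D) \<le> sqrt (\<integral>t. (h t)\<^sup>2 \<partial>lebesgue_on {0..M}) * sqrt (L2_sq M \<sigma>)"
    unfolding eq using p(2) by linarith
qed

lemma powr_quarter_sq: "(x powr (- (1/4)))\<^sup>2 = x powr (- (1/2))" for x :: real
  by (cases "x = 0") (simp_all add: power2_eq_square flip: powr_add)

lemma sqi_edge_powr:
  assumes "0 \<le> M"
  shows "sqi (lebesgue_on {0..M}) (\<lambda>t. B * edge M t powr (- (1/4)))"
proof -
  have "edge M \<in> borel_measurable (lebesgue_on {0..M})"
    by (intro borel_measurable_continuous_on[where f = "edge M", unfolded o_def] continuous_on_edge continuous_on_id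
        measurable_restrict_space1) (auto intro: measurable_completion)
  then have "(\<lambda>t. B * edge M t powr (- (1/4))) \<in> borel_measurable (lebesgue_on {0..M})" by measurable
  moreover have "integrable (lebesgue_on {0..M}) (\<lambda>t. B\<^sup>2 * edge M t powr (- (1/2)))"
    by (intro integrable_mult_right powr_edge_integral(1)) (use assms in auto)
  ultimately show ?thesis by (simp add: sqi_def power_mult_distrib powr_quarter_sq)
qed

text \<open>The function and its two derivatives are all handled by Hilbert's inequality. Continuity
  up to the ends uses the stronger bound on \<open>k0\<close>: it is dominated by a multiple of the
  power -1/4 of \<open>edge M t\<close>, which is independent of \<open>s\<close> and square
  integrable.\<close>

lemma L2_to_H2_edge_kernel:
  fixes k0 k1 k2 :: "real \<Rightarrow> real \<Rightarrow> complex"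
  assumes L: "0 < L" and M: "0 < M" and B: "0 \<le> B" and Ddef: "D = {0<..<M}"
    and d: "\<And>s t. s \<in> {0<..<L} \<Longrightarrow> t \<in> D \<Longrightarrow> ((\<lambda>s. k0 s t) has_vector_derivative k1 s t) (at s)"
      "\<And>s t. s \<in> {0<..<L} \<Longrightarrow> t \<in> D \<Longrightarrow> ((\<lambda>s. k1 s t) has_vector_derivative k2 s t) (at s)"
    and c0: "\<And>t. t \<in> D \<Longrightarrow> continuous_on {0..L} (\<lambda>s. k0 s t)"
    and c2: "\<And>t. t \<in> D \<Longrightarrow> continuous_on {0<..<L} (\<lambda>s. k2 s t)"
    and m0: "\<And>s. s \<in> {0..L} \<Longrightarrow> k0 s \<in> borel_measurable (lebesgue_on D)"
    and m1: "\<And>s. s \<in> {0<..<L} \<Longrightarrow> k1 s \<in> borel_measurable (lebesgue_on D)"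
    and m2: "\<And>s. s \<in> {0<..<L} \<Longrightarrow> k2 s \<in> borel_measurable (lebesgue_on D)"
    and b0: "\<And>s t. s \<in> {0..L} \<Longrightarrow> t \<in> D \<Longrightarrow> cmod (k0 s t) \<le> B * (edge L s + edge M t) powr (- (1/4))"
    and b1: "\<And>s t. s \<in> {0<..<L} \<Longrightarrow> t \<in> D \<Longrightarrow> cmod (k1 s t) \<le> B / (edge L s + edge M t)"
    and b2: "\<And>s t. s \<in> {0<..<L} \<Longrightarrow> t \<in> D \<Longrightarrow> cmod (k2 s t) \<le> B / (edge L s + edge M t)"
  shows "L2_to_H2 M L (\<lambda>\<sigma> s. \<integral>t. k0 s t * \<sigma> t \<partial>lebesgue_on D)"
proof -
  have D: "D \<in> sets lebesgue" "D \<subseteq> {0..M}" using Ddef by auto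
  have sp: "space (lebesgue_on D) = D" by simp
  have et: "0 < edge M t" if "t \<in> D" for t using edge_pos that Ddef by auto
  have int: "{0<..<L} \<subseteq> {0..L}" by auto
  \<comment> \<open>The weaker singularity of \<open>k0\<close> is turned into that of the Hilbert
    kernel: the missing power 3/4 of the total weight is at most that power of L + M.\<close>
  define B' where "B' = B * (L + M) powr (3/4)"
  have B': "0 \<le> B'" using B by (simp add: B'_def)
  have b0': "cmod (k0 s t) \<le> B' / (edge L s + edge M t)" if s: "s \<in> {0<..<L}" and t: "t \<in> D" for s t
  proof -
    let ?m = "edge L s + edge M t"
    have m: "0 < ?m" using edge_pos[OF s] et[OF t] by simp
    have "edge L s \<le> L" "edge M t \<le> M" using edge_le s t Ddef by (auto simp: edge_def)
    then have "?m powr (3/4) \<le> (L + M) powr (3/4)" using m by (intro powr_mono2) auto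
    moreover have "?m powr (- (1/4)) = ?m powr (3/4) / ?m"
      using m powr_diff[of ?m "3/4" 1] by simp
    ultimately have "B * ?m powr (- (1/4)) \<le> B * ((L + M) powr (3/4) / ?m)"
      using m B by (simp add: divide_right_mono mult_left_mono)
    then show ?thesis using b0[OF subsetD[OF int s] t] by (simp add: B'_def)
  qed
  have cs: "continuous_on {0<..<L} (\<lambda>s. k0 s t)" "continuous_on {0<..<L} (\<lambda>s. k1 s t)" if "t \<in> D" for t
  proof -
    show "continuous_on {0<..<L} (\<lambda>s. k0 s t)" by (rule continuous_on_subset[OF c0[OF that] int])
    show "continuous_on {0<..<L} (\<lambda>s. k1 s t)"
      using has_vector_derivative_continuous[OF d(2)[OF _ that]] by (intro continuous_at_imp_continuous_on) blast
  qed
  have H: "L2_to_L2 M L (\<lambda>\<sigma> s. \<integral>t. k0 s t * \<sigma> t \<partial>lebesgue_on D)"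
    "L2_to_L2 M L (\<lambda>\<sigma> s. \<integral>t. k1 s t * \<sigma> t \<partial>lebesgue_on D)"
    "L2_to_L2 M L (\<lambda>\<sigma> s. \<integral>t. k2 s t * \<sigma> t \<partial>lebesgue_on D)"
    by (rule L2_to_L2_hilbert_kernel[OF L M D B' cs(1) m0[OF subsetD[OF int]] b0'], assumption+)
      (rule L2_to_L2_hilbert_kernel[OF L M D B cs(2) m1 b1], assumption+,
       rule L2_to_L2_hilbert_kernel[OF L M D B c2 m2 b2], assumption+)
  have der: "((\<lambda>s. \<integral>t. k s t * \<sigma> t \<partial>lebesgue_on D) has_vector_derivative (\<integral>t. k' s0 t * \<sigma> t \<partial>lebesgue_on D)) (at s0)"
    if \<sigma>: "\<sigma> \<in> L2_carr M" and s0: "s0 \<in> {0<..<L}"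
      and dk: "\<And>s t. s \<in> {0<..<L} \<Longrightarrow> t \<in> D \<Longrightarrow> ((\<lambda>s. k s t) has_vector_derivative k' s t) (at s)"
      and mk: "\<And>s. s \<in> {0<..<L} \<Longrightarrow> k s \<in> borel_measurable (lebesgue_on D)"
        "\<And>s. s \<in> {0<..<L} \<Longrightarrow> k' s \<in> borel_measurable (lebesgue_on D)"
      and bk: "\<And>s t. s \<in> {0<..<L} \<Longrightarrow> t \<in> D \<Longrightarrow> cmod (k s t) \<le> A / (edge L s + edge M t)"
        "\<And>s t. s \<in> {0<..<L} \<Longrightarrow> t \<in> D \<Longrightarrow> cmod (k' s t) \<le> A / (edge L s + edge M t)"
      and A: "0 \<le> A" for k k' \<sigma> s0 A
  proof -
    let ?X = "{s0 / 2<..<(s0 + L) / 2}"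
    have e: "0 < edge L s0 / 2" using edge_pos[OF s0] by simp
    have X: "s \<in> {0<..<L}" "edge L s0 / 2 \<le> edge L s" if "s \<in> ?X" for s
      using that s0 by (auto simp: edge_def)
    have bd: "A / (edge L s + edge M t) \<le> A / (edge L s0 / 2)" if "s \<in> ?X" "t \<in> D" for s t
      using e X(2)[OF that(1)] et[OF that(2)] A by (intro divide_left_mono) auto
    have s0X: "s0 \<in> ?X" using s0 by auto
    have "((\<lambda>s. \<integral>t. k s t * \<sigma> t \<partial>lebesgue_on D) has_vector_derivative (\<integral>t. k' s0 t * \<sigma> t \<partial>lebesgue_on D)) (at s0 within ?X)"
    proof (rule kernel_derivative[OF _ s0X L1_subset_bound(1)[OF \<sigma> M D], where B = "A / (edge L s0 / 2)"])
      show "convex ?X" by simp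
      fix s assume s: "s \<in> ?X"
      show "k s \<in> borel_measurable (lebesgue_on D)" "k' s \<in> borel_measurable (lebesgue_on D)"
        using mk[OF X(1)[OF s]] by auto
      fix t assume "t \<in> space (lebesgue_on D)"
      then have t: "t \<in> D" by simp
      show "((\<lambda>s. k s t) has_vector_derivative k' s t) (at s within ?X)"
        by (rule has_vector_derivative_at_within[OF dk[OF X(1)[OF s] t]])
      show "norm (k s t) \<le> A / (edge L s0 / 2)" "norm (k' s t) \<le> A / (edge L s0 / 2)"
        using bk(1)[OF X(1)[OF s] t] bk(2)[OF X(1)[OF s] t] bd[OF s t] by linarith+
    qed
    then show ?thesis using at_within_open[OF s0X] by simp
  qed
  have cu: "continuous_on {0..L} (\<lambda>s. \<integral>t. k0 s t * \<sigma> t \<partial>lebesgue_on D)" if \<sigma>: "\<sigma> \<in> L2_carr M" for \<sigma>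
    unfolding continuous_on_eq_continuous_within
  proof
    fix s0 assume s0: "s0 \<in> {0..L}"
    let ?g = "\<lambda>t. complex_of_real (B * edge M t powr (- (1/4)))"
    have "edge M \<in> borel_measurable (lebesgue_on D)"
      by (intro borel_measurable_continuous_on[where f = "edge M", unfolded o_def] continuous_on_edge continuous_on_id
        measurable_restrict_space1) (auto intro: measurable_completion)
    then have mg: "?g \<in> borel_measurable (lebesgue_on D)" by measurable
    have "integrable (lebesgue_on D) (\<lambda>t. ?g t * \<sigma> t)"
      by (rule L2_extension(2)[OF D mg sqi_edge_powr[where B = B] _ \<sigma>]) (use M in \<open>auto simp: abs_mult norm_mult\<close>)
    from integrable_norm[OF this]
    have g: "integrable (lebesgue_on D) (\<lambda>t. cmod (?g t * \<sigma> t))" .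
    have m\<sigma>: "\<sigma> \<in> borel_measurable (lebesgue_on D)" using L1_subset_bound(1)[OF \<sigma> M D] by simp
    show "continuous (at s0 within {0..L}) (\<lambda>s. \<integral>t. k0 s t * \<sigma> t \<partial>lebesgue_on D)"
    proof (rule param_continuous[OF _ s0 _ _ g])
      show "(\<lambda>t. k0 s t * \<sigma> t) \<in> borel_measurable (lebesgue_on D)" if "s \<in> {0..L}" for s
        using m0[OF that] m\<sigma> by (rule borel_measurable_times)
      show "AE t in lebesgue_on D. continuous (at s0 within {0..L}) (\<lambda>s. k0 s t * \<sigma> t)"
      proof (rule AE_I2)
        fix t assume "t \<in> space (lebesgue_on D)"
        then have "continuous (at s0 within {0..L}) (\<lambda>s. k0 s t)"
          using c0 s0 by (simp add: continuous_on_eq_continuous_within)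
        then show "continuous (at s0 within {0..L}) (\<lambda>s. k0 s t * \<sigma> t)"
          by (rule continuous_mult[OF _ continuous_const])
      qed
      show "AE t in lebesgue_on D. norm (k0 s t * \<sigma> t) \<le> cmod (?g t * \<sigma> t)" if s: "s \<in> {0..L}" for s
      proof (rule AE_I2)
        fix t assume "t \<in> space (lebesgue_on D)"
        then have t: "t \<in> D" by simp
        have "(edge L s + edge M t) powr (- (1/4)) \<le> edge M t powr (- (1/4))"
          using et[OF t] edge_nonneg[OF s] by (intro powr_mono2') auto
        then have "B * (edge L s + edge M t) powr (- (1/4)) \<le> B * edge M t powr (- (1/4))"
          by (rule mult_left_mono[OF _ B])
        then have "cmod (k0 s t) \<le> B * edge M t powr (- (1/4))" using b0[OF s t] by linarith
        also have "\<dots> = cmod (?g t)" using B by (simp add: norm_mult)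
        finally show "norm (k0 s t * \<sigma> t) \<le> cmod (?g t * \<sigma> t)"
          unfolding norm_mult by (rule mult_right_mono) simp
      qed
    qed
  qed
  obtain C0 where C0: "0 \<le> C0" "\<And>\<sigma>. \<sigma> \<in> L2_carr M \<Longrightarrow>
      L2_bounded L (\<lambda>s. \<integral>t. k0 s t * \<sigma> t \<partial>lebesgue_on D) (C0 * sqrt (L2_sq M \<sigma>))"
    using H(1) unfolding L2_to_L2_def by blast
  obtain C1 where C1: "0 \<le> C1" "\<And>\<sigma>. \<sigma> \<in> L2_carr M \<Longrightarrow>
      L2_bounded L (\<lambda>s. \<integral>t. k1 s t * \<sigma> t \<partial>lebesgue_on D) (C1 * sqrt (L2_sq M \<sigma>))"
    using H(2) unfolding L2_to_L2_def by blast
  obtain C2 where C2: "0 \<le> C2" "\<And>\<sigma>. \<sigma> \<in> L2_carr M \<Longrightarrow>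
      L2_bounded L (\<lambda>s. \<integral>t. k2 s t * \<sigma> t \<partial>lebesgue_on D) (C2 * sqrt (L2_sq M \<sigma>))"
    using H(3) unfolding L2_to_L2_def by blast
  show ?thesis
    unfolding L2_to_H2_def
  proof (intro exI[of _ "C0 + C1 + C2"] conjI ballI)
    show "0 \<le> C0 + C1 + C2" using C0(1) C1(1) C2(1) by simp
    fix \<sigma> assume \<sigma>: "\<sigma> \<in> L2_carr M"
    let ?n = "sqrt (L2_sq M \<sigma>)"
    have n: "0 \<le> ?n" by (simp add: L2_sq_nonneg)
    have le: "(C * ?n)\<^sup>2 \<le> ((C0 + C1 + C2) * ?n)\<^sup>2" if "0 \<le> C" "C \<le> C0 + C1 + C2" for C
      using that n by (intro power_mono mult_right_mono) auto
    have C: "C0 \<le> C0 + C1 + C2" "C1 \<le> C0 + C1 + C2" "C2 \<le> C0 + C1 + C2" using C0(1) C1(1) C2(1) by auto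
    define A where "A = B + B'"
    have A: "0 \<le> A" "B \<le> A" "B' \<le> A" using B B' by (auto simp: A_def)
    have up: "x / (edge L s + edge M t) \<le> A / (edge L s + edge M t)" if "x \<le> A" "s \<in> {0<..<L}" "t \<in> D" for x s t
      using that edge_pos[OF that(2)] et[OF that(3)] by (intro divide_right_mono) auto
    show "H2_bounded L (\<lambda>s. \<integral>t. k0 s t * \<sigma> t \<partial>lebesgue_on D) ((C0 + C1 + C2) * ?n)"
    proof (rule H2_boundedI[where v = "\<lambda>s. \<integral>t. k1 s t * \<sigma> t \<partial>lebesgue_on D" and w = "\<lambda>s. \<integral>t. k2 s t * \<sigma> t \<partial>lebesgue_on D"])
      fix s assume s: "s \<in> {0<..<L}"
      show "((\<lambda>s. \<integral>t. k0 s t * \<sigma> t \<partial>lebesgue_on D) has_vector_derivative (\<integral>t. k1 s t * \<sigma> t \<partial>lebesgue_on D)) (at s)"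
        by (rule der[OF \<sigma> s d(1) m0[OF subsetD[OF int]] m1 order_trans[OF b0' up[OF A(3)]] order_trans[OF b1 up[OF A(2)]] A(1)])
      show "((\<lambda>s. \<integral>t. k1 s t * \<sigma> t \<partial>lebesgue_on D) has_vector_derivative (\<integral>t. k2 s t * \<sigma> t \<partial>lebesgue_on D)) (at s)"
        by (rule der[OF \<sigma> s d(2) m1 m2 b1 b2 B])
    next
      show "0 \<le> (C0 + C1 + C2) * ?n" using n C0(1) C1(1) C2(1) by simp
      show "continuous_on {0..L} (\<lambda>s. \<integral>t. k0 s t * \<sigma> t \<partial>lebesgue_on D)" by (rule cu[OF \<sigma>])
      note b = C0(2)[OF \<sigma>, unfolded L2_bounded_def, THEN conjunct2, THEN conjunct2]
        C1(2)[OF \<sigma>, unfolded L2_bounded_def, THEN conjunct2, THEN conjunct2]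
        C2(2)[OF \<sigma>, unfolded L2_bounded_def, THEN conjunct2, THEN conjunct2]
      show "(\<lambda>s. \<integral>t. k0 s t * \<sigma> t \<partial>lebesgue_on D) \<in> L2_carr L"
        "(\<lambda>s. \<integral>t. k1 s t * \<sigma> t \<partial>lebesgue_on D) \<in> L2_carr L"
        "(\<lambda>s. \<integral>t. k2 s t * \<sigma> t \<partial>lebesgue_on D) \<in> L2_carr L"
        by (rule b[THEN conjunct1])+
      show "L2_sq L (\<lambda>s. \<integral>t. k0 s t * \<sigma> t \<partial>lebesgue_on D) \<le> ((C0 + C1 + C2) * ?n)\<^sup>2"
        by (rule order_trans[OF b(1)[THEN conjunct2] le[OF C0(1) C(1)]])
      show "L2_sq L (\<lambda>s. \<integral>t. k1 s t * \<sigma> t \<partial>lebesgue_on D) \<le> ((C0 + C1 + C2) * ?n)\<^sup>2"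
        by (rule order_trans[OF b(2)[THEN conjunct2] le[OF C1(1) C(2)]])
      show "L2_sq L (\<lambda>s. \<integral>t. k2 s t * \<sigma> t \<partial>lebesgue_on D) \<le> ((C0 + C1 + C2) * ?n)\<^sup>2"
        by (rule order_trans[OF b(3)[THEN conjunct2] le[OF C2(1) C(3)]])
    qed
  qed
qed

section \<open>Cancellation between an end cap and its fin at a corner\<close>

lemma profile_difference:
  assumes prof: "profile k \<Phi>" and C: "0 \<le> C" "\<And>q. 0 < q \<Longrightarrow> q \<le> Q \<Longrightarrow> cmod (\<Phi> (Suc n) q) \<le> C / q ^ Suc n"
    and n: "n < 3" and a: "0 < a" and q: "a \<le> q" "q \<le> Q" "a \<le> q'" "q' \<le> Q"
  shows "cmod (\<Phi> n q - \<Phi> n q') \<le> C / a ^ Suc n * \<bar>q - q'\<bar>"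
proof (rule real_mvt_bound[where X = "{a..Q}"])
  fix x assume "x \<in> {a..Q}"
  then have x: "a \<le> x" "x \<le> Q" "0 < x" using a by auto
  show "(\<Phi> n has_vector_derivative \<Phi> (Suc n) x) (at x within {a..Q})"
    by (rule has_vector_derivative_at_within[OF profileD(2)[OF prof n x(3)]])
  have "C / x ^ Suc n \<le> C / a ^ Suc n"
    using x a C(1) by (intro divide_left_mono power_mono mult_pos_pos zero_less_power) auto
  then show "norm (\<Phi> (Suc n) x) \<le> C / a ^ Suc n" using C(2)[OF x(3,2)] by linarith
qed (use q in auto)

text \<open>Each of the two kernels has the order m^(-2). Passing from \<open>y\<close> to its
  mirror image \<open>z\<close> changes the factor 2 (x - y) . x' by O(m^2), the coefficient of
  \<open>\<Phi> 1\<close> by O(m) and the squared distance by O(m^3). Their sizes are m, 1 and m^2,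
  so each change gains one order, paid for by the curvature bound \<open>A\<close>.\<close>

lemma kap2_difference_bound:
  fixes x x' x'' y z \<tau> :: complex
  assumes prof: "profile k \<Phi>" and C: "0 \<le> C"
    "\<And>q n. 0 < q \<Longrightarrow> q \<le> Q \<Longrightarrow> n \<in> {1,2,3} \<Longrightarrow> cmod (\<Phi> n q) \<le> C / q ^ n"
    and c: "0 < c" and m: "0 < m" "m \<le> R" and A: "0 \<le> A"
    and yz: "y - z = (2 * g) *\<^sub>R \<tau>" and g: "\<bar>g\<bar> \<le> m"
    and x: "norm (x - y) \<le> m" "norm (x - z) \<le> m" "norm x' = 1" "norm x'' \<le> A"
    and \<tau>: "\<bar>\<tau> \<bullet> x'\<bar> \<le> A * m" "\<bar>\<tau> \<bullet> x''\<bar> \<le> A"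
    and q: "(dist x z)\<^sup>2 - (dist x y)\<^sup>2 = 4 * g * h" and h: "\<bar>h\<bar> \<le> A * m\<^sup>2"
    and sep: "c * m \<le> dist x y" "c * m \<le> dist x z" and Q: "(dist x y)\<^sup>2 \<le> Q" "(dist x z)\<^sup>2 \<le> Q"
  shows "cmod (kap2 \<Phi> x x' x'' y - kap2 \<Phi> x x' x'' z) \<le>
    (16 * A * C / c ^ 4 + 16 * A * C / c ^ 6 + 4 * A * C / c\<^sup>2 + (2 + 2 * A * R) * (4 * A * C / c ^ 4)) / m"
proof -
  define a where "a = 2 * ((x - y) \<bullet> x')"
  define b where "b = 2 * ((x - z) \<bullet> x')"
  define e where "e = 2 * (x' \<bullet> x') + 2 * ((x - y) \<bullet> x'')"
  define f where "f = 2 * (x' \<bullet> x') + 2 * ((x - z) \<bullet> x'')"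
  define q1 where "q1 = (dist x y)\<^sup>2"
  define q2 where "q2 = (dist x z)\<^sup>2"
  define r where "r = (c * m)\<^sup>2"
  have cm: "0 < c * m" using c m by simp
  have r: "0 < r" "r \<le> q1" "r \<le> q2" using sep cm unfolding r_def q1_def q2_def by (auto intro!: power_mono)
  have ip: "\<bar>v \<bullet> w\<bar> \<le> M * N" if "norm v \<le> M" "norm w \<le> N" "0 \<le> M" for v w :: complex and M N
    using Cauchy_Schwarz_ineq2[of v w] mult_mono[OF that(1,2,3) norm_ge_zero] by linarith
  have y: "x - z = (x - y) + (2 * g) *\<^sub>R \<tau>" using yz by (simp add: algebra_simps)
  have dab: "b - a = 4 * (g * (\<tau> \<bullet> x'))" unfolding a_def b_def y by (simp add: inner_add_left)
  have def_: "f - e = 4 * (g * (\<tau> \<bullet> x''))" unfolding e_def f_def y by (simp add: inner_add_left)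
  have ab: "\<bar>a\<bar> \<le> 2 * m" "\<bar>b\<bar> \<le> 2 * m"
    using ip[OF x(1), of x' 1] ip[OF x(2), of x' 1] x(3) m by (auto simp: a_def b_def)
  have gx: "\<bar>g * (\<tau> \<bullet> x')\<bar> \<le> m * (A * m)" "\<bar>g * (\<tau> \<bullet> x'')\<bar> \<le> m * A" "\<bar>g * h\<bar> \<le> m * (A * m\<^sup>2)"
    unfolding abs_mult by (intro mult_mono g \<tau> h; use m A in auto)+
  have f: "\<bar>f\<bar> \<le> 2 + 2 * A * R"
  proof -
    have "\<bar>(x - z) \<bullet> x''\<bar> \<le> m * A" using ip[OF x(2,4)] m by simp
    moreover have "m * A \<le> R * A" by (rule mult_right_mono[OF m(2) A])
    moreover have "x' \<bullet> x' = 1" using x(3) by (simp add: dot_square_norm)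
    ultimately have "\<bar>f\<bar> \<le> 2 + 2 * (R * A)" unfolding f_def by linarith
    then show ?thesis by (simp add: mult.commute[of A] mult.assoc)
  qed
  have Pb: "cmod (\<Phi> n q1) \<le> C / r ^ n" if "n \<in> {1,2,3}" for n
  proof -
    have "C / q1 ^ n \<le> C / r ^ n" using r C(1) by (intro divide_left_mono power_mono mult_pos_pos zero_less_power) auto
    then show ?thesis using C(2)[of q1 n] r Q(1) that unfolding q1_def by fastforce
  qed
  have dq: "\<bar>q1 - q2\<bar> \<le> 4 * (m * (A * m\<^sup>2))"
    using gx(3) q unfolding q1_def q2_def by (simp add: abs_if split: if_splits)
  have Pd: "cmod (\<Phi> n q1 - \<Phi> n q2) \<le> C / r ^ Suc n * (4 * (m * (A * m\<^sup>2)))" if "n \<in> {1,2}" for n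
  proof -
    have "cmod (\<Phi> n q1 - \<Phi> n q2) \<le> C / r ^ Suc n * \<bar>q1 - q2\<bar>"
    proof (rule profile_difference[OF prof C(1) _ _ r(1,2) _ r(3)])
      show "cmod (\<Phi> (Suc n) q) \<le> C / q ^ Suc n" if "0 < q" "q \<le> Q" for q
        by (rule C(2)[OF that]) (use \<open>n \<in> {1,2}\<close> in auto)
    qed (use that Q in \<open>auto simp: q1_def q2_def\<close>)
    also have "\<dots> \<le> C / r ^ Suc n * (4 * (m * (A * m\<^sup>2)))" using dq C(1) r by (intro mult_left_mono) auto
    finally show ?thesis .
  qed
  \<comment> \<open>Telescoping: in every summand exactly one factor is a difference, and that
    factor supplies the gain of one order.\<close>
  have split: "kap2 \<Phi> x x' x'' y - kap2 \<Phi> x x' x'' z =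
      ((a - b) * (a + b)) *\<^sub>R \<Phi> 2 q1 + b\<^sup>2 *\<^sub>R (\<Phi> 2 q1 - \<Phi> 2 q2) + (e - f) *\<^sub>R \<Phi> 1 q1 + f *\<^sub>R (\<Phi> 1 q1 - \<Phi> 1 q2)"
    unfolding kap2_def a_def[symmetric] b_def[symmetric] e_def[symmetric] f_def[symmetric] q1_def[symmetric] q2_def[symmetric]
    by (simp add: algebra_simps power2_eq_square)
  have t1: "cmod (((a - b) * (a + b)) *\<^sub>R \<Phi> 2 q1) \<le> (4 * (m * (A * m)) * (4 * m)) * (C / r\<^sup>2)"
    unfolding norm_scaleR abs_mult using dab gx(1) ab Pb[of 2] m A by (intro mult_mono) auto
  have "b\<^sup>2 \<le> (2 * m)\<^sup>2" using ab(2) m by (intro abs_le_square_iff[THEN iffD1]) auto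
  then have t2: "cmod (b\<^sup>2 *\<^sub>R (\<Phi> 2 q1 - \<Phi> 2 q2)) \<le> (2 * m)\<^sup>2 * (C / r ^ 3 * (4 * (m * (A * m\<^sup>2))))"
    unfolding norm_scaleR using Pd[of 2] by (intro mult_mono) (auto simp: numeral_3_eq_3)
  have t3: "cmod ((e - f) *\<^sub>R \<Phi> 1 q1) \<le> (4 * (m * A)) * (C / r ^ 1)"
    unfolding norm_scaleR using def_ gx(2) Pb[of 1] m A by (intro mult_mono) auto
  have t4: "cmod (f *\<^sub>R (\<Phi> 1 q1 - \<Phi> 1 q2)) \<le> (2 + 2 * A * R) * (C / r\<^sup>2 * (4 * (m * (A * m\<^sup>2))))"
    unfolding norm_scaleR using Pd[of 1] f m A by (intro mult_mono) (auto simp: numeral_2_eq_2)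
  have "cmod (kap2 \<Phi> x x' x'' y - kap2 \<Phi> x x' x'' z) \<le>
      (4 * (m * (A * m)) * (4 * m)) * (C / r\<^sup>2) + (2 * m)\<^sup>2 * (C / r ^ 3 * (4 * (m * (A * m\<^sup>2)))) + (4 * (m * A)) * (C / r ^ 1)
      + (2 + 2 * A * R) * (C / r\<^sup>2 * (4 * (m * (A * m\<^sup>2))))"
    unfolding split by (intro norm_triangle_mono t1 t2 t3 t4)
  also have "(4 * (m * (A * m)) * (4 * m)) * (C / r\<^sup>2) = 16 * A * C / c ^ 4 / m"
    using c m by (simp add: r_def field_simps eval_nat_numeral)
  also have "(2 * m)\<^sup>2 * (C / r ^ 3 * (4 * (m * (A * m\<^sup>2)))) = 16 * A * C / c ^ 6 / m"
    using c m by (simp add: r_def field_simps eval_nat_numeral)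
  also have "(4 * (m * A)) * (C / r ^ 1) = 4 * A * C / c\<^sup>2 / m"
    using c m by (simp add: r_def field_simps eval_nat_numeral)
  also have "(2 + 2 * A * R) * (C / r\<^sup>2 * (4 * (m * (A * m\<^sup>2)))) = (2 + 2 * A * R) * (4 * A * C / c ^ 4) / m"
  proof -
    have "C / r\<^sup>2 * (4 * (m * (A * m\<^sup>2))) = 4 * A * C / c ^ 4 / m"
      using c m by (simp add: r_def field_simps eval_nat_numeral)
    then show ?thesis by simp
  qed
  finally show ?thesis by (simp add: add_divide_distrib)
qed

text \<open>The reflection axis is the normal line, so the reflection reverses the tangential
  component alone; in this form the mirror image differs from the point by a multiple of the
  tangent.\<close>

lemma lrefl_tangent_part:
  assumes "norm \<tau> = 1"
  shows "lrefl (- \<i> * \<tau>) v = v - (2 * (v \<bullet> \<tau>)) *\<^sub>R \<tau>"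
proof -
  have "Re \<tau> * Re \<tau> + Im \<tau> * Im \<tau> = 1"
    using assms by (simp add: norm_complex_def power2_eq_square)
  then have "2 * (Re v * Im \<tau> - Im v * Re \<tau>) * Im \<tau> - Re v = Re v - 2 * (Re v * Re \<tau> + Im v * Im \<tau>) * Re \<tau>"
    "- (2 * (Re v * Im \<tau> - Im v * Re \<tau>) * Re \<tau>) - Im v = Im v - 2 * (Re v * Re \<tau> + Im v * Im \<tau>) * Im \<tau>"
    by algebra+
  then show ?thesis
    by (simp add: lrefl_def complex_eq_iff inner_complex_def)
qed

section \<open>Second derivative of the single layer kernel near the corners\<close>

context waveguide_kernels
begin

lemma edge_kernel_bounds:
  assumes p: "p \<in> pieces W C" and TC: "T \<noteq> C \<or> p \<noteq> None"
  shows "\<exists>B\<ge>0. \<forall>s\<in>{0..len W T}. \<forall>t\<in>src_dom W C p. 0 < edge (len W T) s + edge (len W C) t \<longrightarrow>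
    cmod (\<Phi> 0 ((dist (gam W T s) (src_pt W C p t))\<^sup>2)) \<le> B * (edge (len W T) s + edge (len W C) t) powr (- (1/4)) \<and>
    cmod (kap1 \<Phi> (gam W T s) (tang W T s) (src_pt W C p t)) \<le> B / (edge (len W T) s + edge (len W C) t) \<and>
    cmod (kap1 \<Phi> (gam W T s) (nml W T s) (src_pt W C p t)) \<le> B / (edge (len W T) s + edge (len W C) t) \<and>
    cmod (del0 \<Phi> (gam W T s) (src_pt W C p t) (src_nml W C p t)) \<le> B / (edge (len W T) s + edge (len W C) t)"
proof -
  obtain R where R: "R > 0" "\<And>s t. s \<in> {0..len W T} \<Longrightarrow> t \<in> {0..len W C} \<Longrightarrow> dist (gam W T s) (src_pt W C p t) \<le> R"
    using piece_dist_bounded p by blast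
  obtain K where K: "0 \<le> K" "\<And>x y :: complex. 0 < dist x y \<Longrightarrow> dist x y \<le> R \<Longrightarrow>
      cmod (\<Phi> 0 ((dist x y)\<^sup>2)) \<le> K * dist x y powr (- (1/4))"
    "\<And>x x' y. 0 < dist x y \<Longrightarrow> dist x y \<le> R \<Longrightarrow> norm x' = 1 \<Longrightarrow> cmod (kap1 \<Phi> x x' y) \<le> K / dist x y"
    "\<And>x y n. 0 < dist x y \<Longrightarrow> dist x y \<le> R \<Longrightarrow> norm n = 1 \<Longrightarrow> cmod (del0 \<Phi> x y n) \<le> K / dist x y"
    by (rule kernel_bounds[OF prof R(1) order_refl]) (rule that)
  obtain c where c: "c > 0" "\<And>s t. s \<in> {0..len W T} \<Longrightarrow> t \<in> src_dom W C p \<Longrightarrow>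
      c * (edge (len W T) s + edge (len W C) t) \<le> dist (gam W T s) (src_pt W C p t)"
    using piece_separation[OF p TC] by blast
  define B where "B = K * c powr (- (1/4)) + K / c"
  have parts: "0 \<le> K * c powr (- (1/4))" "0 \<le> K / c" using K(1) c(1) by auto
  show ?thesis
  proof (intro exI[of _ B] conjI ballI impI)
    show "0 \<le> B" using parts by (simp add: B_def)
    fix s t assume s: "s \<in> {0..len W T}" and t: "t \<in> src_dom W C p" and m: "0 < edge (len W T) s + edge (len W C) t"
    let ?m = "edge (len W T) s + edge (len W C) t" and ?r = "dist (gam W T s) (src_pt W C p t)"
    have t': "t \<in> {0..len W C}" using t src_dom_subset by blast
    have r: "c * ?m \<le> ?r" by (rule c(2)[OF s t])
    have cm: "0 < c * ?m" using c(1) m by simp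
    have r0: "0 < ?r" using r cm by linarith
    have rR: "?r \<le> R" by (rule R(2)[OF s t'])
    have "?r powr (- (1/4)) \<le> (c * ?m) powr (- (1/4))" by (rule powr_mono2') (use r cm in auto)
    then have "K * ?r powr (- (1/4)) \<le> K * (c * ?m) powr (- (1/4))" by (rule mult_left_mono[OF _ K(1)])
    also have "\<dots> = K * c powr (- (1/4)) * ?m powr (- (1/4))" using c(1) m by (simp add: powr_mult)
    also have "\<dots> \<le> B * ?m powr (- (1/4))" using parts by (intro mult_right_mono) (auto simp: B_def)
    finally show "cmod (\<Phi> 0 (?r\<^sup>2)) \<le> B * ?m powr (- (1/4))" using K(2)[OF r0 rR] by linarith
    have "K / ?r \<le> K / (c * ?m)" using r cm r0 K(1) by (intro divide_left_mono) auto
    also have "\<dots> = K / c / ?m" by simp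
    also have "\<dots> \<le> B / ?m" using parts m by (intro divide_right_mono) (auto simp: B_def)
    finally have le: "K / ?r \<le> B / ?m" .
    show "cmod (kap1 \<Phi> (gam W T s) (tang W T s) (src_pt W C p t)) \<le> B / ?m"
      by (rule order_trans[OF K(3)[OF r0 rR tang_norm[OF s]] le])
    show "cmod (kap1 \<Phi> (gam W T s) (nml W T s) (src_pt W C p t)) \<le> B / ?m"
      by (rule order_trans[OF K(3)[OF r0 rR nml_norm[OF s]] le])
    show "cmod (del0 \<Phi> (gam W T s) (src_pt W C p t) (src_nml W C p t)) \<le> B / ?m"
      by (rule order_trans[OF K(4)[OF r0 rR src_nml_norm[OF p t']] le])
  qed
qed

text \<open>If \<open>t0\<close> is no limit of source parameters, a neighbourhood without any
  source point will do; otherwise the distance stays above half of its value at the given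
  pair.\<close>

lemma kap2_regular_local:
  assumes p: "p \<in> pieces W C" and s0: "s0 \<in> {0..len W T}"
    and ne: "t0 \<in> closure (src_dom W C p) \<Longrightarrow> gam W T s0 \<noteq> src_pt W C p t0"
  shows "\<exists>U b. open U \<and> (s0, t0) \<in> U \<and> 0 \<le> b \<and> (\<forall>s\<in>{0..len W T}. \<forall>t\<in>src_dom W C p. (s, t) \<in> U \<longrightarrow>
    cmod (kap2 \<Phi> (gam W T s) (tang W T s) (acc W T s) (src_pt W C p t)) \<le> b)"
proof (cases "t0 \<in> closure (src_dom W C p)")
  case False
  then show ?thesis
    using closure_subset[of "src_dom W C p"]
    by (intro exI[of _ "UNIV \<times> - closure (src_dom W C p)"] exI[of _ 0]) (auto intro!: open_Times)
next
  case True
  define r where "r = dist (gam W T s0) (src_pt W C p t0)"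
  have r: "r > 0" using ne[OF True] by (simp add: r_def)
  obtain A where A: "A \<ge> 0" "\<And>s. s \<in> {0..len W T} \<Longrightarrow> norm (acc W T s) \<le> A" using acc_bounded by blast
  obtain R where R: "R > 0" "\<And>s t. s \<in> {0..len W T} \<Longrightarrow> t \<in> {0..len W C} \<Longrightarrow> dist (gam W T s) (src_pt W C p t) \<le> R"
    using piece_dist_bounded p by blast
  obtain K where K: "0 \<le> K" "\<And>x x' x'' y. 0 < dist x y \<Longrightarrow> dist x y \<le> R \<Longrightarrow> norm x' = 1 \<Longrightarrow> norm x'' \<le> A \<Longrightarrow>
      cmod (kap2 \<Phi> x x' x'' y) \<le> K / (dist x y)\<^sup>2"
    by (rule kernel_bounds[OF prof R(1) A(1)]) (rule that)
  let ?f = "\<lambda>z. dist (gam W T (fst z)) (src_pt W C p (snd z))"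
  have "continuous_on ({0..len W T} \<times> {0..len W C}) ?f"
    by (intro continuous_on_dist continuous_on_compose2[OF gam_continuous] continuous_on_compose2[OF src_pt_continuous] continuous_intros) auto
  then obtain U where U: "open U" "U \<inter> ({0..len W T} \<times> {0..len W C}) = ?f -` {r / 2<..} \<inter> ({0..len W T} \<times> {0..len W C})"
    unfolding continuous_on_open_invariant by (meson open_greaterThan)
  have "(s0, t0) \<in> ?f -` {r / 2<..} \<inter> ({0..len W T} \<times> {0..len W C})"
    using r s0 True closure_src_dom_subset[of C p] by (auto simp: r_def)
  then have z0U: "(s0, t0) \<in> U" using U(2) by blast
  have "cmod (kap2 \<Phi> (gam W T s) (tang W T s) (acc W T s) (src_pt W C p t)) \<le> K / (r / 2)\<^sup>2"
    if s: "s \<in> {0..len W T}" and t: "t \<in> src_dom W C p" and st: "(s, t) \<in> U" for s t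
  proof -
    have t': "t \<in> {0..len W C}" using t src_dom_subset by blast
    have "(s, t) \<in> ?f -` {r / 2<..}" using U(2) s t' st by blast
    then have d: "r / 2 \<le> dist (gam W T s) (src_pt W C p t)" by auto
    then have d0: "0 < dist (gam W T s) (src_pt W C p t)" using r by linarith
    have "K / (dist (gam W T s) (src_pt W C p t))\<^sup>2 \<le> K / (r / 2)\<^sup>2"
      using d r d0 K(1) by (intro divide_left_mono power_mono mult_pos_pos zero_less_power) auto
    then show ?thesis using K(2)[OF d0 R(2)[OF s t'] tang_norm[OF s] A(2)[OF s]] by linarith
  qed
  then show ?thesis using U(1) z0U K(1) by (intro exI[of _ U] exI[of _ "K / (r / 2)\<^sup>2"]) auto
qed

lemma tang_lipschitz:
  assumes A: "\<And>s. s \<in> {0..len W T} \<Longrightarrow> norm (acc W T s) \<le> A" and s: "s \<in> {0..len W T}" "s0 \<in> {0..len W T}"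
  shows "norm (tang W T s - tang W T s0) \<le> A * \<bar>s - s0\<bar>"
  by (rule real_mvt_bound[OF _ gam_derivs(2) A s]) auto

text \<open>First and second order Taylor estimates: the component along \<open>\<tau>\<close> of
  the target tangent vanishes at \<open>s0\<close> and grows at most at the rate \<open>A\<close>,
  and integrating once more gives the quadratic bound for the curve.\<close>

lemma normal_deviation:
  assumes A0: "0 \<le> A" and A: "\<And>s. s \<in> {0..len W T} \<Longrightarrow> norm (acc W T s) \<le> A" and s: "s \<in> {0..len W T}" "s0 \<in> {0..len W T}"
    and \<tau>: "norm \<tau> = 1" "tang W T s0 \<bullet> \<tau> = 0"
  shows "\<bar>tang W T s \<bullet> \<tau>\<bar> \<le> A * \<bar>s - s0\<bar>" "\<bar>(gam W T s - gam W T s0) \<bullet> \<tau>\<bar> \<le> A * \<bar>s - s0\<bar>\<^sup>2"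
proof -
  have t: "\<bar>tang W T u \<bullet> \<tau>\<bar> \<le> A * \<bar>u - s0\<bar>" if u: "u \<in> {0..len W T}" for u
  proof -
    have "tang W T u \<bullet> \<tau> = (tang W T u - tang W T s0) \<bullet> \<tau>" using \<tau>(2) by (simp add: inner_diff_left)
    then have "\<bar>tang W T u \<bullet> \<tau>\<bar> \<le> norm (tang W T u - tang W T s0)"
      using Cauchy_Schwarz_ineq2[of "tang W T u - tang W T s0" \<tau>] \<tau>(1) by simp
    then show ?thesis using tang_lipschitz[OF A u s(2)] by linarith
  qed
  show "\<bar>tang W T s \<bullet> \<tau>\<bar> \<le> A * \<bar>s - s0\<bar>" by (rule t[OF s(1)])
  let ?X = "{min s0 s..max s0 s}"
  have X: "?X \<subseteq> {0..len W T}" using s by auto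
  have bl: "bounded_linear (\<lambda>z. complex_of_real (z \<bullet> \<tau>))"
    by (rule bounded_linear_compose[OF bounded_linear_of_real bounded_linear_inner_left])
  have "norm (complex_of_real (gam W T s \<bullet> \<tau>) - complex_of_real (gam W T s0 \<bullet> \<tau>)) \<le> (A * \<bar>s - s0\<bar>) * \<bar>s - s0\<bar>"
  proof (rule real_mvt_bound[where X = ?X and f' = "\<lambda>u. complex_of_real (tang W T u \<bullet> \<tau>)"])
    fix u assume u: "u \<in> ?X"
    have u': "u \<in> {0..len W T}" using X u by blast
    show "((\<lambda>u. complex_of_real (gam W T u \<bullet> \<tau>)) has_vector_derivative complex_of_real (tang W T u \<bullet> \<tau>)) (at u within ?X)"
      by (rule bounded_linear.has_vector_derivative[OF bl has_vector_derivative_within_subset[OF gam_derivs(1)[OF u'] X]])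
    have "A * \<bar>u - s0\<bar> \<le> A * \<bar>s - s0\<bar>" using u by (intro mult_left_mono[OF _ A0]) auto
    then show "norm (complex_of_real (tang W T u \<bullet> \<tau>)) \<le> A * \<bar>s - s0\<bar>" using t[OF u'] by simp
  qed auto
  then show "\<bar>(gam W T s - gam W T s0) \<bullet> \<tau>\<bar> \<le> A * \<bar>s - s0\<bar>\<^sup>2"
    by (simp add: inner_diff_left power2_eq_square mult.assoc flip: of_real_diff)
qed

text \<open>The fin mirrors the source curve in the line tangent to the target at the corner, so that
  the singularity of the second derivative loses one order.\<close>

lemma kap2_corner_local:
  assumes TC: "T \<noteq> C" and s0: "s0 \<in> {0..len W T}" and t0: "t0 \<in> {0, len W C}" and eq: "gam W T s0 = gam W C t0"
  shows "\<exists>d b. 0 < d \<and> 0 \<le> b \<and> (\<forall>s\<in>{0<..<len W T}. \<forall>t\<in>{0<..<len W C}. \<bar>s - s0\<bar> < d \<longrightarrow> \<bar>t - t0\<bar> < d \<longrightarrow>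
    cmod (kap2 \<Phi> (gam W T s) (tang W T s) (acc W T s) (src_pt W C None t) -
      kap2 \<Phi> (gam W T s) (tang W T s) (acc W T s) (src_pt W C (Some t0) t)) * (edge (len W T) s + edge (len W C) t) \<le> b)"
proof -
  have t0': "t0 \<in> {0..len W C}" by (rule endpoint_in[OF t0])
  have PN: "None \<in> pieces W C" "Some t0 \<in> pieces W C" using t0 by (auto simp: pieces_def)
  have tN: "t0 \<in> closure (src_dom W C None)"
    using closure_subset[of "src_dom W C None"] t0' by (auto simp: src_dom_def)
  have "t0 \<in> fin_dom W C t0" using t0' small by (auto simp: fin_dom_def small_fins_def)
  then have tS: "t0 \<in> closure (src_dom W C (Some t0))"
    using closure_subset[of "src_dom W C (Some t0)"] by (auto simp: src_dom_def)
  have eN: "gam W T s0 = src_pt W C None t0" using eq by (simp add: src_pt_def)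
  have eS: "gam W T s0 = src_pt W C (Some t0) t0"
    using eq by (simp add: src_pt_def fin_pt_def refl_pt_def lrefl_def)
  note touch = piece_touch[OF PN(1) disjI1[OF TC] s0 tN eN]
  obtain d1 where d1: "d1 > 0" "\<And>s t. s \<in> {0..len W T} \<Longrightarrow> t \<in> {0..len W C} \<Longrightarrow> \<bar>s - s0\<bar> < d1 \<Longrightarrow> \<bar>t - t0\<bar> < d1 \<Longrightarrow>
      1 / 4 * (\<bar>s - s0\<bar> + \<bar>t - t0\<bar>) \<le> dist (gam W T s) (src_pt W C None t)"
    using local_piece_separation[OF PN(1) disjI1[OF TC] s0 tN eN] by blast
  obtain d2 where d2: "d2 > 0" "\<And>s t. s \<in> {0..len W T} \<Longrightarrow> t \<in> {0..len W C} \<Longrightarrow> \<bar>s - s0\<bar> < d2 \<Longrightarrow> \<bar>t - t0\<bar> < d2 \<Longrightarrow>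
      1 / 4 * (\<bar>s - s0\<bar> + \<bar>t - t0\<bar>) \<le> dist (gam W T s) (src_pt W C (Some t0) t)"
    using local_piece_separation[OF PN(2) disjI1[OF TC] s0 tS eS] by blast
  obtain A where A: "A \<ge> 0" "\<And>s. s \<in> {0..len W T} \<Longrightarrow> norm (acc W T s) \<le> A" using acc_bounded by blast
  obtain R' where R': "R' > 0" "\<And>p s t. p \<in> pieces W C \<Longrightarrow> s \<in> {0..len W T} \<Longrightarrow> t \<in> {0..len W C} \<Longrightarrow> dist (gam W T s) (src_pt W C p t) \<le> R'"
    using piece_dist_bounded by blast
  obtain K where K: "0 \<le> K" "\<And>q n. 0 < q \<Longrightarrow> q \<le> R'\<^sup>2 \<Longrightarrow> n \<in> {1,2,3} \<Longrightarrow> cmod (\<Phi> n q) \<le> K / q ^ n"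
    by (rule profile_bound[OF prof]) (rule that)
  \<comment> \<open>The source tangent at the corner; by the right angle it is normal to the target
    there, so the target leaves the corner along the mirror line.\<close>
  define \<tau> where "\<tau> = tang W C t0"
  have \<tau>: "norm \<tau> = 1" "tang W T s0 \<bullet> \<tau> = 0" using tang_norm[OF t0'] touch(6)[OF TC] by (auto simp: \<tau>_def)
  define R where "R = len W T + len W C"
  define c :: real where "c = 1 / 4"
  define b where "b = 16 * A * K / c ^ 4 + 16 * A * K / c ^ 6 + 4 * A * K / c\<^sup>2 + (2 + 2 * A * R) * (4 * A * K / c ^ 4)"
  have R0: "0 < R" using len_pos[of T] len_pos[of C] by (simp add: R_def)
  have b: "0 \<le> b" unfolding b_def c_def using A(1) K(1) R0 by (intro add_nonneg_nonneg mult_nonneg_nonneg divide_nonneg_nonneg) auto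
  have "cmod (kap2 \<Phi> (gam W T s) (tang W T s) (acc W T s) (src_pt W C None t) -
      kap2 \<Phi> (gam W T s) (tang W T s) (acc W T s) (src_pt W C (Some t0) t)) * (edge (len W T) s + edge (len W C) t) \<le> b"
    if si: "s \<in> {0<..<len W T}" and ti: "t \<in> {0<..<len W C}" and sd: "\<bar>s - s0\<bar> < min d1 d2" and td: "\<bar>t - t0\<bar> < min d1 d2" for s t
  proof -
    have s: "s \<in> {0..len W T}" and t: "t \<in> {0..len W C}" using si ti by auto
    define m where "m = \<bar>s - s0\<bar> + \<bar>t - t0\<bar>"
    define v where "v = gam W C t - gam W C t0"
    define X where "X = gam W T s - gam W T s0"
    have m: "0 < m" using si touch(1) by (auto simp: m_def)
    have mR: "m \<le> R" using s s0 t t0' by (auto simp: m_def R_def)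
    have y: "src_pt W C None t = gam W T s0 + v" using eq by (simp add: src_pt_def v_def)
    have z: "src_pt W C (Some t0) t = gam W T s0 + (v - (2 * (v \<bullet> \<tau>)) *\<^sub>R \<tau>)"
      unfolding src_pt_def fin_pt_def refl_pt_def option.case eq v_def[symmetric] nml_def \<tau>_def[symmetric]
      by (simp only: lrefl_tangent_part[OF \<tau>(1)])
    have nv': "norm (v - (2 * (v \<bullet> \<tau>)) *\<^sub>R \<tau>) = norm v"
      using lrefl_isometry[of "- \<i> * \<tau>" v] \<tau>(1) unfolding lrefl_tangent_part[OF \<tau>(1)] by (simp add: norm_mult)
    have nX: "norm X \<le> \<bar>s - s0\<bar>" unfolding X_def by (rule gam_lipschitz[OF s s0])
    have nv: "norm v \<le> \<bar>t - t0\<bar>" unfolding v_def by (rule gam_lipschitz[OF t t0'])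
    have xX: "gam W T s = gam W T s0 + X" by (simp add: X_def)
    have vt: "\<bar>v \<bullet> \<tau>\<bar> \<le> \<bar>t - t0\<bar>" using Cauchy_Schwarz_ineq2[of v \<tau>] \<tau>(1) nv by simp
    note nd = normal_deviation[OF A s s0 \<tau>]
    have Au: "A * \<bar>s - s0\<bar> \<le> A * m" by (rule mult_left_mono[OF _ A(1)]) (simp add: m_def)
    have "\<bar>s - s0\<bar>\<^sup>2 \<le> m\<^sup>2" by (rule power_mono) (auto simp: m_def)
    then have Au2: "A * \<bar>s - s0\<bar>\<^sup>2 \<le> A * m\<^sup>2" by (rule mult_left_mono[OF _ A(1)])
    have "cmod (kap2 \<Phi> (gam W T s) (tang W T s) (acc W T s) (src_pt W C None t) -
        kap2 \<Phi> (gam W T s) (tang W T s) (acc W T s) (src_pt W C (Some t0) t)) \<le> b / m"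
      unfolding b_def
    proof (rule kap2_difference_bound[OF prof K(1) K(2) _ m mR A(1), where g = "v \<bullet> \<tau>" and \<tau> = \<tau> and h = "X \<bullet> \<tau>"])
      show "0 < c" by (simp add: c_def)
      show "src_pt W C None t - src_pt W C (Some t0) t = (2 * (v \<bullet> \<tau>)) *\<^sub>R \<tau>" unfolding y z by simp
      show "\<bar>v \<bullet> \<tau>\<bar> \<le> m" using vt by (simp add: m_def)
      have "gam W T s - src_pt W C None t = X - v" unfolding y xX by simp
      then show "norm (gam W T s - src_pt W C None t) \<le> m"
        using norm_triangle_ineq4[of X v] nX nv by (simp add: m_def)
      have "gam W T s - src_pt W C (Some t0) t = X - (v - (2 * (v \<bullet> \<tau>)) *\<^sub>R \<tau>)" unfolding z xX by simp
      then show "norm (gam W T s - src_pt W C (Some t0) t) \<le> m"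
        using norm_triangle_ineq4[of X "v - (2 * (v \<bullet> \<tau>)) *\<^sub>R \<tau>"] nX nv nv' by (simp add: m_def)
      show "norm (tang W T s) = 1" by (rule tang_norm[OF s])
      show "norm (acc W T s) \<le> A" by (rule A(2)[OF s])
      show "\<bar>\<tau> \<bullet> tang W T s\<bar> \<le> A * m" using nd(1) Au by (simp add: inner_commute)
      show "\<bar>\<tau> \<bullet> acc W T s\<bar> \<le> A" using Cauchy_Schwarz_ineq2[of \<tau> "acc W T s"] \<tau>(1) A(2)[OF s] by simp
      \<comment> \<open>The source point and its mirror image are equally far from the corner, so
        only the cross terms with the target survive; these contain the deviation of the target from
        its tangent line.\<close>
      show "(dist (gam W T s) (src_pt W C (Some t0) t))\<^sup>2 - (dist (gam W T s) (src_pt W C None t))\<^sup>2 = 4 * (v \<bullet> \<tau>) * (X \<bullet> \<tau>)"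
      proof -
        have tt: "\<tau> \<bullet> \<tau> = 1" using \<tau>(1) by (simp add: dot_square_norm)
        show ?thesis
          unfolding y z xX dist_sq_inner
          using tt by (simp add: inner_diff_left inner_diff_right inner_commute algebra_simps)
      qed
      show "\<bar>X \<bullet> \<tau>\<bar> \<le> A * m\<^sup>2" using nd(2) Au2 unfolding X_def by linarith
      show "c * m \<le> dist (gam W T s) (src_pt W C None t)" using d1(2)[OF s t] sd td by (simp add: c_def m_def)
      show "c * m \<le> dist (gam W T s) (src_pt W C (Some t0) t)" using d2(2)[OF s t] sd td by (simp add: c_def m_def)
      show "(dist (gam W T s) (src_pt W C None t))\<^sup>2 \<le> R'\<^sup>2" "(dist (gam W T s) (src_pt W C (Some t0) t))\<^sup>2 \<le> R'\<^sup>2"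
        using R'(2)[OF PN(1) s t] R'(2)[OF PN(2) s t] by (auto intro: power_mono)
    qed
    moreover have e: "edge (len W T) s + edge (len W C) t \<le> m"
      using edge_le_dist_endpoint[OF touch(1) s] edge_le_dist_endpoint[OF t0 t] by (simp add: m_def)
    moreover have "0 \<le> edge (len W T) s + edge (len W C) t" using edge_nonneg[OF s] edge_nonneg[OF t] by simp
    ultimately have "cmod (kap2 \<Phi> (gam W T s) (tang W T s) (acc W T s) (src_pt W C None t) -
        kap2 \<Phi> (gam W T s) (tang W T s) (acc W T s) (src_pt W C (Some t0) t)) * (edge (len W T) s + edge (len W C) t)
        \<le> b / m * m"
      using b m by (intro mult_mono) auto
    then show ?thesis using m by simp
  qed
  then show ?thesis using d1(1) d2(1) b by (intro exI[of _ "min d1 d2"] exI[of _ b]) auto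
qed

text \<open>Signs extended by 0 put the curve and its fins under one integral over the whole end
  cap, so that they cancel before absolute values are taken.\<close>

definition coef :: "curve \<Rightarrow> real option \<Rightarrow> real \<Rightarrow> complex" where
  "coef C p t = (if t \<in> idom C p then src_sgn C p else 0)"

text \<open>The sum of the pieces times the weight is bounded near every point of the closed
  parameter rectangle: at a corner the curve and the fin at that corner cancel, and all other pieces
  are regular there. Compactness gives one bound.\<close>

lemma kap2_total_bound:
  assumes TC: "T \<noteq> Circ j"
  shows "\<exists>B\<ge>0. \<forall>s\<in>{0<..<len W T}. \<forall>t\<in>{0<..<len W (Circ j)}.
    cmod (\<Sum>p\<in>pieces W (Circ j). coef (Circ j) p t * kap2 \<Phi> (gam W T s) (tang W T s) (acc W T s) (src_pt W (Circ j) p t))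
      \<le> B / (edge (len W T) s + edge (len W (Circ j)) t)"
proof -
  let ?C = "Circ j"
  let ?L = "len W T" and ?M = "len W (Circ j)"
  let ?k = "\<lambda>p s t. coef ?C p t * kap2 \<Phi> (gam W T s) (tang W T s) (acc W T s) (src_pt W ?C p t)"
  let ?e = "\<lambda>s t. edge ?L s + edge ?M t"
  let ?F = "\<lambda>z. cmod (\<Sum>p\<in>pieces W ?C. ?k p (fst z) (snd z)) * ?e (fst z) (snd z)"
  let ?K = "{0..?L} \<times> {0..?M}" and ?D = "{0<..<?L} \<times> {0<..<?M}"
  have epos: "0 < ?e s t" if "s \<in> {0<..<?L}" "t \<in> {0<..<?M}" for s t
    using edge_pos[OF that(1)] edge_pos[OF that(2)] by simp
  have ele: "?e s t \<le> ?L + ?M" if "s \<in> {0<..<?L}" "t \<in> {0<..<?M}" for s t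
    using that by (intro add_mono edge_le_len) auto
  have ub: "\<exists>U b. open U \<and> z0 \<in> U \<and> 0 \<le> b \<and> (\<forall>z\<in>U \<inter> ?D. ?F z \<le> b)" if "z0 \<in> ?K" for z0
  proof -
    obtain s0 t0 where z0: "z0 = (s0, t0)" by (cases z0)
    have s0: "s0 \<in> {0..?L}" and t0: "t0 \<in> {0..?M}" using that z0 by auto
    define touching where "touching p \<longleftrightarrow> t0 \<in> closure (src_dom W ?C p) \<and> gam W T s0 = src_pt W ?C p t0" for p
    \<comment> \<open>The pieces without contact at \<open>z0\<close>. Near \<open>z0\<close> they
      have bounded kernels or no source parameters at all.\<close>
    define G where "G = {p \<in> pieces W ?C. \<not> touching p}"
    have finG: "finite G" using finite_pieces by (simp add: G_def)
    have "\<forall>p\<in>G. \<exists>U. \<exists>b. open U \<and> z0 \<in> U \<and> 0 \<le> b \<and> (\<forall>s\<in>{0..?L}. \<forall>t\<in>src_dom W ?C p. (s, t) \<in> U \<longrightarrow>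
        cmod (kap2 \<Phi> (gam W T s) (tang W T s) (acc W T s) (src_pt W ?C p t)) \<le> b)"
      using kap2_regular_local[OF _ s0, of _ ?C t0] unfolding G_def touching_def z0 by auto
    then obtain U b where Ub: "\<And>p. p \<in> G \<Longrightarrow> open (U p)" "\<And>p. p \<in> G \<Longrightarrow> z0 \<in> U p" "\<And>p. p \<in> G \<Longrightarrow> 0 \<le> b p"
      "\<And>p s t. p \<in> G \<Longrightarrow> s \<in> {0..?L} \<Longrightarrow> t \<in> src_dom W ?C p \<Longrightarrow> (s, t) \<in> U p \<Longrightarrow>
        cmod (kap2 \<Phi> (gam W T s) (tang W T s) (acc W T s) (src_pt W ?C p t)) \<le> b p"
      unfolding bchoice_iff by metis
    define U0 where "U0 = (\<Inter>p\<in>G. U p)"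
    define b0 where "b0 = (\<Sum>p\<in>G. b p)"
    have U0: "open U0" "z0 \<in> U0" using Ub finG by (auto simp: U0_def)
    have b0: "0 \<le> b0" using Ub(3) by (auto simp: b0_def intro: sum_nonneg)
    have reg: "cmod (\<Sum>p\<in>G. ?k p s t) \<le> b0" if "s \<in> {0<..<?L}" "(s, t) \<in> U0" for s t
      unfolding b0_def
    proof (rule sum_norm_le)
      fix p assume p: "p \<in> G"
      show "norm (?k p s t) \<le> b p"
      proof (cases "t \<in> idom ?C p")
        case True
        then have "t \<in> src_dom W ?C p" using idom_subset(3) by blast
        moreover have "(s, t) \<in> U p" using that p by (auto simp: U0_def)
        ultimately show ?thesis
          using Ub(4)[OF p, of s t] that True by (simp add: coef_def norm_mult src_sgn_norm)
      next
        case False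
        then show ?thesis using Ub(3)[OF p] by (simp add: coef_def)
      qed
    qed
    define b1 where "b1 = b0 * (?L + ?M)"
    have b1: "0 \<le> b1" using b0 len_pos[of T] len_pos[of ?C] by (simp add: b1_def)
    have reg': "cmod (\<Sum>p\<in>G. ?k p s t) * ?e s t \<le> b1" if "s \<in> {0<..<?L}" "t \<in> {0<..<?M}" "(s, t) \<in> U0" for s t
      unfolding b1_def using reg[OF that(1,3)] ele[OF that(1,2)] epos[OF that(1,2)] b0 by (intro mult_mono) auto
    show ?thesis
    proof (cases "\<exists>p\<in>pieces W ?C. touching p")
      case False
      then have "G = pieces W ?C" by (auto simp: G_def)
      then have "\<forall>z\<in>U0 \<inter> ?D. ?F z \<le> b1" using reg' by auto
      then show ?thesis using U0 b1 by blast
    next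
      case True
      then obtain p where p: "p \<in> pieces W ?C" "t0 \<in> closure (src_dom W ?C p)" "gam W T s0 = src_pt W ?C p t0"
        unfolding touching_def by blast
      note touch = piece_touch[OF p(1) disjI1[OF TC] s0 p(2,3)]
      have PN: "None \<in> pieces W ?C" "Some t0 \<in> pieces W ?C" using touch(2) by (auto simp: pieces_def)
      have tfin: "t0 \<in> fin_dom W ?C t0" using t0 small by (auto simp: fin_dom_def small_fins_def)
      have "touching None"
        unfolding touching_def using t0 touch(3) closure_subset[of "src_dom W ?C None"] by (auto simp: src_dom_def src_pt_def)
      moreover have "touching (Some t0)"
        unfolding touching_def using touch(3) tfin closure_subset[of "src_dom W ?C (Some t0)"]
        by (auto simp: src_dom_def src_pt_def fin_pt_def refl_pt_def lrefl_def)
      moreover have "p' \<in> {None, Some t0}" if "p' \<in> pieces W ?C" "touching p'" for p'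
        using piece_touch(4)[OF that(1) disjI1[OF TC] s0, of t0] that(2) unfolding touching_def by (cases p') auto
      ultimately have G: "G = pieces W ?C - {None, Some t0}" by (auto simp: G_def)
      obtain d b2 where d: "0 < d" and b2: "0 \<le> b2" and near: "\<And>s t. s \<in> {0<..<?L} \<Longrightarrow> t \<in> {0<..<?M} \<Longrightarrow> \<bar>s - s0\<bar> < d \<Longrightarrow> \<bar>t - t0\<bar> < d \<Longrightarrow>
          cmod (kap2 \<Phi> (gam W T s) (tang W T s) (acc W T s) (src_pt W ?C None t) -
            kap2 \<Phi> (gam W T s) (tang W T s) (acc W T s) (src_pt W ?C (Some t0) t)) * ?e s t \<le> b2"
        using kap2_corner_local[OF TC s0 touch(2,3)] by blast
      have fR: "0 < finR W" using small by (simp add: small_fins_def)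
      \<comment> \<open>The neighbourhood is also kept within the fin radius: a curve point farther
        from the corner has no mirror image on the fin to cancel it.\<close>
      define V where "V = U0 \<inter> (ball s0 d \<times> ball t0 (min d (finR W)))"
      have V: "open V" "z0 \<in> V" using U0 d fR by (auto simp: V_def z0 intro!: open_Int open_Times)
      have "?F z \<le> b2 + b1" if "z \<in> V \<inter> ?D" for z
      proof -
        obtain s t where z: "z = (s, t)" by (cases z)
        have s: "s \<in> {0<..<?L}" and t: "t \<in> {0<..<?M}" and U: "(s, t) \<in> U0" and sd: "\<bar>s - s0\<bar> < d" and td: "\<bar>t - t0\<bar> < d"
          and tR: "\<bar>t - t0\<bar> < finR W"
          using that by (auto simp: z V_def dist_real_def abs_minus_commute)
        have "dist (gam W ?C t) (gam W ?C t0) < finR W"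
          using gam_lipschitz[of t ?C t0] t t0 tR by (auto simp: dist_norm)
        then have "t \<in> idom ?C (Some t0)" "t \<in> idom ?C None" using t by (auto simp: idom_def src_dom_def fin_dom_def)
        \<comment> \<open>Opposite signs, by the odd reflection of densities on the end caps; this
          is where the parity enters.\<close>
        then have co: "coef ?C None t = 1" "coef ?C (Some t0) t = - 1" by (auto simp: coef_def src_sgn_def)
        have "(\<Sum>p\<in>pieces W ?C. ?k p s t) = (\<Sum>p\<in>G. ?k p s t) + (\<Sum>p\<in>{None, Some t0}. ?k p s t)"
          unfolding G by (rule sum.subset_diff) (use PN finite_pieces in auto)
        then have "cmod (\<Sum>p\<in>pieces W ?C. ?k p s t) \<le> cmod (\<Sum>p\<in>G. ?k p s t) +
            cmod (kap2 \<Phi> (gam W T s) (tang W T s) (acc W T s) (src_pt W ?C None t) -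
              kap2 \<Phi> (gam W T s) (tang W T s) (acc W T s) (src_pt W ?C (Some t0) t))"
          using norm_triangle_ineq by (simp add: co)
        from mult_right_mono[OF this less_imp_le[OF epos[OF s t]]]
        show ?thesis
          using near[OF s t sd td] reg'[OF s t U] by (simp add: z distrib_right)
      qed
      then show ?thesis using V b1 b2 by (intro exI[of _ V] exI[of _ "b2 + b1"]) auto
    qed
  qed
  have loc: "\<exists>U c. open U \<and> z0 \<in> U \<and> 0 < c \<and> (\<forall>z\<in>U \<inter> ?D. c * ?F z \<le> 1)" if z0: "z0 \<in> ?K" for z0
  proof -
    obtain U b where U: "open U" "z0 \<in> U" "0 \<le> b" "\<And>z. z \<in> U \<inter> ?D \<Longrightarrow> ?F z \<le> b"
      using ub[OF z0] by blast
    have "1 / (b + 1) * ?F z \<le> 1" if "z \<in> U \<inter> ?D" for z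
      using U(4)[OF that] U(3) by (simp add: field_simps)
    then show ?thesis using U by (intro exI[of _ U] exI[of _ "1 / (b + 1)"]) auto
  qed
  have "\<exists>c>0. \<forall>z\<in>?D. c * ?F z \<le> 1"
  \<comment> \<open>An upper bound in the guise of a lower one: a positive multiple of
    \<open>?F\<close> stays below the constant 1.\<close>
  proof (rule compact_local_to_global[of ?K ?D ?F "\<lambda>_. 1"])
    show "compact ?K" by (intro compact_Times) auto
    show "?D \<subseteq> ?K" by auto
    show "0 \<le> ?F z" if "z \<in> ?D" for z using epos[of "fst z" "snd z"] that by auto
  qed (use loc in blast)
  then obtain c where c: "c > 0" "\<And>z. z \<in> ?D \<Longrightarrow> c * ?F z \<le> 1" by blast
  show ?thesis
  proof (intro exI[of _ "1 / c"] conjI ballI)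
    show "0 \<le> 1 / c" using c(1) by simp
    fix s t assume s: "s \<in> {0<..<?L}" and t: "t \<in> {0<..<?M}"
    have "c * (cmod (\<Sum>p\<in>pieces W ?C. ?k p s t) * ?e s t) \<le> 1" using c(2)[of "(s, t)"] s t by auto
    moreover have "x \<le> 1 / c / e" if "c * (x * e) \<le> 1" "0 < e" for x e :: real
      using that c(1) by (simp add: field_simps)
    ultimately show "cmod (\<Sum>p\<in>pieces W ?C. ?k p s t) \<le> 1 / c / ?e s t"
      using epos[OF s t] by blast
  qed
qed

end

section \<open>Mapping properties of the potentials of the end caps\<close>

context waveguide_kernels
begin

lemma total_measurable:
  assumes "\<And>p. p \<in> pieces W C \<Longrightarrow> continuous_on (idom C p) (f p)"
  shows "(\<lambda>t. \<Sum>p\<in>pieces W C. coef C p t * f p t) \<in> borel_measurable (lebesgue_on {0<..<len W C})"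
proof (rule borel_measurable_sum)
  fix p assume p: "p \<in> pieces W C"
  have "(\<lambda>t. src_sgn C p * f p t) \<in> borel_measurable (lebesgue_on (idom C p))"
    by (rule continuous_on_imp_measurable_lebesgue_on[OF continuous_on_mult_left[OF assms[OF p]] idom_sets])
  from borel_measurable_if_I[OF this idom_sets]
  have "(\<lambda>t. if t \<in> idom C p then src_sgn C p * f p t else 0) \<in> borel_measurable (lebesgue_on {0<..<len W C})"
    by (rule measurable_restrict_space1)
  moreover have "(\<lambda>t. if t \<in> idom C p then src_sgn C p * f p t else 0) = (\<lambda>t. coef C p t * f p t)"
    by (auto simp: coef_def)
  ultimately show "(\<lambda>t. coef C p t * f p t) \<in> borel_measurable (lebesgue_on {0<..<len W C})" by simp
qed

lemma total_bound:
  assumes "\<And>p. p \<in> pieces W C \<Longrightarrow> t \<in> idom C p \<Longrightarrow> cmod (f p) \<le> b p" "\<And>p. p \<in> pieces W C \<Longrightarrow> 0 \<le> b p"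
  shows "cmod (\<Sum>p\<in>pieces W C. coef C p t * f p) \<le> (\<Sum>p\<in>pieces W C. b p)"
proof (rule sum_norm_le)
  fix p assume "p \<in> pieces W C"
  then show "norm (coef C p t * f p) \<le> b p"
    using assms[of p] by (cases "t \<in> idom C p") (auto simp: coef_def norm_mult src_sgn_norm)
qed

text \<open>Each piece is separately integrable against the density by its square integrable
  majorant, so the summed kernel, in which the cancellation takes place, represents the layer
  potential.\<close>

lemma total_integral:
  assumes c: "\<And>p. p \<in> pieces W C \<Longrightarrow> continuous_on (idom C p) (f p)"
    and h: "\<And>p. p \<in> pieces W C \<Longrightarrow> sqi (lebesgue_on {0..len W C}) (h p)"
    and le: "\<And>p t. p \<in> pieces W C \<Longrightarrow> t \<in> idom C p \<Longrightarrow> cmod (f p t) \<le> \<bar>h p t\<bar>"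
    and \<sigma>: "\<sigma> \<in> L2_carr (len W C)"
  shows "(\<integral>t. (\<Sum>p\<in>pieces W C. coef C p t * f p t) * \<sigma> t \<partial>lebesgue_on {0<..<len W C}) =
    (\<Sum>p\<in>pieces W C. src_sgn C p * (\<integral>t. f p t * \<sigma> t \<partial>lebesgue_on (idom C p)))"
proof -
  let ?D = "{0<..<len W C}"
  let ?g = "\<lambda>p t. indicator (idom C p) t *\<^sub>R (f p t * \<sigma> t)"
  have mf: "f p \<in> borel_measurable (lebesgue_on (idom C p))" if "p \<in> pieces W C" for p
    by (rule continuous_on_imp_measurable_lebesgue_on[OF c[OF that] idom_sets])
  have int: "integrable (lebesgue_on ?D) (?g p)" if p: "p \<in> pieces W C" for p
  proof -
    let ?k = "\<lambda>t. if t \<in> idom C p then f p t else 0"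
    have "?k \<in> L2_carr (len W C)" by (rule L2_extension(1)[OF idom_sets idom_subset(1) mf[OF p] h[OF p] le[OF p]])
    from L2_pairing(1)[OF this \<sigma>]
    have "integrable (lebesgue_on ?D) (\<lambda>t. ?k t * \<sigma> t)"
      by (rule integrable_lebesgue_on_subset) auto
    moreover have "(\<lambda>t. ?k t * \<sigma> t) = ?g p" by (auto simp: indicator_def)
    ultimately show ?thesis by simp
  qed
  have "(\<lambda>t. (\<Sum>p\<in>pieces W C. coef C p t * f p t) * \<sigma> t) = (\<lambda>t. \<Sum>p\<in>pieces W C. src_sgn C p * ?g p t)"
    by (auto simp: sum_distrib_right coef_def indicator_def fun_eq_iff intro!: sum.cong)
  then have "(\<integral>t. (\<Sum>p\<in>pieces W C. coef C p t * f p t) * \<sigma> t \<partial>lebesgue_on ?D) =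
      (\<integral>t. (\<Sum>p\<in>pieces W C. src_sgn C p * ?g p t) \<partial>lebesgue_on ?D)"
    by (simp only:)
  also have "\<dots> = (\<Sum>p\<in>pieces W C. \<integral>t. src_sgn C p * ?g p t \<partial>lebesgue_on ?D)"
    by (rule Bochner_Integration.integral_sum[OF integrable_mult_right[OF int]])
  also have "\<dots> = (\<Sum>p\<in>pieces W C. src_sgn C p * (\<integral>t. ?g p t \<partial>lebesgue_on ?D))"
    by (simp only: integral_mult_right_zero)
  also have "\<dots> = (\<Sum>p\<in>pieces W C. src_sgn C p * (\<integral>t. f p t * \<sigma> t \<partial>lebesgue_on (idom C p)))"
    by (intro sum.cong refl arg_cong2[where f = "(*)"] integral_lebesgue_on_subset[symmetric] idom_sets idom_subset(2)) auto
  finally show ?thesis .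
qed

lemma idom_ne:
  assumes p: "p \<in> pieces W C" and TC: "T \<noteq> C \<or> p \<noteq> None" and s: "s \<in> {0..len W T}" and t: "t \<in> idom C p"
  shows "gam W T s \<noteq> src_pt W C p t"
  using no_touch_interior[OF p TC s subsetD[OF idom_subset(3) t]] subsetD[OF idom_subset(2) t] by blast

lemma target_continuity:
  assumes p: "p \<in> pieces W C" and TC: "T \<noteq> C \<or> p \<noteq> None" and t: "t \<in> idom C p"
  shows "continuous_on {0..len W T} (\<lambda>s. \<Phi> 0 ((dist (gam W T s) (src_pt W C p t))\<^sup>2))"
    "continuous_on {0..len W T} (\<lambda>s. kap1 \<Phi> (gam W T s) (nml W T s) (src_pt W C p t))"
    "continuous_on {0..len W T} (\<lambda>s. kap2 \<Phi> (gam W T s) (tang W T s) (acc W T s) (src_pt W C p t))"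
    "continuous_on {0..len W T} (\<lambda>s. del0 \<Phi> (gam W T s) (src_pt W C p t) (src_nml W C p t))"
proof -
  note * = kernels_continuous[where x = "gam W T" and y = "\<lambda>_. src_pt W C p t",
    OF prof gam_continuous continuous_on_const idom_ne[OF p TC _ t]]
  show "continuous_on {0..len W T} (\<lambda>s. \<Phi> 0 ((dist (gam W T s) (src_pt W C p t))\<^sup>2))" by (rule *(1))
  show "continuous_on {0..len W T} (\<lambda>s. kap1 \<Phi> (gam W T s) (nml W T s) (src_pt W C p t))"
    by (rule *(2)[OF _ nml_continuous])
  show "continuous_on {0..len W T} (\<lambda>s. kap2 \<Phi> (gam W T s) (tang W T s) (acc W T s) (src_pt W C p t))"
    by (rule *(3)[OF _ tang_continuous acc_continuous])
  show "continuous_on {0..len W T} (\<lambda>s. del0 \<Phi> (gam W T s) (src_pt W C p t) (src_nml W C p t))"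
    by (rule *(4)[OF _ continuous_on_const])
qed

lemma source_continuity:
  assumes p: "p \<in> pieces W C" and TC: "T \<noteq> C \<or> p \<noteq> None" and s: "s \<in> {0..len W T}"
  shows "continuous_on (idom C p) (\<lambda>t. \<Phi> 0 ((dist (gam W T s) (src_pt W C p t))\<^sup>2))"
    "continuous_on (idom C p) (\<lambda>t. kap1 \<Phi> (gam W T s) v (src_pt W C p t))"
    "continuous_on (idom C p) (\<lambda>t. kap2 \<Phi> (gam W T s) v w (src_pt W C p t))"
    "continuous_on (idom C p) (\<lambda>t. del0 \<Phi> (gam W T s) (src_pt W C p t) (src_nml W C p t))"
proof -
  note * = kernels_continuous[where x = "\<lambda>_. gam W T s" and y = "src_pt W C p",
    OF prof continuous_on_const src_continuous_idom(1) idom_ne[OF p TC s]]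
  show "continuous_on (idom C p) (\<lambda>t. \<Phi> 0 ((dist (gam W T s) (src_pt W C p t))\<^sup>2))" by (rule *(1))
  show "continuous_on (idom C p) (\<lambda>t. kap1 \<Phi> (gam W T s) v (src_pt W C p t))" by (rule *(2)[OF _ continuous_on_const])
  show "continuous_on (idom C p) (\<lambda>t. kap2 \<Phi> (gam W T s) v w (src_pt W C p t))"
    by (rule *(3)[OF _ continuous_on_const continuous_on_const])
  show "continuous_on (idom C p) (\<lambda>t. del0 \<Phi> (gam W T s) (src_pt W C p t) (src_nml W C p t))"
    by (rule *(4)[OF _ src_continuous_idom(2)])
qed

lemma edge_sum_pos:
  assumes "s \<in> {0..len W T}" "t \<in> idom C p"
  shows "0 < edge (len W T) s + edge (len W C) t"
  using edge_nonneg[OF assms(1)] edge_pos[OF subsetD[OF idom_subset(2) assms(2)]] by simp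

text \<open>One derivative of the logarithmic kernel has the size of the Hilbert kernel, so the
  pieces are bounded one by one without any cancellation.\<close>

lemma L2_to_L2_Sop':
  assumes TC: "T \<noteq> C"
  shows "L2_to_L2 (len W C) (len W T) (Sop' W T C)"
proof (rule L2_to_L2_cong[OF L2_to_L2_sum[OF finite_pieces L2_to_L2_scale]])
  fix p assume p: "p \<in> pieces W C"
  note TC' = disjI1[OF TC, of "p \<noteq> None"]
  obtain B where B: "0 \<le> B" "\<And>s t. s \<in> {0..len W T} \<Longrightarrow> t \<in> src_dom W C p \<Longrightarrow> 0 < edge (len W T) s + edge (len W C) t \<Longrightarrow>
      cmod (kap1 \<Phi> (gam W T s) (nml W T s) (src_pt W C p t)) \<le> B / (edge (len W T) s + edge (len W C) t)"
    using edge_kernel_bounds[OF p TC'] by metis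
  show "L2_to_L2 (len W C) (len W T) (\<lambda>\<sigma> s. \<integral>t. kap1 \<Phi> (gam W T s) (nml W T s) (src_pt W C p t) * \<sigma> t \<partial>lebesgue_on (idom C p))"
  proof (rule L2_to_L2_hilbert_kernel[OF len_pos len_pos idom_sets idom_subset(1) B(1)])
    show "continuous_on {0<..<len W T} (\<lambda>s. kap1 \<Phi> (gam W T s) (nml W T s) (src_pt W C p t))" if "t \<in> idom C p" for t
      by (rule continuous_on_subset[OF target_continuity(2)[OF p TC' that]]) auto
    fix s assume "s \<in> {0<..<len W T}"
    then have s: "s \<in> {0..len W T}" by auto
    show "(\<lambda>t. kap1 \<Phi> (gam W T s) (nml W T s) (src_pt W C p t)) \<in> borel_measurable (lebesgue_on (idom C p))"
      by (rule continuous_on_imp_measurable_lebesgue_on[OF source_continuity(2)[OF p TC' s] idom_sets])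
    show "cmod (kap1 \<Phi> (gam W T s) (nml W T s) (src_pt W C p t)) \<le> B / (edge (len W T) s + edge (len W C) t)"
      if "t \<in> idom C p" for t
      by (rule B(2)[OF s subsetD[OF idom_subset(3) that] edge_sum_pos[OF s that]])
  qed
next
  fix \<sigma> s assume "s \<in> {0<..<len W T}"
  then have s: "s \<in> {0..len W T}" by auto
  show "Sop' W T C \<sigma> s = (\<Sum>p\<in>pieces W C. src_sgn C p *
      (\<integral>t. kap1 \<Phi> (gam W T s) (nml W T s) (src_pt W C p t) * \<sigma> t \<partial>lebesgue_on (idom C p)))"
    by (rule Sop'_pieces[OF s])
qed

text \<open>The kernel and its first derivative are estimated piece by piece; only the second
  derivative needs the sum over the pieces, through \<open>kap2_total_bound\<close>.\<close>

lemma L2_to_H2_Sop_circ: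
  assumes TC: "T \<noteq> Circ j"
  shows "L2_to_H2 (len W (Circ j)) (len W T) (Sop W T (Circ j))"
proof -
  let ?C = "Circ j"
  let ?L = "len W T" and ?M = "len W (Circ j)" and ?P = "pieces W (Circ j)"
  let ?f0 = "\<lambda>s p t. \<Phi> 0 ((dist (gam W T s) (src_pt W ?C p t))\<^sup>2)"
  let ?f1 = "\<lambda>s p t. kap1 \<Phi> (gam W T s) (tang W T s) (src_pt W ?C p t)"
  let ?f2 = "\<lambda>s p t. kap2 \<Phi> (gam W T s) (tang W T s) (acc W T s) (src_pt W ?C p t)"
  let ?e = "\<lambda>s t. edge ?L s + edge ?M t"
  note TC' = disjI1[OF TC]
  have "\<forall>p\<in>?P. \<exists>B. 0 \<le> B \<and> (\<forall>s\<in>{0..?L}. \<forall>t\<in>src_dom W ?C p. 0 < ?e s t \<longrightarrow>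
      cmod (?f0 s p t) \<le> B * ?e s t powr (- (1/4)) \<and> cmod (?f1 s p t) \<le> B / ?e s t)"
    using edge_kernel_bounds[OF _ TC'] by meson
  from bchoice[OF this] obtain b where b: "\<And>p. p \<in> ?P \<Longrightarrow> 0 \<le> b p"
    "\<And>p s t. p \<in> ?P \<Longrightarrow> s \<in> {0..?L} \<Longrightarrow> t \<in> src_dom W ?C p \<Longrightarrow> 0 < ?e s t \<Longrightarrow> cmod (?f0 s p t) \<le> b p * ?e s t powr (- (1/4))"
    "\<And>p s t. p \<in> ?P \<Longrightarrow> s \<in> {0..?L} \<Longrightarrow> t \<in> src_dom W ?C p \<Longrightarrow> 0 < ?e s t \<Longrightarrow> cmod (?f1 s p t) \<le> b p / ?e s t"
    by blast
  obtain B2 where B2: "0 \<le> B2" "\<And>s t. s \<in> {0<..<?L} \<Longrightarrow> t \<in> {0<..<?M} \<Longrightarrow>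
      cmod (\<Sum>p\<in>?P. coef ?C p t * ?f2 s p t) \<le> B2 / ?e s t"
    using kap2_total_bound[OF TC] by blast
  define b0 where "b0 = (\<Sum>p\<in>?P. b p)"
  have b0: "0 \<le> b0" using b(1) by (auto simp: b0_def intro: sum_nonneg)
  define B where "B = b0 + B2"
  have B: "0 \<le> B" "b0 \<le> B" "B2 \<le> B" using b0 B2(1) by (auto simp: B_def)
  have der: "((\<lambda>s. \<Sum>p\<in>?P. coef ?C p t * f s p t) has_vector_derivative (\<Sum>p\<in>?P. coef ?C p t * f' s p t)) (at s)"
    if "\<And>p. p \<in> ?P \<Longrightarrow> t \<in> idom ?C p \<Longrightarrow> ((\<lambda>s. f s p t) has_vector_derivative f' s p t) (at s within {0..?L})"
      and s: "s \<in> {0<..<?L}" for f f' :: "real \<Rightarrow> real option \<Rightarrow> real \<Rightarrow> complex" and s t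
  proof (rule has_vector_derivative_sum)
    fix p assume p: "p \<in> ?P"
    show "((\<lambda>s. coef ?C p t * f s p t) has_vector_derivative coef ?C p t * f' s p t) (at s)"
    proof (cases "t \<in> idom ?C p")
      case True
      have "s \<in> interior {0..?L}" using s by simp
      from that(1)[OF p True] have "((\<lambda>s. f s p t) has_vector_derivative f' s p t) (at s)"
        unfolding at_within_interior[OF \<open>s \<in> interior {0..?L}\<close>] .
      then show ?thesis by (rule has_vector_derivative_mult_right)
    next
      case False
      then show ?thesis by (simp add: coef_def)
    qed
  qed
  have cont: "continuous_on {0..?L} (\<lambda>s. \<Sum>p\<in>?P. coef ?C p t * f s p t)"
    if "\<And>p. p \<in> ?P \<Longrightarrow> t \<in> idom ?C p \<Longrightarrow> continuous_on {0..?L} (\<lambda>s. f s p t)"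
    for f :: "real \<Rightarrow> real option \<Rightarrow> real \<Rightarrow> complex" and t
  proof (rule continuous_on_sum)
    fix p assume p: "p \<in> ?P"
    show "continuous_on {0..?L} (\<lambda>s. coef ?C p t * f s p t)"
      using that[OF p] by (cases "t \<in> idom ?C p") (auto simp: coef_def intro: continuous_on_mult_left)
  qed
  have int: "{0<..<?L} \<subseteq> {0..?L}" by auto
  have up: "x / ?e s t \<le> B / ?e s t" if "x \<le> B" "s \<in> {0<..<?L}" "t \<in> {0<..<?M}" for x s t
    using that(1) edge_pos[OF that(2)] edge_pos[OF that(3)] by (intro divide_right_mono) auto
  have kd: "((\<lambda>s. ?f0 s p t) has_vector_derivative ?f1 s p t) (at s within {0..?L})"
    "((\<lambda>s. ?f1 s p t) has_vector_derivative ?f2 s p t) (at s within {0..?L})"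
    if "s \<in> {0..?L}" "p \<in> ?P" "t \<in> idom ?C p" for s p t
    by (rule kernel_curve_derivs[where x = "gam W T" and x' = "tang W T" and x'' = "acc W T",
        OF prof gam_derivs(1)[OF that(1)] gam_derivs(2)[OF that(1)] idom_ne[OF that(2) TC' that(1,3)]])+
  have k0: "cmod (\<Sum>p\<in>?P. coef ?C p t * ?f0 s p t) \<le> B * ?e s t powr (- (1/4))" if "s \<in> {0..?L}" "t \<in> {0<..<?M}" for s t
  proof -
    have "cmod (\<Sum>p\<in>?P. coef ?C p t * ?f0 s p t) \<le> (\<Sum>p\<in>?P. b p * ?e s t powr (- (1/4)))"
      by (rule total_bound) (use b edge_sum_pos[OF that(1)] idom_subset(3) that in \<open>auto simp: subset_iff\<close>)
    also have "\<dots> \<le> B * ?e s t powr (- (1/4))"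
      unfolding sum_distrib_right[symmetric] b0_def[symmetric] by (rule mult_right_mono[OF B(2)]) simp
    finally show ?thesis .
  qed
  have k1: "cmod (\<Sum>p\<in>?P. coef ?C p t * ?f1 s p t) \<le> B / ?e s t" if "s \<in> {0<..<?L}" "t \<in> {0<..<?M}" for s t
  proof -
    have s: "s \<in> {0..?L}" using that by auto
    have "0 \<le> ?e s t" using edge_pos[OF that(1)] edge_pos[OF that(2)] by simp
    then have "cmod (\<Sum>p\<in>?P. coef ?C p t * ?f1 s p t) \<le> (\<Sum>p\<in>?P. b p / ?e s t)"
      by (intro total_bound) (use b edge_sum_pos[OF s] idom_subset(3) s in \<open>auto simp: subset_iff\<close>)
    also have "\<dots> \<le> B / ?e s t"
      unfolding sum_divide_distrib[symmetric] b0_def[symmetric] by (rule up[OF B(2) that])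
    finally show ?thesis .
  qed
  have "L2_to_H2 ?M ?L (\<lambda>\<sigma> s. \<integral>t. (\<Sum>p\<in>?P. coef ?C p t * ?f0 s p t) * \<sigma> t \<partial>lebesgue_on {0<..<?M})"
  proof (rule L2_to_H2_edge_kernel[OF len_pos len_pos B(1) refl])
    fix s assume s: "s \<in> {0..?L}"
    show "(\<lambda>t. \<Sum>p\<in>?P. coef ?C p t * ?f0 s p t) \<in> borel_measurable (lebesgue_on {0<..<?M})"
      by (rule total_measurable[OF source_continuity(1)[OF _ TC' s]])
  next
    fix s assume "s \<in> {0<..<?L}"
    then have s: "s \<in> {0..?L}" by auto
    show "(\<lambda>t. \<Sum>p\<in>?P. coef ?C p t * ?f1 s p t) \<in> borel_measurable (lebesgue_on {0<..<?M})"
      by (rule total_measurable[OF source_continuity(2)[OF _ TC' s]])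
    show "(\<lambda>t. \<Sum>p\<in>?P. coef ?C p t * ?f2 s p t) \<in> borel_measurable (lebesgue_on {0<..<?M})"
      by (rule total_measurable[OF source_continuity(3)[OF _ TC' s]])
  next
    fix t assume t: "t \<in> {0<..<?M}"
    show "continuous_on {0..?L} (\<lambda>s. \<Sum>p\<in>?P. coef ?C p t * ?f0 s p t)"
      by (rule cont[where f = ?f0, OF target_continuity(1)[OF _ TC']])
    show "continuous_on {0<..<?L} (\<lambda>s. \<Sum>p\<in>?P. coef ?C p t * ?f2 s p t)"
      by (rule continuous_on_subset[OF cont[where f = ?f2, OF target_continuity(3)[OF _ TC']] int])
  next
    fix s t assume s: "s \<in> {0<..<?L}" and t: "t \<in> {0<..<?M}"
    note s' = subsetD[OF int s]
    show "((\<lambda>s. \<Sum>p\<in>?P. coef ?C p t * ?f0 s p t) has_vector_derivative (\<Sum>p\<in>?P. coef ?C p t * ?f1 s p t)) (at s)"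
      by (rule der[where f = ?f0 and f' = ?f1, OF kd(1)[OF s'] s])
    show "((\<lambda>s. \<Sum>p\<in>?P. coef ?C p t * ?f1 s p t) has_vector_derivative (\<Sum>p\<in>?P. coef ?C p t * ?f2 s p t)) (at s)"
      by (rule der[where f = ?f1 and f' = ?f2, OF kd(2)[OF s'] s])
    show "cmod (\<Sum>p\<in>?P. coef ?C p t * ?f1 s p t) \<le> B / ?e s t" by (rule k1[OF s t])
    show "cmod (\<Sum>p\<in>?P. coef ?C p t * ?f2 s p t) \<le> B / ?e s t"
      by (rule order_trans[OF B2(2)[OF s t] up[OF B(3) s t]])
  qed (rule k0)
  then show ?thesis
  proof (rule L2_to_H2_cong[OF _ len_pos])
    fix \<sigma> s assume \<sigma>: "\<sigma> \<in> L2_carr ?M" and s: "s \<in> {0..?L}"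
    have "(\<integral>t. (\<Sum>p\<in>?P. coef ?C p t * ?f0 s p t) * \<sigma> t \<partial>lebesgue_on {0<..<?M}) =
        (\<Sum>p\<in>?P. src_sgn ?C p * (\<integral>t. ?f0 s p t * \<sigma> t \<partial>lebesgue_on (idom ?C p)))"
    proof (rule total_integral[OF source_continuity(1)[OF _ TC' s] sqi_edge_powr _ \<sigma>])
      show "0 \<le> ?M" using len_pos[of ?C] by simp
      fix p t assume p: "p \<in> ?P" and t: "t \<in> idom ?C p"
      have "?e s t powr (- (1/4)) \<le> edge ?M t powr (- (1/4))"
        using edge_nonneg[OF s] edge_pos[OF subsetD[OF idom_subset(2) t]] by (intro powr_mono2') auto
      then have "b p * ?e s t powr (- (1/4)) \<le> b p * edge ?M t powr (- (1/4))" by (rule mult_left_mono[OF _ b(1)[OF p]])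
      then show "cmod (?f0 s p t) \<le> \<bar>b p * edge ?M t powr (- (1/4))\<bar>"
        using b(2)[OF p s subsetD[OF idom_subset(3) t] edge_sum_pos[OF s t]] by linarith
    qed
    then show "Sop W T ?C \<sigma> s = (\<integral>t. (\<Sum>p\<in>?P. coef ?C p t * ?f0 s p t) * \<sigma> t \<partial>lebesgue_on {0<..<?M})"
      using Sop_pieces[OF s] by simp
  qed
qed

lemma L2_to_H2_K_star_circ: "L2_to_H2 (len W (Circ j)) (len W (Star i)) (K_star_circ W i j)"
proof -
  let ?T = "Star i" and ?C = "Circ j"
  have TC: "?T \<noteq> ?C" by simp
  note S = L2_to_H2_Sop_circ[OF TC] and S' = L2_to_L2_Sop'[OF TC]
  have "L2_to_H2 (len W ?C) (len W ?T) (\<lambda>\<sigma> s.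
      (c1 W * Sop W ?T ?C \<sigma> s + (- (1 / c1 W)) * Gop W i (Sop W ?T ?C \<sigma>) s) + Gop W i (Sop' W ?T ?C \<sigma>) s)"
    by (rule L2_to_H2_add, rule L2_to_H2_add, rule L2_to_H2_scale, rule S, rule L2_to_H2_scale,
      rule L2_to_H2_Gop, rule L2_to_H2_imp_L2_to_L2, rule S, rule L2_to_H2_Gop, rule S')
  then show ?thesis
    by (rule L2_to_H2_cong[OF _ len_pos])
      (simp only: K_star_circ_def Let_def mult_minus_left add_uminus_conv_diff)
qed

section \<open>Boundedness of \<open>B_op\<close> from the end caps to the walls\<close>

lemma L2_circ_components:
  assumes "\<rho> \<in> carr (L2_circ W)"
  shows "(\<lambda>s. \<rho> (j, s)) \<in> L2_carr (len W (Circ j))"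
    "sqrt (L2_sq (len W (Circ j)) (\<lambda>s. \<rho> (j, s))) \<le> nrm (L2_circ W) \<rho>"
proof -
  show "(\<lambda>s. \<rho> (j, s)) \<in> L2_carr (len W (Circ j))" using assms by (simp add: L2_circ_def)
  have "L2_sq (len W (Circ j)) (\<lambda>s. \<rho> (j, s)) \<le> (\<Sum>j\<in>UNIV. L2_sq (len W (Circ j)) (\<lambda>s. \<rho> (j, s)))"
    by (rule member_le_sum) (auto simp: L2_sq_nonneg)
  then show "sqrt (L2_sq (len W (Circ j)) (\<lambda>s. \<rho> (j, s))) \<le> nrm (L2_circ W) \<rho>" by (simp add: L2_circ_def)
qed

lemma K_star_row_bounded:
  "\<exists>C\<ge>0. \<forall>\<rho>\<in>carr (L2_circ W). H2_bounded (len W (Star i)) (K_star_row W i \<rho>) (C * nrm (L2_circ W) \<rho>)"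
proof -
  have "\<exists>C. 0 \<le> C \<and> (\<forall>\<rho>\<in>carr (L2_circ W). H2_bounded (len W (Star i)) (K_star_circ W i j (\<lambda>t. \<rho> (j, t))) (C * nrm (L2_circ W) \<rho>))" for j
  proof -
    obtain C where C: "0 \<le> C" "\<And>\<sigma>. \<sigma> \<in> L2_carr (len W (Circ j)) \<Longrightarrow>
        H2_bounded (len W (Star i)) (K_star_circ W i j \<sigma>) (C * sqrt (L2_sq (len W (Circ j)) \<sigma>))"
      using L2_to_H2_K_star_circ unfolding L2_to_H2_def by blast
    show ?thesis
      by (intro exI[of _ C] conjI ballI C(1) H2_bounded_mono[OF C(2)] mult_left_mono L2_circ_components) auto
  qed
  then obtain C where C: "\<And>j. 0 \<le> C j" "\<And>j \<rho>. \<rho> \<in> carr (L2_circ W) \<Longrightarrow>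
      H2_bounded (len W (Star i)) (K_star_circ W i j (\<lambda>t. \<rho> (j, t))) (C j * nrm (L2_circ W) \<rho>)" by metis
  have "H2_bounded (len W (Star i)) (K_star_row W i \<rho>) (2 * (C False + C True) * nrm (L2_circ W) \<rho>)"
    if "\<rho> \<in> carr (L2_circ W)" for \<rho>
  proof -
    have "2 * (C False * nrm (L2_circ W) \<rho> + C True * nrm (L2_circ W) \<rho>) = 2 * (C False + C True) * nrm (L2_circ W) \<rho>"
      by (simp add: distrib_right)
    moreover have "K_star_row W i \<rho> = (\<lambda>s. K_star_circ W i False (\<lambda>t. \<rho> (False, t)) s + K_star_circ W i True (\<lambda>t. \<rho> (True, t)) s)"
      by (simp add: K_star_row_def UNIV_bool fun_eq_iff)
    ultimately show ?thesis using H2_bounded_add[OF C(2)[OF that, of False] C(2)[OF that, of True]] by simp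
  qed
  then show ?thesis using C(1) by (intro exI[of _ "2 * (C False + C True)"]) auto
qed

text \<open>Inverses return members of the space with a norm bound, but no \<open>H2_bounded\<close>
  certificate. Between the two inversions \<open>K_star_cross\<close> supplies a new one, as it
  needs only the L2 norm of its argument; this allows the difference to be formed before the Schur
  complement is inverted.\<close>

lemma B_op_bounded:
  assumes self: "\<And>i. invertible_on (H2_star W i) (K_star_self W i)"
    and schur: "\<And>i. invertible_on (H2_star W i) (schur_op W i)"
  shows "\<exists>C\<ge>0. \<forall>\<rho>\<in>carr (L2_circ W). B_op W i \<rho> \<in> carr (H2_star W i) \<and>
    nrm (H2_star W i) (B_op W i \<rho>) \<le> C * nrm (L2_circ W) \<rho>"
proof -
  let ?L = "len W (Star i)" and ?L' = "len W (Star (\<not> i))"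
  obtain C1 where C1: "0 \<le> C1" "\<And>\<rho>. \<rho> \<in> carr (L2_circ W) \<Longrightarrow> H2_bounded ?L (K_star_row W i \<rho>) (C1 * nrm (L2_circ W) \<rho>)"
    using K_star_row_bounded by blast
  obtain C2 where C2: "0 \<le> C2" "\<And>\<rho>. \<rho> \<in> carr (L2_circ W) \<Longrightarrow> H2_bounded ?L' (K_star_row W (\<not> i) \<rho>) (C2 * nrm (L2_circ W) \<rho>)"
    using K_star_row_bounded by blast
  let ?inv = "inv_on (H2_star W (\<not> i)) (K_star_self W (\<not> i))"
  obtain C3 where C3: "0 \<le> C3" "\<And>f N. H2_bounded ?L' f N \<Longrightarrow> ?inv f \<in> carr (H2_space ?L') \<and> nrm (H2_space ?L') (?inv f) \<le> C3 * N"
    using H2_inv_on_bounded[OF len_pos self[unfolded H2_star_def]] unfolding H2_star_def by blast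
  obtain C4 where C4: "0 \<le> C4" "\<And>\<sigma>. \<sigma> \<in> L2_carr ?L' \<Longrightarrow> H2_bounded ?L (K_star_cross W (\<not> i) \<sigma>) (C4 * sqrt (L2_sq ?L' \<sigma>))"
    using L2_to_H2_K_star_cross[of "\<not> i"] unfolding L2_to_H2_def by auto
  obtain C5 where C5: "0 \<le> C5" "\<And>f N. H2_bounded ?L f N \<Longrightarrow> inv_on (H2_star W i) (schur_op W i) f \<in> carr (H2_star W i) \<and>
      nrm (H2_star W i) (inv_on (H2_star W i) (schur_op W i) f) \<le> C5 * N"
    using H2_inv_on_bounded[OF len_pos schur[unfolded H2_star_def]] unfolding H2_star_def by blast
  have "B_op W i \<rho> \<in> carr (H2_star W i) \<and> nrm (H2_star W i) (B_op W i \<rho>) \<le> C5 * (2 * (C4 * (C3 * C2) + C1)) * nrm (L2_circ W) \<rho>"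
    if \<rho>: "\<rho> \<in> carr (L2_circ W)" for \<rho>
  proof -
    let ?n = "nrm (L2_circ W) \<rho>"
    let ?g = "?inv (K_star_row W (\<not> i) \<rho>)"
    have g: "?g \<in> carr (H2_space ?L')" "nrm (H2_space ?L') ?g \<le> C3 * (C2 * ?n)" using C3(2)[OF C2(2)[OF \<rho>]] by auto
    have "sqrt (L2_sq ?L' ?g) \<le> nrm (H2_space ?L') ?g"
      using H2_components(1) H2_nrm_nonneg by (intro real_le_lsqrt) (auto simp: L2_sq_nonneg)
    then have "C4 * sqrt (L2_sq ?L' ?g) \<le> C4 * (C3 * (C2 * ?n))" using g(2) by (intro mult_left_mono C4(1)) auto
    then have "H2_bounded ?L (K_star_cross W (\<not> i) ?g) (C4 * (C3 * (C2 * ?n)))"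
      by (rule H2_bounded_mono[OF C4(2)[OF H2_in_L2(1)[OF len_pos g(1)]]])
    then have A: "H2_bounded ?L (A_op W (\<not> i) (K_star_row W (\<not> i) \<rho>)) (C4 * (C3 * (C2 * ?n)))"
      by (simp only: A_op_def[abs_def])
    have "H2_bounded ?L (\<lambda>s. A_op W (\<not> i) (K_star_row W (\<not> i) \<rho>) s + (- 1) * K_star_row W i \<rho> s)
        (2 * (C4 * (C3 * (C2 * ?n)) + cmod (- 1) * (C1 * ?n)))"
      by (rule H2_bounded_add[OF A H2_bounded_scale[OF C1(2)[OF \<rho>]]])
    from C5(2)[OF this] show ?thesis
      by (simp add: B_op_def distrib_right distrib_left mult.assoc)
  qed
  then show ?thesis using C1(1) C2(1) C3(1) C4(1) C5(1) by (intro exI[of _ "C5 * (2 * (C4 * (C3 * C2) + C1))"]) auto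
qed

end

section \<open>Compactness of the difference of the reduced operators\<close>

text \<open>The limit is defined pointwise and inherits the majorant \<open>h\<close>, so the
  squared differences are dominated by 4 h^2.\<close>

lemma L2_dominated_limit:
  assumes F: "\<And>n. F n \<in> L2_carr L" and h: "sqi (lebesgue_on {0..L}) h"
    and dom: "\<And>n s. s \<in> {0<..<L} \<Longrightarrow> cmod (F n s) \<le> h s"
    and conv: "\<And>s. s \<in> {0<..<L} \<Longrightarrow> convergent (\<lambda>n. F n s)"
  shows "\<exists>g\<in>L2_carr L. (\<lambda>n. L2_sq L (\<lambda>s. F n s - g s)) \<longlonglongrightarrow> 0"
proof -
  let ?M = "lebesgue_on {0..L}"
  \<comment> \<open>Convergence is known only in the interior; the value 0 at the two ends makes the
    limit exist everywhere without changing any norm.\<close>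
  define F' where "F' n s = (if s \<in> {0<..<L} then F n s else 0)" for n s
  define g where "g s = lim (\<lambda>n. F' n s)" for s
  have F': "F' n \<in> L2_carr L" for n by (rule L2_cong_interior(1)[OF F]) (simp add: F'_def)
  have lim: "(\<lambda>n. F' n s) \<longlonglongrightarrow> g s" for s
    using conv[of s] unfolding g_def by (cases "s \<in> {0<..<L}") (auto simp: F'_def convergent_LIMSEQ_iff)
  have le: "cmod (F' n s) \<le> \<bar>h s\<bar>" for n s
    using dom[of s n] by (auto simp: F'_def)
  have gle: "cmod (g s) \<le> \<bar>h s\<bar>" for s
    by (rule LIMSEQ_le_const2[OF tendsto_norm[OF lim]]) (use le in auto)
  have mg: "g \<in> borel_measurable ?M"
    by (rule borel_measurable_LIMSEQ_metric[OF L2_carrD(1)[OF F'] lim])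
  have g: "g \<in> L2_carr L" by (rule L2_bound(1)[OF h mg gle])
  have "(\<lambda>n. \<integral>s. (cmod (F' n s - g s))\<^sup>2 \<partial>?M) \<longlonglongrightarrow> (\<integral>s. 0 \<partial>?M)"
  proof (rule integral_dominated_convergence[where w = "\<lambda>s. 4 * (h s)\<^sup>2"])
    show "(\<lambda>s. (cmod (F' n s - g s))\<^sup>2) \<in> borel_measurable ?M" for n
      using L2_carrD(1)[OF F'] mg by measurable
    show "integrable ?M (\<lambda>s. 4 * (h s)\<^sup>2)" by (intro integrable_mult_right sqi_square h)
    have "(\<lambda>n. (cmod (F' n s - g s))\<^sup>2) \<longlonglongrightarrow> (cmod (g s - g s))\<^sup>2" for s by (intro tendsto_intros lim)
    then show "AE s in ?M. (\<lambda>n. (cmod (F' n s - g s))\<^sup>2) \<longlonglongrightarrow> 0" by simp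
    have "(cmod (F' n s - g s))\<^sup>2 \<le> (2 * \<bar>h s\<bar>)\<^sup>2" for n s
      using norm_triangle_ineq4[of "F' n s" "g s"] le[of n s] gle[of s] by (intro power_mono) auto
    then show "AE s in ?M. norm ((cmod (F' n s - g s))\<^sup>2) \<le> 4 * (h s)\<^sup>2" for n
      by (simp add: power_mult_distrib)
  qed simp
  moreover have "L2_sq L (\<lambda>s. F n s - g s) = L2_sq L (\<lambda>s. F' n s - g s)" for n
    by (rule L2_cong_interior(2)[OF L2_sub(1)[OF F' g]]) (simp add: F'_def)
  ultimately show ?thesis using g by (auto simp: L2_sq_def intro!: bexI[of _ g])
qed

text \<open>Only convergence of the pairings is recorded, without a limit element: the potentials
  are shown to converge at each target, and their limit function is constructed from those
  values.\<close>

definition weakly_convergent :: "real \<Rightarrow> (nat \<Rightarrow> real \<Rightarrow> complex) \<Rightarrow> bool" where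
  "weakly_convergent L \<sigma> \<longleftrightarrow> (\<forall>n. \<sigma> n \<in> L2_carr L) \<and>
     (\<forall>g\<in>L2_carr L. convergent (\<lambda>n. \<integral>s. g s * \<sigma> n s \<partial>lebesgue_on {0..L}))"

lemma weakly_convergent_subseq:
  "weakly_convergent L \<sigma> \<Longrightarrow> strict_mono (r :: nat \<Rightarrow> nat) \<Longrightarrow> weakly_convergent L (\<lambda>n. \<sigma> (r n))"
  unfolding weakly_convergent_def using convergent_subseq_convergent[of _ r] by (fastforce simp: o_def)

lemma common_weakly_convergent_subseq:
  assumes "finite A" and "\<And>a n. a \<in> A \<Longrightarrow> \<sigma> a n \<in> L2_carr (L a)"
    and "\<And>a. a \<in> A \<Longrightarrow> \<exists>B. \<forall>n. L2_sq (L a) (\<sigma> a n) \<le> B"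
  shows "\<exists>r :: nat \<Rightarrow> nat. strict_mono r \<and> (\<forall>a\<in>A. weakly_convergent (L a) (\<lambda>n. \<sigma> a (r n)))"
  using assms
proof (induction A rule: finite_induct)
  case empty
  then show ?case by (auto intro: exI[of _ id] simp: strict_mono_def)
next
  case (insert a A)
  then obtain r :: "nat \<Rightarrow> nat" where r: "strict_mono r" "\<And>b. b \<in> A \<Longrightarrow> weakly_convergent (L b) (\<lambda>n. \<sigma> b (r n))"
    by auto
  obtain B where B: "\<And>n. L2_sq (L a) (\<sigma> a n) \<le> B" using insert.prems(2)[of a] by blast
  obtain r' :: "nat \<Rightarrow> nat" where r': "strict_mono r'" "weakly_convergent (L a) (\<lambda>n. \<sigma> a (r (r' n)))"
    using L2_weakly_compact[of "\<lambda>n. \<sigma> a (r n)" "L a" B] B insert.prems(1)[of a] by (auto simp: weakly_convergent_def)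
  have "weakly_convergent (L b) (\<lambda>n. \<sigma> b (r (r' n)))" if "b \<in> insert a A" for b
    using that r'(2) weakly_convergent_subseq[OF r(2) r'(1), of b] by (cases "b = a") simp_all
  then show ?case using strict_mono_compose[OF r(1) r'(1)] by (intro exI[of _ "\<lambda>n. r (r' n)"] conjI ballI)
qed

lemma weakly_convergent_kernel:
  fixes k :: "real \<Rightarrow> complex"
  assumes D: "D \<in> sets lebesgue" "D \<subseteq> {0..M}" and k: "k \<in> borel_measurable (lebesgue_on D)"
    and h: "sqi (lebesgue_on {0..M}) h" and le: "\<And>t. t \<in> D \<Longrightarrow> cmod (k t) \<le> \<bar>h t\<bar>"
    and \<sigma>: "weakly_convergent M \<sigma>"
  shows "convergent (\<lambda>n. \<integral>t. k t * \<sigma> n t \<partial>lebesgue_on D)"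
proof -
  note e = L2_extension[OF D k h le]
  have c: "\<sigma> n \<in> L2_carr M" for n using \<sigma> by (simp add: weakly_convergent_def)
  have "(\<integral>t. k t * \<sigma> n t \<partial>lebesgue_on D) = (\<integral>t. (if t \<in> D then k t else 0) * \<sigma> n t \<partial>lebesgue_on {0..M})" for n
    by (rule e(3)[OF _ c]) assumption
  then show ?thesis using \<sigma> e(1) by (simp add: weakly_convergent_def)
qed

section \<open>Bounds and limits of the layer potentials at a fixed target\<close>

context waveguide_kernels
begin

text \<open>A majorant of the single layer kernel with an L2 norm bounded uniformly in the target.
  Off the source curve, and on fins, the singularity sits at the ends and the majorant is a power of
  \<open>edge\<close>; on the source curve itself it moves with the target and the chord-arc bound
  gives a power of the parameter distance.\<close>

lemma weight_bound:
  assumes p: "p \<in> pieces W C"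
  shows "\<exists>h N. \<forall>s\<in>{0<..<len W T}. sqi (lebesgue_on {0..len W C}) (h s) \<and>
    sqrt (\<integral>t. (h s t)\<^sup>2 \<partial>lebesgue_on {0..len W C}) \<le> N \<and>
    (\<forall>t\<in>idom C p - {s}. cmod (\<Phi> 0 ((dist (gam W T s) (src_pt W C p t))\<^sup>2)) \<le> \<bar>h s t\<bar>)"
proof (cases "T \<noteq> C \<or> p \<noteq> None")
  case True
  obtain B where B: "0 \<le> B" "\<And>s t. s \<in> {0..len W T} \<Longrightarrow> t \<in> src_dom W C p \<Longrightarrow> 0 < edge (len W T) s + edge (len W C) t \<Longrightarrow>
      cmod (\<Phi> 0 ((dist (gam W T s) (src_pt W C p t))\<^sup>2)) \<le> B * (edge (len W T) s + edge (len W C) t) powr (- (1/4))"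
    using edge_kernel_bounds[OF p True] by metis
  let ?h = "\<lambda>t. B * edge (len W C) t powr (- (1/4))"
  show ?thesis
  proof (intro exI[of _ "\<lambda>_. ?h"] exI[of _ "sqrt (\<integral>t. (?h t)\<^sup>2 \<partial>lebesgue_on {0..len W C})"] ballI conjI order_refl)
    show "sqi (lebesgue_on {0..len W C}) ?h" using len_pos[of C] by (intro sqi_edge_powr) simp
    fix s t assume s: "s \<in> {0<..<len W T}" and t: "t \<in> idom C p - {s}"
    have s': "s \<in> {0..len W T}" and t': "t \<in> idom C p" using s t by auto
    have "(edge (len W T) s + edge (len W C) t) powr (- (1/4)) \<le> edge (len W C) t powr (- (1/4))"
      using edge_nonneg[OF s'] edge_pos[OF subsetD[OF idom_subset(2) t']] by (intro powr_mono2') auto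
    from mult_left_mono[OF this B(1)]
    show "cmod (\<Phi> 0 ((dist (gam W T s) (src_pt W C p t))\<^sup>2)) \<le> \<bar>?h t\<bar>"
      using B(2)[OF s' subsetD[OF idom_subset(3) t'] edge_sum_pos[OF s' t']] by linarith
  qed
next
  case False
  then have TC: "T = C" and pN: "p = None" by auto
  obtain R where R: "R > 0" "\<And>s t. s \<in> {0..len W T} \<Longrightarrow> t \<in> {0..len W C} \<Longrightarrow> dist (gam W T s) (src_pt W C p t) \<le> R"
    using piece_dist_bounded p by blast
  obtain K where K: "0 \<le> K" "\<And>x y :: complex. 0 < dist x y \<Longrightarrow> dist x y \<le> R \<Longrightarrow>
      cmod (\<Phi> 0 ((dist x y)\<^sup>2)) \<le> K * dist x y powr (- (1/4))"
    by (rule kernel_bounds[OF prof R(1) order_refl]) (rule that)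
  obtain c where c: "c > 0" "\<And>s t. s \<in> {0..len W C} \<Longrightarrow> t \<in> {0..len W C} \<Longrightarrow> c * \<bar>s - t\<bar> \<le> dist (gam W C s) (gam W C t)"
    using self_separation by blast
  define B where "B = K * c powr (- (1/4))"
  let ?M = "len W C"
  let ?h = "\<lambda>s t. B * \<bar>t - s\<bar> powr (- (1/4))"
  have hsq: "(?h s t)\<^sup>2 = B\<^sup>2 * \<bar>t - s\<bar> powr (- (1/2))" for s t by (simp add: power_mult_distrib powr_quarter_sq)
  show ?thesis
  proof (intro exI[of _ ?h] exI[of _ "sqrt (B\<^sup>2 * (2 * ?M powr (1 - 1/2) / (1 - 1/2)))"] ballI conjI)
    fix s assume s: "s \<in> {0<..<len W T}"
    then have s': "s \<in> {0..?M}" by (auto simp: TC)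
    have M0: "0 \<le> ?M" using len_pos[of C] by simp
    note w = powr_weight_integral[OF _ _ M0 s', of "1/2"]
    have "(\<lambda>t. ?h s t) \<in> borel_measurable borel" by measurable
    then have "?h s \<in> borel_measurable (lebesgue_on {0..?M})" by (intro measurable_completion measurable_restrict_space1) simp
    then show "sqi (lebesgue_on {0..?M}) (?h s)"
      unfolding sqi_def hsq by (intro conjI integrable_mult_right w) auto
    show "sqrt (\<integral>t. (?h s t)\<^sup>2 \<partial>lebesgue_on {0..?M}) \<le> sqrt (B\<^sup>2 * (2 * ?M powr (1 - 1/2) / (1 - 1/2)))"
      unfolding hsq integral_mult_right_zero by (intro real_sqrt_le_mono mult_left_mono w) auto
    fix t assume t: "t \<in> idom C p - {s}"
    then have t': "t \<in> {0..?M}" and ts: "0 < \<bar>s - t\<bar>" using idom_subset(1)[of C p] by auto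
    let ?r = "dist (gam W T s) (src_pt W C p t)"
    have r: "c * \<bar>s - t\<bar> \<le> ?r" using c(2)[OF s' t'] by (simp add: TC pN src_pt_def)
    have cm: "0 < c * \<bar>s - t\<bar>" using c(1) ts by simp
    have r0: "0 < ?r" using r cm by linarith
    have "?r powr (- (1/4)) \<le> (c * \<bar>s - t\<bar>) powr (- (1/4))" by (rule powr_mono2') (use r cm in auto)
    then have "K * ?r powr (- (1/4)) \<le> K * (c * \<bar>s - t\<bar>) powr (- (1/4))" by (rule mult_left_mono[OF _ K(1)])
    also have "\<dots> = ?h s t" using c(1) by (simp add: powr_mult B_def abs_minus_commute)
    finally show "cmod (\<Phi> 0 (?r\<^sup>2)) \<le> \<bar>?h s t\<bar>"
      using K(2)[OF r0 R(2)] s' t' TC by fastforce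
  qed
qed

text \<open>For fixed \<open>s\<close> the kernel is a square integrable function of
  \<open>t\<close>. Cauchy-Schwarz gives the uniform bound, and pairing with this function gives
  convergence along weakly convergent densities.\<close>

lemma Sop_pointwise:
  "\<exists>K\<ge>0. \<forall>s\<in>{0<..<len W T}. (\<forall>\<sigma>\<in>L2_carr (len W C). cmod (Sop W T C \<sigma> s) \<le> K * sqrt (L2_sq (len W C) \<sigma>)) \<and>
    (\<forall>\<sigma>. weakly_convergent (len W C) \<sigma> \<longrightarrow> convergent (\<lambda>n. Sop W T C (\<sigma> n) s))"
proof -
  let ?P = "pieces W C" and ?M = "len W C"
  let ?k = "\<lambda>s p t. \<Phi> 0 ((dist (gam W T s) (src_pt W C p t))\<^sup>2)"
  obtain h N where h: "\<And>p s. p \<in> ?P \<Longrightarrow> s \<in> {0<..<len W T} \<Longrightarrow> sqi (lebesgue_on {0..?M}) (h p s)"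
    and N: "\<And>p s. p \<in> ?P \<Longrightarrow> s \<in> {0<..<len W T} \<Longrightarrow> sqrt (\<integral>t. (h p s t)\<^sup>2 \<partial>lebesgue_on {0..?M}) \<le> N p"
    and le: "\<And>p s t. p \<in> ?P \<Longrightarrow> s \<in> {0<..<len W T} \<Longrightarrow> t \<in> idom C p - {s} \<Longrightarrow> cmod (?k s p t) \<le> \<bar>h p s t\<bar>"
  proof -
    have "\<forall>p\<in>?P. \<exists>h N. \<forall>s\<in>{0<..<len W T}. sqi (lebesgue_on {0..?M}) (h s) \<and>
        sqrt (\<integral>t. (h s t)\<^sup>2 \<partial>lebesgue_on {0..?M}) \<le> N \<and> (\<forall>t\<in>idom C p - {s}. cmod (?k s p t) \<le> \<bar>h s t\<bar>)"
      by (intro ballI weight_bound)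
    from bchoice[OF this] obtain h where "\<forall>p\<in>?P. \<exists>N. \<forall>s\<in>{0<..<len W T}. sqi (lebesgue_on {0..?M}) (h p s) \<and>
        sqrt (\<integral>t. (h p s t)\<^sup>2 \<partial>lebesgue_on {0..?M}) \<le> N \<and> (\<forall>t\<in>idom C p - {s}. cmod (?k s p t) \<le> \<bar>h p s t\<bar>)"
      by blast
    from bchoice[OF this] show ?thesis using that by blast
  qed
  let ?K = "\<Sum>p\<in>?P. \<bar>N p\<bar>"
  show ?thesis
  proof (intro exI[of _ ?K] conjI ballI allI impI)
    show "0 \<le> ?K" by (intro sum_nonneg) simp
    fix s assume s: "s \<in> {0<..<len W T}"
    then have s': "s \<in> {0..len W T}" by auto
    \<comment> \<open>On the source curve the kernel is singular at \<open>t = s\<close>; removing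
      this point changes no integral and leaves a continuous kernel.\<close>
    have D: "idom C p - {s} \<in> sets lebesgue" "idom C p - {s} \<subseteq> {0..?M}" for p
      using idom_sets[of C p] idom_subset(1)[of C p] by auto
    have cut: "(\<integral>t. ?k s p t * \<sigma> t \<partial>lebesgue_on (idom C p)) = (\<integral>t. ?k s p t * \<sigma> t \<partial>lebesgue_on (idom C p - {s}))" for p \<sigma>
      by (rule integral_lebesgue_on_mod_finite[OF idom_sets D(1), where F = "{s}"]) auto
    have m: "?k s p \<in> borel_measurable (lebesgue_on (idom C p - {s}))" if p: "p \<in> ?P" for p
    proof (rule continuous_on_imp_measurable_lebesgue_on[OF _ D(1)])
      show "continuous_on (idom C p - {s}) (?k s p)"
      proof (rule kernels_continuous(1)[OF prof continuous_on_const])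
        show "continuous_on (idom C p - {s}) (src_pt W C p)" by (rule continuous_on_subset[OF src_continuous_idom(1)]) auto
        show "gam W T s \<noteq> src_pt W C p t" if "t \<in> idom C p - {s}" for t
          using touch_finite[OF p s' subsetD[OF idom_subset(3)], of t] that idom_subset(2)[of C p] by auto
      qed
    qed
    note e = L2_extension[OF D m h[OF _ s] le[OF _ s]] and cv = weakly_convergent_kernel[OF D m h[OF _ s] le[OF _ s]]
    {
      fix \<sigma> assume \<sigma>: "\<sigma> \<in> L2_carr ?M"
      show "cmod (Sop W T C \<sigma> s) \<le> ?K * sqrt (L2_sq ?M \<sigma>)"
        unfolding Sop_pieces[OF s'] cut sum_distrib_right
      proof (rule sum_norm_le)
        fix p assume p: "p \<in> ?P"
        have "cmod (\<integral>t. ?k s p t * \<sigma> t \<partial>lebesgue_on (idom C p - {s})) \<le>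
            sqrt (\<integral>t. (h p s t)\<^sup>2 \<partial>lebesgue_on {0..?M}) * sqrt (L2_sq ?M \<sigma>)"
          by (rule e(4)[OF p p p _ \<sigma>])
        also have "\<dots> \<le> \<bar>N p\<bar> * sqrt (L2_sq ?M \<sigma>)"
          using N[OF p s] by (intro mult_right_mono) (auto simp: L2_sq_nonneg)
        finally show "cmod (src_sgn C p * (\<integral>t. ?k s p t * \<sigma> t \<partial>lebesgue_on (idom C p - {s}))) \<le> \<bar>N p\<bar> * sqrt (L2_sq ?M \<sigma>)"
          by (simp add: norm_mult src_sgn_norm)
      qed
    next
      fix \<sigma> assume \<sigma>: "weakly_convergent ?M \<sigma>"
      show "convergent (\<lambda>n. Sop W T C (\<sigma> n) s)"
        unfolding Sop_pieces[OF s'] cut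
        by (intro convergent_sum convergent_mult convergent_const cv \<sigma>)
    }
  qed
qed

text \<open>The kernel 1 / (s + t) is not square integrable in \<open>t\<close> uniformly in
  \<open>s\<close>, so the bound uses the supremum of the density instead of its L2 norm.
  Convergence at a fixed target still needs weak convergence alone.\<close>

lemma Dop_pointwise:
  assumes TC: "T \<noteq> C"
  shows "\<exists>K\<ge>0. \<forall>s\<in>{0<..<len W T}.
    (\<forall>\<sigma>\<in>L2_carr (len W C). \<forall>N. (\<forall>t\<in>{0..len W C}. cmod (\<sigma> t) \<le> N) \<longrightarrow>
       cmod (Dop W T C \<sigma> s) \<le> K * edge (len W T) s powr (- (1/4)) * N) \<and>
    (\<forall>\<sigma>. weakly_convergent (len W C) \<sigma> \<longrightarrow> convergent (\<lambda>n. Dop W T C (\<sigma> n) s))"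
proof -
  let ?P = "pieces W C" and ?M = "len W C" and ?L = "len W T"
  let ?k = "\<lambda>s p t. del0 \<Phi> (gam W T s) (src_pt W C p t) (src_nml W C p t)"
  let ?w = "\<lambda>t. edge ?M t powr (- (3/4))"
  have M0: "0 \<le> ?M" using len_pos[of C] by simp
  have "\<forall>p\<in>?P. \<exists>B\<ge>0. \<forall>s\<in>{0..?L}. \<forall>t\<in>src_dom W C p. 0 < edge ?L s + edge ?M t \<longrightarrow>
      cmod (?k s p t) \<le> B / (edge ?L s + edge ?M t)"
    using edge_kernel_bounds[OF _ disjI1[OF TC]] by meson
  from bchoice[OF this] obtain B where B: "\<And>p. p \<in> ?P \<Longrightarrow> 0 \<le> B p"
    "\<And>p s t. p \<in> ?P \<Longrightarrow> s \<in> {0..?L} \<Longrightarrow> t \<in> src_dom W C p \<Longrightarrow> 0 < edge ?L s + edge ?M t \<Longrightarrow>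
      cmod (?k s p t) \<le> B p / (edge ?L s + edge ?M t)" by blast
  define I where "I = (\<integral>t. ?w t \<partial>lebesgue_on {0..?M})"
  have I0: "0 \<le> I" unfolding I_def by simp
  have iw: "integrable (lebesgue_on {0..?M}) ?w" by (rule powr_edge_integral(1)[OF _ _ M0]) auto
  let ?K = "\<Sum>p\<in>?P. B p * I"
  show ?thesis
  proof (intro exI[of _ ?K] conjI ballI allI impI)
    show "0 \<le> ?K" using B(1) I0 by (intro sum_nonneg) auto
    fix s assume s: "s \<in> {0<..<?L}"
    then have s': "s \<in> {0..?L}" by auto
    have es: "0 < edge ?L s" by (rule edge_pos[OF s])
    have et: "0 < edge ?M t" if "t \<in> idom C p" for t p by (rule edge_pos[OF subsetD[OF idom_subset(2) that]])
    have m: "?k s p \<in> borel_measurable (lebesgue_on (idom C p))" if p: "p \<in> ?P" for p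
      by (rule continuous_on_imp_measurable_lebesgue_on[OF source_continuity(4)[OF p disjI1[OF TC] s'] idom_sets])
    have b: "cmod (?k s p t) \<le> B p / (edge ?L s + edge ?M t)" if "p \<in> ?P" "t \<in> idom C p" for p t
      by (rule B(2)[OF that(1) s' subsetD[OF idom_subset(3) that(2)] edge_sum_pos[OF s' that(2)]])
    \<comment> \<open>At a fixed interior target the kernel is bounded, hence square integrable,
      which suffices for the pairing with a weakly convergent sequence.\<close>
    have le1: "cmod (?k s p t) \<le> \<bar>B p / edge ?L s\<bar>" if "p \<in> ?P" "t \<in> idom C p" for p t
    proof -
      have "B p / (edge ?L s + edge ?M t) \<le> B p / edge ?L s"
        using B(1)[OF that(1)] es et[OF that(2)] by (intro divide_left_mono) auto
      then show ?thesis using b[OF that] by linarith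
    qed
    \<comment> \<open>The exponent 1 is split as 1/4 + 3/4: the part in \<open>t\<close> remains
      integrable and the part in \<open>s\<close> remains square integrable.\<close>
    have le2: "cmod (?k s p t) \<le> B p * edge ?L s powr (- (1/4)) * ?w t" if p: "p \<in> ?P" and t: "t \<in> idom C p" for p t
    proof -
      let ?e = "edge ?L s + edge ?M t"
      have e0: "0 < ?e" using es et[OF t] by linarith
      have "inverse ?e = ?e powr (- (1/4)) * ?e powr (- (3/4))"
        unfolding powr_add[symmetric] using e0 by (simp add: powr_minus)
      also have "\<dots> \<le> edge ?L s powr (- (1/4)) * ?w t"
        using es et[OF t] by (intro mult_mono powr_mono2') auto
      finally have "B p * inverse ?e \<le> B p * (edge ?L s powr (- (1/4)) * ?w t)" by (rule mult_left_mono[OF _ B(1)[OF p]])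
      then show ?thesis
        unfolding mult.assoc by (rule order_trans[OF b[OF p t, unfolded divide_inverse]])
    qed
    {
      fix \<sigma> N assume \<sigma>: "\<sigma> \<in> L2_carr ?M" and N: "\<forall>t\<in>{0..?M}. cmod (\<sigma> t) \<le> N"
      have N0: "0 \<le> N" using order_trans[OF norm_ge_zero bspec[OF N, of 0]] M0 by simp
      show "cmod (Dop W T C \<sigma> s) \<le> ?K * edge ?L s powr (- (1/4)) * N"
        unfolding Dop_pieces[OF s'] sum_distrib_right
      proof (rule sum_norm_le)
        fix p assume p: "p \<in> ?P"
        let ?c = "B p * edge ?L s powr (- (1/4)) * N"
        have c0: "0 \<le> ?c" using B(1)[OF p] N0 by simp
        have ind: "(\<integral>t. ?k s p t * \<sigma> t \<partial>lebesgue_on (idom C p)) =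
            (\<integral>t. indicator (idom C p) t *\<^sub>R (?k s p t * \<sigma> t) \<partial>lebesgue_on {0..?M})"
          by (rule integral_lebesgue_on_subset[OF _ idom_sets idom_subset(1)]) simp
        have "norm (\<integral>t. indicator (idom C p) t *\<^sub>R (?k s p t * \<sigma> t) \<partial>lebesgue_on {0..?M}) \<le> (\<integral>t. ?c * ?w t \<partial>lebesgue_on {0..?M})"
        proof (rule order_trans[OF integral_norm_bound integral_mono_AE'])
          show "integrable (lebesgue_on {0..?M}) (\<lambda>t. ?c * ?w t)" by (rule integrable_mult_right[OF iw])
          have "norm (indicator (idom C p) t *\<^sub>R (?k s p t * \<sigma> t)) \<le> ?c * ?w t" if t: "t \<in> {0..?M}" for t
          proof (cases "t \<in> idom C p")
            case True
            have "cmod (?k s p t) * cmod (\<sigma> t) \<le> B p * edge ?L s powr (- (1/4)) * ?w t * N"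
              using le2[OF p True] N t by (intro mult_mono) (use B(1)[OF p] in auto)
            then show ?thesis using True by (simp add: norm_mult mult_ac)
          next
            case False
            then show ?thesis using mult_nonneg_nonneg[OF c0, of "?w t"] by simp
          qed
          then show "AE t in lebesgue_on {0..?M}. norm (indicator (idom C p) t *\<^sub>R (?k s p t * \<sigma> t)) \<le> ?c * ?w t"
            by (intro AE_I2) simp
        qed (rule AE_I2, rule mult_nonneg_nonneg[OF c0], simp)
        also have "\<dots> = B p * I * edge ?L s powr (- (1/4)) * N" by (simp add: I_def)
        finally show "cmod (src_sgn C p * (\<integral>t. ?k s p t * \<sigma> t \<partial>lebesgue_on (idom C p))) \<le> B p * I * edge ?L s powr (- (1/4)) * N"
          unfolding ind by (simp add: norm_mult src_sgn_norm)
      qed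
    next
      fix \<sigma> assume \<sigma>: "weakly_convergent ?M \<sigma>"
      show "convergent (\<lambda>n. Dop W T C (\<sigma> n) s)"
        unfolding Dop_pieces[OF s']
        by (intro convergent_sum convergent_mult convergent_const)
          (rule weakly_convergent_kernel[OF idom_sets idom_subset(1) m sqi_const_lebesgue_on le1 \<sigma>])
    }
  qed
qed

section \<open>Independence of the representative of the density\<close>

lemma layer_cut_cong_AE:
  assumes K: "\<And>p. p \<in> pieces W C \<Longrightarrow> continuous_on {t \<in> src_dom W C p. 0 < dist x (src_pt W C p t)}
      (\<lambda>t. K x nx (src_pt W C p t) (src_nml W C p t))"
    and m: "\<sigma> \<in> borel_measurable (lebesgue_on {0..len W C})" "\<tau> \<in> borel_measurable (lebesgue_on {0..len W C})"
    and eq: "AE t in lebesgue_on {0..len W C}. \<sigma> t = \<tau> t"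
  shows "layer_cut W K C \<sigma> x nx 0 = layer_cut W K C \<tau> x nx 0"
  unfolding layer_cut_pieces
proof (rule sum.cong[OF refl])
  fix p assume p: "p \<in> pieces W C"
  let ?A = "{t \<in> src_dom W C p. 0 < dist x (src_pt W C p t)}"
  have A: "?A \<in> sets lebesgue" by (rule cut_set_measurable)
  have sub: "?A \<subseteq> {0..len W C}" using src_dom_subset[of C p] by auto
  have I: "{0..len W C} \<in> sets lebesgue" by simp
  show "(\<integral>t. K x nx (src_pt W C p t) (src_nml W C p t) * (src_sgn C p * \<sigma> t) \<partial>lebesgue_on ?A) =
      (\<integral>t. K x nx (src_pt W C p t) (src_nml W C p t) * (src_sgn C p * \<tau> t) \<partial>lebesgue_on ?A)"
  proof (rule integral_cong_AE)
    have k: "(\<lambda>t. K x nx (src_pt W C p t) (src_nml W C p t)) \<in> borel_measurable (lebesgue_on ?A)"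
      by (rule continuous_on_imp_measurable_lebesgue_on[OF K[OF p] A])
    have s: "\<sigma> \<in> borel_measurable (lebesgue_on ?A)" "\<tau> \<in> borel_measurable (lebesgue_on ?A)"
      unfolding lebesgue_on_subset[OF I A sub] by (intro measurable_restrict_space1 m)+
    show "(\<lambda>t. K x nx (src_pt W C p t) (src_nml W C p t) * (src_sgn C p * \<sigma> t)) \<in> borel_measurable (lebesgue_on ?A)"
      "(\<lambda>t. K x nx (src_pt W C p t) (src_nml W C p t) * (src_sgn C p * \<tau> t)) \<in> borel_measurable (lebesgue_on ?A)"
      using k s by measurable
    have "AE t in lebesgue_on ?A. \<sigma> t = \<tau> t"
      using eq I A sub by (auto simp: AE_restrict_space_iff elim!: eventually_mono)
    then show "AE t in lebesgue_on ?A. K x nx (src_pt W C p t) (src_nml W C p t) * (src_sgn C p * \<sigma> t) =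
        K x nx (src_pt W C p t) (src_nml W C p t) * (src_sgn C p * \<tau> t)"
      by (rule eventually_mono) simp
  qed
qed

lemma single_layer_cong_AE:
  assumes "\<sigma> \<in> borel_measurable (lebesgue_on {0..len W C})" "\<tau> \<in> borel_measurable (lebesgue_on {0..len W C})"
    "AE t in lebesgue_on {0..len W C}. \<sigma> t = \<tau> t"
  shows "Sop W T C \<sigma> = Sop W T C \<tau>" "Sop' W T C \<sigma> = Sop' W T C \<tau>"
proof -
  have src: "continuous_on {t \<in> src_dom W C p. 0 < dist x (src_pt W C p t)} (src_pt W C p)" for x p
    by (rule continuous_on_subset[OF src_pt_continuous]) (use src_dom_subset[of C p] in auto)
  have ne: "x \<noteq> src_pt W C p t" if "t \<in> {t \<in> src_dom W C p. 0 < dist x (src_pt W C p t)}" for x p t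
    using that by auto
  note kc = kernels_continuous[OF prof continuous_on_const src ne]
  show "Sop W T C \<sigma> = Sop W T C \<tau>"
  proof
    fix s
    show "Sop W T C \<sigma> s = Sop W T C \<tau> s"
      unfolding Sop_def
      by (rule layer_cut_cong_AE[OF _ assms], rule continuous_on_eq[OF kc(1)]) (auto simp: kerS_eq[OF prof])
  qed
  show "Sop' W T C \<sigma> = Sop' W T C \<tau>"
  proof
    fix s
    show "Sop' W T C \<sigma> s = Sop' W T C \<tau> s"
      unfolding Sop'_def
      by (rule layer_cut_cong_AE[OF _ assms], rule continuous_on_eq[OF kc(2)[OF _ continuous_on_const[where c = "nml W T s"]]])
        (auto simp: kerS'_eq[OF prof] kap1_def)
  qed
qed

text \<open>The layer potentials of densities equal almost everywhere are the same functions, so the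
  choices made by \<open>inv_on\<close> inside \<open>B_op\<close> are the same too. Only the term I
  / 2 sees the representative.\<close>

lemma M_red_cong:
  assumes f: "f \<in> carr (L2_circ W)" and g: "g \<in> carr (L2_circ W)" and eq: "eq_in (L2_circ W) f g"
  shows "M_red W a f (j, s) - M_red W a g (j, s) = (f (j, s) - g (j, s)) / 2"
proof -
  note cf = L2_circ_components(1)[OF f] and cg = L2_circ_components(1)[OF g]
  have null: "(\<lambda>s. f (j, s) - g (j, s)) \<in> L2_carr (len W (Circ j)) \<and> L2_sq (len W (Circ j)) (\<lambda>s. f (j, s) - g (j, s)) = 0" for j
    using eq by (cases j) (auto simp: eq_in_def L2_circ_def UNIV_bool L2_sq_nonneg add_nonneg_eq_0_iff)
  have AE: "AE t in lebesgue_on {0..len W (Circ j)}. f (j, t) = g (j, t)" for j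
    using L2_sq_eq_0[of "\<lambda>s. f (j, s) - g (j, s)" "len W (Circ j)"] null[of j] by simp
  note eqs = single_layer_cong_AE[OF L2_carrD(1)[OF cf] L2_carrD(1)[OF cg] AE]
  have row: "K_star_row W i f = K_star_row W i g" for i
    unfolding K_star_row_def K_star_circ_def Let_def eqs ..
  have B: "B_op W i f = B_op W i g" for i unfolding B_op_def row ..
  show ?thesis
    by (simp add: M_red_def B K_circ_block_def K_circ_circ_def Let_def eqs UNIV_bool diff_divide_distrib)
qed

lemma M_red_respects:
  assumes f: "f \<in> carr (L2_circ W)" and g: "g \<in> carr (L2_circ W)" and eq: "eq_in (L2_circ W) f g"
  shows "eq_in (L2_circ W) (M_red W a f) (M_red W a g)"
proof -
  have "(\<lambda>x. M_red W a f x - M_red W a g x) = (\<lambda>x. (1 / 2) * (f x - g x))"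
    using M_red_cong[OF assms] by (auto simp: fun_eq_iff)
  then show ?thesis
    using eq L2_scale[of "\<lambda>s. f (j, s) - g (j, s)" "len W (Circ j)" "1 / 2" for j]
    by (simp add: eq_in_def L2_circ_def UNIV_bool L2_sq_nonneg add_nonneg_eq_0_iff)
qed

section \<open>Compactness of the difference of two reduced operators\<close>

lemma M_red_diff:
  "M_red W b \<rho> (j, s) - M_red W a \<rho> (j, s) = (b - a) *
     ((\<Sum>j'\<in>UNIV. Sop W (Circ j) (Circ j') (\<lambda>t. \<rho> (j', t)) s) +
      (\<Sum>i\<in>UNIV. Dop W (Circ j) (Star i) (B_op W i \<rho>) s - 1 / c1 W * Sop W (Circ j) (Star i) (B_op W i \<rho>) s))"
  by (simp add: M_red_def K_circ_block_def K_circ_circ_def K_star_col_def K_circ_star_def Let_def UNIV_bool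
      ring_distribs diff_divide_distrib)

text \<open>The single layers are controlled by the L2 norms of the densities, the double layers by
  the suprema of the images under \<open>B_op\<close>; the Sobolev embedding \<open>H2_sup\<close>
  provides the latter. Measurability of the difference is inherited from the assumed mapping
  properties of the two operators.\<close>

lemma M_red_diff_compact:
  fixes f :: "nat \<Rightarrow> bool \<times> real \<Rightarrow> complex"
  assumes self: "\<And>i. invertible_on (H2_star W i) (K_star_self W i)"
    and schur: "\<And>i. invertible_on (H2_star W i) (schur_op W i)"
    and Ma: "\<And>\<rho>. \<rho> \<in> carr (L2_circ W) \<Longrightarrow> M_red W a \<rho> \<in> carr (L2_circ W)"
    and Mb: "\<And>\<rho>. \<rho> \<in> carr (L2_circ W) \<Longrightarrow> M_red W b \<rho> \<in> carr (L2_circ W)"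
    and f: "\<And>n. f n \<in> carr (L2_circ W)" and bd: "\<And>n. nrm (L2_circ W) (f n) \<le> N"
  shows "\<exists>r :: nat \<Rightarrow> nat. strict_mono r \<and> (\<exists>g\<in>carr (L2_circ W).
    (\<lambda>n. nrm (L2_circ W) (\<lambda>x. (M_red W b (f (r n)) x - M_red W a (f (r n)) x) - g x)) \<longlonglongrightarrow> 0)"
proof -
  have N0: "0 \<le> N"
  proof -
    have "0 \<le> nrm (L2_circ W) (f 0)" by (simp add: L2_circ_def L2_sq_nonneg sum_nonneg)
    then show ?thesis using bd[of 0] by linarith
  qed
  have "\<exists>c. \<forall>n. B_op W i (f n) \<in> L2_carr (len W (Star i)) \<and> sqrt (L2_sq (len W (Star i)) (B_op W i (f n))) \<le> c \<and>
      (\<forall>s\<in>{0..len W (Star i)}. cmod (B_op W i (f n) s) \<le> c)" for i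
  proof -
    let ?L = "len W (Star i)"
    obtain C where C: "0 \<le> C" "\<And>\<rho>. \<rho> \<in> carr (L2_circ W) \<Longrightarrow> B_op W i \<rho> \<in> carr (H2_space ?L)"
      "\<And>\<rho>. \<rho> \<in> carr (L2_circ W) \<Longrightarrow> nrm (H2_space ?L) (B_op W i \<rho>) \<le> C * nrm (L2_circ W) \<rho>"
      using B_op_bounded[OF self schur] unfolding H2_star_def by metis
    obtain K where K: "0 \<le> K" "\<And>u s. u \<in> carr (H2_space ?L) \<Longrightarrow> s \<in> {0..?L} \<Longrightarrow> cmod (u s) \<le> K * nrm (H2_space ?L) u"
      using H2_sup[OF len_pos] by metis
    have n: "nrm (H2_space ?L) (B_op W i (f n)) \<le> C * N" for n
      by (rule order_trans[OF C(3)[OF f] mult_left_mono[OF bd C(1)]])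
    have CN: "0 \<le> C * N" using C(1) N0 by simp
    have "cmod (B_op W i (f n) s) \<le> C * N + K * (C * N)" if "s \<in> {0..?L}" for n s
      using order_trans[OF K(2)[OF C(2)[OF f] that] mult_left_mono[OF n K(1)], of n] CN by linarith
    moreover have "sqrt (L2_sq ?L (B_op W i (f n))) \<le> C * N + K * (C * N)" for n
    proof -
      have "sqrt (L2_sq ?L (B_op W i (f n))) \<le> nrm (H2_space ?L) (B_op W i (f n))"
        using H2_components(1) H2_nrm_nonneg by (intro real_le_lsqrt) (auto simp: L2_sq_nonneg)
      then show ?thesis using n[of n] mult_nonneg_nonneg[OF K(1) CN] by linarith
    qed
    ultimately show ?thesis using H2_in_L2(1)[OF len_pos C(2)[OF f]] by blast
  qed
  then obtain c where BL: "\<And>i n. B_op W i (f n) \<in> L2_carr (len W (Star i))"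
    and Bsq: "\<And>i n. sqrt (L2_sq (len W (Star i)) (B_op W i (f n))) \<le> c i"
    and Bsup: "\<And>i n s. s \<in> {0..len W (Star i)} \<Longrightarrow> cmod (B_op W i (f n) s) \<le> c i"
    by metis
  \<comment> \<open>The two cap densities and the two wall densities are gathered into one family,
    so that a single subsequence serves all four.\<close>
  define \<sigma> where "\<sigma> q = (case q of Inl j \<Rightarrow> \<lambda>n s. f n (j, s) | Inr i \<Rightarrow> \<lambda>n. B_op W i (f n))" for q :: "bool + bool"
  define L where "L q = (case q of Inl j \<Rightarrow> len W (Circ j) | Inr i \<Rightarrow> len W (Star i))" for q :: "bool + bool"
  have fsq: "sqrt (L2_sq (len W (Circ j)) (\<lambda>s. f n (j, s))) \<le> N" for j n
    by (rule order_trans[OF L2_circ_components(2)[OF f] bd])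
  have "\<exists>r :: nat \<Rightarrow> nat. strict_mono r \<and> (\<forall>q\<in>UNIV. weakly_convergent (L q) (\<lambda>n. \<sigma> q (r n)))"
  proof (rule common_weakly_convergent_subseq)
    show "\<sigma> q n \<in> L2_carr (L q)" for q n
      using BL L2_circ_components(1)[OF f] by (cases q) (simp_all add: \<sigma>_def L_def)
    show "\<exists>B. \<forall>n. L2_sq (L q) (\<sigma> q n) \<le> B" for q
    proof (cases q)
      case (Inl j)
      then show ?thesis using sqrt_le_D[OF fsq] by (auto simp: \<sigma>_def L_def)
    next
      case (Inr i)
      then show ?thesis using sqrt_le_D[OF Bsq] by (auto simp: \<sigma>_def L_def)
    qed
  qed simp
  then obtain r :: "nat \<Rightarrow> nat" where r: "strict_mono r" and w: "\<And>q. weakly_convergent (L q) (\<lambda>n. \<sigma> q (r n))" by blast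
  have wf: "weakly_convergent (len W (Circ j)) (\<lambda>n t. f (r n) (j, t))" for j
    using w[of "Inl j"] by (simp add: \<sigma>_def L_def)
  have wB: "weakly_convergent (len W (Star i)) (\<lambda>n. B_op W i (f (r n)))" for i
    using w[of "Inr i"] by (simp add: \<sigma>_def L_def)
  have "\<exists>g\<in>L2_carr (len W (Circ j)).
      (\<lambda>n. L2_sq (len W (Circ j)) (\<lambda>s. (M_red W b (f (r n)) (j, s) - M_red W a (f (r n)) (j, s)) - g s)) \<longlonglongrightarrow> 0" for j
  proof -
    let ?T = "Circ j" and ?L = "len W (Circ j)"
    have ne: "?T \<noteq> Star i" for i by simp
    obtain S where S: "\<And>C. 0 \<le> S C"
      "\<And>C s \<tau>. s \<in> {0<..<?L} \<Longrightarrow> \<tau> \<in> L2_carr (len W C) \<Longrightarrow> cmod (Sop W ?T C \<tau> s) \<le> S C * sqrt (L2_sq (len W C) \<tau>)"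
      "\<And>C s \<tau>. s \<in> {0<..<?L} \<Longrightarrow> weakly_convergent (len W C) \<tau> \<Longrightarrow> convergent (\<lambda>n. Sop W ?T C (\<tau> n) s)"
      using Sop_pointwise[of ?T] by metis
    obtain D where D: "\<And>i. 0 \<le> D i"
      "\<And>i s \<tau> N. s \<in> {0<..<?L} \<Longrightarrow> \<tau> \<in> L2_carr (len W (Star i)) \<Longrightarrow> (\<forall>t\<in>{0..len W (Star i)}. cmod (\<tau> t) \<le> N) \<Longrightarrow>
        cmod (Dop W ?T (Star i) \<tau> s) \<le> D i * edge ?L s powr (- (1/4)) * N"
      "\<And>i s \<tau>. s \<in> {0<..<?L} \<Longrightarrow> weakly_convergent (len W (Star i)) \<tau> \<Longrightarrow> convergent (\<lambda>n. Dop W ?T (Star i) (\<tau> n) s)"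
      using Dop_pointwise[OF ne] by metis
    define c0 where "c0 = (\<Sum>j'\<in>UNIV. S (Circ j') * N) + (\<Sum>i\<in>UNIV. cmod (1 / c1 W) * (S (Star i) * c i))"
    define d0 where "d0 = (\<Sum>i\<in>UNIV. D i * c i)"
    \<comment> \<open>The constant collects all single layer terms; the power -1/4, still square
      integrable, comes from the double layers of the walls.\<close>
    define h where "h s = cmod (b - a) * (c0 + d0 * edge ?L s powr (- (1/4)))" for s
    show ?thesis
    proof (rule L2_dominated_limit[where h = h])
      show "(\<lambda>s. M_red W b (f (r n)) (j, s) - M_red W a (f (r n)) (j, s)) \<in> L2_carr ?L" for n
        by (intro L2_sub(1) L2_circ_components(1) Ma Mb f)
      show "sqi (lebesgue_on {0..?L}) h"
        unfolding h_def using len_pos[of ?T] by (intro sqi_scale sqi_add sqi_const_lebesgue_on sqi_edge_powr) simp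
      fix s assume s: "s \<in> {0<..<?L}"
      show "convergent (\<lambda>n. M_red W b (f (r n)) (j, s) - M_red W a (f (r n)) (j, s))"
        unfolding M_red_diff
        by (intro convergent_mult convergent_const convergent_add convergent_sum convergent_diff S(3)[OF s] D(3)[OF s] wf wB)
      fix n
      have "cmod (\<Sum>j'\<in>UNIV. Sop W ?T (Circ j') (\<lambda>t. f (r n) (j', t)) s) \<le> (\<Sum>j'\<in>UNIV. S (Circ j') * N)"
      proof (rule sum_norm_le)
        fix j'
        show "cmod (Sop W ?T (Circ j') (\<lambda>t. f (r n) (j', t)) s) \<le> S (Circ j') * N"
          by (rule order_trans[OF S(2)[OF s L2_circ_components(1)[OF f]] mult_left_mono[OF fsq S(1)]])
      qed
      moreover have "cmod (\<Sum>i\<in>UNIV. Dop W ?T (Star i) (B_op W i (f (r n))) s - 1 / c1 W * Sop W ?T (Star i) (B_op W i (f (r n))) s)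
          \<le> (\<Sum>i\<in>UNIV. D i * c i * edge ?L s powr (- (1/4)) + cmod (1 / c1 W) * (S (Star i) * c i))"
      proof (rule sum_norm_le)
        fix i
        have "cmod (Sop W ?T (Star i) (B_op W i (f (r n))) s) \<le> S (Star i) * c i"
          by (rule order_trans[OF S(2)[OF s BL] mult_left_mono[OF Bsq S(1)]])
        then have "cmod (1 / c1 W * Sop W ?T (Star i) (B_op W i (f (r n))) s) \<le> cmod (1 / c1 W) * (S (Star i) * c i)"
          unfolding norm_mult by (rule mult_left_mono) simp
        moreover have "cmod (Dop W ?T (Star i) (B_op W i (f (r n))) s) \<le> D i * edge ?L s powr (- (1/4)) * c i"
          by (rule D(2)[OF s BL]) (use Bsup in blast)
        ultimately show "cmod (Dop W ?T (Star i) (B_op W i (f (r n))) s - 1 / c1 W * Sop W ?T (Star i) (B_op W i (f (r n))) s)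
            \<le> D i * c i * edge ?L s powr (- (1/4)) + cmod (1 / c1 W) * (S (Star i) * c i)"
          unfolding mult.assoc[of "D i" "c i"] mult.commute[of "c i" "edge ?L s powr (- (1/4))"] mult.assoc[symmetric, of "D i"]
          by (intro order_trans[OF norm_triangle_ineq4 add_mono])
      qed
      ultimately have "cmod ((\<Sum>j'\<in>UNIV. Sop W ?T (Circ j') (\<lambda>t. f (r n) (j', t)) s) +
          (\<Sum>i\<in>UNIV. Dop W ?T (Star i) (B_op W i (f (r n))) s - 1 / c1 W * Sop W ?T (Star i) (B_op W i (f (r n))) s))
          \<le> c0 + d0 * edge ?L s powr (- (1/4))"
        unfolding sum.distrib sum_distrib_right[symmetric] c0_def d0_def
        by (intro order_trans[OF norm_triangle_ineq]) linarith
      then show "cmod (M_red W b (f (r n)) (j, s) - M_red W a (f (r n)) (j, s)) \<le> h s"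
        unfolding M_red_diff norm_mult h_def by (rule mult_left_mono) simp
    qed
  qed
  then have "\<forall>j. \<exists>g. g \<in> L2_carr (len W (Circ j)) \<and>
      (\<lambda>n. L2_sq (len W (Circ j)) (\<lambda>s. (M_red W b (f (r n)) (j, s) - M_red W a (f (r n)) (j, s)) - g s)) \<longlonglongrightarrow> 0"
    by blast
  from choice[OF this] obtain g where g: "\<And>j. g j \<in> L2_carr (len W (Circ j))"
    and lim: "\<And>j. (\<lambda>n. L2_sq (len W (Circ j)) (\<lambda>s. (M_red W b (f (r n)) (j, s) - M_red W a (f (r n)) (j, s)) - g j s)) \<longlonglongrightarrow> 0"
    by blast
  define G where "G = (\<lambda>(j, s). g j s)"
  have "G \<in> carr (L2_circ W)" using g by (simp add: L2_circ_def G_def)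
  moreover have "(\<lambda>n. nrm (L2_circ W) (\<lambda>x. (M_red W b (f (r n)) x - M_red W a (f (r n)) x) - G x)) \<longlonglongrightarrow> sqrt (\<Sum>j\<in>(UNIV :: bool set). 0)"
    unfolding L2_circ_def G_def fspace.simps prod.case by (intro tendsto_real_sqrt tendsto_sum lim)
  ultimately show ?thesis using r by (intro exI[of _ r] conjI bexI[of _ G]) simp_all
qed

end

section \<open>The function space over the end caps and the two impedance maps\<close>

lemma L2_circ_seminormed: "seminormed_fspace (L2_circ W)"
proof
  let ?L = "\<lambda>j. len W (Circ j)"
  have null: "(nrm (L2_circ W) f = 0) \<longleftrightarrow> (\<forall>j. AE s in lebesgue_on {0..?L j}. f (j, s) = 0)" if "f \<in> carr (L2_circ W)" for f
  proof -
    have "nrm (L2_circ W) f = 0 \<longleftrightarrow> (\<forall>j. L2_sq (?L j) (\<lambda>s. f (j, s)) = 0)"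
      by (simp add: L2_circ_def sum_nonneg_eq_0_iff L2_sq_nonneg)
    also have "\<dots> \<longleftrightarrow> (\<forall>j. AE s in lebesgue_on {0..?L j}. f (j, s) = 0)"
      using that by (simp add: L2_sq_eq_0 L2_circ_def)
    finally show ?thesis .
  qed
  show lc: "(\<lambda>x. \<alpha> * f x + \<beta> * g x) \<in> carr (L2_circ W)" if "f \<in> carr (L2_circ W)" "g \<in> carr (L2_circ W)" for f g \<alpha> \<beta>
    using that by (simp add: L2_circ_def L2_add(1)[OF L2_scale(1) L2_scale(1)])
  show "0 \<le> nrm (L2_circ W) f" for f by (simp add: L2_circ_def L2_sq_nonneg sum_nonneg)
  show "nrm (L2_circ W) (\<lambda>x. \<alpha> * f x + \<beta> * g x) = 0"
    if "f \<in> carr (L2_circ W)" "g \<in> carr (L2_circ W)" "nrm (L2_circ W) f = 0" "nrm (L2_circ W) g = 0" for f g \<alpha> \<beta>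
  proof -
    have "\<And>j. AE s in lebesgue_on {0..?L j}. f (j, s) = 0" "\<And>j. AE s in lebesgue_on {0..?L j}. g (j, s) = 0"
      using null that by blast+
    then have "AE s in lebesgue_on {0..?L j}. \<alpha> * f (j, s) + \<beta> * g (j, s) = 0" for j
      by (smt (verit, best) eventually_elim2 add.right_neutral mult_zero_right)
    then show ?thesis using null[OF lc[OF that(1,2)]] by blast
  qed
  show zero: "(\<lambda>x. 0) \<in> carr (L2_circ W)" by (simp add: L2_circ_def L2_carr_def)
  show "nrm (L2_circ W) (\<lambda>x. 0) = 0" by (simp add: L2_circ_def L2_sq_def)
  show "nrm (L2_circ W) f = nrm (L2_circ W) g"
    if f: "f \<in> carr (L2_circ W)" and g: "g \<in> carr (L2_circ W)" and eq: "eq_in (L2_circ W) f g" for f g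
  proof -
    have "L2_sq (?L j) (\<lambda>s. f (j, s)) = L2_sq (?L j) (\<lambda>s. g (j, s))" for j
    proof -
      have "\<forall>j. AE s in lebesgue_on {0..?L j}. f (j, s) - g (j, s) = 0"
        using eq null[of "\<lambda>x. f x - g x"] by (simp add: eq_in_def)
      then have ae: "AE s in lebesgue_on {0..?L j}. f (j, s) - g (j, s) = 0" by blast
      have m: "(\<lambda>s. f (j, s)) \<in> borel_measurable (lebesgue_on {0..?L j})" "(\<lambda>s. g (j, s)) \<in> borel_measurable (lebesgue_on {0..?L j})"
        using f g by (auto simp: L2_circ_def L2_carr_def)
      show ?thesis unfolding L2_sq_def
      proof (rule integral_cong_AE)
        show "AE s in lebesgue_on {0..?L j}. (cmod (f (j, s)))\<^sup>2 = (cmod (g (j, s)))\<^sup>2"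
          using ae by (rule eventually_mono) simp
      qed (use m in measurable)
    qed
    then show ?thesis by (simp add: L2_circ_def)
  qed
qed

theorem mainTheorem3:
  fixes W :: waveguide
  assumes "waveguide_geometry W" and "small_fins W" and "waveguide_constants W"
    and "\<And>i. invertible_on (H2_star W i) (K_star_self W i)"
    and "\<And>i. invertible_on (H2_star W i) (schur_op W i)"
    and "invertible_on (L2_circ W) (M_plus W)"
    and "invertible_on (L2_circ W) (M_minus W)"
  shows "fredholm_second_kind (L2_circ W) (I_minus_plus W) \<and>
         fredholm_second_kind (L2_circ W) (I_plus_minus W)"
proof -
  have "0 < wnum W" using assms(3) by (simp add: waveguide_constants_def)
  then obtain \<Phi> where "profile (wnum W) \<Phi>" using profile_exists by blast
  then interpret waveguide_kernels W \<Phi>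
    using assms(1-3) by unfold_locales
  interpret seminormed_fspace "L2_circ W" by (rule L2_circ_seminormed)
  \<comment> \<open>Stated for arbitrary values of \<open>a\<close>, so that both maps are instances
    with the two wave number values exchanged.\<close>
  have quot: "fredholm_second_kind (L2_circ W) (M_red W b \<circ> inv_on (L2_circ W) (M_red W a))"
    if a: "invertible_on (L2_circ W) (M_red W a)" and b: "invertible_on (L2_circ W) (M_red W b)" for a b
  proof (rule fredholm_quotient[OF a b M_red_respects M_red_respects])
    fix f :: "nat \<Rightarrow> bool \<times> real \<Rightarrow> complex"
    assume f: "\<And>m. f m \<in> carr (L2_circ W)" and "\<exists>N. \<forall>m. nrm (L2_circ W) (f m) \<le> N"
    then obtain N where N: "\<And>m. nrm (L2_circ W) (f m) \<le> N" by blast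
    show "\<exists>r :: nat \<Rightarrow> nat. strict_mono r \<and> (\<exists>g\<in>carr (L2_circ W).
        (\<lambda>m. nrm (L2_circ W) (\<lambda>y. (M_red W b (f (r m)) y - M_red W a (f (r m)) y) - g y)) \<longlonglongrightarrow> 0)"
      by (rule M_red_diff_compact[OF assms(4,5) _ _ f N]) (use a b in \<open>simp_all add: invertible_on_def\<close>)
  qed
  show ?thesis
    using assms(6,7) unfolding I_minus_plus_def I_plus_minus_def M_plus_def M_minus_def
    by (intro conjI quot)
qed

end
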